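(* Let $R>0$ and let $\alpha=\alpha_n>0$, $\beta=\beta_n>0$ depend on $n$ so that $\lim_{n\to\infty}n\beta_n=\kappa\in(0,\infty)$ and $\lim_{n\to\infty}\alpha_n/n=\lambda$ with $\kappa(\lambda-1)>2$. Then for $n$ large enough $Z_n<\infty$, so $P_n$ is well defined. Moreover, for any way of realizing random vectors $X_n\sim P_n$ ($n$ large) on a common probability space, almost surely $\lim_{n\to\infty}\mathrm{d}_{\mathrm{BL}}(\mu_{X_n},\mu_* )=0$, where $\mu_*$ is the unique minimizer over probability measures $\mu$ on $\mathbb{C}$ of \[ \mu\mapsto \frac12\iint-\log|x-y|\,\mathrm{d}\mu(x)\mathrm{d}\mu(y)-\lambda\int U_\rho\,\mathrm{d}\mu+\frac1\kappa\int\varphi\log\varphi\,\mathrm{d}\ell_{\mathbb{C}} \] (the last term being $+\infty$ unless $\mu=\varphi\,\ell_{\mathbb{C}}$ is absolutely continuous); $\mu_*$ has a density $\varphi$ which satisfies on its support \[ \Delta\log\varphi=2\pi\kappa\Big(\varphi-\lambda\frac{\mathbf{1}_{|\cdot|\le R}}{\pi R^2}\Big). \]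
   Context: $\ell_{\mathbb{C}}$ is Lebesgue measure on $\mathbb{C}$; $D_r=\{z\in\mathbb{C}:|z|\le r\}$. $\rho$ is the uniform probability measure on $D_R$ and $U_\rho(x)=-\int\log|x-y|\,\mathrm{d}\rho(y)$. For $n$ particles, with $\alpha=\alpha_n,\beta=\beta_n$, set $V=-\frac{\alpha_n}{n}U_\rho$, $E_n(x_1,\dots,x_n)=\sum_{i<j}-\log|x_i-x_j|+n\sum_{i=1}^nV(x_i)$, $Z_n=\int_{\mathbb{C}^n}e^{-\beta_n E_n}\,\mathrm{d}\ell_{\mathbb{C}}^{\otimes n}$, and when $Z_n<\infty$, $P_n=Z_n^{-1}e^{-\beta_n E_n}\,\mathrm{d}\ell_{\mathbb{C}}^{\otimes n}$. For $X_n=(X_{n,1},\dots,X_{n,n})\sim P_n$, the empirical measure is $\mu_{X_n}=\frac1n\sum_{k=1}^n\delta_{X_{n,k}}$. The bounded-Lipschitz distance is $\mathrm{d}_{\mathrm{BL}}(\mu,\nu)=\sup\{\int f\,\mathrm{d}(\mu-\nu):\sup|f|\le1,\ |f(x)-f(y)|\le|x-y|\ \forall x,y\}$. *)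

theory Defs
  imports "HOL-Probability.Probability"
begin

definition rho :: "real \<Rightarrow> complex measure" where
  "rho R = uniform_measure lborel (cball 0 R)"

definition U_rho :: "real \<Rightarrow> complex \<Rightarrow> real" where
  "U_rho R x = - (\<integral>y. ln (cmod (x - y)) \<partial>rho R)"

definition V_pot :: "nat \<Rightarrow> real \<Rightarrow> real \<Rightarrow> complex \<Rightarrow> real" where
  "V_pot n a R x = - (a / real n) * U_rho R x"

definition E_n :: "nat \<Rightarrow> real \<Rightarrow> real \<Rightarrow> (nat \<Rightarrow> complex) \<Rightarrow> real" where
  "E_n n a R x = (\<Sum>j<n. \<Sum>i<j. - ln (cmod (x i - x j))) + real n * (\<Sum>i<n. V_pot n a R (x i))"

text \<open>Boltzmann weight exp(-beta E_n); at coinciding points -log 0 = +infinity,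
  so the weight is 0 there.\<close>
definition gibbs_weight :: "nat \<Rightarrow> real \<Rightarrow> real \<Rightarrow> real \<Rightarrow> (nat \<Rightarrow> complex) \<Rightarrow> real" where
  "gibbs_weight n a b R x =
     (if \<exists>i<n. \<exists>j<n. i \<noteq> j \<and> x i = x j then 0 else exp (- b * E_n n a R x))"

definition leb_n :: "nat \<Rightarrow> (nat \<Rightarrow> complex) measure" where
  "leb_n n = PiM {..<n} (\<lambda>_. lborel)"

definition Z_n :: "nat \<Rightarrow> real \<Rightarrow> real \<Rightarrow> real \<Rightarrow> ennreal" where
  "Z_n n a b R = (\<integral>\<^sup>+ x. ennreal (gibbs_weight n a b R x) \<partial>leb_n n)"

definition P_n :: "nat \<Rightarrow> real \<Rightarrow> real \<Rightarrow> real \<Rightarrow> (nat \<Rightarrow> complex) measure" where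
  "P_n n a b R = density (leb_n n) (\<lambda>x. ennreal (gibbs_weight n a b R x) / Z_n n a b R)"

definition empirical :: "nat \<Rightarrow> (nat \<Rightarrow> complex) \<Rightarrow> complex measure" where
  "empirical n x = measure_pmf (map_pmf x (pmf_of_set {..<n}))"

definition d_BL :: "complex measure \<Rightarrow> complex measure \<Rightarrow> real" where
  "d_BL \<mu> \<nu> = Sup {(\<integral>z. f z \<partial>\<mu>) - (\<integral>z. f z \<partial>\<nu>) | f :: complex \<Rightarrow> real.
                     (\<forall>z. \<bar>f z\<bar> \<le> 1) \<and> (\<forall>z w. \<bar>f z - f w\<bar> \<le> dist z w)}"

text \<open>Extended-real integral of an extended-real function: integral of the positive
  part minus integral of the negative part; an undefined difference infinity - infinity
  is +infinity by the ereal convention.\<close>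
definition ereal_int :: "'a measure \<Rightarrow> ('a \<Rightarrow> ereal) \<Rightarrow> ereal" where
  "ereal_int M f = enn2ereal (\<integral>\<^sup>+ x. e2ennreal (f x) \<partial>M) - enn2ereal (\<integral>\<^sup>+ x. e2ennreal (- f x) \<partial>M)"

definition log_kernel :: "complex \<Rightarrow> complex \<Rightarrow> ereal" where
  "log_kernel x y = (if x = y then \<infinity> else ereal (- ln (cmod (x - y))))"

definition prob_measures_C :: "complex measure set" where
  "prob_measures_C = {\<mu>. sets \<mu> = sets borel \<and> prob_space \<mu>}"

definition log_energy :: "complex measure \<Rightarrow> ereal" where
  "log_energy \<mu> = ereal_int (\<mu> \<Otimes>\<^sub>M \<mu>) (\<lambda>(x, y). log_kernel x y)"

definition entropy_C :: "complex measure \<Rightarrow> ereal" where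
  "entropy_C \<mu> = (if absolutely_continuous lborel \<mu>
      then ereal_int lborel (\<lambda>x. let \<phi> = enn2real (RN_deriv lborel \<mu> x) in ereal (\<phi> * ln \<phi>))
      else \<infinity>)"

definition I_functional :: "real \<Rightarrow> real \<Rightarrow> real \<Rightarrow> complex measure \<Rightarrow> ereal" where
  "I_functional \<kappa> lam R \<mu> =
     ereal (1/2) * log_energy \<mu>
     - ereal lam * ereal_int \<mu> (\<lambda>x. ereal (U_rho R x))
     + ereal (1 / \<kappa>) * entropy_C \<mu>"

definition is_minimizer :: "real \<Rightarrow> real \<Rightarrow> real \<Rightarrow> complex measure \<Rightarrow> bool" where
  "is_minimizer \<kappa> lam R \<mu> \<longleftrightarrow> \<mu> \<in> prob_measures_C \<and>
     (\<forall>\<nu> \<in> prob_measures_C. I_functional \<kappa> lam R \<mu> \<le> I_functional \<kappa> lam R \<nu>)"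

definition pdir :: "complex \<Rightarrow> (complex \<Rightarrow> real) \<Rightarrow> complex \<Rightarrow> real" where
  "pdir v g z = deriv (\<lambda>s::real. g (z + of_real s * v)) 0"

definition cont_partials :: "(complex \<Rightarrow> real) \<Rightarrow> bool" where
  "cont_partials g \<longleftrightarrow> continuous_on UNIV g \<and>
     (\<forall>v \<in> {1, \<i>}. (\<forall>z. (\<lambda>s::real. g (z + of_real s * v)) differentiable (at 0))
                  \<and> continuous_on UNIV (pdir v g))"

definition C2_fun :: "(complex \<Rightarrow> real) \<Rightarrow> bool" where
  "C2_fun g \<longleftrightarrow> cont_partials g \<and> (\<forall>v \<in> {1, \<i>}. cont_partials (pdir v g))"

definition laplacian :: "(complex \<Rightarrow> real) \<Rightarrow> complex \<Rightarrow> real" where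
  "laplacian g z = pdir 1 (pdir 1 g) z + pdir \<i> (pdir \<i> g) z"

definition test_fun :: "complex set \<Rightarrow> (complex \<Rightarrow> real) \<Rightarrow> bool" where
  "test_fun S g \<longleftrightarrow> C2_fun g \<and> compact (closure {z. g z \<noteq> 0}) \<and> closure {z. g z \<noteq> 0} \<subseteq> S"

definition measure_support :: "complex measure \<Rightarrow> complex set" where
  "measure_support \<mu> = {x. \<forall>e>0. emeasure \<mu> (ball x e) > 0}"

end

theory Submission
  imports Defs "HOL-Real_Asymp.Real_Asymp"
begin

text \<open>
  The logarithm is a superposition of Gaussians (Frullani), so on neutral charges the logarithmic
  energy is an integral of squared distances between Gaussian smoothings. This makes the free energy
  convex. The strict convexity of the entropy turns minimizing sequences of densities, taken relative
  to a Gibbs reference measure, into Cauchy sequences in \<open>L\<^sup>1\<close>, which gives existence and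
  uniqueness of the minimizer. Comparing the minimizer with the Gibbs density of its own potential
  yields the Euler--Lagrange equation, hence the differential equation.

  By the Euler--Lagrange equation, the density of \<open>P_n\<close> relative to the \<open>n\<close>-fold product of the
  equilibrium measure is, up to a factor \<open>exp (o(n))\<close>, the exponential of \<open>- n \<kappa> / 2\<close> times the
  modulated energy, i.e. the off-diagonal logarithmic energy of the difference between the empirical
  and the equilibrium measure. Jensen's inequality bounds the normalization from below. The
  modulated energy controls the bounded-Lipschitz distance from below, so deviations have
  exponentially small probability and the Borel--Cantelli lemma applies.
\<close>

section \<open>Gaussian integrals in the plane\<close>

text \<open>Two infinities shape the proof: -ln|x - y| is unbounded above at the diagonal and
  unbounded below at infinity. The second is cured by weights: \<open>log_kern\<close> adds
  \<open>1 + Lg x + Lg y\<close>, so energies become non-negative extended integrals, and the added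
  one-body terms go into a reference density with tail (1 + |x|^2)^(-\<kappa>(lam - 1)/2).
  Integrability of this tail over the plane is the condition \<kappa>(lam - 1) > 2. Its strictness
  leaves a margin that is spent twice: on exponential moments of \<open>Lg\<close>, which turn
  finite entropy into a finite logarithmic moment, and on absorbing the small one-body error caused
  by n \<beta>_n and \<beta>_n \<alpha>_n not being equal to their limits. The first infinity
  matters for empirical measures, whose self-energy is infinite. Cutting the Gaussian scales at S
  costs \<open>reg S 0 / n\<close> on the diagonal and O(1/S) against a bounded density, so S is
  fixed first and n is large afterwards. Boundedness of the minimizer comes from its Gibbs form.
  Jensen's bound is sharp enough because under the product of equilibrium measures the mean
  modulated energy is only of order 1/n.\<close>

lemma lborel_complex_eq:
  "distr (lborel \<Otimes>\<^sub>M lborel) borel (\<lambda>(a, b). Complex a b) = (lborel :: complex measure)"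
proof (rule lborel_eqI[symmetric])
  have m: "(\<lambda>(a, b). Complex a b) \<in> borel_measurable (lborel \<Otimes>\<^sub>M lborel)"
    unfolding lborel_prod
    by (auto intro!: borel_measurable_continuous_onI continuous_intros simp: case_prod_unfold)
  fix l u :: complex
  assume "\<And>b. b \<in> Basis \<Longrightarrow> l \<bullet> b \<le> u \<bullet> b"
  from this[of 1] this[of \<i>] have le: "Re l \<le> Re u" "Im l \<le> Im u"
    by (auto simp: Basis_complex_def)
  have vim: "(\<lambda>(a, b). Complex a b) -` box l u \<inter> space (lborel \<Otimes>\<^sub>M lborel)
      = {Re l<..<Re u} \<times> {Im l<..<Im u}"
    by (auto simp: box_def Basis_complex_def space_pair_measure)
  show "emeasure (distr (lborel \<Otimes>\<^sub>M lborel) borel (\<lambda>(a, b). Complex a b)) (box l u)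
      = ennreal (\<Prod>b\<in>Basis. (u - l) \<bullet> b)"
    using le
    by (simp add: emeasure_distr[OF m] vim lborel.emeasure_pair_measure_Times
        ennreal_mult Basis_complex_def)
qed simp

lemma measurable_Complex_pair [measurable]:
  "(\<lambda>(a, b). Complex a b) \<in> borel_measurable (lborel \<Otimes>\<^sub>M lborel)"
  unfolding lborel_prod
  by (auto intro!: borel_measurable_continuous_onI continuous_intros simp: case_prod_unfold)

lemma measurable_Complex [measurable (raw)]:
  "f \<in> borel_measurable M \<Longrightarrow> g \<in> borel_measurable M \<Longrightarrow> (\<lambda>x. Complex (f x) (g x)) \<in> borel_measurable M"
  using measurable_compose[OF _ measurable_Complex_pair, of "\<lambda>x. (f x, g x)" M] by auto

lemma nn_integral_complex:
  assumes [measurable]: "f \<in> borel_measurable borel"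
  shows "(\<integral>\<^sup>+z. f z \<partial>(lborel :: complex measure)) = (\<integral>\<^sup>+a. \<integral>\<^sup>+b. f (Complex a b) \<partial>lborel \<partial>lborel)"
proof -
  have "(\<integral>\<^sup>+z. f z \<partial>lborel) = (\<integral>\<^sup>+p. f (case p of (a, b) \<Rightarrow> Complex a b) \<partial>(lborel \<Otimes>\<^sub>M lborel))"
    by (subst lborel_complex_eq[symmetric]) (simp add: nn_integral_distr)
  also have "\<dots> = (\<integral>\<^sup>+a. \<integral>\<^sup>+b. f (Complex a b) \<partial>lborel \<partial>lborel)"
    by (subst lborel.nn_integral_fst[symmetric]) (auto simp: case_prod_unfold)
  finally show ?thesis .
qed

lemma nn_integral_gauss_real:
  assumes "a > 0"
  shows "(\<integral>\<^sup>+x. ennreal (exp (- a * (x - m)\<^sup>2)) \<partial>lborel) = ennreal (sqrt (pi / a))"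
proof -
  \<comment> \<open>The standard deviation with 2 s^2 = 1/a, which makes the Gaussian a multiple of
    a normal density.\<close>
  define s where "s = 1 / sqrt (2 * a)"
  have s: "s > 0" "2 * s\<^sup>2 = 1 / a" "sqrt (2 * pi * s\<^sup>2) = sqrt (pi / a)"
    using assms by (auto simp: s_def power_divide)
  have "(\<integral>\<^sup>+x. ennreal (normal_density m s x) \<partial>lborel) = 1"
    using s(1) by (simp add: nn_integral_eq_integral normal_density_nonneg)
  moreover have "exp (- a * (x - m)\<^sup>2) = sqrt (pi / a) * normal_density m s x" for x
    unfolding normal_density_def s using assms by (simp add: field_simps)
  ultimately show ?thesis
    using assms by (simp add: ennreal_mult' nn_integral_cmult)
qed

lemma nn_integral_gauss_complex:
  fixes m :: complex
  assumes "a > 0"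
  shows "(\<integral>\<^sup>+z. ennreal (exp (- a * (cmod (z - m))\<^sup>2)) \<partial>lborel) = ennreal (pi / a)"
proof -
  have "(\<integral>\<^sup>+z. ennreal (exp (- a * (cmod (z - m))\<^sup>2)) \<partial>lborel)
     = (\<integral>\<^sup>+x. \<integral>\<^sup>+y. ennreal (exp (- a * (x - Re m)\<^sup>2)) * ennreal (exp (- a * (y - Im m)\<^sup>2)) \<partial>lborel \<partial>lborel)"
    by (subst nn_integral_complex)
       (auto intro!: nn_integral_cong simp: cmod_power2 ennreal_mult'[symmetric] exp_add[symmetric] algebra_simps)
  also have "\<dots> = ennreal (sqrt (pi / a)) * ennreal (sqrt (pi / a))"
    using assms nn_integral_gauss_real[of a "Re m"] nn_integral_gauss_real[of a "Im m"]
    by (simp add: nn_integral_cmult nn_integral_multc)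
  also have "\<dots> = ennreal (pi / a)"
    using assms by (simp add: ennreal_mult'[symmetric])
  finally show ?thesis .
qed

lemma emeasure_cball_complex:
  assumes "r \<ge> 0"
  shows "emeasure lborel (cball (c :: complex) r) = ennreal (pi * r\<^sup>2)"
  using assms emeasure_cball[of r c] by (simp add: unit_ball_vol_2)

lemma nn_integral_exp_decay:
  assumes "u > (0::real)"
  shows "(\<integral>\<^sup>+s. ennreal (exp (- s * u)) * indicator {0<..} s \<partial>lborel) = ennreal (1 / u)"
proof -
  have "(\<integral>\<^sup>+s. ennreal (exp (- s * u)) * indicator {0<..} s \<partial>lborel)
      = (\<integral>\<^sup>+s. ennreal (exp (- s * u)) * indicator {0..} s \<partial>lborel)"
    by (intro nn_integral_cong_AE, use AE_lborel_singleton[of 0] in eventually_elim)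
       (auto simp: indicator_def)
  also have "\<dots> = ennreal (0 - (- exp (- 0 * u) / u))"
  proof (rule nn_integral_FTC_atLeast)
    show "((\<lambda>s. - exp (- s * u) / u) \<longlongrightarrow> 0) at_top"
      using assms by real_asymp
    show "DERIV (\<lambda>s. - exp (- s * u) / u) s :> exp (- s * u)" for s
      using assms by (auto intro!: derivative_eq_intros)
  qed auto
  finally show ?thesis by simp
qed

text \<open>The integrand is the integral of exp(-su) over u between a and b; integrating in s first
  leaves 1/u.\<close>

lemma nn_integral_frullani:
  assumes "0 < a" "a \<le> b"
  shows "(\<integral>\<^sup>+s. ennreal ((exp (- s * a) - exp (- s * b)) / s) * indicator {0<..} s \<partial>lborel)
       = ennreal (ln b - ln a)"
proof -
  have inner: "ennreal ((exp (- s * a) - exp (- s * b)) / s) * indicator {0<..} s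
      = (\<integral>\<^sup>+u. ennreal (exp (- s * u)) * indicator {0<..} s * indicator {a..b} u \<partial>lborel)" for s :: real
  proof (cases "s > 0")
    case True
    have "(\<integral>\<^sup>+u. ennreal (exp (- s * u)) * indicator {a..b} u \<partial>lborel)
        = ennreal ((- exp (- s * b) / s) - (- exp (- s * a) / s))"
      using True assms
      by (intro nn_integral_FTC_Icc) (auto intro!: derivative_eq_intros)
    with True show ?thesis by (simp add: diff_divide_distrib)
  qed simp
  have "(\<integral>\<^sup>+s. ennreal ((exp (- s * a) - exp (- s * b)) / s) * indicator {0<..} s \<partial>lborel)
      = (\<integral>\<^sup>+s. \<integral>\<^sup>+u. ennreal (exp (- s * u)) * indicator {0<..} s * indicator {a..b} u \<partial>lborel \<partial>lborel)"
    by (intro nn_integral_cong) (rule inner)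
  also have "\<dots> = (\<integral>\<^sup>+u. \<integral>\<^sup>+s. ennreal (exp (- s * u)) * indicator {0<..} s * indicator {a..b} u \<partial>lborel \<partial>lborel)"
    by (rule lborel_pair.Fubini'[symmetric]) (measurable; simp)
  also have "\<dots> = (\<integral>\<^sup>+u. ennreal (1 / u) * indicator {a..b} u \<partial>lborel)"
  proof (intro nn_integral_cong)
    fix u :: real
    show "(\<integral>\<^sup>+s. ennreal (exp (- s * u)) * indicator {0<..} s * indicator {a..b} u \<partial>lborel)
        = ennreal (1 / u) * indicator {a..b} u"
    proof (cases "u \<in> {a..b}")
      case True
      then show ?thesis using assms nn_integral_exp_decay[of u] by simp
    qed simp
  qed
  also have "\<dots> = ennreal (ln b - ln a)"
    using assms by (intro nn_integral_FTC_Icc) (auto intro!: derivative_eq_intros simp: field_simps)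
  finally show ?thesis .
qed

text \<open>A smooth non-negative substitute for ln|x| at infinity. In this form ln|x - y| \<le> Lg
  x + Lg y holds with no additive constant, and \<open>exp (- p * Lg x)\<close> is the power (1 +
  |x|^2)^(-p/2).\<close>

definition Lg :: "complex \<Rightarrow> real" where
  "Lg x = ln (1 + (cmod x)\<^sup>2) / 2"

lemma measurable_Lg [measurable]: "Lg \<in> borel_measurable borel"
  unfolding Lg_def[abs_def] by measurable

lemma Lg_nonneg: "Lg x \<ge> 0"
  by (simp add: Lg_def)

lemma exp_Lg: "exp (a * Lg x) = (1 + (cmod x)\<^sup>2) powr (a / 2)"
proof -
  have "1 + (cmod x)\<^sup>2 > 0"
    by (smt (verit) zero_le_power2)
  then show ?thesis
    by (simp add: Lg_def powr_def)
qed

text \<open>Layer cake: with q = p/2, (1 + |z|^2)^(-q) is the integral of q (1 + u)^(-q-1) over u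
  \<ge> |z|^2. After the exchange of integrals the disc |z|^2 \<le> u contributes its area pi u, and
  (1 + u)^(-q) is integrable because q > 1.\<close>

lemma nn_integral_exp_Lg:
  assumes "p > 2"
  shows "(\<integral>\<^sup>+z. ennreal (exp (- p * Lg z)) \<partial>lborel) < \<infinity>"
proof -
  define q where "q = p / 2"
  have q: "q > 1" using assms by (simp add: q_def)
  have layer: "ennreal (exp (- p * Lg z))
      = (\<integral>\<^sup>+u. ennreal (q * (1 + u) powr (- q - 1)) * indicator {(cmod z)\<^sup>2..} u \<partial>lborel)" for z
  proof -
    have "(\<integral>\<^sup>+u. ennreal (q * (1 + u) powr (- q - 1)) * indicator {(cmod z)\<^sup>2..} u \<partial>lborel)
        = ennreal (0 - (- ((1 + (cmod z)\<^sup>2) powr (- q))))"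
    proof (rule nn_integral_FTC_atLeast)
      show "((\<lambda>u. - ((1 + u) powr (- q))) \<longlongrightarrow> 0) at_top"
        using q by real_asymp
      show "DERIV (\<lambda>u. - ((1 + u) powr (- q))) u :> q * (1 + u) powr (- q - 1)" if "(cmod z)\<^sup>2 \<le> u" for u
      proof -
        have "0 < 1 + u" using that by (smt (verit) zero_le_power2)
        then show ?thesis by (auto intro!: derivative_eq_intros simp: powr_diff)
      qed
    qed (use q in auto)
    then show ?thesis using exp_Lg[of "-p" z] by (simp add: q_def)
  qed
  have "(\<integral>\<^sup>+z. ennreal (exp (- p * Lg z)) \<partial>lborel)
      = (\<integral>\<^sup>+z. \<integral>\<^sup>+u. ennreal (q * (1 + u) powr (- q - 1)) * indicator {(cmod z)\<^sup>2..} u \<partial>lborel \<partial>lborel)"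
    by (intro nn_integral_cong) (rule layer)
  also have "\<dots> = (\<integral>\<^sup>+u. \<integral>\<^sup>+z. ennreal (q * (1 + u) powr (- q - 1)) * indicator {(cmod (z::complex))\<^sup>2..} u \<partial>lborel \<partial>lborel)"
    by (rule lborel_pair.Fubini'[symmetric]) (unfold indicator_def atLeast_iff, measurable)
  also have "\<dots> \<le> (\<integral>\<^sup>+u. ennreal (q * (1 + u) powr (- q)) * indicator {0..} u * ennreal pi \<partial>lborel)"
  proof (intro nn_integral_mono)
    fix u :: real
    show "(\<integral>\<^sup>+z. ennreal (q * (1 + u) powr (- q - 1)) * indicator {(cmod (z::complex))\<^sup>2..} u \<partial>lborel)
        \<le> ennreal (q * (1 + u) powr (- q)) * indicator {0..} u * ennreal pi"
    proof (cases "u \<ge> 0")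
      case True
      have "(cmod (z::complex))\<^sup>2 \<le> u \<longleftrightarrow> cmod z \<le> sqrt u" for z
        by (metis real_sqrt_le_iff real_sqrt_abs abs_norm_cancel)
      then have ind: "indicator {(cmod (z::complex))\<^sup>2..} u = (indicator (cball 0 (sqrt u)) z :: ennreal)" for z
        by (simp add: indicator_def)
      have "(\<integral>\<^sup>+z. ennreal (q * (1 + u) powr (- q - 1)) * indicator {(cmod (z::complex))\<^sup>2..} u \<partial>lborel)
          = ennreal (q * (1 + u) powr (- q - 1)) * ennreal (pi * u)"
        using True by (simp add: ind nn_integral_cmult_indicator emeasure_cball_complex)
      also have "\<dots> \<le> ennreal (q * (1 + u) powr (- q)) * ennreal pi"
      proof -
        have "(1 + u) powr (- q - 1) * u \<le> (1 + u) powr (- q - 1) * (1 + u) powr 1"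
          using True by (intro mult_left_mono) auto
        also have "\<dots> = (1 + u) powr (- q)"
          by (simp only: powr_add[symmetric]) simp
        finally have "(1 + u) powr (- q - 1) * u * (q * pi) \<le> (1 + u) powr (- q) * (q * pi)"
          using q by (intro mult_right_mono) auto
        then show ?thesis
          using q True by (subst (1 2) ennreal_mult'[symmetric]) (auto simp: ac_simps intro!: ennreal_leI)
      qed
      finally show ?thesis using True by simp
    next
      case False
      then have "u < (cmod z)\<^sup>2" for z by (smt (verit) zero_le_power2)
      then have "indicator {(cmod z)\<^sup>2..} u = (0::ennreal)" for z by (auto simp: indicator_def not_le)
      then show ?thesis by simp
    qed
  qed
  also have "\<dots> = ennreal (0 - (- (q / (q - 1)) * (1 + 0) powr (1 - q))) * ennreal pi"
  proof (subst nn_integral_multc, simp, subst nn_integral_FTC_atLeast[where F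
      = "\<lambda>u. - (q / (q - 1)) * (1 + u) powr (1 - q)"])
    show "((\<lambda>u. - (q / (q - 1)) * (1 + u) powr (1 - q)) \<longlongrightarrow> 0) at_top"
      using q by real_asymp
    show "DERIV (\<lambda>u. - (q / (q - 1)) * (1 + u) powr (1 - q)) u :> q * (1 + u) powr (- q)" if "0 \<le> u" for u
    proof -
      have "0 < 1 + u" using that by linarith
      then have "DERIV (\<lambda>u. - (q / (q - 1)) * (1 + u) powr (1 - q)) u :> - (q / (q - 1)) * ((1 - q) * (1
          + u) powr (1 - q - of_nat 1) * 1)"
        by (intro DERIV_cmult DERIV_fun_powr) (auto intro!: derivative_eq_intros)
      then have "DERIV (\<lambda>u. - (q / (q - 1)) * (1 + u) powr (1 - q)) u :> - (q / (q - 1)) * ((1 - q) * (1 + u) powr (- q))"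
        by simp
      also have "- (q / (q - 1)) * ((1 - q) * (1 + u) powr (- q)) = q * (1 + u) powr (- q)"
        using q by (simp add: divide_simps) (simp add: algebra_simps)
      finally show ?thesis .
    qed
  qed (use q in auto)
  also have "\<dots> < \<infinity>"
    by (simp add: ennreal_mult_less_top)
  finally show ?thesis .
qed

section \<open>Truncated Gaussian representation of the logarithm\<close>

text \<open>By Frullani, \<open>- ln r\<close> is half the integral of \<open>(exp (- s * r\<^sup>2) - exp (- s)) / s\<close> over
  \<open>s > 0\<close>. Cutting the first exponential off at \<open>S\<close> gives the bounded kernel \<open>reg S\<close>, and
  \<open>htail S\<close> is the non-negative remainder, which is singular at \<open>0\<close> but uniformly integrable.\<close>
definition hq :: "real \<Rightarrow> real \<Rightarrow> real \<Rightarrow> real" where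
  "hq S r s = ((if s \<le> S then exp (- s * r\<^sup>2) else 0) - exp (- s)) / s * indicator {0<..} s"

definition reg :: "real \<Rightarrow> real \<Rightarrow> real" where
  "reg S r = (\<integral>s. hq S r s \<partial>lborel) / 2"

definition htail :: "real \<Rightarrow> real \<Rightarrow> ennreal" where
  "htail S r = (\<integral>\<^sup>+s. ennreal (exp (- s * r\<^sup>2) / s * indicator {S<..} s) \<partial>lborel) / 2"

lemma measurable_hq [measurable]:
  assumes [measurable]: "f \<in> borel_measurable M" "g \<in> borel_measurable M"
  shows "(\<lambda>x. hq S (f x) (g x)) \<in> borel_measurable M"
  unfolding hq_def by measurable

lemma measurable_htail [measurable]: "htail S \<in> borel_measurable borel"
  unfolding htail_def[abs_def] by measurable

lemma measurable_reg [measurable]: "reg S \<in> borel_measurable borel"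
  unfolding reg_def[abs_def] by measurable

lemma nn_integral_exp_minus: "(\<integral>\<^sup>+s. ennreal (exp (- s) * indicator {0<..} s) \<partial>lborel) = 1"
  using nn_integral_exp_decay[of 1] by (simp add: ennreal_mult' ennreal_indicator)

lemma exp_diff_quotient_le: "s > 0 \<Longrightarrow> r \<le> 1 \<Longrightarrow> r \<ge> 0 \<Longrightarrow> \<bar>exp (- s * r\<^sup>2) - exp (- s)\<bar> / s \<le> (1::real)"
proof -
  assume s: "s > 0" "r \<le> 1" "r \<ge> 0"
  then have "r\<^sup>2 \<le> 1" by (simp add: power_le_one)
  then have "s * r\<^sup>2 \<le> s" using s by (simp add: mult_left_le)
  moreover have "exp (- s * r\<^sup>2) \<le> 1" using s by simp
  moreover have "1 - s \<le> exp (- s)" using exp_ge_add_one_self[of "-s"] by simp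
  moreover have "exp (- s) \<le> exp (- s * r\<^sup>2)" using \<open>s * r\<^sup>2 \<le> s\<close> by simp
  ultimately have "\<bar>exp (- s * r\<^sup>2) - exp (- s)\<bar> \<le> s" by linarith
  then show ?thesis using s by simp
qed

text \<open>The point is the merely logarithmic growth in r, which a logarithmic moment can control.
  For r > 1 the difference of the two exponentials has constant sign, and Frullani between 1 and r^2
  gives the term 2 ln r.\<close>

lemma nn_integral_abs_hq_le:
  assumes "S \<ge> 1" "r \<ge> 0"
  shows "(\<integral>\<^sup>+s. ennreal \<bar>hq S r s\<bar> \<partial>lborel) \<le> ennreal (S + 1 + 2 * max 0 (ln r))"
proof (cases "r \<le> 1")
  case True
  have "\<bar>hq S r s\<bar> \<le> indicator {0..S} s + exp (- s) * indicator {0<..} s" for s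
  proof (cases "s > 0")
    case s: True
    show ?thesis
    proof (cases "s \<le> S")
      case True
      with s have "\<bar>hq S r s\<bar> \<le> 1"
        using exp_diff_quotient_le[OF s \<open>r \<le> 1\<close> assms(2)] by (simp add: hq_def)
      with s True show ?thesis by (simp add: add_increasing2)
    next
      case False
      with s assms show ?thesis by (simp add: hq_def divide_le_eq)
    qed
  qed (simp add: hq_def)
  then have "(\<integral>\<^sup>+s. ennreal \<bar>hq S r s\<bar> \<partial>lborel)
      \<le> (\<integral>\<^sup>+s. indicator {0..S} s + ennreal (exp (- s) * indicator {0<..} s) \<partial>lborel)"
    by (intro nn_integral_mono) (simp add: ennreal_indicator[symmetric] ennreal_plus[symmetric] del: ennreal_plus)
  also have "\<dots> = ennreal S + 1"
    using assms by (subst nn_integral_add) (auto simp: nn_integral_exp_minus)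
  also have "\<dots> \<le> ennreal (S + 1 + 2 * max 0 (ln r))"
    using assms by (simp add: ennreal_1[symmetric] ennreal_plus[symmetric] ennreal_leI del: ennreal_plus ennreal_1)
  finally show ?thesis .
next
  case False
  then have r: "r > 1" "r\<^sup>2 > 1" by auto
  have "\<bar>hq S r s\<bar> \<le> (exp (- s * 1) - exp (- s * r\<^sup>2)) / s * indicator {0<..} s + exp (- s) * indicator {0<..} s" for s
  proof (cases "s > 0")
    case s: True
    then have e: "exp (- s * r\<^sup>2) \<le> exp (- s)" using r by simp
    show ?thesis
    proof (cases "s \<le> S")
      case True
      have "\<bar>exp (- (s * r\<^sup>2)) - exp (- s)\<bar> / s = (exp (- s) - exp (- (s * r\<^sup>2))) / s"
        using e by simp
      with s True show ?thesis
        by (simp add: hq_def abs_mult)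
    next
      case False
      have "\<bar>hq S r s\<bar> \<le> exp (- s)" using s False assms by (simp add: hq_def divide_le_eq)
      moreover have "0 \<le> (exp (- s * 1) - exp (- s * r\<^sup>2)) / s" using s e by simp
      ultimately show ?thesis using s by simp
    qed
  qed (simp add: hq_def)
  then have "(\<integral>\<^sup>+s. ennreal \<bar>hq S r s\<bar> \<partial>lborel)
      \<le> (\<integral>\<^sup>+s. ennreal ((exp (- s * 1) - exp (- s * r\<^sup>2)) / s) * indicator {0<..} s
            + ennreal (exp (- s) * indicator {0<..} s) \<partial>lborel)"
  proof (intro nn_integral_mono)
    fix s :: real
    assume le: "\<bar>hq S r s\<bar> \<le> (exp (- s * 1) - exp (- s * r\<^sup>2)) / s * indicator {0<..} s + exp (- s)
        * indicator {0<..} s" for s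
    have "0 \<le> (exp (- s * 1) - exp (- s * r\<^sup>2)) / s * indicator {0<..} s"
      using r by (auto simp: indicator_def)
    then show "ennreal \<bar>hq S r s\<bar> \<le> ennreal ((exp (- s * 1) - exp (- s * r\<^sup>2)) / s) * indicator {0<..} s
            + ennreal (exp (- s) * indicator {0<..} s)"
      using ennreal_leI[OF le[of s]]
      by (auto simp: indicator_def split: if_splits simp flip: ennreal_plus)
  qed
  also have "\<dots> = ennreal (ln (r\<^sup>2) - ln 1) + 1"
    using r nn_integral_frullani[of 1 "r\<^sup>2"] by (subst nn_integral_add) (auto simp: nn_integral_exp_minus)
  also have "\<dots> \<le> ennreal (S + 1 + 2 * max 0 (ln r))"
    using assms r by (simp add: ln_realpow ennreal_1[symmetric] ennreal_plus[symmetric] ennreal_leI del: ennreal_plus ennreal_1)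
  finally show ?thesis .
qed

lemma integrable_hq:
  assumes "S \<ge> 1" "r \<ge> 0"
  shows "integrable lborel (hq S r)"
  using le_less_trans[OF nn_integral_abs_hq_le[OF assms] ennreal_less_top]
  by (intro integrableI_bounded) auto

text \<open>Frullani with limits r^2 and 1. The sign of the integrand depends on whether r is below
  1, and each case reduces to the non-negative version.\<close>

lemma frullani_integral:
  fixes r :: real
  assumes "r > 0"
  shows "has_bochner_integral lborel (\<lambda>s. (exp (- s * r\<^sup>2) - exp (- s)) / s * indicator {0<..} s) (- 2 * ln r)"
proof (cases "r \<le> 1")
  case True
  then have r2: "0 < r\<^sup>2" "r\<^sup>2 \<le> 1" using assms by (simp_all add: power_le_one)
  have "(\<integral>\<^sup>+s. ennreal ((exp (- s * r\<^sup>2) - exp (- s * 1)) / s) * indicator {0<..} s \<partial>lborel) = ennreal (ln 1 - ln (r\<^sup>2))"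
    using r2 by (rule nn_integral_frullani)
  also have "(\<integral>\<^sup>+s. ennreal ((exp (- s * r\<^sup>2) - exp (- s * 1)) / s) * indicator {0<..} s \<partial>lborel)
      = (\<integral>\<^sup>+s. ennreal ((exp (- s * r\<^sup>2) - exp (- s)) / s * indicator {0<..} s) \<partial>lborel)"
    by (intro nn_integral_cong) (simp split: split_indicator)
  finally have eq: "(\<integral>\<^sup>+s. ennreal ((exp (- s * r\<^sup>2) - exp (- s)) / s * indicator {0<..} s) \<partial>lborel)
      = ennreal (- 2 * ln r)"
    using assms by (simp add: ln_realpow)
  have "0 \<le> (exp (- s * r\<^sup>2) - exp (- s)) / s * indicator {0<..} s" for s :: real
    using r2 by (auto simp: mult_left_le split: split_indicator)
  with eq show ?thesis
    using assms True by (intro has_bochner_integral_nn_integral) auto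
next
  case False
  then have r2: "1 < r\<^sup>2" "r > 1" by auto
  have "(\<integral>\<^sup>+s. ennreal ((exp (- s * 1) - exp (- s * r\<^sup>2)) / s) * indicator {0<..} s \<partial>lborel) = ennreal (ln (r\<^sup>2) - ln 1)"
    using r2 by (intro nn_integral_frullani) auto
  also have "(\<integral>\<^sup>+s. ennreal ((exp (- s * 1) - exp (- s * r\<^sup>2)) / s) * indicator {0<..} s \<partial>lborel)
      = (\<integral>\<^sup>+s. ennreal ((exp (- s * 1) - exp (- s * r\<^sup>2)) / s * indicator {0<..} s) \<partial>lborel)"
    by (intro nn_integral_cong) (simp split: split_indicator)
  finally have eq: "(\<integral>\<^sup>+s. ennreal ((exp (- s * 1) - exp (- s * r\<^sup>2)) / s * indicator {0<..} s) \<partial>lborel)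
      = ennreal (2 * ln r)"
    using r2 by (simp add: ln_realpow)
  have "0 \<le> (exp (- s * 1) - exp (- s * r\<^sup>2)) / s * indicator {0<..} s" for s :: real
    using r2 by (auto split: split_indicator)
  with eq have "has_bochner_integral lborel (\<lambda>s. (exp (- s * 1) - exp (- s * r\<^sup>2)) / s * indicator {0<..} s) (2 * ln r)"
    using r2 by (intro has_bochner_integral_nn_integral) auto
  from has_bochner_integral_minus[OF this] show ?thesis
    by (simp add: algebra_simps diff_divide_distrib)
qed

text \<open>Beyond S the factor 1/s is at most 1/S, and the remaining exponential integrates to at
  most 1/r^2. The rate 1/S at fixed r gives the convergence of the cutoff kernel.\<close>

lemma exp_tail_integrable:
  fixes r S :: real
  assumes "S \<ge> 1" "r > 0"
  shows "integrable lborel (\<lambda>s. exp (- s * r\<^sup>2) / s * indicator {S<..} s)"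
    and "(\<integral>s. exp (- s * r\<^sup>2) / s * indicator {S<..} s \<partial>lborel) \<ge> 0"
    and "(\<integral>s. exp (- s * r\<^sup>2) / s * indicator {S<..} s \<partial>lborel) \<le> 1 / (S * r\<^sup>2)"
proof -
  have le: "ennreal (exp (- s * r\<^sup>2) / s * indicator {S<..} s)
      \<le> ennreal (1 / S) * (ennreal (exp (- s * r\<^sup>2)) * indicator {0<..} s)" for s :: real
    using assms by (auto simp: indicator_def ennreal_mult'[symmetric] field_simps intro!: ennreal_leI)
  have "(\<integral>\<^sup>+s. ennreal (exp (- s * r\<^sup>2) / s * indicator {S<..} s) \<partial>lborel) \<le> ennreal (1 / S) * ennreal (1 / r\<^sup>2)"
    using assms nn_integral_exp_decay[of "r\<^sup>2"]
    by (intro order_trans[OF nn_integral_mono[OF le]]) (simp add: nn_integral_cmult)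
  then have b: "(\<integral>\<^sup>+s. ennreal (exp (- s * r\<^sup>2) / s * indicator {S<..} s) \<partial>lborel) \<le> ennreal (1 / (S * r\<^sup>2))"
    using assms by (simp add: ennreal_mult'[symmetric])
  have nn: "0 \<le> exp (- s * r\<^sup>2) / s * indicator {S<..} s" for s
    using assms by (auto simp: indicator_def)
  show i: "integrable lborel (\<lambda>s. exp (- s * r\<^sup>2) / s * indicator {S<..} s)"
    using b nn by (intro integrableI_nonneg) (auto intro: le_less_trans)
  show "(\<integral>s. exp (- s * r\<^sup>2) / s * indicator {S<..} s \<partial>lborel) \<ge> 0"
    using nn by simp
  show "(\<integral>s. exp (- s * r\<^sup>2) / s * indicator {S<..} s \<partial>lborel) \<le> 1 / (S * r\<^sup>2)"
    using b nn_integral_eq_integral[OF i] nn assms by simp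
qed

lemma reg_eq:
  assumes "S \<ge> 1" "r > 0"
  shows "reg S r = - ln r - (\<integral>s. exp (- s * r\<^sup>2) / s * indicator {S<..} s \<partial>lborel) / 2"
proof -
  have "hq S r s = (exp (- s * r\<^sup>2) - exp (- s)) / s * indicator {0<..} s - exp (- s * r\<^sup>2) / s * indicator {S<..} s" for s
    using assms by (auto simp: hq_def indicator_def diff_divide_distrib)
  then have "(\<integral>s. hq S r s \<partial>lborel) = - 2 * ln r - (\<integral>s. exp (- s * r\<^sup>2) / s * indicator {S<..} s \<partial>lborel)"
    using frullani_integral[OF assms(2)] exp_tail_integrable[OF assms]
    by (simp add: has_bochner_integral_iff)
  then show ?thesis by (simp add: reg_def)
qed

lemma reg_le: "S \<ge> 1 \<Longrightarrow> r > 0 \<Longrightarrow> reg S r \<le> - ln r"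
  using reg_eq[of S r] exp_tail_integrable(2)[of S r] by simp

lemma htail_eq: "S \<ge> 1 \<Longrightarrow> r > 0 \<Longrightarrow> htail S r = ennreal (- ln r - reg S r)"
  unfolding htail_def reg_eq
  using exp_tail_integrable[of S r]
  by (subst nn_integral_eq_integral)
     (auto simp: indicator_def divide_ennreal[symmetric] simp flip: ennreal_numeral)

lemma reg_tendsto:
  assumes "r > 0"
  shows "(\<lambda>n. reg (real (Suc n)) r) \<longlonglongrightarrow> - ln r"
proof (rule tendsto_sandwich)
  show "\<forall>\<^sub>F n in sequentially. - ln r - 1 / (real (Suc n) * r\<^sup>2) / 2 \<le> reg (real (Suc n)) r"
  proof (intro always_eventually allI)
    fix n show "- ln r - 1 / (real (Suc n) * r\<^sup>2) / 2 \<le> reg (real (Suc n)) r"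
      using exp_tail_integrable(3)[of "real (Suc n)" r] assms by (subst reg_eq) auto
  qed
  show "\<forall>\<^sub>F n in sequentially. reg (real (Suc n)) r \<le> - ln r"
    using assms by (intro always_eventually allI reg_le) auto
  show "(\<lambda>n. - ln r - 1 / (real (Suc n) * r\<^sup>2) / 2) \<longlonglongrightarrow> - ln r"
    using assms by real_asymp
qed simp

text \<open>For r \<le> 1 the integrand is non-negative up to S, and beyond S \<ge> 1 it is
  -exp(-s)/s \<ge> -exp(-s), so the loss is at most half the integral of exp(-s). The bound is
  uniform in S, which later keeps all weighted cutoff kernels non-negative.\<close>

lemma reg_ge_small:
  assumes "S \<ge> 1" "0 \<le> r" "r \<le> 1"
  shows "reg S r \<ge> - 1 / 2"
proof -
  have "r\<^sup>2 \<le> 1" using assms by (simp add: power_le_one)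
  have "- (exp (- s) * indicator {0<..} s) \<le> hq S r s" for s
  proof (cases "s > 0")
    case s: True
    then have e: "exp (- s) \<le> exp (- s * r\<^sup>2)" using \<open>r\<^sup>2 \<le> 1\<close> by (simp add: mult_left_le)
    show ?thesis
    proof (cases "s \<le> S")
      case True
      have "0 \<le> (exp (- s * r\<^sup>2) - exp (- s)) / s" using s e by simp
      with s True have "0 \<le> hq S r s" by (simp add: hq_def)
      moreover have "- (exp (- s) * indicator {0<..} s) \<le> 0" using s by simp
      ultimately show ?thesis by linarith
    next
      case False
      then show ?thesis using s assms by (simp add: hq_def field_simps)
    qed
  qed (simp add: hq_def)
  moreover have i: "has_bochner_integral lborel (\<lambda>s. exp (- s) * indicator {0<..} (s::real)) 1"
    using nn_integral_exp_minus by (intro has_bochner_integral_nn_integral) auto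
  ultimately have "(\<integral>s. - (exp (- s) * indicator {0<..} (s::real)) \<partial>lborel) \<le> (\<integral>s. hq S r s \<partial>lborel)"
    using assms by (intro integral_mono integrable_hq) (auto simp: has_bochner_integral_iff)
  then show ?thesis using i by (simp add: reg_def has_bochner_integral_iff)
qed

lemma reg_ge_large:
  assumes "S \<ge> 1" "r > 1"
  shows "reg S r \<ge> - ln r - 1 / 2"
proof -
  have "1 \<le> S * r\<^sup>2" using assms by (smt (verit) mult_less_cancel_left1 one_less_power pos2 mult_left_mono)
  then have "1 / (S * r\<^sup>2) \<le> 1" by simp
  with exp_tail_integrable(3)[of S r]
  have "(\<integral>s. exp (- s * r\<^sup>2) / s * indicator {S<..} s \<partial>lborel) \<le> 1"
    using assms by linarith
  then show ?thesis
    using assms by (subst reg_eq) auto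
qed

text \<open>At cutoff 1 the regularized kernel is bounded above, so the whole singularity of -ln at
  0 sits in \<open>htail 1\<close>.\<close>

lemma reg_1_le:
  assumes "0 < r"
  shows "reg 1 r \<le> 1 / 2"
proof (cases "r \<le> 1")
  case True
  have "hq 1 r s \<le> indicator {0..1} s" for s
  proof (cases "s > 0")
    case s: True
    show ?thesis using s exp_diff_quotient_le[OF s True] assms
      by (auto simp: hq_def indicator_def abs_le_iff)
  qed (simp add: hq_def)
  then have "(\<integral>s. hq 1 r s \<partial>lborel) \<le> (\<integral>s. indicator {0..1::real} s \<partial>lborel)"
    using assms by (intro integral_mono integrable_hq) auto
  then show ?thesis by (simp add: reg_def)
next
  case False
  then show ?thesis using reg_le[of 1 r] assms by (smt (verit) ln_ge_zero field_sum_of_halves)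
qed

text \<open>The Gaussian integrates to pi/s over the plane, leaving half the integral of pi/s^2
  beyond S. The value is independent of x and of order 1/S: against a density bounded by B, the
  cutoff costs at most B pi/(2S).\<close>

lemma nn_integral_htail:
  fixes x :: complex
  assumes "S \<ge> 1"
  shows "(\<integral>\<^sup>+y. htail S (cmod (x - y)) \<partial>lborel) = ennreal (pi / (2 * S))"
proof -
  have "(\<integral>\<^sup>+y. htail S (cmod (x - y)) \<partial>lborel)
      = (\<integral>\<^sup>+y. \<integral>\<^sup>+s. ennreal (exp (- s * (cmod (x - y))\<^sup>2) / s * indicator {S<..} s) \<partial>lborel \<partial>lborel) / 2"
    unfolding htail_def divide_ennreal_def by (rule nn_integral_multc) measurable
  also have "(\<integral>\<^sup>+y. \<integral>\<^sup>+s. ennreal (exp (- s * (cmod (x - y))\<^sup>2) / s * indicator {S<..} s) \<partial>lborel \<partial>lborel)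
      = (\<integral>\<^sup>+s. \<integral>\<^sup>+y. ennreal (exp (- s * (cmod (x - y))\<^sup>2) / s * indicator {S<..} s) \<partial>lborel \<partial>lborel)"
    by (rule lborel_pair.Fubini'[symmetric]) measurable
  also have "\<dots> = (\<integral>\<^sup>+s. ennreal (pi / s\<^sup>2) * indicator {S..} s \<partial>lborel)"
  proof (intro nn_integral_cong_AE, use AE_lborel_singleton[of S] in eventually_elim)
    fix s :: real assume "s \<noteq> S"
    show "(\<integral>\<^sup>+y. ennreal (exp (- s * (cmod (x - y))\<^sup>2) / s * indicator {S<..} s) \<partial>lborel)
        = ennreal (pi / s\<^sup>2) * indicator {S..} s"
    proof (cases "s > S")
      case True
      then have s: "s > 0" using assms by simp
      have "(\<integral>\<^sup>+y. ennreal (exp (- s * (cmod (x - y))\<^sup>2) / s * indicator {S<..} s) \<partial>lborel)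
          = (\<integral>\<^sup>+y. ennreal (exp (- s * (cmod (y - x))\<^sup>2)) * ennreal (1 / s) \<partial>lborel)"
        using s True by (intro nn_integral_cong) (simp add: ennreal_mult'[symmetric] norm_minus_commute)
      also have "\<dots> = ennreal (pi / s) * ennreal (1 / s)"
        using s nn_integral_gauss_complex[of s x] by (simp add: nn_integral_multc)
      finally show ?thesis using s True by (simp add: ennreal_mult'[symmetric] power2_eq_square)
    qed (use \<open>s \<noteq> S\<close> in simp)
  qed
  also have "\<dots> = ennreal (0 - (- pi / S))"
  proof (rule nn_integral_FTC_atLeast)
    show "((\<lambda>s. - pi / s) \<longlongrightarrow> 0) at_top" by real_asymp
    show "DERIV (\<lambda>s. - pi / s) s :> pi / s\<^sup>2" if "S \<le> s" for s
      using that assms by (auto intro!: derivative_eq_intros simp: power2_eq_square)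
  qed auto
  finally show ?thesis
    using assms divide_ennreal[of "pi / S" 2] by (simp add: mult.commute)
qed

lemma one_plus_sq_pos: "1 + (cmod x)\<^sup>2 > 0"
  by (smt (verit) zero_le_power2)

text \<open>Cauchy--Schwarz: (|x| + |y|)^2 \<le> (1 + |x|^2)(1 + |y|^2), here from the square of 1 -
  |x||y|.\<close>

lemma ln_dist_le: "ln (cmod (x - y)) \<le> Lg x + Lg y"
proof (cases "x = y")
  case False
  have "(cmod (x - y))\<^sup>2 \<le> (cmod x + cmod y)\<^sup>2"
    by (intro power_mono norm_triangle_ineq4) auto
  also have "\<dots> \<le> (1 + (cmod x)\<^sup>2) * (1 + (cmod y)\<^sup>2)"
    using zero_le_power2[of "1 - cmod x * cmod y"] by (simp add: power2_eq_square algebra_simps)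
  finally have "ln ((cmod (x - y))\<^sup>2) \<le> ln ((1 + (cmod x)\<^sup>2) * (1 + (cmod y)\<^sup>2))"
    using False one_plus_sq_pos[of x] one_plus_sq_pos[of y] by (subst ln_le_cancel_iff) (auto intro!: mult_pos_pos)
  then show ?thesis
    using False one_plus_sq_pos[of x] one_plus_sq_pos[of y] by (simp add: Lg_def ln_mult ln_realpow)
qed (simp add: Lg_nonneg)

text \<open>Peetre's inequality in logarithmic form.\<close>

lemma Lg_peetre: "Lg x \<le> ln 2 / 2 + Lg y + Lg (x - y)"
proof -
  have "cmod x \<le> cmod y + cmod (x - y)" by (metis add_diff_cancel_left' diff_add_cancel norm_triangle_ineq)
  then have "(cmod x)\<^sup>2 \<le> (cmod y + cmod (x - y))\<^sup>2" by (intro power_mono) auto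
  also have "\<dots> \<le> 2 * ((cmod y)\<^sup>2 + (cmod (x - y))\<^sup>2)"
    using zero_le_power2[of "cmod y - cmod (x - y)"] by (simp add: power2_eq_square algebra_simps)
  finally have *: "(cmod x)\<^sup>2 \<le> 2 * ((cmod y)\<^sup>2 + (cmod (x - y))\<^sup>2)" .
  have "1 + (cmod x)\<^sup>2 \<le> 2 * (1 + (cmod y)\<^sup>2) * (1 + (cmod (x - y))\<^sup>2)"
  proof -
    have "1 + t \<le> 2 * (1 + a) * (1 + b)" if "t \<le> 2 * (a + b)" "0 \<le> a" "0 \<le> b" for t a b :: real
    proof -
      have "0 \<le> a * b" using that by simp
      moreover have "2 * (1 + a) * (1 + b) = 2 + 2 * (a + b) + 2 * (a * b)" by (simp add: algebra_simps)
      ultimately show ?thesis using that(1) by linarith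
    qed
    from this[OF *] show ?thesis by simp
  qed
  then have "ln (1 + (cmod x)\<^sup>2) \<le> ln (2 * (1 + (cmod y)\<^sup>2) * (1 + (cmod (x - y))\<^sup>2))"
    by (rule ln_mono[OF _ one_plus_sq_pos])
  moreover have "ln (2 * a * b) = ln 2 + ln a + ln b" if "a > 0" "b > 0" for a b :: real
    using that by (simp add: ln_mult)
  from this[OF one_plus_sq_pos one_plus_sq_pos]
  have "ln (2 * (1 + (cmod y)\<^sup>2) * (1 + (cmod (x - y))\<^sup>2)) = ln 2 + ln (1 + (cmod y)\<^sup>2) + ln (1 + (cmod (x - y))\<^sup>2)" .
  ultimately show ?thesis unfolding Lg_def by linarith
qed

text \<open>The growth in x cancels: far from y, Peetre's inequality lets ln|x - y| compensate
  \<open>Lg x\<close>, and near y only the integrable singularity \<open>htail 1\<close> remains.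
  Hence the logarithmic potential of a bounded density with logarithmic moment is
  \<open>Lg x\<close> up to a bounded term.\<close>

lemma Lg_minus_ln_dist_le:
  assumes "x \<noteq> y"
  shows "ennreal (Lg x - ln (cmod (x - y))) \<le> ennreal (2 + Lg y) + htail 1 (cmod (x - y))"
proof -
  define r where "r = cmod (x - y)"
  have r: "r > 0" using assms by (simp add: r_def)
  have l2: "ln 2 \<le> (1::real)" using ln_le_minus_one[of 2] by simp
  have Lr: "Lg (x - y) = ln (1 + r\<^sup>2) / 2" by (simp add: Lg_def r_def)
  have pos: "0 < 1 + r\<^sup>2" by (smt (verit) zero_le_power2)
  show ?thesis
  proof (cases "r \<le> 1")
    case True
    then have "r\<^sup>2 \<le> 1" using r by (simp add: power_le_one)
    then have "ln (1 + r\<^sup>2) \<le> ln 2" using pos by (subst ln_le_cancel_iff) auto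
    then have "Lg x - ln r \<le> (2 + Lg y) + (- ln r - reg 1 r)"
      using Lg_peetre[of x y] Lr l2 reg_1_le[OF r] by linarith
    then show ?thesis
      using r reg_le[of 1 r] Lg_nonneg[of y]
      by (auto simp: htail_eq ennreal_plus[symmetric] r_def[symmetric] simp del: ennreal_plus intro!: ennreal_leI)
  next
    case False
    have "ln (1 + r\<^sup>2) \<le> ln (2 * r\<^sup>2)"
      using False pos by (subst ln_le_cancel_iff) (auto intro: self_le_power)
    then have "ln (1 + r\<^sup>2) \<le> ln 2 + 2 * ln r" using r by (simp add: ln_mult ln_realpow)
    then have "Lg x - ln r \<le> 2 + Lg y"
      using Lg_peetre[of x y] Lr l2 by linarith
    from ennreal_leI[OF this] show ?thesis
      unfolding r_def[symmetric] by (intro add_increasing2) auto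
  qed
qed

text \<open>The weights absorb the logarithmic decrease of \<open>reg\<close> at large distance,
  uniformly in S. The resulting positivity is what Fatou's lemma requires when S tends to
  infinity.\<close>

lemma one_plus_reg_ge:
  assumes "S \<ge> 1"
  shows "1 + Lg x + Lg y + reg S (cmod (x - y)) \<ge> 1 / 2"
  using reg_ge_small[OF assms, of "cmod (x - y)"] reg_ge_large[OF assms, of "cmod (x - y)"]
    ln_dist_le[of x y] Lg_nonneg[of x] Lg_nonneg[of y]
  by (cases "cmod (x - y) \<le> 1") auto

text \<open>The pointwise bound on Lg x - ln|x - y| is integrated against m: mass, logarithmic
  moment and supremum of m control its three terms, none of which depends on x.\<close>

lemma log_potential_bound:
  fixes m :: "complex \<Rightarrow> real"
  assumes [measurable]: "m \<in> borel_measurable borel" and m: "\<And>x. 0 \<le> m x" "\<And>x. m x \<le> B"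
    and int: "(\<integral>\<^sup>+x. ennreal (m x) \<partial>lborel) = 1"
    and L: "(\<integral>\<^sup>+x. ennreal (Lg x * m x) \<partial>lborel) < \<infinity>"
  shows "\<exists>C. \<forall>x. integrable lborel (\<lambda>y. ln (cmod (x - y)) * m y)
              \<and> \<bar>(\<integral>y. ln (cmod (x - y)) * m y \<partial>lborel) - Lg x\<bar> \<le> C"
proof -
  have B: "B \<ge> 0" using m order_trans by blast
  obtain c where c: "c \<ge> 0" "(\<integral>\<^sup>+x. ennreal (Lg x * m x) \<partial>lborel) = ennreal c"
    using L by (metis ennreal_cases infinity_ennreal_def less_irrefl)
  have m1: "has_bochner_integral lborel m 1"
    using int m by (intro has_bochner_integral_nn_integral) auto
  show ?thesis
  proof (intro exI[of _ "2 + c + B * (pi / 2)"] allI)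
    fix x :: complex
    define d where "d y = (Lg x - ln (cmod (x - y))) * m y" for y
    have [measurable]: "d \<in> borel_measurable borel" unfolding d_def[abs_def] by measurable
    have "ennreal \<bar>d y\<bar> \<le> ennreal (2 * m y) + ennreal (Lg y * m y) + ennreal B * htail 1 (cmod (x - y))" if "y \<noteq> x" for y
    proof -
      have "ennreal \<bar>Lg x - ln (cmod (x - y))\<bar> \<le> ennreal (2 + Lg y) + htail 1 (cmod (x - y))"
      proof (cases "Lg x - ln (cmod (x - y)) \<ge> 0")
        case True
        then show ?thesis using Lg_minus_ln_dist_le[of x y] that by simp
      next
        case False
        then have "\<bar>Lg x - ln (cmod (x - y))\<bar> \<le> 2 + Lg y" using ln_dist_le[of x y] by linarith
        from ennreal_leI[OF this] show ?thesis by (intro add_increasing2) auto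
      qed
      then have "ennreal \<bar>Lg x - ln (cmod (x - y))\<bar> * ennreal (m y)
          \<le> (ennreal (2 + Lg y) + htail 1 (cmod (x - y))) * ennreal (m y)"
        by (intro mult_right_mono) auto
      also have "\<dots> = ennreal (2 * m y) + ennreal (Lg y * m y) + ennreal (m y) * htail 1 (cmod (x - y))"
        using m[of y] Lg_nonneg[of y] by (simp add: distrib_right distrib_left ennreal_mult' ac_simps)
      also have "\<dots> \<le> ennreal (2 * m y) + ennreal (Lg y * m y) + ennreal B * htail 1 (cmod (x - y))"
        using m[of y] by (intro add_left_mono mult_right_mono ennreal_leI) auto
      finally show ?thesis using m[of y] by (simp add: d_def abs_mult ennreal_mult')
    qed
    then have "(\<integral>\<^sup>+y. ennreal \<bar>d y\<bar> \<partial>lborel)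
        \<le> (\<integral>\<^sup>+y. ennreal (2 * m y) + ennreal (Lg y * m y) + ennreal B * htail 1 (cmod (x - y)) \<partial>lborel)"
      by (intro nn_integral_mono_AE, use AE_lborel_singleton[of x] in eventually_elim) auto
    also have "\<dots> = 2 + ennreal c + ennreal B * ennreal (pi / 2)"
      using nn_integral_htail[of 1 x] int c
      by (simp add: nn_integral_add nn_integral_cmult ennreal_mult')
    also have "\<dots> = ennreal (2 + c + B * (pi / 2))"
      using c B by (subst ennreal_mult'[symmetric]) auto
    finally have b: "(\<integral>\<^sup>+y. ennreal \<bar>d y\<bar> \<partial>lborel) \<le> ennreal (2 + c + B * (pi / 2))" .
    then have di: "integrable lborel d"
      by (intro integrableI_bounded) (auto intro: le_less_trans)
    have "ennreal \<bar>\<integral>y. d y \<partial>lborel\<bar> \<le> (\<integral>\<^sup>+y. ennreal \<bar>d y\<bar> \<partial>lborel)"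
      using integral_norm_bound_ennreal[OF di] by simp
    from order_trans[OF this b] have dle: "\<bar>\<integral>y. d y \<partial>lborel\<bar> \<le> 2 + c + B * (pi / 2)"
      using c B by (subst (asm) ennreal_le_iff) auto
    have eq: "ln (cmod (x - y)) * m y = Lg x * m y - d y" for y
      by (simp add: d_def algebra_simps)
    show "integrable lborel (\<lambda>y. ln (cmod (x - y)) * m y)
              \<and> \<bar>(\<integral>y. ln (cmod (x - y)) * m y \<partial>lborel) - Lg x\<bar> \<le> 2 + c + B * (pi / 2)"
      unfolding eq using di dle m1 by (simp add: has_bochner_integral_iff)
  qed
qed

section \<open>Minimizing energy plus relative entropy\<close>

text \<open>The terms - t + 1 integrate to zero for a probability density relative to a probability
  measure, but they make the integrand non-negative, so that relative entropy becomes an extended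
  non-negative integral. The convention \<open>ln 0 = 0\<close> gives the correct value 1 at t =
  0.\<close>

definition ent :: "real \<Rightarrow> real" where
  "ent t = t * ln t - t + 1"

text \<open>A Hellinger-type lower bound, from 1 - 1/v \<le> ln v at v = sqrt t.\<close>

lemma ent_sqrt_le:
  assumes "t \<ge> 0"
  shows "(sqrt t - 1)\<^sup>2 \<le> ent t"
proof (cases "t = 0")
  case False
  define v where "v = sqrt t"
  have v: "v > 0" "t = v\<^sup>2" using assms False by (auto simp: v_def)
  have "1 - 1 / v \<le> ln v" using ln_le_minus_one[of "1 / v"] v by (simp add: ln_div)
  then have "2 * v\<^sup>2 * (1 - 1 / v) \<le> 2 * v\<^sup>2 * ln v" using v by (intro mult_left_mono) auto
  moreover have "2 * v\<^sup>2 * (1 - 1 / v) = 2 * v\<^sup>2 - 2 * v"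
    using v by (simp add: right_diff_distrib power2_eq_square)
  moreover have "ln (v\<^sup>2) = 2 * ln v" using v by (simp add: ln_realpow)
  ultimately have "2 * v\<^sup>2 - 2 * v \<le> v\<^sup>2 * ln (v\<^sup>2)" by simp
  then have "(v - 1)\<^sup>2 \<le> ent t"
    unfolding ent_def v by (simp add: power2_eq_square algebra_simps)
  then show ?thesis by (simp add: v_def)
qed (simp add: ent_def)

lemma ent_nonneg: "t \<ge> 0 \<Longrightarrow> ent t \<ge> 0"
  using ent_sqrt_le[of t] by (smt (verit) zero_le_power2)

lemma ent_eq_0D: "t \<ge> 0 \<Longrightarrow> ent t = 0 \<Longrightarrow> t = 1"
  using ent_sqrt_le[of t] by (simp add: power2_eq_square) (smt (verit) real_sqrt_eq_1_iff zero_le_square mult_eq_0_iff)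

text \<open>On this range sqrt t \<le> 3/2, so (sqrt t + 1)^2 \<le> 7 and the Hellinger bound
  dominates (t - 1)^2/7.\<close>

lemma ent_quadratic:
  assumes "0 \<le> t" "t \<le> 2"
  shows "(t - 1)\<^sup>2 / 7 \<le> ent t"
proof -
  define v where "v = sqrt t"
  have v: "v \<ge> 0" "t = v\<^sup>2" using assms by (auto simp: v_def)
  have "v \<le> 3 / 2" unfolding v_def using assms by (intro real_le_lsqrt) (auto simp: power2_eq_square)
  then have "(v + 1)\<^sup>2 \<le> (5 / 2)\<^sup>2" using v by (intro power_mono) auto
  then have "(v + 1)\<^sup>2 \<le> 7" by (simp add: power2_eq_square)
  then have "(v + 1)\<^sup>2 * (v - 1)\<^sup>2 \<le> 7 * (v - 1)\<^sup>2" by (intro mult_right_mono) auto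
  moreover have "(t - 1)\<^sup>2 = (v + 1)\<^sup>2 * (v - 1)\<^sup>2" by (simp add: v power2_eq_square algebra_simps)
  ultimately show ?thesis using ent_sqrt_le[OF assms(1)] by (simp add: v_def)
qed

text \<open>Change of reference: a ln a is expressed relative to an arbitrary level m. This passes
  between entropies relative to Lebesgue measure, to the reference density and to the Gibbs
  competitor.\<close>

lemma ent_scale:
  assumes "m > 0" "a \<ge> 0"
  shows "a * ln a = m * ent (a / m) + a * ln m + a - m"
  using assms by (cases "a = 0") (auto simp: ent_def ln_div field_simps)

text \<open>With m the midpoint and a = m(1 + u), b = m(1 - u), the midpoint convexity defect of
  \<open>ent\<close> is at least m u^2/7, while |a - b| = 2m|u|. Young's inequality with the free
  parameter e trades the square for a first power, so that the gain integrates to an L^1 distance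
  and the error to a constant.\<close>

lemma ent_gap:
  assumes "a \<ge> 0" "b \<ge> 0" "e \<ge> 0"
  shows "e * \<bar>a - b\<bar> + ent ((a + b) / 2) \<le> 4 * e\<^sup>2 * (a + b) + (ent a + ent b) / 2"
proof (cases "a + b = 0")
  case True
  then have "a = 0" "b = 0" using assms by auto
  then show ?thesis by simp
next
  case False
  define m u where "m = (a + b) / 2" and "u = a / m - 1"
  have m: "m > 0" "a + b = 2 * m" using False assms by (auto simp: m_def)
  have am: "a / m = 1 + u" "b / m = 1 - u" using m by (auto simp: u_def field_simps)
  have u: "0 \<le> 1 + u" "0 \<le> 1 - u" using assms m by (auto simp: am[symmetric])
  have "(ent a + ent b) / 2 - ent m = m * (ent (1 + u) + ent (1 - u)) / 2"
  proof -
    have "ent a = m * ent (1 + u) + a * ln m - m + 1" "ent b = m * ent (1 - u) + b * ln m - m + 1"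
      using ent_scale[OF m(1) assms(1)] ent_scale[OF m(1) assms(2)]
      unfolding am by (simp_all add: ent_def[of a] ent_def[of b])
    moreover have "a * ln m + b * ln m = 2 * (m * ln m)" using m(2) by (simp add: distrib_right[symmetric])
    moreover have "(A + x - m + 1 + (B + y - m + 1)) / 2 - (l - m + 1) = (A + B) / 2"
      if "x + y = 2 * l" for A B x y l :: real
      using that by (simp add: field_simps)
    ultimately show ?thesis by (simp only: ent_def[of m] distrib_left)
  qed
  moreover have "u\<^sup>2 / 7 + u\<^sup>2 / 7 \<le> ent (1 + u) + ent (1 - u)"
    using ent_quadratic[of "1 + u"] ent_quadratic[of "1 - u"] u by (intro add_mono) auto
  then have "m * (u\<^sup>2 / 7 + u\<^sup>2 / 7) \<le> m * (ent (1 + u) + ent (1 - u))"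
    using m by (intro mult_left_mono) auto
  moreover have "e * \<bar>a - b\<bar> \<le> 4 * e\<^sup>2 * (a + b) + m * (u\<^sup>2 / 7)"
  proof -
    have "a - b = 2 * m * u" using m am by (simp add: field_simps)
    then have ab: "\<bar>a - b\<bar> = 2 * m * \<bar>u\<bar>" using m by (simp add: abs_mult)
    have "(7 * e - \<bar>u\<bar>)\<^sup>2 = 49 * e\<^sup>2 - 14 * (e * \<bar>u\<bar>) + u\<^sup>2"
      by (simp add: power2_eq_square algebra_simps)
    moreover have "0 \<le> (7 * e - \<bar>u\<bar>)\<^sup>2" "0 \<le> e\<^sup>2" by simp_all
    ultimately have "2 * (e * \<bar>u\<bar>) \<le> 8 * e\<^sup>2 + u\<^sup>2 / 7" by linarith
    then have "m * (2 * (e * \<bar>u\<bar>)) \<le> m * (8 * e\<^sup>2 + u\<^sup>2 / 7)" using m by (intro mult_left_mono) auto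
    then show ?thesis unfolding ab m(2) by (simp add: algebra_simps)
  qed
  moreover have "d + M \<le> y + E" if "E - M = z / 2" "m * (x + x) \<le> z" "d \<le> y + m * x" for d M y E z x :: real
    using that by (simp add: distrib_left)
  ultimately show ?thesis unfolding m_def[symmetric] by (metis add.commute)
qed

text \<open>This is the non-negativity of \<open>ent\<close> at a/m and b/m, with m the convex
  combination, rescaled to the level m.\<close>

lemma ent_convex:
  assumes "a \<ge> 0" "b \<ge> 0" "0 \<le> t" "t \<le> 1"
  shows "ent ((1 - t) * a + t * b) \<le> (1 - t) * ent a + t * ent b"
proof (cases "(1 - t) * a + t * b = 0")
  case True
  then have z: "(1 - t) * a = 0" "t * b = 0" using assms by (smt (verit) mult_nonneg_nonneg)+
  then have e: "(1 - t) * ent a = 1 - t" "t * ent b = t" by (auto simp: ent_def)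
  show ?thesis unfolding True e by (simp add: ent_def)
next
  case False
  define m where "m = (1 - t) * a + t * b"
  have m: "m > 0" using False assms by (smt (verit) m_def mult_nonneg_nonneg)
  have "0 \<le> (1 - t) * (m * ent (a / m)) + t * (m * ent (b / m))"
    using assms m by (auto intro!: add_nonneg_nonneg mult_nonneg_nonneg ent_nonneg)
  also have "\<dots> = (1 - t) * (a * ln a - a * ln m - a + m) + t * (b * ln b - b * ln m - b + m)"
    using ent_scale[OF m assms(1)] ent_scale[OF m assms(2)] by simp
  also have "\<dots> = (1 - t) * (a * ln a) + t * (b * ln b) - ((1 - t) * a + t * b) * ln m - ((1 - t) * a + t * b) + m"
    by (simp add: algebra_simps)
  finally have "m * ln m \<le> (1 - t) * (a * ln a) + t * (b * ln b)" unfolding m_def[symmetric] by simp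
  then show ?thesis unfolding m_def[symmetric] unfolding ent_def by (simp add: m_def algebra_simps)
qed

text \<open>The critical point is 0, where t ln t tends to 0 in agreement with
  \<open>ln 0 = 0\<close>.\<close>

lemma continuous_on_ent: "continuous_on {0..} ent"
proof -
  have "continuous (at t within {0..}) ent" if t: "t \<ge> 0" for t
  proof (cases "t = 0")
    case True
    have "((\<lambda>t::real. t * ln t - t + 1) \<longlongrightarrow> 1) (at_right 0)" by real_asymp
    then have "(ent \<longlongrightarrow> ent 0) (at 0 within {0..})"
      unfolding ent_def[abs_def] by (simp add: at_within_Ici_at_right)
    then show ?thesis using True by (simp add: continuous_within)
  next
    case False
    then show ?thesis unfolding ent_def[abs_def] using t by (intro continuous_intros) auto
  qed
  then show ?thesis by (simp add: continuous_on_eq_continuous_within)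
qed

lemma ent_le: "t \<ge> 0 \<Longrightarrow> ent t \<le> t\<^sup>2 + 1"
proof (cases "t = 0")
  case False
  assume "t \<ge> 0"
  then have "t * ln t \<le> t * (t - 1)" using False ln_le_minus_one[of t] by (intro mult_left_mono) auto
  with \<open>t \<ge> 0\<close> show ?thesis by (simp add: ent_def power2_eq_square algebra_simps)
qed (simp add: ent_def)

lemma measurable_ent [measurable]: "ent \<in> borel_measurable borel"
  unfolding ent_def[abs_def] by measurable

lemma ennreal_half: "(x :: ennreal) / 2 = x * ennreal (1 / 2)"
  using inverse_ennreal[of 2] by (simp add: divide_ennreal_def inverse_eq_divide)

section \<open>Abstract free energy: a non-negative bilinear energy plus relative entropy\<close>

locale gibbs_variational = prob_space \<gamma> for \<gamma> :: "'a measure" +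
  fixes K :: "'a \<Rightarrow> 'a \<Rightarrow> real" and \<kappa> :: real
  assumes measurable_K [measurable]: "(\<lambda>(x, y). K x y) \<in> borel_measurable (\<gamma> \<Otimes>\<^sub>M \<gamma>)"
    and K_nonneg: "K x y \<ge> 0"
    and K_sym: "K x y = K y x"
    and \<kappa>_pos: "\<kappa> > 0"
begin

text \<open>Extended values keep the bilinear algebra valid before finiteness is known. In return
  there is no subtraction, so convexity has to be expressed with the cross term on one side and the
  self-terms on the other.\<close>

definition KK :: "('a \<Rightarrow> real) \<Rightarrow> ('a \<Rightarrow> real) \<Rightarrow> ennreal" where
  "KK f g = (\<integral>\<^sup>+x. \<integral>\<^sup>+y. ennreal (K x y) * ennreal (f x) * ennreal (g y) \<partial>\<gamma> \<partial>\<gamma>)"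

definition pot :: "('a \<Rightarrow> real) \<Rightarrow> 'a \<Rightarrow> ennreal" where
  "pot f x = (\<integral>\<^sup>+y. ennreal (K x y) * ennreal (f y) \<partial>\<gamma>)"

definition EE :: "('a \<Rightarrow> real) \<Rightarrow> ennreal" where
  "EE f = (\<integral>\<^sup>+x. ennreal (ent (f x) / \<kappa>) \<partial>\<gamma>)"

definition J :: "('a \<Rightarrow> real) \<Rightarrow> ennreal" where
  "J f = KK f f / 2 + EE f"

definition dens :: "('a \<Rightarrow> real) \<Rightarrow> bool" where
  "dens f \<longleftrightarrow> f \<in> borel_measurable \<gamma> \<and> (\<forall>x. 0 \<le> f x) \<and> (\<integral>\<^sup>+x. ennreal (f x) \<partial>\<gamma>) = 1"

lemma measurable_K' [measurable (raw)]:
  "f \<in> measurable M \<gamma> \<Longrightarrow> g \<in> measurable M \<gamma> \<Longrightarrow> (\<lambda>x. K (f x) (g x)) \<in> borel_measurable M"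
  using measurable_compose[OF _ measurable_K, of "\<lambda>x. (f x, g x)" M] by auto

sublocale pair: pair_sigma_finite \<gamma> \<gamma> ..

lemma measurable_pot [measurable]:
  assumes [measurable]: "f \<in> borel_measurable \<gamma>" shows "pot f \<in> borel_measurable \<gamma>"
  unfolding pot_def[abs_def] by measurable

lemma KK_sym:
  assumes [measurable]: "f \<in> borel_measurable \<gamma>" "g \<in> borel_measurable \<gamma>"
  shows "KK f g = KK g f"
proof -
  have "KK f g = (\<integral>\<^sup>+y. \<integral>\<^sup>+x. ennreal (K x y) * ennreal (f x) * ennreal (g y) \<partial>\<gamma> \<partial>\<gamma>)"
    unfolding KK_def by (rule pair.Fubini'[symmetric]) measurable
  then show ?thesis unfolding KK_def by (simp add: K_sym mult.assoc mult.commute mult.left_commute)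
qed

lemma KK_pot:
  assumes [measurable]: "f \<in> borel_measurable \<gamma>" "g \<in> borel_measurable \<gamma>"
  shows "KK f g = (\<integral>\<^sup>+x. pot g x * ennreal (f x) \<partial>\<gamma>)"
  unfolding KK_def pot_def
  by (intro nn_integral_cong, subst nn_integral_multc[symmetric]) (auto intro!: nn_integral_cong simp: ac_simps)

lemma KK_mono:
  assumes "\<And>x. 0 \<le> f x" "\<And>x. f x \<le> f' x" "\<And>x. 0 \<le> g x" "\<And>x. g x \<le> g' x"
  shows "KK f g \<le> KK f' g'"
  unfolding KK_def using assms by (intro nn_integral_mono mult_mono ennreal_leI) auto

lemma pot_lincomb:
  assumes [measurable]: "f \<in> borel_measurable \<gamma>" "g \<in> borel_measurable \<gamma>"
    and "\<And>x. f x \<ge> 0" "\<And>x. g x \<ge> 0" "a \<ge> 0" "b \<ge> 0"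
    and "x \<in> space \<gamma>"
  shows "pot (\<lambda>x. a * f x + b * g x) x = ennreal a * pot f x + ennreal b * pot g x"
proof -
  have [measurable]: "x \<in> space \<gamma>" by fact
  have "pot (\<lambda>x. a * f x + b * g x) x
      = (\<integral>\<^sup>+y. ennreal a * (ennreal (K x y) * ennreal (f y)) + ennreal b * (ennreal (K x y) * ennreal (g y)) \<partial>\<gamma>)"
    unfolding pot_def using assms by (intro nn_integral_cong) (simp add: ennreal_mult distrib_left ac_simps)
  also have "\<dots> = ennreal a * pot f x + ennreal b * pot g x"
    unfolding pot_def by (simp add: nn_integral_add nn_integral_cmult)
  finally show ?thesis .
qed

lemma KK_lincomb:
  assumes [measurable]: "f \<in> borel_measurable \<gamma>" "g \<in> borel_measurable \<gamma>" "h \<in> borel_measurable \<gamma>"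
    and nn: "\<And>x. f x \<ge> 0" "\<And>x. g x \<ge> 0" "a \<ge> 0" "b \<ge> 0"
  shows "KK h (\<lambda>x. a * f x + b * g x) = ennreal a * KK h f + ennreal b * KK h g"
proof -
  have "KK h (\<lambda>x. a * f x + b * g x)
      = (\<integral>\<^sup>+x. ennreal a * (pot f x * ennreal (h x)) + ennreal b * (pot g x * ennreal (h x)) \<partial>\<gamma>)"
    by (subst KK_pot, measurable, intro nn_integral_cong) (simp add: pot_lincomb nn distrib_right distrib_left ac_simps)
  then show ?thesis by (simp add: nn_integral_add nn_integral_cmult KK_pot)
qed

lemma KK_quadratic:
  assumes [measurable]: "f \<in> borel_measurable \<gamma>" "g \<in> borel_measurable \<gamma>"
    and nn: "\<And>x. f x \<ge> 0" "\<And>x. g x \<ge> 0" "a \<ge> 0" "b \<ge> 0"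
  shows "KK (\<lambda>x. a * f x + b * g x) (\<lambda>x. a * f x + b * g x)
     = ennreal (a\<^sup>2) * KK f f + ennreal (2 * a * b) * KK f g + ennreal (b\<^sup>2) * KK g g"
proof -
  let ?h = "\<lambda>x. a * f x + b * g x"
  have "KK ?h ?h = ennreal a * KK ?h f + ennreal b * KK ?h g"
    by (intro KK_lincomb nn) measurable
  also have "KK ?h f = ennreal a * KK f f + ennreal b * KK f g"
    by (subst KK_sym, measurable) (intro KK_lincomb nn; measurable)
  also have "KK ?h g = ennreal a * KK f g + ennreal b * KK g g"
    by (subst KK_sym, measurable, subst KK_lincomb) (use nn KK_sym[of g f] in auto)
  also have "ennreal a * (ennreal a * KK f f + ennreal b * KK f g) + ennreal b * (ennreal a * KK f g + ennreal b * KK g g)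
     = ennreal (a\<^sup>2) * KK f f + (ennreal (a * b) + ennreal (a * b)) * KK f g + ennreal (b\<^sup>2) * KK g g"
    using nn by (simp add: ennreal_mult power2_eq_square distrib_left distrib_right ac_simps)
  also have "ennreal (a * b) + ennreal (a * b) = ennreal (2 * a * b)"
    using nn by (simp add: ennreal_plus[symmetric] del: ennreal_plus)
  finally show ?thesis .
qed

text \<open>\<open>ent_gap\<close> is integrated and added to the quadratic expansion of the energy
  at the midpoint. Positive definiteness enters in the subtraction-free form \<open>pos\<close>; the
  unit masses of f and g turn 4e^2(f + g) into 8e^2.\<close>

lemma J_gap:
  assumes f: "dens f" and g: "dens g" and e: "e \<ge> 0"
    and pos: "2 * KK f g \<le> KK f f + KK g g"
  shows "J (\<lambda>x. (f x + g x) / 2) + ennreal (e / \<kappa>) * (\<integral>\<^sup>+x. ennreal \<bar>f x - g x\<bar> \<partial>\<gamma>)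
     \<le> (J f + J g) / 2 + ennreal (8 * e\<^sup>2 / \<kappa>)"
proof -
  have [measurable]: "f \<in> borel_measurable \<gamma>" "g \<in> borel_measurable \<gamma>"
    and nn: "\<And>x. f x \<ge> 0" "\<And>x. g x \<ge> 0"
    and int: "(\<integral>\<^sup>+x. ennreal (f x) \<partial>\<gamma>) = 1" "(\<integral>\<^sup>+x. ennreal (g x) \<partial>\<gamma>) = 1"
    using f g by (auto simp: dens_def)
  let ?m = "\<lambda>x. (f x + g x) / 2"
  have "KK ?m ?m = KK (\<lambda>x. (1/2) * f x + (1/2) * g x) (\<lambda>x. (1/2) * f x + (1/2) * g x)"
    by (simp add: add_divide_distrib)
  also have "\<dots> = ennreal (1/4) * (KK f f + 2 * KK f g + KK g g)"
    using nn by (subst KK_quadratic)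
        (use ennreal_mult'[of "1/4" 2] in \<open>auto simp: power2_eq_square distrib_left mult.assoc[symmetric]\<close>)
  also have "\<dots> \<le> ennreal (1/4) * (KK f f + (KK f f + KK g g) + KK g g)"
    using pos by (intro mult_left_mono add_mono) auto
  also have "\<dots> = (KK f f + KK g g) / 2"
  proof -
    have "KK f f + (KK f f + KK g g) + KK g g = 2 * (KK f f + KK g g)"
      by (simp add: mult_2 ac_simps)
    moreover have "ennreal (1/4) * (2 * x) = x / 2" for x
      using ennreal_mult'[of "1/4" 2] by (simp add: ennreal_half mult.assoc[symmetric] mult.commute)
    ultimately show ?thesis by metis
  qed
  finally have 1: "KK ?m ?m / 2 \<le> (KK f f + KK g g) / 2 / 2"
    by (rule divide_right_mono_ennreal)
  have "EE ?m + ennreal (e / \<kappa>) * (\<integral>\<^sup>+x. ennreal \<bar>f x - g x\<bar> \<partial>\<gamma>)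
      = (\<integral>\<^sup>+x. ennreal ((ent (?m x) + e * \<bar>f x - g x\<bar>) / \<kappa>) \<partial>\<gamma>)"
    unfolding EE_def using \<kappa>_pos e nn
    by (subst nn_integral_cmult[symmetric], measurable, subst nn_integral_add[symmetric])
       (auto intro!: nn_integral_cong simp: ennreal_mult'[symmetric] ennreal_plus[symmetric] ent_nonneg add_divide_distrib simp del: ennreal_plus)
  also have "\<dots> \<le> (\<integral>\<^sup>+x. ennreal ((4 * e\<^sup>2 * (f x + g x) + (ent (f x) + ent (g x)) / 2) / \<kappa>) \<partial>\<gamma>)"
    using ent_gap[OF nn e] \<kappa>_pos
    by (intro nn_integral_mono ennreal_leI divide_right_mono) (auto simp: add.commute)
  also have "\<dots> = (\<integral>\<^sup>+x. ennreal (4 * e\<^sup>2 / \<kappa>) * (ennreal (f x) + ennreal (g x)) + (ennreal (ent (f x) / \<kappa>)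
      + ennreal (ent (g x) / \<kappa>)) * ennreal (1/2) \<partial>\<gamma>)"
  proof (intro nn_integral_cong)
    fix x
    have *: "ennreal (p * (q + r) + (b + c) / 2)
        = ennreal p * (ennreal q + ennreal r) + (ennreal b + ennreal c) * ennreal (1/2)"
      if "p \<ge> 0" "q \<ge> 0" "r \<ge> 0" "b \<ge> 0" "c \<ge> 0" for p q r b c :: real
    proof -
      have "ennreal (p * (q + r) + (b + c) / 2) = ennreal (p * (q + r)) + ennreal ((b + c) * (1/2))" using that by simp
      with that show ?thesis by (simp only: ennreal_mult ennreal_plus add_nonneg_nonneg)
    qed
    have "(4 * e\<^sup>2 * (f x + g x) + (ent (f x) + ent (g x)) / 2) / \<kappa>
        = 4 * e\<^sup>2 / \<kappa> * (f x + g x) + (ent (f x) / \<kappa> + ent (g x) / \<kappa>) / 2"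
      by (simp add: add_divide_distrib)
    then show "ennreal ((4 * e\<^sup>2 * (f x + g x) + (ent (f x) + ent (g x)) / 2) / \<kappa>)
        = ennreal (4 * e\<^sup>2 / \<kappa>) * (ennreal (f x) + ennreal (g x)) + (ennreal (ent (f x) / \<kappa>) + ennreal (ent (g x)
            / \<kappa>)) * ennreal (1/2)"
      using nn \<kappa>_pos by (simp only:) (rule *, auto intro!: divide_nonneg_pos ent_nonneg)
  qed
  also have "\<dots> = ennreal (4 * e\<^sup>2 / \<kappa>) * (1 + 1) + (EE f + EE g) * ennreal (1/2)"
    unfolding EE_def by (simp add: nn_integral_add nn_integral_cmult nn_integral_multc int)
  also have "ennreal (4 * e\<^sup>2 / \<kappa>) * (1 + 1) = ennreal (8 * e\<^sup>2 / \<kappa>)"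
    using \<kappa>_pos ennreal_mult''[of 2 "4 * e\<^sup>2 / \<kappa>"] by simp
  also have "(EE f + EE g) * ennreal (1/2) = (EE f + EE g) / 2"
    by (simp add: ennreal_half)
  finally have 2: "EE ?m + ennreal (e / \<kappa>) * (\<integral>\<^sup>+x. ennreal \<bar>f x - g x\<bar> \<partial>\<gamma>) \<le> ennreal (8 * e\<^sup>2 / \<kappa>) + (EE f + EE g) / 2" .
  have "J ?m + ennreal (e / \<kappa>) * (\<integral>\<^sup>+x. ennreal \<bar>f x - g x\<bar> \<partial>\<gamma>)
      \<le> (KK f f + KK g g) / 2 / 2 + (ennreal (8 * e\<^sup>2 / \<kappa>) + (EE f + EE g) / 2)"
    unfolding J_def add.assoc by (intro add_mono 1 2)
  also have "\<dots> = (J f + J g) / 2 + ennreal (8 * e\<^sup>2 / \<kappa>)"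
    unfolding J_def divide_ennreal_def by (simp add: distrib_right distrib_left ac_simps)
  finally show ?thesis .
qed

text \<open>Since \<gamma> has mass 1, the entropy can be placed under the double integral. The
  result is one non-negative integrand, continuous in the values of f, to which Fatou's lemma
  applies.\<close>

lemma J_as_integral:
  assumes [measurable]: "f \<in> borel_measurable \<gamma>" and nn: "\<And>x. f x \<ge> 0"
  shows "J f = (\<integral>\<^sup>+x. \<integral>\<^sup>+y. ennreal (K x y * f x * f y / 2 + ent (f x) / \<kappa>) \<partial>\<gamma> \<partial>\<gamma>)"
proof -
  have "(\<integral>\<^sup>+x. \<integral>\<^sup>+y. ennreal (K x y * f x * f y / 2 + ent (f x) / \<kappa>) \<partial>\<gamma> \<partial>\<gamma>)
      = (\<integral>\<^sup>+x. \<integral>\<^sup>+y. (ennreal (K x y) * ennreal (f x) * ennreal (f y)) * ennreal (1/2) + ennreal (ent (f x) / \<kappa>) \<partial>\<gamma> \<partial>\<gamma>)"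
  proof (intro nn_integral_cong)
    fix x y
    have "ennreal (A / 2 + B) = ennreal A * ennreal (1/2) + ennreal B" if "A \<ge> 0" "B \<ge> 0" for A B :: real
    proof -
      have "ennreal (A / 2 + B) = ennreal (A * (1/2)) + ennreal B" using that by simp
      with that show ?thesis by (simp only: ennreal_mult)
    qed
    from this[of "K x y * f x * f y" "ent (f x) / \<kappa>"]
    show "ennreal (K x y * f x * f y / 2 + ent (f x) / \<kappa>)
       = (ennreal (K x y) * ennreal (f x) * ennreal (f y)) * ennreal (1/2) + ennreal (ent (f x) / \<kappa>)"
      using nn \<kappa>_pos K_nonneg[of x y] by (simp only: ennreal_mult mult_nonneg_nonneg ent_nonneg divide_nonneg_pos)
  qed
  also have "\<dots> = (\<integral>\<^sup>+x. (\<integral>\<^sup>+y. ennreal (K x y) * ennreal (f x) * ennreal (f y) \<partial>\<gamma>) * ennreal (1/2)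
      + ennreal (ent (f x) / \<kappa>) \<partial>\<gamma>)"
    by (intro nn_integral_cong) (simp add: nn_integral_add nn_integral_multc emeasure_space_1)
  also have "\<dots> = J f"
    unfolding J_def KK_def EE_def
    by (subst nn_integral_add) (auto simp: nn_integral_multc ennreal_half)
  finally show ?thesis ..
qed

text \<open>Fatou in each of the two variables, with \<open>ent\<close> continuous up to 0.\<close>

lemma J_lower_semicontinuous:
  assumes [measurable]: "\<And>k. f k \<in> borel_measurable \<gamma>" "g \<in> borel_measurable \<gamma>"
    and nn: "\<And>k x. f k x \<ge> 0" "\<And>x. g x \<ge> 0"
    and lim: "AE x in \<gamma>. (\<lambda>k. f k x) \<longlonglongrightarrow> g x"
  shows "J g \<le> liminf (\<lambda>k. J (f k))"
proof -
  define G where "G k x y = ennreal (K x y * f k x * f k y / 2 + ent (f k x) / \<kappa>)" for k x y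
  have [measurable]: "(\<lambda>(x, y). G k x y) \<in> borel_measurable (\<gamma> \<Otimes>\<^sub>M \<gamma>)" for k
    unfolding G_def by measurable
  have conv: "ennreal (K x y * g x * g y / 2 + ent (g x) / \<kappa>) = liminf (\<lambda>k. G k x y)"
    if "(\<lambda>k. f k x) \<longlonglongrightarrow> g x" "(\<lambda>k. f k y) \<longlonglongrightarrow> g y" for x y
  proof -
    have "(\<lambda>k. ent (f k x)) \<longlonglongrightarrow> ent (g x)"
      using that(1) nn by (intro continuous_on_tendsto_compose[OF continuous_on_ent]) auto
    then have "(\<lambda>k. G k x y) \<longlonglongrightarrow> ennreal (K x y * g x * g y / 2 + ent (g x) / \<kappa>)"
      unfolding G_def using \<kappa>_pos by (intro tendsto_intros that) auto
    then show ?thesis by (intro lim_imp_Liminf[symmetric]) auto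
  qed
  have "J g = (\<integral>\<^sup>+x. \<integral>\<^sup>+y. ennreal (K x y * g x * g y / 2 + ent (g x) / \<kappa>) \<partial>\<gamma> \<partial>\<gamma>)"
    using nn by (intro J_as_integral) auto
  also have "\<dots> = (\<integral>\<^sup>+x. \<integral>\<^sup>+y. liminf (\<lambda>k. G k x y) \<partial>\<gamma> \<partial>\<gamma>)"
    using lim
  proof (intro nn_integral_cong_AE, eventually_elim)
    fix x assume x: "(\<lambda>k. f k x) \<longlonglongrightarrow> g x"
    show "(\<integral>\<^sup>+y. ennreal (K x y * g x * g y / 2 + ent (g x) / \<kappa>) \<partial>\<gamma>) = (\<integral>\<^sup>+y. liminf (\<lambda>k. G k x y) \<partial>\<gamma>)"
      using lim by (intro nn_integral_cong_AE, eventually_elim) (rule conv[OF x])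
  qed
  also have "\<dots> \<le> (\<integral>\<^sup>+x. liminf (\<lambda>k. \<integral>\<^sup>+y. G k x y \<partial>\<gamma>) \<partial>\<gamma>)"
    by (intro nn_integral_mono nn_integral_liminf) measurable
  also have "\<dots> \<le> liminf (\<lambda>k. \<integral>\<^sup>+x. \<integral>\<^sup>+y. G k x y \<partial>\<gamma> \<partial>\<gamma>)"
    by (intro nn_integral_liminf) measurable
  also have "\<dots> = liminf (\<lambda>k. J (f k))"
    unfolding G_def using nn by (subst J_as_integral) auto
  finally show ?thesis .
qed

lemma dens_mean: "dens f \<Longrightarrow> dens g \<Longrightarrow> dens (\<lambda>x. (f x + g x) / 2)"
proof -
  assume f: "dens f" and g: "dens g"
  then have [measurable]: "f \<in> borel_measurable \<gamma>" "g \<in> borel_measurable \<gamma>"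
    and nn: "\<And>x. f x \<ge> 0" "\<And>x. g x \<ge> 0"
    and int: "(\<integral>\<^sup>+x. ennreal (f x) \<partial>\<gamma>) = 1" "(\<integral>\<^sup>+x. ennreal (g x) \<partial>\<gamma>) = 1"
    by (auto simp: dens_def)
  have "(\<integral>\<^sup>+x. ennreal ((f x + g x) / 2) \<partial>\<gamma>) = (\<integral>\<^sup>+x. (ennreal (f x) + ennreal (g x)) * ennreal (1/2) \<partial>\<gamma>)"
  proof (intro nn_integral_cong)
    fix x
    have "ennreal ((f x + g x) / 2) = ennreal ((f x + g x) * (1/2))" by simp
    also have "\<dots> = (ennreal (f x) + ennreal (g x)) * ennreal (1/2)"
      using nn[of x] by (simp only: ennreal_mult ennreal_plus add_nonneg_nonneg)
    finally show "ennreal ((f x + g x) / 2) = (ennreal (f x) + ennreal (g x)) * ennreal (1/2)" .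
  qed
  also have "\<dots> = (1 + 1) * ennreal (1/2)"
    by (simp add: nn_integral_multc nn_integral_add int)
  also have "\<dots> = 1" using ennreal_mult'[of 2 "1/2"] by simp
  finally show ?thesis using nn by (auto simp: dens_def)
qed

end

text \<open>Positivity is demanded at finite J because for the logarithmic kernel it is proved for
  measures with a logarithmic moment, which finite entropy supplies. The condition on the constant
  density yields a competitor of finite energy and bounds the energy of every bounded
  density.\<close>

locale gibbs_variational_pos = gibbs_variational +
  assumes KK_cross: "dens f \<Longrightarrow> dens g \<Longrightarrow> J f < \<infinity> \<Longrightarrow> J g < \<infinity> \<Longrightarrow> 2 * KK f g \<le> KK f f + KK g g"
    and KK_1: "KK (\<lambda>_. 1) (\<lambda>_. 1) < \<infinity>"
begin

lemma dens_1: "dens (\<lambda>_. 1)"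
  by (simp add: dens_def emeasure_space_1)

lemma J_1: "J (\<lambda>_. 1) < \<infinity>"
  using KK_1 ennreal_less_top[of "1/2"] by (simp add: J_def EE_def ent_def ennreal_half ennreal_mult_less_top)

text \<open>The quantitative strict convexity of the entropy makes near-minimizers close in \<open>L\<^sup>1\<close>.\<close>
lemma near_minimizers_close:
  assumes f: "dens f" and g: "dens g" and e: "e > 0" and c: "c \<ge> 0" "d \<ge> 0"
    and low: "\<And>h. dens h \<Longrightarrow> ennreal c \<le> J h"
    and up: "J f \<le> ennreal (c + d)" "J g \<le> ennreal (c + d)"
  shows "(\<integral>\<^sup>+x. ennreal \<bar>f x - g x\<bar> \<partial>\<gamma>) \<le> ennreal (\<kappa> * d / e + 8 * e)"
proof -
  let ?m = "\<lambda>x. (f x + g x) / 2"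
  let ?D = "\<integral>\<^sup>+x. ennreal \<bar>f x - g x\<bar> \<partial>\<gamma>"
  have fin: "J f < \<infinity>" "J g < \<infinity>" using up by (auto intro: le_less_trans)
  have "ennreal c + ennreal (e / \<kappa>) * ?D \<le> J ?m + ennreal (e / \<kappa>) * ?D"
    by (intro add_right_mono low dens_mean f g)
  also have "\<dots> \<le> (J f + J g) / 2 + ennreal (8 * e\<^sup>2 / \<kappa>)"
    using e by (intro J_gap f g KK_cross fin) auto
  also have "\<dots> \<le> (ennreal (c + d) + ennreal (c + d)) / 2 + ennreal (8 * e\<^sup>2 / \<kappa>)"
    using up by (intro add_right_mono divide_right_mono_ennreal add_mono)
  also have "(ennreal (c + d) + ennreal (c + d)) / 2 = ennreal (c + d)"
    using c divide_ennreal[of "c + d + (c + d)" 2] by (simp add: ennreal_plus[symmetric] del: ennreal_plus)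
  also have "ennreal (c + d) + ennreal (8 * e\<^sup>2 / \<kappa>) = ennreal c + ennreal (d + 8 * e\<^sup>2 / \<kappa>)"
    using c e \<kappa>_pos by (simp add: ac_simps)
  finally have "ennreal (e / \<kappa>) * ?D \<le> ennreal (d + 8 * e\<^sup>2 / \<kappa>)"
    by (simp add: ennreal_add_left_cancel_le)
  then have "ennreal (\<kappa> / e) * (ennreal (e / \<kappa>) * ?D) \<le> ennreal (\<kappa> / e) * ennreal (d + 8 * e\<^sup>2 / \<kappa>)"
    by (intro mult_left_mono) auto
  moreover have "ennreal (\<kappa> / e) * (ennreal (e / \<kappa>) * ?D) = ?D"
    using e \<kappa>_pos ennreal_mult'[of "\<kappa> / e" "e / \<kappa>"] by (simp add: mult.assoc[symmetric])
  moreover have "ennreal (\<kappa> / e) * ennreal (d + 8 * e\<^sup>2 / \<kappa>) = ennreal (\<kappa> * d / e + 8 * e)"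
    using e \<kappa>_pos c by (subst ennreal_mult'[symmetric]) (auto simp: field_simps power2_eq_square)
  ultimately show ?thesis by simp
qed

text \<open>No tightness or weak compactness is involved: summable L^1 increments have an integrable
  dominating function, which gives an almost everywhere limit, preserves the mass and leaves only
  Fatou's lemma for J.\<close>

lemma minimizer_exists:
  "\<exists>f. dens f \<and> J f < \<infinity> \<and> (\<forall>g. dens g \<longrightarrow> J f \<le> J g)"
proof -
  define I where "I = (INF f\<in>Collect dens. J f)"
  have low: "I \<le> J f" if "dens f" for f
    unfolding I_def using that by (intro INF_lower) auto
  have "I < \<infinity>" using low[OF dens_1] J_1 by (rule le_less_trans)
  then obtain i where i: "i \<ge> 0" "I = ennreal i" by (metis ennreal_cases infinity_ennreal_def less_irrefl)
  \<comment> \<open>An excess of 4^(-k) combined with e = 2^(-k) makes both terms of the distance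
    bound of order 2^(-k), hence summable.\<close>
  define \<delta> :: "nat \<Rightarrow> real" where "\<delta> k = (1/4) ^ k" for k
  have "\<exists>f. dens f \<and> J f < ennreal (i + \<delta> k)" for k
  proof -
    have "I < ennreal (i + \<delta> k)" using i by (simp add: \<delta>_def ennreal_less_iff)
    then show ?thesis unfolding I_def by (auto simp: INF_less_iff)
  qed
  then obtain f where f: "\<And>k. dens (f k)" "\<And>k. J (f k) < ennreal (i + \<delta> k)" by metis
  have [measurable]: "\<And>k. f k \<in> borel_measurable \<gamma>" and nn: "\<And>k x. f k x \<ge> 0"
    and int: "\<And>k. (\<integral>\<^sup>+x. ennreal (f k x) \<partial>\<gamma>) = 1"
    using f(1) by (auto simp: dens_def)
  have close: "(\<integral>\<^sup>+x. ennreal \<bar>f (Suc k) x - f k x\<bar> \<partial>\<gamma>) \<le> ennreal ((\<kappa> + 8) * (1/2) ^ k)" for k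
  proof -
    have "(\<integral>\<^sup>+x. ennreal \<bar>f (Suc k) x - f k x\<bar> \<partial>\<gamma>) \<le> ennreal (\<kappa> * \<delta> k / (1/2) ^ k + 8 * (1/2) ^ k)"
    proof (rule near_minimizers_close[OF f(1) f(1) _ i(1)])
      show "ennreal i \<le> J h" if "dens h" for h using low[OF that] i by simp
      have "\<delta> (Suc k) \<le> \<delta> k" by (simp add: \<delta>_def)
      then show "J (f (Suc k)) \<le> ennreal (i + \<delta> k)"
        using f(2)[of "Suc k"] by (meson add_left_mono ennreal_leI less_imp_le order_trans)
      show "J (f k) \<le> ennreal (i + \<delta> k)" using f(2)[of k] by simp
    qed (simp_all add: \<delta>_def)
    also have "\<kappa> * \<delta> k / (1/2) ^ k + 8 * (1/2) ^ k = (\<kappa> + 8) * (1/2) ^ k"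
    proof -
      have "\<delta> k = (1/2) ^ k * (1/2) ^ k" by (simp add: \<delta>_def power_mult_distrib[symmetric])
      then show ?thesis by (simp add: distrib_right)
    qed
    finally show ?thesis .
  qed
  define w where "w x = ennreal (f 0 x) + (\<Sum>k. ennreal \<bar>f (Suc k) x - f k x\<bar>)" for x
  have [measurable]: "w \<in> borel_measurable \<gamma>" unfolding w_def[abs_def] by measurable
  have "(\<integral>\<^sup>+x. w x \<partial>\<gamma>) = 1 + (\<Sum>k. \<integral>\<^sup>+x. ennreal \<bar>f (Suc k) x - f k x\<bar> \<partial>\<gamma>)"
    unfolding w_def by (subst nn_integral_add) (auto simp: int nn_integral_suminf)
  also have "\<dots> \<le> 1 + (\<Sum>k. ennreal ((\<kappa> + 8) * (1/2) ^ k))"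
    by (intro add_left_mono suminf_le close) auto
  also have "(\<Sum>k. ennreal ((\<kappa> + 8) * (1/2) ^ k)) = ennreal (\<Sum>k. (\<kappa> + 8) * (1/2) ^ k)"
    using \<kappa>_pos by (intro suminf_ennreal2 summable_mult summable_geometric) auto
  finally have w_fin: "(\<integral>\<^sup>+x. w x \<partial>\<gamma>) < \<infinity>"
    by (simp add: le_less_trans ennreal_add_less_top)
  \<comment> \<open>\<open>lim\<close> is unspecified where the sequence diverges; the truncation at
    0 makes the limit non-negative at every point, as \<open>dens\<close> demands.\<close>
  define g where "g x = max 0 (lim (\<lambda>k. f k x))" for x
  have [measurable]: "g \<in> borel_measurable \<gamma>" unfolding g_def[abs_def] by measurable
  have w_AE: "AE x in \<gamma>. w x \<noteq> \<infinity>"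
    using w_fin by (intro nn_integral_PInf_AE) auto
  have lim: "AE x in \<gamma>. (\<lambda>k. f k x) \<longlonglongrightarrow> g x"
    using w_AE
  proof eventually_elim
    fix x assume "w x \<noteq> \<infinity>"
    then have "(\<Sum>k. ennreal \<bar>f (Suc k) x - f k x\<bar>) \<noteq> \<infinity>" by (auto simp: w_def)
    then have "summable (\<lambda>k. \<bar>f (Suc k) x - f k x\<bar>)"
      by (intro summable_suminf_not_top) auto
    then have "summable (\<lambda>k. f (Suc k) x - f k x)" by (rule summable_rabs_cancel)
    from summable_LIMSEQ[OF this]
    have "(\<lambda>n. f n x - f 0 x) \<longlonglongrightarrow> (\<Sum>k. f (Suc k) x - f k x)" by (simp only: sum_lessThan_telescope[of "\<lambda>k. f k x"])
    from tendsto_add[OF this tendsto_const[of "f 0 x"]] have "convergent (\<lambda>k. f k x)" by (auto simp: convergent_def)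
    then have l: "(\<lambda>k. f k x) \<longlonglongrightarrow> lim (\<lambda>k. f k x)" by (simp add: convergent_LIMSEQ_iff)
    then have "0 \<le> lim (\<lambda>k. f k x)" using nn by (intro LIMSEQ_le_const[OF l]) auto
    then show "(\<lambda>k. f k x) \<longlonglongrightarrow> g x" using l by (simp add: g_def)
  qed
  have bound: "ennreal (f k x) \<le> w x" for k x
  proof -
    have "f k x \<le> f 0 x + (\<Sum>j<k. \<bar>f (Suc j) x - f j x\<bar>)"
      by (induction k) auto
    then have "ennreal (f k x) \<le> ennreal (f 0 x) + (\<Sum>j<k. ennreal \<bar>f (Suc j) x - f j x\<bar>)"
      using nn by (simp add: sum_ennreal ennreal_plus[symmetric] sum_nonneg ennreal_leI del: ennreal_plus)
    also have "\<dots> \<le> w x" unfolding w_def by (intro add_left_mono sum_le_suminf) auto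
    finally show ?thesis .
  qed
  have "(\<lambda>k. \<integral>\<^sup>+x. ennreal (f k x) \<partial>\<gamma>) \<longlonglongrightarrow> (\<integral>\<^sup>+x. ennreal (g x) \<partial>\<gamma>)"
  proof (rule nn_integral_dominated_convergence[where w = w])
    show "AE x in \<gamma>. (\<lambda>k. ennreal (f k x)) \<longlonglongrightarrow> ennreal (g x)"
      using lim by eventually_elim (rule tendsto_ennrealI)
  qed (use w_fin bound in auto)
  then have "(\<integral>\<^sup>+x. ennreal (g x) \<partial>\<gamma>) = 1"
    by (simp add: int LIMSEQ_const_iff)
  then have g: "dens g" by (simp add: dens_def g_def)
  have "J g \<le> liminf (\<lambda>k. J (f k))"
    using lim nn by (intro J_lower_semicontinuous) (auto simp: g_def)
  also have "\<dots> \<le> liminf (\<lambda>k. ennreal (i + \<delta> k))"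
    using f(2) by (intro Liminf_mono always_eventually) (auto intro: less_imp_le)
  also have "\<dots> = ennreal (i + 0)"
    unfolding \<delta>_def by (intro lim_imp_Liminf tendsto_intros LIMSEQ_realpow_zero) auto
  finally have "J g \<le> I" using i by simp
  with low \<open>I < \<infinity>\<close> g show ?thesis by (metis le_less_trans order_trans)
qed

text \<open>With zero excess the distance bound for two minimizers reduces to 8e for every e >
  0.\<close>

lemma minimizer_unique:
  assumes f: "dens f" "J f < \<infinity>" "\<And>h. dens h \<Longrightarrow> J f \<le> J h" and g: "dens g" "J g \<le> J f"
  shows "AE x in \<gamma>. g x = f x"
proof -
  have [measurable]: "f \<in> borel_measurable \<gamma>" "g \<in> borel_measurable \<gamma>" using f g by (auto simp: dens_def)
  obtain c where c: "c \<ge> 0" "J f = ennreal c" using f(2) by (metis ennreal_cases infinity_ennreal_def less_irrefl)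
  have "(\<integral>\<^sup>+x. ennreal \<bar>f x - g x\<bar> \<partial>\<gamma>) \<le> ennreal e" if "e > 0" for e
    using near_minimizers_close[OF f(1) g(1), of "e / 8" c 0] that c f(3) g(2) by simp
  then have "(\<integral>\<^sup>+x. ennreal \<bar>f x - g x\<bar> \<partial>\<gamma>) = 0"
    by (intro antisym[OF ennreal_le_epsilon]) auto
  then have "AE x in \<gamma>. ennreal \<bar>f x - g x\<bar> = 0" by (subst (asm) nn_integral_0_iff_AE) auto
  then show ?thesis by eventually_elim auto
qed

text \<open>The competitor is the Gibbs density of the minimizer's own potential; the first-order
  condition in its direction says that a relative entropy is non-positive.\<close>
lemma minimizer_gibbs:
  assumes f: "dens f" "J f < \<infinity>" "\<And>h. dens h \<Longrightarrow> J f \<le> J h"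
  shows "\<exists>Z>0. AE x in \<gamma>. f x = (if pot f x = \<infinity> then 0 else exp (- \<kappa> * enn2real (pot f x)) / Z)"
proof -
  have [measurable]: "f \<in> borel_measurable \<gamma>" and nn: "\<And>x. f x \<ge> 0" and int: "(\<integral>\<^sup>+x. ennreal (f x) \<partial>\<gamma>) = 1"
    using f by (auto simp: dens_def)
  define P where "P x = enn2real (pot f x)" for x
  \<comment> \<open>\<open>enn2real\<close> sends infinity to 0, so points of infinite potential
    need their own case; the Boltzmann factor there is 0.\<close>
  define t0 where "t0 x = (if pot f x = \<infinity> then 0 else exp (- \<kappa> * P x))" for x
  have [measurable]: "P \<in> borel_measurable \<gamma>" "t0 \<in> borel_measurable \<gamma>"
    unfolding P_def[abs_def] t0_def[abs_def] by measurable
  have P0: "P x \<ge> 0" for x by (simp add: P_def)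
  have t0: "0 \<le> t0 x" "t0 x \<le> 1" for x using P0[of x] \<kappa>_pos by (auto simp: t0_def)
  define Z where "Z = (\<integral>x. t0 x \<partial>\<gamma>)"
  have t0_int: "integrable \<gamma> t0" using t0 by (intro integrable_const_bound[of _ 1]) auto
  have Z0: "Z \<ge> 0" unfolding Z_def using t0 by simp
  have "KK f f \<noteq> \<infinity>" using f(2) by (auto simp: J_def ennreal_half ennreal_mult_eq_top_iff)
  then have KKf: "(\<integral>\<^sup>+x. pot f x * ennreal (f x) \<partial>\<gamma>) \<noteq> \<infinity>" by (simp add: KK_pot)
  then have fin_AE: "AE x in \<gamma>. pot f x * ennreal (f x) \<noteq> \<infinity>" by (intro nn_integral_PInf_AE) auto
  \<comment> \<open>Otherwise the potential would be infinite almost everywhere, and finite energy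
    would force f = 0 almost everywhere.\<close>
  have "Z \<noteq> 0"
  proof
    assume "Z = 0"
    then have "AE x in \<gamma>. t0 x = 0" using t0_int t0 unfolding Z_def by (subst (asm) integral_nonneg_eq_0_iff_AE) auto
    with fin_AE have "AE x in \<gamma>. f x = 0"
      by eventually_elim (use nn in \<open>auto simp: t0_def ennreal_top_mult split: if_splits\<close>)
    then have "(\<integral>\<^sup>+x. ennreal (f x) \<partial>\<gamma>) = 0" by (subst nn_integral_0_iff_AE) auto
    with int show False by simp
  qed
  with Z0 have Z: "Z > 0" by simp
  define \<tau> where "\<tau> x = t0 x / Z" for x
  have [measurable]: "\<tau> \<in> borel_measurable \<gamma>" unfolding \<tau>_def[abs_def] by measurable
  have \<tau>: "0 \<le> \<tau> x" "\<tau> x \<le> 1 / Z" for x using t0[of x] Z by (auto simp: \<tau>_def divide_right_mono)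
  have \<tau>_int: "has_bochner_integral \<gamma> \<tau> 1"
    using t0_int Z unfolding \<tau>_def[abs_def] by (auto simp: has_bochner_integral_iff Z_def)
  have \<tau>_dens: "dens \<tau>"
    unfolding dens_def using \<tau> \<tau>_int by (simp add: nn_integral_eq_integral has_bochner_integral_iff)
  have f_int: "has_bochner_integral \<gamma> f 1"
    using int nn by (intro has_bochner_integral_nn_integral) auto
  \<comment> \<open>Comparison with the constant density, since \<tau> \<le> 1/Z.\<close>
  have "KK \<tau> \<tau> \<le> KK (\<lambda>x. (1 / Z) * 1 + 0 * 1) (\<lambda>x. (1 / Z) * 1 + 0 * 1)"
    using \<tau> by (intro KK_mono) auto
  also have "\<dots> < \<infinity>" using Z KK_1 by (subst KK_quadratic) (auto simp: ennreal_mult_less_top)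
  finally have KK\<tau>: "KK \<tau> \<tau> < \<infinity>" .
  have ent_bd: "ent (\<tau> x) \<le> (1 / Z)\<^sup>2 + 1" for x
    using ent_le[OF \<tau>(1)[of x]] power_mono[OF \<tau>(2)[of x] \<tau>(1)[of x], of 2] by linarith
  have ent\<tau>_int: "integrable \<gamma> (\<lambda>x. ent (\<tau> x))"
    using ent_bd ent_nonneg[OF \<tau>(1)] by (intro integrable_const_bound[of _ "(1 / Z)\<^sup>2 + 1"]) auto
  have EE_eq: "EE h = ennreal ((\<integral>x. ent (h x) \<partial>\<gamma>) / \<kappa>)" if "integrable \<gamma> (\<lambda>x. ent (h x))" "\<And>x. h x \<ge> 0" for h
    unfolding EE_def using that \<kappa>_pos by (subst nn_integral_eq_integral) (auto intro!: divide_nonneg_pos ent_nonneg)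
  have J\<tau>: "J \<tau> < \<infinity>"
    using KK\<tau> ennreal_less_top[of "1/2"] by (simp add: J_def EE_eq[OF ent\<tau>_int \<tau>(1)] ennreal_half ennreal_mult_less_top)
  have entf_int: "integrable \<gamma> (\<lambda>x. ent (f x))"
  proof -
    have "EE f < \<infinity>" using f(2) by (auto simp: J_def less_top)
    then have "integrable \<gamma> (\<lambda>x. ent (f x) / \<kappa>)"
      unfolding EE_def using \<kappa>_pos nn by (intro integrableI_nonneg) (auto intro!: divide_nonneg_pos ent_nonneg)
    then have "integrable \<gamma> (\<lambda>x. \<kappa> * (ent (f x) / \<kappa>))" by (rule integrable_mult_right)
    then show ?thesis using \<kappa>_pos by simp
  qed
  have "2 * KK f \<tau> \<le> KK f f + KK \<tau> \<tau>" by (rule KK_cross[OF f(1) \<tau>_dens f(2) J\<tau>])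
  also have "\<dots> < \<infinity>" using KK\<tau> \<open>KK f f \<noteq> \<infinity>\<close> by (simp add: less_top)
  finally have "KK f \<tau> < \<infinity>" by (auto simp: ennreal_mult_less_top)
  obtain a b c where abc: "KK f f = ennreal a" "KK f \<tau> = ennreal b" "KK \<tau> \<tau> = ennreal c" "a \<ge> 0" "b \<ge> 0" "c \<ge> 0"
    using KK\<tau> \<open>KK f f \<noteq> \<infinity>\<close> \<open>KK f \<tau> < \<infinity>\<close> by (metis ennreal_cases infinity_ennreal_def less_irrefl)
  define ef where "ef = (\<integral>x. ent (f x) \<partial>\<gamma>) / \<kappa>"
  define et where "et = (\<integral>x. ent (\<tau> x) \<partial>\<gamma>) / \<kappa>"
  have e0: "ef \<ge> 0" "et \<ge> 0" unfolding ef_def et_def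
      using \<kappa>_pos nn \<tau> by (auto intro!: divide_nonneg_pos Bochner_Integration.integral_nonneg ent_nonneg)
  have Jf: "J f = ennreal (a / 2 + ef)"
    using abc(4) e0 divide_ennreal[of a 2] by (simp add: J_def EE_eq[OF entf_int nn] abc ef_def)
  \<comment> \<open>Minimality tested against (1 - s) f + s \<tau> and divided by s: the energy is
    expanded exactly, the entropy is bounded by convexity.\<close>
  have key: "0 \<le> (b - a + et - ef) + s * (a / 2 - b + c / 2)" if s: "0 < s" "s \<le> 1" for s
  proof -
    define h where "h x = (1 - s) * f x + s * \<tau> x" for x
    have [measurable]: "h \<in> borel_measurable \<gamma>" unfolding h_def[abs_def] by measurable
    have h0: "h x \<ge> 0" for x unfolding h_def using s nn \<tau> by auto
    have h_int: "has_bochner_integral \<gamma> h ((1 - s) * 1 + s * 1)"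
      unfolding h_def[abs_def] by (intro has_bochner_integral_add has_bochner_integral_mult_right f_int \<tau>_int)
    have "dens h" unfolding dens_def using h0 h_int by (simp add: nn_integral_eq_integral has_bochner_integral_iff)
    have conv: "ent (h x) \<le> (1 - s) * ent (f x) + s * ent (\<tau> x)" for x
      unfolding h_def using s nn \<tau> by (intro ent_convex) auto
    have ih: "integrable \<gamma> (\<lambda>x. ent (h x))"
    proof (rule Bochner_Integration.integrable_bound)
      show "integrable \<gamma> (\<lambda>x. (1 - s) * ent (f x) + s * ent (\<tau> x))" using entf_int ent\<tau>_int by simp
      show "AE x in \<gamma>. norm (ent (h x)) \<le> norm ((1 - s) * ent (f x) + s * ent (\<tau> x))"
        using conv ent_nonneg[OF h0] order_trans[OF conv abs_ge_self] by (intro AE_I2) simp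
    qed measurable
    have "(\<integral>x. ent (h x) \<partial>\<gamma>) \<le> (\<integral>x. (1 - s) * ent (f x) + s * ent (\<tau> x) \<partial>\<gamma>)"
      using conv ih entf_int ent\<tau>_int by (intro integral_mono) auto
    also have "\<dots> = (1 - s) * (ef * \<kappa>) + s * (et * \<kappa>)"
      using entf_int ent\<tau>_int \<kappa>_pos by (simp add: ef_def et_def)
    finally have "(\<integral>x. ent (h x) \<partial>\<gamma>) / \<kappa> \<le> ((1 - s) * (ef * \<kappa>) + s * (et * \<kappa>)) / \<kappa>"
      using \<kappa>_pos by (intro divide_right_mono) auto
    also have "\<dots> = (1 - s) * ef + s * et" using \<kappa>_pos by (simp add: add_divide_distrib)
    finally have eh: "(\<integral>x. ent (h x) \<partial>\<gamma>) / \<kappa> \<le> (1 - s) * ef + s * et" .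
    define q where "q = (1 - s)\<^sup>2 * a + 2 * (1 - s) * s * b + s\<^sup>2 * c"
    have q0: "q \<ge> 0" unfolding q_def using s abc by (intro add_nonneg_nonneg mult_nonneg_nonneg) auto
    have "KK h h = ennreal ((1 - s)\<^sup>2) * KK f f + ennreal (2 * (1 - s) * s) * KK f \<tau> + ennreal (s\<^sup>2) * KK \<tau> \<tau>"
      unfolding h_def using s nn \<tau> by (intro KK_quadratic) auto
    also have "\<dots> = ennreal q"
      unfolding abc(1-3) q_def using s abc(4-6)
      by (simp only: ennreal_mult[symmetric] ennreal_plus[symmetric] mult_nonneg_nonneg add_nonneg_nonneg zero_le_power2 diff_ge_0_iff_ge less_imp_le zero_le_numeral)
    finally have KKh: "KK h h = ennreal q" .
    have "ennreal (a / 2 + ef) \<le> J h" using f(3)[OF \<open>dens h\<close>] Jf by simp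
    also have "J h = ennreal (q / 2 + (\<integral>x. ent (h x) \<partial>\<gamma>) / \<kappa>)"
      using q0 divide_ennreal[of q 2] \<kappa>_pos h0
      by (subst ennreal_plus) (auto simp: J_def EE_eq[OF ih h0] KKh intro!: divide_nonneg_pos Bochner_Integration.integral_nonneg ent_nonneg)
    also have "\<dots> \<le> ennreal (q / 2 + ((1 - s) * ef + s * et))" using eh by (intro ennreal_leI) auto
    finally have "a / 2 + ef \<le> q / 2 + ((1 - s) * ef + s * et)"
      using s q0 e0 by (subst (asm) ennreal_le_iff) auto
    then have "0 \<le> s * ((b - a + et - ef) + s * (a / 2 - b + c / 2))"
      unfolding q_def by (simp add: power2_eq_square field_simps)
    then show ?thesis using s by (simp add: zero_le_mult_iff)
  qed
  have lin: "0 \<le> b - a + et - ef"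
  proof (rule tendsto_lowerbound)
    show "((\<lambda>s. (b - a + et - ef) + s * (a / 2 - b + c / 2)) \<longlongrightarrow> b - a + et - ef) (at_right 0)"
      by (auto intro!: tendsto_eq_intros)
    show "\<forall>\<^sub>F s in at_right 0. 0 \<le> (b - a + et - ef) + s * (a / 2 - b + c / 2)"
      by (rule eventually_mono[OF eventually_at_right_real[of 0 1]]) (auto intro!: key)
  qed simp
  have potf: "pot f x = ennreal (P x)" if "pot f x \<noteq> \<infinity>" for x
    using that by (simp add: P_def less_top)
  have P\<tau>: "has_bochner_integral \<gamma> (\<lambda>x. P x * \<tau> x) b"
  proof (rule has_bochner_integral_nn_integral)
    have "(\<integral>\<^sup>+x. ennreal (P x * \<tau> x) \<partial>\<gamma>) = (\<integral>\<^sup>+x. pot f x * ennreal (\<tau> x) \<partial>\<gamma>)"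
    proof (intro nn_integral_cong)
      fix x show "ennreal (P x * \<tau> x) = pot f x * ennreal (\<tau> x)"
      proof (cases "pot f x = \<infinity>")
        case False
        then show ?thesis using ennreal_mult[OF P0[of x] \<tau>(1)[of x]] potf[of x] by simp
      qed (simp add: \<tau>_def t0_def)
    qed
    also have "\<dots> = KK \<tau> f" by (simp add: KK_pot)
    also have "\<dots> = KK f \<tau>" by (rule KK_sym) measurable
    finally show "(\<integral>\<^sup>+x. ennreal (P x * \<tau> x) \<partial>\<gamma>) = ennreal b" using abc by simp
  qed (use P0 \<tau> abc in auto)
  have Pf: "has_bochner_integral \<gamma> (\<lambda>x. P x * f x) a"
  proof (rule has_bochner_integral_nn_integral)
    have "(\<integral>\<^sup>+x. ennreal (P x * f x) \<partial>\<gamma>) = (\<integral>\<^sup>+x. pot f x * ennreal (f x) \<partial>\<gamma>)"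
      using fin_AE
    proof (intro nn_integral_cong_AE, eventually_elim)
      fix x assume "pot f x * ennreal (f x) \<noteq> \<infinity>"
      then show "ennreal (P x * f x) = pot f x * ennreal (f x)"
        using P0[of x] nn[of x] potf[of x] by (cases "pot f x
            = \<infinity>") (auto simp: ennreal_mult ennreal_top_mult split: if_splits)
    qed
    also have "\<dots> = KK f f" by (simp add: KK_pot)
    finally show "(\<integral>\<^sup>+x. ennreal (P x * f x) \<partial>\<gamma>) = ennreal a" using abc by simp
  qed (use P0 nn abc in auto)
  \<comment> \<open>ln \<tau> is affine in the potential, so the entropy of \<tau> is explicit; its
    term in b cancels the cross energy in the first-order condition.\<close>
  have "et * \<kappa> = - \<kappa> * b - ln Z"
  proof -
    have eq: "ent (\<tau> x) = - \<kappa> * (P x * \<tau> x) - ln Z * \<tau> x - \<tau> x + 1" for x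
    proof (cases "pot f x = \<infinity>")
      case False
      then have ln\<tau>: "ln (\<tau> x) = - \<kappa> * P x - ln Z" using Z by (simp add: \<tau>_def t0_def ln_div)
      show ?thesis unfolding ent_def ln\<tau> by (simp add: algebra_simps)
    qed (simp add: ent_def \<tau>_def t0_def)
    have "has_bochner_integral \<gamma> (\<lambda>x. - \<kappa> * (P x * \<tau> x) - ln Z * \<tau> x - \<tau> x + 1) (- \<kappa> * b - ln Z * 1 - 1 + 1)"
      by (intro has_bochner_integral_add has_bochner_integral_diff has_bochner_integral_mult_right P\<tau> \<tau>_int)
          (auto simp: has_bochner_integral_iff prob_space)
    then have "(\<integral>x. ent (\<tau> x) \<partial>\<gamma>) = - \<kappa> * b - ln Z" unfolding eq by (simp add: has_bochner_integral_iff)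
    then show ?thesis using \<kappa>_pos by (simp add: et_def)
  qed
  moreover have "ef * \<kappa> = (\<integral>x. ent (f x) \<partial>\<gamma>)" using \<kappa>_pos by (simp add: ef_def)
  moreover have "0 \<le> (b - a + et - ef) * \<kappa>" using lin \<kappa>_pos by simp
  ultimately have neg: "(\<integral>x. ent (f x) \<partial>\<gamma>) + \<kappa> * a + ln Z \<le> 0" by (simp add: algebra_simps)
  \<comment> \<open>The pointwise relative entropy of f with respect to \<tau>, written so that its
    integral is known. That integral is at most 0 while D is non-negative almost everywhere, which
    forces D = 0 and f = \<tau>.\<close>
  define D where "D x = ent (f x) + \<kappa> * (P x * f x) + ln Z * f x - 1 + \<tau> x" for x
  have D_int: "integrable \<gamma> D" "(\<integral>x. D x \<partial>\<gamma>) = (\<integral>x. ent (f x) \<partial>\<gamma>) + \<kappa> * a + ln Z"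
    unfolding D_def[abs_def] using entf_int Pf f_int \<tau>_int by (auto simp: has_bochner_integral_iff prob_space)
  have D_eq: "D x = \<tau> x * ent (f x / \<tau> x)" if "pot f x \<noteq> \<infinity>" for x
  proof -
    have "\<tau> x > 0" using that Z by (simp add: \<tau>_def t0_def)
    moreover have ln\<tau>: "ln (\<tau> x) = - \<kappa> * P x - ln Z" using that Z by (simp add: \<tau>_def t0_def ln_div)
    ultimately have "f x * ln (f x) = \<tau> x * ent (f x / \<tau> x) + f x * (- \<kappa> * P x - ln Z) + f x - \<tau> x"
      using ent_scale[of "\<tau> x" "f x"] nn[of x] by (simp only: ln\<tau>)
    then show ?thesis by (simp add: D_def ent_def[of "f x"] algebra_simps)
  qed
  \<comment> \<open>Both densities vanish here, and \<open>ent 0 = 1\<close> is compensated by the -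
    1 in D.\<close>
  have D_top: "D x = 0" if "pot f x = \<infinity>" "f x = 0" for x
    using that by (simp add: D_def ent_def \<tau>_def t0_def)
  have D_cases: "AE x in \<gamma>. pot f x \<noteq> \<infinity> \<or> f x = 0"
    using fin_AE by eventually_elim (use nn in \<open>auto simp: ennreal_top_mult split: if_splits\<close>)
  have D_nonneg: "AE x in \<gamma>. 0 \<le> D x"
    using D_cases
  proof eventually_elim
    fix x assume "pot f x \<noteq> \<infinity> \<or> f x = 0"
    then show "0 \<le> D x" using D_eq[of x] D_top[of x] \<tau>(1)[of x] nn[of x]
      by (cases "pot f x = \<infinity>") (auto intro!: mult_nonneg_nonneg ent_nonneg)
  qed
  have "(\<integral>x. D x \<partial>\<gamma>) = 0"
    using neg D_int(2) integral_nonneg_AE[OF D_nonneg] by simp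
  then have "AE x in \<gamma>. D x = 0"
    using integral_nonneg_eq_0_iff_AE[OF D_int(1) D_nonneg] by simp
  with D_cases have "AE x in \<gamma>. f x = (if pot f x = \<infinity> then 0 else exp (- \<kappa> * enn2real (pot f x)) / Z)"
  proof eventually_elim
    fix x assume x: "pot f x \<noteq> \<infinity> \<or> f x = 0" "D x = 0"
    show "f x = (if pot f x = \<infinity> then 0 else exp (- \<kappa> * enn2real (pot f x)) / Z)"
    proof (cases "pot f x = \<infinity>")
      case False
      have t: "\<tau> x > 0" using False Z by (simp add: \<tau>_def t0_def)
      then have "ent (f x / \<tau> x) = 0" using D_eq[OF False] x by simp
      then have "f x / \<tau> x = 1" using t nn[of x] by (intro ent_eq_0D) auto
      then show ?thesis using False t Z by (simp add: \<tau>_def t0_def P_def)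
    qed (use x in auto)
  qed
  then show ?thesis using Z by blast
qed

end

section \<open>Gaussian distances between probability measures\<close>

definition logmom :: "complex measure \<Rightarrow> bool" where
  "logmom \<mu> \<longleftrightarrow> sets \<mu> = sets borel \<and> prob_space \<mu> \<and> integrable \<mu> Lg"

text \<open>The exponent 2s is chosen so that the product of two such Gaussians integrates to a
  Gaussian of exponent s in the difference of their centres.\<close>

definition gconv :: "real \<Rightarrow> complex measure \<Rightarrow> complex \<Rightarrow> real" where
  "gconv s \<mu> z = (\<integral>x. exp (- 2 * s * (cmod (x - z))\<^sup>2) \<partial>\<mu>)"

text \<open>The squared distance of the Gaussian kernel (maximum mean discrepancy): the prefactor
  makes it the double integral of exp(-s|x - y|^2) against \<mu> - \<nu> in both variables. As an
  L^2 norm it is visibly non-negative.\<close>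

definition gdist :: "real \<Rightarrow> complex measure \<Rightarrow> complex measure \<Rightarrow> real" where
  "gdist s \<mu> \<nu> = 4 * s / pi * (\<integral>z. (gconv s \<mu> z - gconv s \<nu> z)\<^sup>2 \<partial>lborel)"

definition reg_energy :: "real \<Rightarrow> complex measure \<Rightarrow> complex measure \<Rightarrow> real" where
  "reg_energy S \<mu> \<nu> = (\<integral>p. reg S (cmod (fst p - snd p)) \<partial>(\<mu> \<Otimes>\<^sub>M \<nu>))"

text \<open>The logarithmic bound in the distance becomes Lg x + Lg y, which both measures
  integrate. This licenses exchanging the points with the Gaussian scale s.\<close>

lemma reg_integrable_fubini:
  assumes \<mu>: "logmom \<mu>" and \<nu>: "logmom \<nu>" and S: "S \<ge> 1"
  shows "integrable ((\<mu> \<Otimes>\<^sub>M \<nu>) \<Otimes>\<^sub>M lborel) (\<lambda>q. hq S (cmod (fst (fst q) - snd (fst q))) (snd q))"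
proof -
  interpret \<mu>: prob_space \<mu> using \<mu> by (simp add: logmom_def)
  interpret \<nu>: prob_space \<nu> using \<nu> by (simp add: logmom_def)
  interpret pair_prob_space \<mu> \<nu> ..
  have [measurable_cong]: "sets \<mu> = sets borel" "sets \<nu> = sets borel" using \<mu> \<nu> by (auto simp: logmom_def)
  have L: "integrable \<mu> Lg" "integrable \<nu> Lg" using \<mu> \<nu> by (auto simp: logmom_def)
  have fin: "(\<integral>\<^sup>+x. ennreal (Lg x) \<partial>\<mu>) < \<infinity>" "(\<integral>\<^sup>+x. ennreal (Lg x) \<partial>\<nu>) < \<infinity>"
    using L by (auto simp: nn_integral_eq_integral Lg_nonneg)
  have bound: "(\<integral>\<^sup>+s. ennreal \<bar>hq S (cmod (x - y)) s\<bar> \<partial>lborel)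
      \<le> ennreal (S + 1) + 2 * ennreal (Lg x) + 2 * ennreal (Lg y)" for x y
  proof -
    have "(\<integral>\<^sup>+s. ennreal \<bar>hq S (cmod (x - y)) s\<bar> \<partial>lborel) \<le> ennreal (S + 1 + 2 * max 0 (ln (cmod (x - y))))"
      by (rule nn_integral_abs_hq_le[OF S norm_ge_zero])
    also have "\<dots> \<le> ennreal (S + 1 + 2 * (Lg x + Lg y))"
      using ln_dist_le[of x y] Lg_nonneg[of x] Lg_nonneg[of y] by (intro ennreal_leI) auto
    also have "\<dots> = ennreal (S + 1) + 2 * ennreal (Lg x) + 2 * ennreal (Lg y)"
      using S Lg_nonneg[of x] Lg_nonneg[of y] by (simp add: ennreal_mult distrib_left add.assoc)
    finally show ?thesis .
  qed
  show ?thesis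
  proof (rule integrableI_bounded)
    have "(\<integral>\<^sup>+q. ennreal (norm (hq S (cmod (fst (fst q) - snd (fst q))) (snd q))) \<partial>((\<mu> \<Otimes>\<^sub>M \<nu>) \<Otimes>\<^sub>M lborel))
        = (\<integral>\<^sup>+p. \<integral>\<^sup>+s. ennreal \<bar>hq S (cmod (fst p - snd p)) s\<bar> \<partial>lborel \<partial>(\<mu> \<Otimes>\<^sub>M \<nu>))"
      by (subst lborel.nn_integral_fst[symmetric]) (auto simp: case_prod_unfold)
    also have "\<dots> \<le> (\<integral>\<^sup>+p. ennreal (S + 1) + 2 * ennreal (Lg (fst p)) + 2 * ennreal (Lg (snd p)) \<partial>(\<mu> \<Otimes>\<^sub>M \<nu>))"
      by (intro nn_integral_mono bound)
    also have "\<dots> = (\<integral>\<^sup>+x. \<integral>\<^sup>+y. ennreal (S + 1) + 2 * ennreal (Lg x) + 2 * ennreal (Lg y) \<partial>\<nu> \<partial>\<mu>)"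
      by (subst \<nu>.nn_integral_fst[symmetric]) auto
    also have "\<dots> = ennreal (S + 1) + 2 * (\<integral>\<^sup>+x. ennreal (Lg x) \<partial>\<mu>) + 2 * (\<integral>\<^sup>+x. ennreal (Lg x) \<partial>\<nu>)"
      by (simp add: nn_integral_add nn_integral_cmult \<mu>.emeasure_space_1 \<nu>.emeasure_space_1 add.assoc)
    also have "\<dots> < \<infinity>" using fin by (simp add: ennreal_mult_less_top)
    finally show "(\<integral>\<^sup>+q. ennreal (norm (hq S (cmod (fst (fst q) - snd (fst q))) (snd q))) \<partial>((\<mu> \<Otimes>\<^sub>M \<nu>) \<Otimes>\<^sub>M lborel)) < \<infinity>" .
  qed measurable
qed

lemma reg_energy_fubini:
  assumes \<mu>: "logmom \<mu>" and \<nu>: "logmom \<nu>" and S: "S \<ge> 1"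
  shows "integrable (\<mu> \<Otimes>\<^sub>M \<nu>) (\<lambda>p. reg S (cmod (fst p - snd p)))"
    and "has_bochner_integral lborel (\<lambda>s. \<integral>p. hq S (cmod (fst p - snd p)) s \<partial>(\<mu> \<Otimes>\<^sub>M \<nu>)) (2 * reg_energy S \<mu> \<nu>)"
proof -
  interpret \<mu>: prob_space \<mu> using \<mu> by (simp add: logmom_def)
  interpret \<nu>: prob_space \<nu> using \<nu> by (simp add: logmom_def)
  interpret pair_prob_space \<mu> \<nu> ..
  interpret q: pair_sigma_finite "\<mu> \<Otimes>\<^sub>M \<nu>" "lborel :: real measure" ..
  note i = reg_integrable_fubini[OF assms]
  have i': "integrable ((\<mu> \<Otimes>\<^sub>M \<nu>) \<Otimes>\<^sub>M lborel) (\<lambda>(p, s). hq S (cmod (fst p - snd p)) s)"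
    using i by (simp add: case_prod_unfold)
  show "integrable (\<mu> \<Otimes>\<^sub>M \<nu>) (\<lambda>p. reg S (cmod (fst p - snd p)))"
    unfolding reg_def using q.integrable_fst[OF i'] by simp
  have "(\<integral>s. \<integral>p. hq S (cmod (fst p - snd p)) s \<partial>(\<mu> \<Otimes>\<^sub>M \<nu>) \<partial>lborel)
      = (\<integral>p. \<integral>s. hq S (cmod (fst p - snd p)) s \<partial>lborel \<partial>(\<mu> \<Otimes>\<^sub>M \<nu>))"
    by (rule q.Fubini_integral[OF i'])
  also have "\<dots> = 2 * reg_energy S \<mu> \<nu>"
    unfolding reg_energy_def reg_def by simp
  finally show "has_bochner_integral lborel (\<lambda>s. \<integral>p. hq S (cmod (fst p - snd p)) s \<partial>(\<mu> \<Otimes>\<^sub>M \<nu>)) (2 * reg_energy S \<mu> \<nu>)"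
    using q.integrable_snd[OF i'] by (simp add: has_bochner_integral_iff)
qed

text \<open>Parallelogram identity: one exponent in x - y and one about the midpoint.\<close>

lemma gauss_split: "- 2 * s * (cmod (x - z))\<^sup>2 + - 2 * s * (cmod (y - z))\<^sup>2
   = - s * (cmod (x - y))\<^sup>2 + - (4 * s) * (cmod (z - (x + y) / 2))\<^sup>2"
proof -
  have "Re ((x + y) / 2) = (Re x + Re y) / 2" "Im ((x + y) / 2) = (Im x + Im y) / 2" by simp_all
  then show ?thesis unfolding cmod_power2 minus_complex.sel by (simp add: power2_eq_square field_simps)
qed

text \<open>The Gaussian of exponent s is, up to a constant, the overlap of two Gaussians of
  exponent 2s; this is why the Gaussian kernel is positive definite.\<close>

lemma gauss_product:
  assumes "s > 0"
  shows "(\<integral>\<^sup>+z. ennreal (exp (- 2 * s * (cmod (x - z))\<^sup>2)) * ennreal (exp (- 2 * s * (cmod (y - z))\<^sup>2)) \<partial>lborel)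
     = ennreal (pi / (4 * s)) * ennreal (exp (- s * (cmod (x - y))\<^sup>2))"
proof -
  have "(\<integral>\<^sup>+z. ennreal (exp (- 2 * s * (cmod (x - z))\<^sup>2)) * ennreal (exp (- 2 * s * (cmod (y - z))\<^sup>2)) \<partial>lborel)
      = (\<integral>\<^sup>+z. ennreal (exp (- s * (cmod (x - y))\<^sup>2)) * ennreal (exp (- (4 * s) * (cmod (z - (x + y) / 2))\<^sup>2)) \<partial>lborel)"
    by (intro nn_integral_cong) (simp only: ennreal_mult'[symmetric] exp_ge_zero exp_add[symmetric] gauss_split)
  also have "\<dots> = ennreal (exp (- s * (cmod (x - y))\<^sup>2)) * ennreal (pi / (4 * s))"
    using assms by (subst nn_integral_cmult) (simp_all only: nn_integral_gauss_complex, auto)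
  finally show ?thesis by (simp add: mult.commute)
qed

context
  fixes \<mu> :: "complex measure" and s :: real
  assumes \<mu>: "prob_space \<mu>" "sets \<mu> = sets borel" and s: "s > 0"
begin

interpretation \<mu>: prob_space \<mu> by (rule \<mu>)

lemma measurable_gconv: "gconv s \<mu> \<in> borel_measurable borel"
proof -
  have [measurable_cong]: "sets \<mu> = sets borel" by (rule \<mu>)
  show ?thesis unfolding gconv_def[abs_def] by measurable
qed

lemma gconv_integrand: "integrable \<mu> (\<lambda>x. exp (- 2 * s * (cmod (x - z))\<^sup>2))"
proof -
  have [measurable_cong]: "sets \<mu> = sets borel" by (rule \<mu>)
  show ?thesis using s by (intro \<mu>.integrable_const_bound[of _ 1]) auto
qed

lemma gconv_nonneg: "0 \<le> gconv s \<mu> z"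
  unfolding gconv_def by (intro Bochner_Integration.integral_nonneg) auto

lemma ennreal_gconv: "ennreal (gconv s \<mu> z) = (\<integral>\<^sup>+x. ennreal (exp (- 2 * s * (cmod (x - z))\<^sup>2)) \<partial>\<mu>)"
  unfolding gconv_def by (intro nn_integral_eq_integral[symmetric] gconv_integrand) auto

lemma gconv_integral: "has_bochner_integral lborel (gconv s \<mu>) (pi / (2 * s))"
proof (rule has_bochner_integral_nn_integral)
  have [measurable_cong]: "sets \<mu> = sets borel" by (rule \<mu>)
  interpret pair_sigma_finite \<mu> "lborel :: complex measure" ..
  have "(\<integral>\<^sup>+z. ennreal (gconv s \<mu> z) \<partial>lborel) = (\<integral>\<^sup>+x. \<integral>\<^sup>+z. ennreal (exp (- 2 * s * (cmod (x - z))\<^sup>2)) \<partial>lborel \<partial>\<mu>)"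
    unfolding ennreal_gconv by (rule Fubini') measurable
  also have "\<dots> = (\<integral>\<^sup>+x. ennreal (pi / (2 * s)) \<partial>\<mu>)"
    using s nn_integral_gauss_complex[of "2 * s"] by (simp add: norm_minus_commute)
  finally show "(\<integral>\<^sup>+z. ennreal (gconv s \<mu> z) \<partial>lborel) = ennreal (pi / (2 * s))"
    by (simp add: \<mu>.emeasure_space_1)
  show "gconv s \<mu> \<in> borel_measurable lborel" using measurable_gconv by simp
qed (use s gconv_nonneg in auto)

end

lemma gauss_energy:
  assumes \<mu>: "prob_space \<mu>" "sets \<mu> = sets borel" and \<nu>: "prob_space \<nu>" "sets \<nu> = sets borel" and s: "s > 0"
  shows "has_bochner_integral lborel (\<lambda>z. gconv s \<mu> z * gconv s \<nu> z)
     (pi / (4 * s) * (\<integral>p. exp (- s * (cmod (fst p - snd p))\<^sup>2) \<partial>(\<mu> \<Otimes>\<^sub>M \<nu>)))"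
proof (rule has_bochner_integral_nn_integral)
  interpret \<mu>: prob_space \<mu> by fact
  interpret \<nu>: prob_space \<nu> by fact
  interpret pair_prob_space \<mu> \<nu> ..
  interpret m: pair_sigma_finite \<mu> "lborel :: complex measure" ..
  interpret n: pair_sigma_finite \<nu> "lborel :: complex measure" ..
  have [measurable_cong]: "sets \<mu> = sets borel" "sets \<nu> = sets borel" by fact+
  note [measurable] = measurable_gconv[OF \<mu> s] measurable_gconv[OF \<nu> s]
  show "(\<lambda>z. gconv s \<mu> z * gconv s \<nu> z) \<in> borel_measurable lborel" by measurable
  have i: "integrable (\<mu> \<Otimes>\<^sub>M \<nu>) (\<lambda>p. exp (- s * (cmod (fst p - snd p))\<^sup>2))"
    using s by (intro P.integrable_const_bound[of _ 1]) auto
  have "(\<integral>\<^sup>+z. ennreal (gconv s \<mu> z * gconv s \<nu> z) \<partial>lborel)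
      = (\<integral>\<^sup>+z. \<integral>\<^sup>+x. \<integral>\<^sup>+y. ennreal (exp (- 2 * s * (cmod (x - z))\<^sup>2)) * ennreal (exp (- 2 * s * (cmod (y
          - z))\<^sup>2)) \<partial>\<nu> \<partial>\<mu> \<partial>lborel)"
    by (simp add: ennreal_mult gconv_nonneg[OF \<mu> s] gconv_nonneg[OF \<nu> s] ennreal_gconv[OF \<mu> s] ennreal_gconv[OF \<nu> s]
        nn_integral_cmult nn_integral_multc)
  also have "\<dots> = (\<integral>\<^sup>+x. \<integral>\<^sup>+z. \<integral>\<^sup>+y. ennreal (exp (- 2 * s * (cmod (x - z))\<^sup>2)) * ennreal (exp (- 2 * s * (cmod (y
      - z))\<^sup>2)) \<partial>\<nu> \<partial>lborel \<partial>\<mu>)"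
    by (rule m.Fubini') measurable
  also have "\<dots> = (\<integral>\<^sup>+x. \<integral>\<^sup>+y. \<integral>\<^sup>+z. ennreal (exp (- 2 * s * (cmod (x - z))\<^sup>2)) * ennreal (exp (- 2 * s * (cmod (y
      - z))\<^sup>2)) \<partial>lborel \<partial>\<nu> \<partial>\<mu>)"
    by (intro nn_integral_cong n.Fubini') measurable
  also have "\<dots> = ennreal (pi / (4 * s)) * (\<integral>\<^sup>+x. \<integral>\<^sup>+y. ennreal (exp (- s * (cmod (x - y))\<^sup>2)) \<partial>\<nu> \<partial>\<mu>)"
    by (simp only: gauss_product[OF s]) (simp add: nn_integral_cmult)
  also have "(\<integral>\<^sup>+x. \<integral>\<^sup>+y. ennreal (exp (- s * (cmod (x - y))\<^sup>2)) \<partial>\<nu> \<partial>\<mu>)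
      = (\<integral>\<^sup>+p. ennreal (exp (- s * (cmod (fst p - snd p))\<^sup>2)) \<partial>(\<mu> \<Otimes>\<^sub>M \<nu>))"
    by (subst \<nu>.nn_integral_fst[symmetric]) auto
  also have "\<dots> = ennreal (\<integral>p. exp (- s * (cmod (fst p - snd p))\<^sup>2) \<partial>(\<mu> \<Otimes>\<^sub>M \<nu>))"
    using i by (intro nn_integral_eq_integral) auto
  also have "ennreal (pi / (4 * s)) * \<dots> = ennreal (pi / (4 * s) * (\<integral>p. exp (- s * (cmod (fst p - snd p))\<^sup>2) \<partial>(\<mu> \<Otimes>\<^sub>M \<nu>)))"
    using s by (intro ennreal_mult'[symmetric]) auto
  finally show "(\<integral>\<^sup>+z. ennreal (gconv s \<mu> z * gconv s \<nu> z) \<partial>lborel)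
     = ennreal (pi / (4 * s) * (\<integral>p. exp (- s * (cmod (fst p - snd p))\<^sup>2) \<partial>(\<mu> \<Otimes>\<^sub>M \<nu>)))" .
qed (use s gconv_nonneg[OF \<mu> s] gconv_nonneg[OF \<nu> s] in \<open>auto intro!: mult_nonneg_nonneg Bochner_Integration.integral_nonneg\<close>)

lemma gdist_nonneg: "s > 0 \<Longrightarrow> gdist s \<mu> \<nu> \<ge> 0"
  unfolding gdist_def by simp

lemma gdist_eq:
  assumes \<mu>: "prob_space \<mu>" "sets \<mu> = sets borel" and \<nu>: "prob_space \<nu>" "sets \<nu> = sets borel" and s: "s > 0"
  shows "gdist s \<mu> \<nu> = (\<integral>p. exp (- s * (cmod (fst p - snd p))\<^sup>2) \<partial>(\<mu> \<Otimes>\<^sub>M \<mu>))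
     - 2 * (\<integral>p. exp (- s * (cmod (fst p - snd p))\<^sup>2) \<partial>(\<mu> \<Otimes>\<^sub>M \<nu>))
     + (\<integral>p. exp (- s * (cmod (fst p - snd p))\<^sup>2) \<partial>(\<nu> \<Otimes>\<^sub>M \<nu>))"
    and "integrable lborel (\<lambda>z. (gconv s \<mu> z - gconv s \<nu> z)\<^sup>2)"
proof -
  note e = gauss_energy[OF \<mu> \<mu> s] gauss_energy[OF \<mu> \<nu> s] gauss_energy[OF \<nu> \<nu> s]
  have eq: "(gconv s \<mu> z - gconv s \<nu> z)\<^sup>2
      = gconv s \<mu> z * gconv s \<mu> z - 2 * (gconv s \<mu> z * gconv s \<nu> z) + gconv s \<nu> z * gconv s \<nu> z" for z
    by (simp add: power2_eq_square algebra_simps)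
  show "integrable lborel (\<lambda>z. (gconv s \<mu> z - gconv s \<nu> z)\<^sup>2)"
    unfolding eq using e by (auto simp: has_bochner_integral_iff)
  show "gdist s \<mu> \<nu> = (\<integral>p. exp (- s * (cmod (fst p - snd p))\<^sup>2) \<partial>(\<mu> \<Otimes>\<^sub>M \<mu>))
     - 2 * (\<integral>p. exp (- s * (cmod (fst p - snd p))\<^sup>2) \<partial>(\<mu> \<Otimes>\<^sub>M \<nu>))
     + (\<integral>p. exp (- s * (cmod (fst p - snd p))\<^sup>2) \<partial>(\<nu> \<Otimes>\<^sub>M \<nu>))"
    unfolding gdist_def eq using e s by (simp add: has_bochner_integral_iff field_simps)
qed

text \<open>The term exp(-s)/s does not depend on the measures, so it disappears from every neutral
  combination.\<close>

lemma hq_pair_integral: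
  assumes \<mu>: "prob_space \<mu>" "sets \<mu> = sets borel" and \<nu>: "prob_space \<nu>" "sets \<nu> = sets borel"
  shows "(\<integral>p. hq S (cmod (fst p - snd p)) s \<partial>(\<mu> \<Otimes>\<^sub>M \<nu>))
    = (if s \<le> S then (\<integral>p. exp (- s * (cmod (fst p - snd p))\<^sup>2) \<partial>(\<mu> \<Otimes>\<^sub>M \<nu>)) else 0) / s * indicator {0<..} s
       - exp (- s) / s * indicator {0<..} s"
proof (cases "s > 0")
  case True
  interpret \<mu>: prob_space \<mu> by fact
  interpret \<nu>: prob_space \<nu> by fact
  interpret pair_prob_space \<mu> \<nu> ..
  have [measurable_cong]: "sets \<mu> = sets borel" "sets \<nu> = sets borel" by fact+
  have i: "integrable (\<mu> \<Otimes>\<^sub>M \<nu>) (\<lambda>p. exp (- s * (cmod (fst p - snd p))\<^sup>2))"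
    using True by (intro P.integrable_const_bound[of _ 1]) auto
  then show ?thesis
    using True by (cases "s \<le> S") (auto simp: hq_def P.prob_space diff_divide_distrib)
qed (simp add: hq_def)

text \<open>\<mu> - \<nu> has total charge 0, so the counterterms cancel with the weights 1, -2, 1.
  What remains is \<open>gdist\<close> for s \<le> S and nothing beyond S.\<close>

lemma reg_energy_identity:
  assumes \<mu>: "logmom \<mu>" and \<nu>: "logmom \<nu>" and S: "S \<ge> 1"
  shows "has_bochner_integral lborel (\<lambda>s. gdist s \<mu> \<nu> / s * indicator {0<..S} s)
     (2 * (reg_energy S \<mu> \<mu> - 2 * reg_energy S \<mu> \<nu> + reg_energy S \<nu> \<nu>))"
proof -
  have p: "prob_space \<mu>" "sets \<mu> = sets borel" "prob_space \<nu>" "sets \<nu> = sets borel"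
    using \<mu> \<nu> by (auto simp: logmom_def)
  note r = reg_energy_fubini(2)[OF \<mu> \<mu> S] reg_energy_fubini(2)[OF \<mu> \<nu> S] reg_energy_fubini(2)[OF \<nu> \<nu> S]
  have "has_bochner_integral lborel (\<lambda>s. (\<integral>p. hq S (cmod (fst p - snd p)) s \<partial>(\<mu> \<Otimes>\<^sub>M \<mu>))
       - 2 * (\<integral>p. hq S (cmod (fst p - snd p)) s \<partial>(\<mu> \<Otimes>\<^sub>M \<nu>)) + (\<integral>p. hq S (cmod (fst p - snd p)) s \<partial>(\<nu> \<Otimes>\<^sub>M \<nu>)))
     (2 * reg_energy S \<mu> \<mu> - 2 * (2 * reg_energy S \<mu> \<nu>) + 2 * reg_energy S \<nu> \<nu>)"
    by (intro has_bochner_integral_add has_bochner_integral_diff has_bochner_integral_mult_right r)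
  moreover have "(\<integral>p. hq S (cmod (fst p - snd p)) s \<partial>(\<mu> \<Otimes>\<^sub>M \<mu>))
       - 2 * (\<integral>p. hq S (cmod (fst p - snd p)) s \<partial>(\<mu> \<Otimes>\<^sub>M \<nu>)) + (\<integral>p. hq S (cmod (fst p - snd p)) s \<partial>(\<nu> \<Otimes>\<^sub>M \<nu>))
     = gdist s \<mu> \<nu> / s * indicator {0<..S} s" for s
  proof (cases "0 < s \<and> s \<le> S")
    case True
    then show ?thesis
      by (simp add: hq_pair_integral p gdist_eq(1) field_simps)
  qed (auto simp: hq_pair_integral p)
  ultimately show ?thesis by (simp add: algebra_simps)
qed

lemma reg_energy_positive:
  assumes "logmom \<mu>" "logmom \<nu>" "S \<ge> 1"
  shows "2 * reg_energy S \<mu> \<nu> \<le> reg_energy S \<mu> \<mu> + reg_energy S \<nu> \<nu>"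
proof -
  have "0 \<le> (\<integral>s. gdist s \<mu> \<nu> / s * indicator {0<..S} s \<partial>lborel)"
    by (intro Bochner_Integration.integral_nonneg) (auto simp: indicator_def gdist_nonneg)
  then show ?thesis using reg_energy_identity[OF assms] by (simp add: has_bochner_integral_iff)
qed

text \<open>On [a, 2a] the weight 1/s is at least 1/(2a); the integral is then at least c/2, and the
  factor 2 in the identity leaves c/4.\<close>

lemma reg_energy_lower:
  assumes "logmom \<mu>" "logmom \<nu>" "S \<ge> 1" and a: "a > 0" "2 * a \<le> S"
    and c: "c \<ge> 0" "\<And>s. a \<le> s \<Longrightarrow> s \<le> 2 * a \<Longrightarrow> gdist s \<mu> \<nu> \<ge> c"
  shows "reg_energy S \<mu> \<mu> - 2 * reg_energy S \<mu> \<nu> + reg_energy S \<nu> \<nu> \<ge> c / 4"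
proof -
  have "(\<integral>s. c / (2 * a) * indicator {a..2*a} s \<partial>lborel) \<le> (\<integral>s. gdist s \<mu> \<nu> / s * indicator {0<..S} s \<partial>lborel)"
  proof (rule integral_mono)
    show "integrable lborel (\<lambda>s. gdist s \<mu> \<nu> / s * indicator {0<..S} s)"
      using reg_energy_identity[OF assms(1-3)] by (simp add: has_bochner_integral_iff)
    fix s :: real
    show "c / (2 * a) * indicator {a..2*a} s \<le> gdist s \<mu> \<nu> / s * indicator {0<..S} s"
    proof (cases "s \<in> {a..2*a}")
      case True
      then have "c / (2 * a) \<le> gdist s \<mu> \<nu> / s" using a c gdist_nonneg[of s \<mu> \<nu>] by (intro frac_le) auto
      then show ?thesis using True a by simp
    qed (auto simp: indicator_def gdist_nonneg)
  qed (use a in \<open>intro integrable_mult_right integrable_real_indicator; simp\<close>)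
  moreover have "(\<integral>s. c / (2 * a) * indicator {a..2*a} s \<partial>lborel) = c / 2" using a by simp
  ultimately show ?thesis using reg_energy_identity[OF assms(1-3)] by (simp add: has_bochner_integral_iff)
qed

section \<open>Gaussian smoothing seen by bounded Lipschitz functions\<close>

lemma gauss_first_moment:
  assumes s: "s > 0"
  shows "(\<integral>\<^sup>+z. ennreal (cmod (x - z) * (2 * s / pi * exp (- 2 * s * (cmod (x - z))\<^sup>2))) \<partial>lborel) \<le> ennreal (2 / sqrt s)"
proof -
  \<comment> \<open>This lets half of the Gaussian absorb the distance |x - z|, leaving a Gaussian
    of exponent s.\<close>
  have le: "u * exp (- u\<^sup>2) \<le> 1" if "u \<ge> 0" for u :: real
  proof -
    have "u \<le> 1 + u\<^sup>2" using zero_le_power2[of "u - 1"] that by (simp add: power2_eq_square algebra_simps)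
    also have "\<dots> \<le> exp (u\<^sup>2)" by simp
    finally show ?thesis by (simp add: exp_minus field_simps)
  qed
  have "cmod (x - z) * (2 * s / pi * exp (- 2 * s * (cmod (x - z))\<^sup>2))
      \<le> 2 * sqrt s / pi * exp (- s * (cmod (z - x))\<^sup>2)" for z
  proof -
    define r where "r = cmod (x - z)"
    have sq: "(sqrt s * r)\<^sup>2 = s * r\<^sup>2" using s by (simp add: power_mult_distrib)
    have "r * (2 * s / pi * exp (- 2 * s * r\<^sup>2)) = 2 * sqrt s / pi * exp (- s * r\<^sup>2) * (sqrt s * r * exp (- (sqrt s * r)\<^sup>2))"
    proof -
      have "exp (- 2 * s * r\<^sup>2) = exp (- s * r\<^sup>2) * exp (- (sqrt s * r)\<^sup>2)"
        unfolding sq exp_add[symmetric] by simp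
      moreover have "s = sqrt s * sqrt s" using s by simp
      ultimately show ?thesis by simp
    qed
    also have "\<dots> \<le> 2 * sqrt s / pi * exp (- s * r\<^sup>2) * 1"
      using s by (intro mult_left_mono le) (auto simp: r_def)
    finally show ?thesis by (simp add: r_def norm_minus_commute)
  qed
  then have "(\<integral>\<^sup>+z. ennreal (cmod (x - z) * (2 * s / pi * exp (- 2 * s * (cmod (x - z))\<^sup>2))) \<partial>lborel)
      \<le> (\<integral>\<^sup>+z. ennreal (2 * sqrt s / pi) * ennreal (exp (- s * (cmod (z - x))\<^sup>2)) \<partial>lborel)"
    using s by (intro nn_integral_mono) (simp add: ennreal_mult'[symmetric] ennreal_leI)
  also have "\<dots> = ennreal (2 * sqrt s / pi) * ennreal (pi / s)"
    using nn_integral_gauss_complex[OF s, of x] by (subst nn_integral_cmult) auto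
  also have "\<dots> = ennreal (2 / sqrt s)"
  proof -
    have "2 * sqrt s / pi * (pi / s) = 2 / sqrt s"
      using s by (simp add: field_simps)
    then show ?thesis using s by (subst ennreal_mult'[symmetric]) auto
  qed
  finally show ?thesis .
qed

text \<open>\<open>gconv\<close> normalized to a probability density: the smoothing of \<mu> at a
  length scale of order 1 / sqrt s.\<close>

definition gsm :: "real \<Rightarrow> complex measure \<Rightarrow> complex \<Rightarrow> real" where
  "gsm s \<mu> z = 2 * s / pi * gconv s \<mu> z"

lemma gsm_nonneg: "prob_space \<mu> \<Longrightarrow> sets \<mu> = sets borel \<Longrightarrow> s > 0 \<Longrightarrow> gsm s \<mu> z \<ge> 0"
  by (simp add: gsm_def gconv_nonneg)

lemma gsm_integral:
  "prob_space \<mu> \<Longrightarrow> sets \<mu> = sets borel \<Longrightarrow> s > 0 \<Longrightarrow> has_bochner_integral lborel (gsm s \<mu>) 1"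
proof -
  assume "prob_space \<mu>" "sets \<mu> = sets borel" "s > 0"
  then have "has_bochner_integral lborel (\<lambda>z. 2 * s / pi * gconv s \<mu> z) (2 * s / pi * (pi / (2 * s)))"
    by (intro has_bochner_integral_mult_right gconv_integral)
  with \<open>s > 0\<close> show ?thesis unfolding gsm_def[abs_def] by simp
qed

lemma lipschitz_borel_measurable:
  fixes f :: "complex \<Rightarrow> real"
  assumes "\<And>z w. \<bar>f z - f w\<bar> \<le> dist z w"
  shows "f \<in> borel_measurable borel"
  using assms
  by (intro borel_measurable_continuous_onI lipschitz_on_continuous_on[of 1 UNIV f] lipschitz_onI)
     (auto simp: dist_real_def)

text \<open>Smoothing changes a 1-Lipschitz function by at most the mean displacement of the
  Gaussian, which is of order 1 / sqrt s. Fubini moves the smoothing from the function to the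
  measure.\<close>

lemma lipschitz_gauss_approx:
  fixes f :: "complex \<Rightarrow> real"
  assumes \<mu>: "prob_space \<mu>" "sets \<mu> = sets borel" and s: "s > 0"
    and f: "\<And>z. \<bar>f z\<bar> \<le> 1" "\<And>z w. \<bar>f z - f w\<bar> \<le> dist z w"
  shows "\<bar>(\<integral>x. f x \<partial>\<mu>) - (\<integral>z. f z * gsm s \<mu> z \<partial>lborel)\<bar> \<le> 2 / sqrt s"
proof -
  interpret \<mu>: prob_space \<mu> by fact
  interpret pair_sigma_finite \<mu> "lborel :: complex measure" ..
  have [measurable_cong]: "sets \<mu> = sets borel" by fact
  have [measurable]: "f \<in> borel_measurable borel" using f(2) by (rule lipschitz_borel_measurable)
  define k where "k x z = 2 * s / pi * exp (- 2 * s * (cmod (x - z))\<^sup>2)" for x z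
  have [measurable]: "(\<lambda>p. k (fst p) (snd p)) \<in> borel_measurable (\<mu> \<Otimes>\<^sub>M lborel)"
    unfolding k_def by measurable
  have [measurable]: "k x \<in> borel_measurable borel" for x unfolding k_def[abs_def] by measurable
  have k0: "k x z \<ge> 0" for x z using s by (simp add: k_def)
  have k1: "has_bochner_integral lborel (k x) 1" for x
  proof (rule has_bochner_integral_nn_integral)
    have "(\<integral>\<^sup>+z. ennreal (k x z) \<partial>lborel)
        = (\<integral>\<^sup>+z. ennreal (2 * s / pi) * ennreal (exp (- (2 * s) * (cmod (z - x))\<^sup>2)) \<partial>lborel)"
      using s by (intro nn_integral_cong) (simp add: k_def ennreal_mult'[symmetric] norm_minus_commute)
    also have "\<dots> = ennreal (2 * s / pi) * ennreal (pi / (2 * s))"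
      using nn_integral_gauss_complex[of "2 * s" x] s by (simp add: nn_integral_cmult)
    also have "\<dots> = ennreal 1" using s by (subst ennreal_mult'[symmetric]) auto
    finally show "(\<integral>\<^sup>+z. ennreal (k x z) \<partial>lborel) = ennreal 1" .
  qed (auto simp: k0)
  have int2: "integrable (\<mu> \<Otimes>\<^sub>M lborel) (\<lambda>(x, z). f z * k x z)"
  proof (rule integrableI_bounded)
    have "(\<integral>\<^sup>+p. ennreal (norm (case p of (x, z) \<Rightarrow> f z * k x z)) \<partial>(\<mu> \<Otimes>\<^sub>M lborel))
        \<le> (\<integral>\<^sup>+p. ennreal (k (fst p) (snd p)) \<partial>(\<mu> \<Otimes>\<^sub>M lborel))"
      using f(1) k0 by (intro nn_integral_mono ennreal_leI) (auto simp: abs_mult intro!: mult_left_le_one_le)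
    also have "\<dots> = (\<integral>\<^sup>+x. \<integral>\<^sup>+z. ennreal (k x z) \<partial>lborel \<partial>\<mu>)"
      by (subst lborel.nn_integral_fst[symmetric]) auto
    also have "\<dots> = 1"
      using k1 k0 by (simp add: nn_integral_eq_integral has_bochner_integral_iff \<mu>.emeasure_space_1)
    finally show "(\<integral>\<^sup>+p. ennreal (norm (case p of (x, z) \<Rightarrow> f z * k x z)) \<partial>(\<mu> \<Otimes>\<^sub>M lborel)) < \<infinity>"
      by (simp add: le_less_trans)
  qed (simp add: case_prod_unfold)
  have fk: "integrable lborel (\<lambda>z. f z * k x z)" for x
  proof (rule Bochner_Integration.integrable_bound[of _ "k x"])
    show "AE z in lborel. norm (f z * k x z) \<le> norm (k x z)"
      using f(1) k0 by (intro AE_I2) (auto simp: abs_mult intro!: mult_left_le_one_le)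
  qed (use k1 in \<open>auto simp: has_bochner_integral_iff\<close>)
  have point: "\<bar>f x - (\<integral>z. f z * k x z \<partial>lborel)\<bar> \<le> 2 / sqrt s" for x
  proof -
    have i: "integrable lborel (\<lambda>z. f x * k x z - f z * k x z)"
      using k1[of x] fk[of x] by (intro Bochner_Integration.integrable_diff integrable_mult_right)
          (auto simp: has_bochner_integral_iff)
    have "f x - (\<integral>z. f z * k x z \<partial>lborel) = (\<integral>z. f x * k x z - f z * k x z \<partial>lborel)"
      using k1[of x] fk[of x] by (subst Bochner_Integration.integral_diff) (auto simp: has_bochner_integral_iff)
    then have "ennreal \<bar>f x - (\<integral>z. f z * k x z \<partial>lborel)\<bar> \<le> (\<integral>\<^sup>+z. ennreal \<bar>f x * k x z - f z * k x z\<bar> \<partial>lborel)"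
      using integral_norm_bound_ennreal[OF i] by simp
    also have "\<dots> \<le> (\<integral>\<^sup>+z. ennreal (cmod (x - z) * k x z) \<partial>lborel)"
    proof (intro nn_integral_mono ennreal_leI)
      fix z
      have "\<bar>f x * k x z - f z * k x z\<bar> = \<bar>f x - f z\<bar> * k x z"
        using k0[of x z] by (simp add: abs_mult left_diff_distrib[symmetric])
      also have "\<dots> \<le> cmod (x - z) * k x z" using f(2)[of x z] k0[of x z] by (intro mult_right_mono) (auto simp: dist_norm)
      finally show "\<bar>f x * k x z - f z * k x z\<bar> \<le> cmod (x - z) * k x z" .
    qed
    also have "\<dots> \<le> ennreal (2 / sqrt s)" unfolding k_def by (rule gauss_first_moment[OF s])
    finally show ?thesis using s by (subst (asm) ennreal_le_iff) auto
  qed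
  have f_int: "integrable \<mu> f" using f(1) by (intro \<mu>.integrable_const_bound[of _ 1]) auto
  have inner: "(\<integral>x. f z * k x z \<partial>\<mu>) = f z * gsm s \<mu> z" for z
    unfolding k_def gsm_def gconv_def by simp
  have "(\<integral>z. f z * gsm s \<mu> z \<partial>lborel) = (\<integral>x. \<integral>z. f z * k x z \<partial>lborel \<partial>\<mu>)"
    unfolding inner[symmetric] by (rule Fubini_integral[OF int2])
  moreover have i2: "integrable \<mu> (\<lambda>x. \<integral>z. f z * k x z \<partial>lborel)"
    using integrable_fst[OF int2] by simp
  ultimately have "(\<integral>x. f x \<partial>\<mu>) - (\<integral>z. f z * gsm s \<mu> z \<partial>lborel) = (\<integral>x. f x - (\<integral>z. f z * k x z \<partial>lborel) \<partial>\<mu>)"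
    using f_int by simp
  also have "\<bar>\<dots>\<bar> \<le> (\<integral>x. \<bar>f x - (\<integral>z. f z * k x z \<partial>lborel)\<bar> \<partial>\<mu>)"
    by (rule integral_abs_bound)
  also have "\<dots> \<le> (\<integral>x. 2 / sqrt s \<partial>\<mu>)"
    using point i2 f_int by (intro integral_mono) auto
  also have "\<dots> = 2 / sqrt s" by (simp add: \<mu>.prob_space)
  finally show ?thesis .
qed

text \<open>Both smoothings have mass 1, so their L^1 distance is twice the integral of the positive
  part of \<open>gsm s \<nu> z - gsm s \<mu> z\<close>. That positive part is at most
  \<open>gsm s \<nu> z\<close>, so outside the disc only the tail of \<nu> appears; inside, Young's
  inequality with parameter \<theta> passes to the square.\<close>

lemma gsm_difference_bound:
  assumes \<mu>: "prob_space \<mu>" "sets \<mu> = sets borel" and \<nu>: "prob_space \<nu>" "sets \<nu> = sets borel" and s: "s > 0"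
    and A: "A \<ge> 0" and \<theta>: "\<theta> > 0"
  shows "(\<integral>z. \<bar>gsm s \<mu> z - gsm s \<nu> z\<bar> \<partial>lborel)
     \<le> 2 * (\<theta> * (pi * A\<^sup>2) + s / (4 * pi * \<theta>) * gdist s \<mu> \<nu> + (\<integral>z. gsm s \<nu> z * indicator (- cball 0 A) z \<partial>lborel))"
proof -
  note gm = gsm_integral[OF \<mu> s] and gn = gsm_integral[OF \<nu> s]
  define d where "d z = gsm s \<nu> z - gsm s \<mu> z" for z
  have d_int: "integrable lborel d" "(\<integral>z. d z \<partial>lborel) = 0"
    unfolding d_def[abs_def] using gm gn by (auto simp: has_bochner_integral_iff)
  have d2: "d z = (- (2 * s / pi)) * (gconv s \<mu> z - gconv s \<nu> z)" for z
    by (simp add: d_def gsm_def algebra_simps)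
  have dsq: "has_bochner_integral lborel (\<lambda>z. (d z)\<^sup>2) (s / pi * gdist s \<mu> \<nu>)"
  proof -
    have "has_bochner_integral lborel (\<lambda>z. (2 * s / pi)\<^sup>2 * (gconv s \<mu> z - gconv s \<nu> z)\<^sup>2) ((2 * s / pi)\<^sup>2
        * (\<integral>z. (gconv s \<mu> z - gconv s \<nu> z)\<^sup>2 \<partial>lborel))"
      using gdist_eq(2)[OF \<mu> \<nu> s] by (intro has_bochner_integral_mult_right) (simp add: has_bochner_integral_iff)
    also have "(2 * s / pi)\<^sup>2 * (\<integral>z. (gconv s \<mu> z - gconv s \<nu> z)\<^sup>2 \<partial>lborel) = s / pi * gdist s \<mu> \<nu>"
      by (simp add: gdist_def power2_eq_square)
    finally show ?thesis unfolding d2 power_mult_distrib by simp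
  qed
  have B: "has_bochner_integral lborel (indicator (cball 0 A) :: complex \<Rightarrow> real) (pi * A\<^sup>2)"
    using emeasure_cball_complex[OF A, of 0] has_bochner_integral_real_indicator[of "cball 0 A :: complex set" lborel]
    by (simp add: measure_def A)
  have T: "integrable lborel (\<lambda>z. gsm s \<nu> z * indicator (- cball 0 A) z)"
    using gn by (intro integrable_real_mult_indicator) (auto simp: has_bochner_integral_iff)
  have "max 0 (d z) \<le> \<theta> * indicator (cball 0 A) z + (1 / (4 * \<theta>)) * (d z)\<^sup>2 + gsm s \<nu> z * indicator (- cball 0 A) z" for z
  proof (cases "z \<in> cball 0 A")
    case True
    have "0 \<le> (d z - 2 * \<theta>)\<^sup>2" by simp
    then have "4 * \<theta> * d z \<le> 4 * \<theta> * (\<theta> + (1 / (4 * \<theta>)) * (d z)\<^sup>2)"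
      using \<theta> by (simp add: power2_eq_square algebra_simps)
    then have "d z \<le> \<theta> + (1 / (4 * \<theta>)) * (d z)\<^sup>2" using \<theta> by (simp only: mult_le_cancel_left_pos)
    then show ?thesis using True \<theta> by simp
  next
    case False
    have "d z \<le> gsm s \<nu> z" using gsm_nonneg[OF \<mu> s] by (simp add: d_def)
    then show ?thesis using False \<theta> gsm_nonneg[OF \<nu> s, of z] by (auto simp: add_increasing)
  qed
  then have "(\<integral>z. max 0 (d z) \<partial>lborel)
      \<le> (\<integral>z. \<theta> * indicator (cball 0 A) z + (1 / (4 * \<theta>)) * (d z)\<^sup>2 + gsm s \<nu> z * indicator (- cball 0 A) z \<partial>lborel)"
    using B dsq T d_int(1) by (intro integral_mono) (auto simp: has_bochner_integral_iff)
  also have "\<dots> = \<theta> * (pi * A\<^sup>2) + (1 / (4 * \<theta>)) * (s / pi * gdist s \<mu> \<nu>) + (\<integral>z. gsm s \<nu> z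
      * indicator (- cball 0 A) z \<partial>lborel)"
    using B dsq T by (simp add: has_bochner_integral_iff)
  finally have le: "(\<integral>z. max 0 (d z) \<partial>lborel)
      \<le> \<theta> * (pi * A\<^sup>2) + s / (4 * pi * \<theta>) * gdist s \<mu> \<nu> + (\<integral>z. gsm s \<nu> z * indicator (- cball 0 A) z \<partial>lborel)"
    by (simp add: field_simps)
  have "\<bar>gsm s \<mu> z - gsm s \<nu> z\<bar> = 2 * max 0 (d z) - d z" for z by (simp add: d_def max_def)
  then have "(\<integral>z. \<bar>gsm s \<mu> z - gsm s \<nu> z\<bar> \<partial>lborel) = 2 * (\<integral>z. max 0 (d z) \<partial>lborel)"
    using d_int by simp
  with le show ?thesis by simp
qed

text \<open>If two probability measures are separated by a bounded Lipschitz function, then their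
  Gaussian-smoothed difference is bounded below at a whole range of scales; the tightness of one of
  the two measures suffices.\<close>
lemma gdist_coercive:
  assumes \<nu>: "prob_space \<nu>" "sets \<nu> = sets borel" and e: "e > 0"
  shows "\<exists>a>0. \<exists>c>0. \<forall>\<mu> f s. prob_space \<mu> \<longrightarrow> sets \<mu> = sets borel \<longrightarrow>
     (\<forall>z::complex. \<bar>f z\<bar> \<le> (1::real)) \<longrightarrow> (\<forall>z w. \<bar>f z - f w\<bar> \<le> dist z w) \<longrightarrow>
     \<bar>(\<integral>z. f z \<partial>\<mu>) - (\<integral>z. f z \<partial>\<nu>)\<bar> \<ge> e \<longrightarrow> a \<le> s \<longrightarrow> s \<le> 2 * a \<longrightarrow> gdist s \<mu> \<nu> \<ge> c"
proof -
  \<comment> \<open>For s \<ge> 256/e^2 smoothing costs at most 2 / sqrt s \<le> e/8 for each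
    measure. The area and tail terms will take 2(e/8 + e/8), which leaves e/4 for the quadratic
    term.\<close>
  define a where "a = 256 / e\<^sup>2"
  have a: "a > 0" using e by (simp add: a_def)
  have sqa: "sqrt a = 16 / e" using e by (simp add: a_def real_sqrt_divide)
  note ga = gsm_integral[OF \<nu> a]
  have "(\<lambda>n. \<integral>z. gsm a \<nu> z * indicator (- cball 0 (real n)) z \<partial>lborel) \<longlonglongrightarrow> (\<integral>z. 0 \<partial>(lborel :: complex measure))"
  proof (rule integral_dominated_convergence[where w = "gsm a \<nu>"])
    show "AE z in lborel. (\<lambda>n. gsm a \<nu> z * indicator (- cball 0 (real n)) z) \<longlonglongrightarrow> 0"
    proof (intro AE_I2 tendsto_eventually)
      fix z :: complex
      have "\<forall>\<^sub>F n in sequentially. cmod z \<le> real n"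
        using real_arch_simple[of "cmod z"] eventually_sequentially by (metis of_nat_mono order_trans)
      then show "\<forall>\<^sub>F n in sequentially. gsm a \<nu> z * indicator (- cball 0 (real n)) z = 0"
        by eventually_elim simp
    qed
    show "AE z in lborel. norm (gsm a \<nu> z * indicator (- cball 0 (real n)) z) \<le> gsm a \<nu> z" for n
      using gsm_nonneg[OF \<nu> a] by (intro AE_I2) (auto simp: indicator_def)
  qed (use ga in \<open>auto simp: has_bochner_integral_iff intro!: borel_measurable_times borel_measurable_indicator\<close>)
  then have "\<forall>\<^sub>F n in sequentially. (\<integral>z. gsm a \<nu> z * indicator (- cball 0 (real n)) z \<partial>lborel) < e / 16"
    using e by (intro order_tendstoD) auto
  then obtain n where n: "(\<integral>z. gsm a \<nu> z * indicator (- cball 0 (real n)) z \<partial>lborel) < e / 16"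
    by (meson eventually_happens sequentially_bot)
  define A where "A = real n"
  \<comment> \<open>Makes the area term at most e/8; the summand 1 covers A = 0.\<close>
  define \<theta> where "\<theta> = e / (8 * pi * (A\<^sup>2 + 1))"
  have A2: "A\<^sup>2 + 1 > 0" by (smt (verit) zero_le_power2)
  have \<theta>: "\<theta> > 0" using e A2 by (simp add: \<theta>_def)
  have "e / (8 * pi * b) * (pi * t) = e / 8 * (t / b)" if "b > 0" for b t :: real
    using that by (simp add: field_simps)
  from this[OF A2] have "\<theta> * (pi * A\<^sup>2) = e / 8 * (A\<^sup>2 / (A\<^sup>2 + 1))" by (simp add: \<theta>_def)
  also have "\<dots> \<le> e / 8 * 1" using e A2 by (intro mult_left_mono) (auto simp: divide_le_eq)
  finally have \<theta>A: "\<theta> * (pi * A\<^sup>2) \<le> e / 8" by simp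
  define c where "c = e / 4 * (2 * pi * \<theta>) / (2 * a)"
  have c: "c > 0" using e \<theta> a by (simp add: c_def)
  show ?thesis
  proof (rule exI[of _ a], intro conjI exI[of _ c] allI impI a c)
    fix \<mu> :: "complex measure" and f :: "complex \<Rightarrow> real" and s :: real
    assume \<mu>: "prob_space \<mu>" "sets \<mu> = sets borel" and f: "\<forall>z. \<bar>f z\<bar> \<le> 1" "\<forall>z w. \<bar>f z - f w\<bar> \<le> dist z w"
      and ge: "\<bar>(\<integral>z. f z \<partial>\<mu>) - (\<integral>z. f z \<partial>\<nu>)\<bar> \<ge> e" and s: "a \<le> s" "s \<le> 2 * a"
    have s0: "s > 0" using s a by simp
    note gm = gsm_integral[OF \<mu> s0] and gn = gsm_integral[OF \<nu> s0]
    have [measurable]: "f \<in> borel_measurable borel" using f(2) by (intro lipschitz_borel_measurable) auto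
    have 1: "\<bar>(\<integral>x. f x \<partial>\<mu>) - (\<integral>z. f z * gsm s \<mu> z \<partial>lborel)\<bar> \<le> 2 / sqrt s"
            "\<bar>(\<integral>x. f x \<partial>\<nu>) - (\<integral>z. f z * gsm s \<nu> z \<partial>lborel)\<bar> \<le> 2 / sqrt s"
      using f by (auto intro!: lipschitz_gauss_approx \<mu> \<nu> s0)
    have "2 / sqrt s \<le> 2 / sqrt a" using s a by (intro divide_left_mono) auto
    then have 2: "2 / sqrt s \<le> e / 8" by (simp add: sqa)
    have fi: "integrable lborel (\<lambda>z. f z * gsm s \<mu> z)" "integrable lborel (\<lambda>z. f z * gsm s \<nu> z)"
    proof -
      show "integrable lborel (\<lambda>z. f z * gsm s \<mu> z)"
      proof (rule Bochner_Integration.integrable_bound[of _ "gsm s \<mu>"])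
        show "AE z in lborel. norm (f z * gsm s \<mu> z) \<le> norm (gsm s \<mu> z)"
          using f(1) by (intro AE_I2) (auto simp: abs_mult intro!: mult_left_le_one_le)
      qed (use gm in \<open>auto simp: has_bochner_integral_iff intro!: borel_measurable_times\<close>)
      show "integrable lborel (\<lambda>z. f z * gsm s \<nu> z)"
      proof (rule Bochner_Integration.integrable_bound[of _ "gsm s \<nu>"])
        show "AE z in lborel. norm (f z * gsm s \<nu> z) \<le> norm (gsm s \<nu> z)"
          using f(1) by (intro AE_I2) (auto simp: abs_mult intro!: mult_left_le_one_le)
      qed (use gn in \<open>auto simp: has_bochner_integral_iff intro!: borel_measurable_times\<close>)
    qed
    have "\<bar>(\<integral>z. f z * gsm s \<mu> z \<partial>lborel) - (\<integral>z. f z * gsm s \<nu> z \<partial>lborel)\<bar> = \<bar>\<integral>z. f z * (gsm s \<mu> z - gsm s \<nu> z) \<partial>lborel\<bar>"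
      using fi by (simp add: right_diff_distrib)
    also have "\<dots> \<le> (\<integral>z. \<bar>f z * (gsm s \<mu> z - gsm s \<nu> z)\<bar> \<partial>lborel)" by (rule integral_abs_bound)
    also have "\<dots> \<le> (\<integral>z. \<bar>gsm s \<mu> z - gsm s \<nu> z\<bar> \<partial>lborel)"
    proof (rule integral_mono)
      show "integrable lborel (\<lambda>z. \<bar>f z * (gsm s \<mu> z - gsm s \<nu> z)\<bar>)"
        using fi by (simp add: right_diff_distrib)
      show "integrable lborel (\<lambda>z. \<bar>gsm s \<mu> z - gsm s \<nu> z\<bar>)" using gm gn by (auto simp: has_bochner_integral_iff)
    qed (use f(1) in \<open>auto simp: abs_mult intro!: mult_left_le_one_le\<close>)
    also have "\<dots> \<le> 2 * (\<theta> * (pi * A\<^sup>2) + s / (4 * pi * \<theta>) * gdist s \<mu> \<nu> + (\<integral>z. gsm s \<nu> z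
        * indicator (- cball 0 A) z \<partial>lborel))"
      by (intro gsm_difference_bound \<mu> \<nu> s0 \<theta>) (simp add: A_def)
    finally have 3: "\<bar>(\<integral>z. f z * gsm s \<mu> z \<partial>lborel) - (\<integral>z. f z * gsm s \<nu> z \<partial>lborel)\<bar>
      \<le> 2 * (\<theta> * (pi * A\<^sup>2) + s / (4 * pi * \<theta>) * gdist s \<mu> \<nu> + (\<integral>z. gsm s \<nu> z * indicator (- cball 0 A) z \<partial>lborel))" .
    have "(\<integral>z. gsm s \<nu> z * indicator (- cball 0 A) z \<partial>lborel) \<le> (\<integral>z. 2 * (gsm a \<nu> z * indicator (- cball 0 A) z) \<partial>lborel)"
    proof (rule integral_mono)
      show "integrable lborel (\<lambda>z. gsm s \<nu> z * indicator (- cball 0 A) z)" "integrable lborel (\<lambda>z. 2 * (gsm a \<nu> z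
          * indicator (- cball 0 A) z))"
        using gn ga by (auto simp: has_bochner_integral_iff intro!: integrable_real_mult_indicator integrable_mult_right)
      \<comment> \<open>The radius A was chosen at scale a, but it serves all s up to 2a: the
        Gaussians decrease in s and the prefactor at most doubles.\<close>
      have "gconv s \<nu> z \<le> gconv a \<nu> z" for z
        unfolding gconv_def using s a
        by (intro integral_mono gconv_integrand \<nu> s0) (auto intro!: mult_right_mono)
      then have "gsm s \<nu> z \<le> 2 * gsm a \<nu> z" for z
        unfolding gsm_def using s a gconv_nonneg[OF \<nu> s0, of z]
        by (simp only: mult.assoc[symmetric]) (intro mult_mono, auto simp: divide_right_mono)
      then show "gsm s \<nu> z * indicator (- cball 0 A) z \<le> 2 * (gsm a \<nu> z * indicator (- cball 0 A) z)" for z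
        by (auto simp: indicator_def)
    qed
    with n have 4: "(\<integral>z. gsm s \<nu> z * indicator (- cball 0 A) z \<partial>lborel) \<le> e / 8" by (simp add: A_def)
    define X where "X = s / (4 * pi * \<theta>) * gdist s \<mu> \<nu>"
    have "e \<le> \<bar>(\<integral>x. f x \<partial>\<mu>) - (\<integral>z. f z * gsm s \<mu> z \<partial>lborel)\<bar> + \<bar>(\<integral>x. f x \<partial>\<nu>) - (\<integral>z. f z * gsm s \<nu> z \<partial>lborel)\<bar>
        + \<bar>(\<integral>z. f z * gsm s \<mu> z \<partial>lborel) - (\<integral>z. f z * gsm s \<nu> z \<partial>lborel)\<bar>"
      using ge by linarith
    also have "\<dots> \<le> e / 8 + e / 8 + 2 * (e / 8 + X + e / 8)"
      by (intro add_mono order_trans[OF 1(1) 2] order_trans[OF 1(2) 2] order_trans[OF 3[folded X_def]] mult_left_mono \<theta>A 4 order_refl) auto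
    finally have "e / 4 \<le> 2 * X" by simp
    also have "2 * X = s / (2 * pi * \<theta>) * gdist s \<mu> \<nu>" by (simp add: X_def)
    also have "\<dots> \<le> 2 * a / (2 * pi * \<theta>) * gdist s \<mu> \<nu>"
      using s \<theta> gdist_nonneg[OF s0] by (intro mult_right_mono divide_right_mono) auto
    finally show "c \<le> gdist s \<mu> \<nu>"
      using a \<theta> by (simp add: c_def field_simps)
  qed
qed

section \<open>The Laplacian of the logarithm\<close>

lemma integral_complex:
  fixes f :: "complex \<Rightarrow> real"
  assumes f: "integrable lborel f"
  shows "(\<integral>z. f z \<partial>lborel) = (\<integral>a. \<integral>b. f (Complex a b) \<partial>lborel \<partial>lborel)"
    and "(\<integral>z. f z \<partial>lborel) = (\<integral>b. \<integral>a. f (Complex a b) \<partial>lborel \<partial>lborel)"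
proof -
  have [measurable]: "f \<in> borel_measurable borel" using f by (simp add: integrable_iff_bounded)
  have i: "integrable (lborel \<Otimes>\<^sub>M lborel) (\<lambda>(a, b). f (Complex a b))"
    using f unfolding lborel_complex_eq[symmetric]
    by (subst (asm) integrable_distr_eq) (auto simp: case_prod_unfold)
  have eq: "(\<integral>z. f z \<partial>lborel) = (\<integral>p. (case p of (a, b) \<Rightarrow> f (Complex a b)) \<partial>(lborel \<Otimes>\<^sub>M lborel))"
    by (subst lborel_complex_eq[symmetric], subst integral_distr) (auto simp: case_prod_unfold)
  show 1: "(\<integral>z. f z \<partial>lborel) = (\<integral>a. \<integral>b. f (Complex a b) \<partial>lborel \<partial>lborel)"
    unfolding eq by (rule lborel_pair.integral_fst[OF i, symmetric])
  show "(\<integral>z. f z \<partial>lborel) = (\<integral>b. \<integral>a. f (Complex a b) \<partial>lborel \<partial>lborel)"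
    unfolding 1 by (rule lborel_pair.Fubini_integral[OF i, symmetric])
qed

lemma integral_affine_complex:
  fixes f :: "complex \<Rightarrow> real"
  assumes [measurable]: "f \<in> borel_measurable borel" and c: "c > 0"
  shows "(\<integral>x. f x \<partial>lborel) = c\<^sup>2 * (\<integral>w. f (y + c *\<^sub>R w) \<partial>lborel)"
proof -
  have "(lborel :: complex measure) = density (distr lborel borel (\<lambda>x. y + c *\<^sub>R x)) (\<lambda>_. ennreal (\<bar>c\<bar> ^ DIM(complex)))"
    using c by (intro lborel_affine) auto
  then have eq: "(lborel :: complex measure) = density (distr lborel borel (\<lambda>x. y + c *\<^sub>R x)) (\<lambda>_. ennreal (c\<^sup>2))"
    using c by simp
  have "(\<integral>x. f x \<partial>lborel) = (\<integral>x. c\<^sup>2 *\<^sub>R f x \<partial>(distr lborel borel (\<lambda>x. y + c *\<^sub>R x)))"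
    by (subst eq, subst integral_density) auto
  also have "\<dots> = c\<^sup>2 * (\<integral>w. f (y + c *\<^sub>R w) \<partial>lborel)"
    by (subst integral_distr) auto
  finally show ?thesis .
qed

lemma integrable_compact_support:
  fixes f :: "complex \<Rightarrow> real"
  assumes "continuous_on UNIV f" "\<And>z. B < cmod z \<Longrightarrow> f z = 0"
  shows "integrable lborel f"
proof -
  have "integrable lborel (\<lambda>z. indicator (cball 0 B) z *\<^sub>R f z)"
    using assms(1) by (intro borel_integrable_compact) (auto intro: continuous_on_subset)
  moreover have "(\<lambda>z. indicator (cball 0 B) z *\<^sub>R f z) = f"
    using assms(2) by (auto simp: indicator_def not_le fun_eq_iff)
  ultimately show ?thesis by simp
qed

text \<open>\<open>pdir\<close> is a derivative at parameter 0; shifting the base point turns it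
  into the derivative along the whole line.\<close>

lemma cont_partials_derivative:
  assumes "cont_partials g" "v \<in> {1, \<i>}"
  shows "((\<lambda>t::real. g (z + of_real t * v)) has_real_derivative pdir v g (z + of_real t * v)) (at t)"
proof -
  have "(\<lambda>s::real. g ((z + of_real t * v) + of_real s * v)) differentiable (at 0)"
    using assms by (auto simp: cont_partials_def)
  then have "((\<lambda>s::real. g ((z + of_real t * v) + of_real s * v)) has_real_derivative pdir v g (z + of_real t * v)) (at 0)"
    unfolding pdir_def using DERIV_deriv_iff_real_differentiable by blast
  then have "((\<lambda>x. g ((z + of_real t * v) + of_real (x + - t) * v)) has_real_derivative pdir v g (z + of_real t * v)) (at t)"
    using DERIV_shift[of "\<lambda>s::real. g ((z + of_real t * v) + of_real s * v)" _ t "- t"] by simp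
  moreover have "(z + of_real t * v) + of_real (x + - t) * v = z + of_real x * v" for x
    by (simp add: algebra_simps)
  ultimately show ?thesis by (simp only:)
qed

text \<open>The exterior of the disc is open, so g vanishes along a short segment through z.\<close>

lemma pdir_zero_outside:
  assumes "\<And>z. B < cmod z \<Longrightarrow> g z = 0" "B < cmod z"
  shows "pdir v g z = 0"
proof -
  have "\<forall>\<^sub>F s in nhds (0::real). B < cmod (z + of_real s * v)"
  proof (rule order_tendstoD(1))
    show "((\<lambda>s::real. cmod (z + of_real s * v)) \<longlongrightarrow> cmod (z + of_real 0 * v)) (nhds 0)"
      by (intro tendsto_intros filterlim_ident)
  qed (use assms in simp)
  then have "\<forall>\<^sub>F s in nhds (0::real). g (z + of_real s * v) = 0"
    by eventually_elim (rule assms(1))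
  then have "deriv (\<lambda>s::real. g (z + of_real s * v)) 0 = deriv (\<lambda>s::real. 0) 0"
    by (intro deriv_cong_ev) auto
  then show ?thesis by (simp add: pdir_def)
qed

text \<open>Green's identity on a line: e h2 - e2 h is the derivative of e h1 - e1 h, which vanishes
  at both ends of an interval reaching beyond the support.\<close>

lemma parts_line:
  fixes h h1 h2 e e1 e2 :: "real \<Rightarrow> real"
  assumes h: "\<And>t. (h has_real_derivative h1 t) (at t)" "\<And>t. (h1 has_real_derivative h2 t) (at t)" "continuous_on UNIV h2"
    and e: "\<And>t. (e has_real_derivative e1 t) (at t)" "\<And>t. (e1 has_real_derivative e2 t) (at t)" "continuous_on UNIV e2"
    and supp: "\<And>t. B < \<bar>t\<bar> \<Longrightarrow> h t = 0 \<and> h1 t = 0 \<and> h2 t = 0"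
  shows "(\<integral>t. e t * h2 t \<partial>lborel) = (\<integral>t. e2 t * h t \<partial>lborel)"
proof -
  define A where "A = \<bar>B\<bar> + 1"
  have ch: "continuous_on UNIV h" "continuous_on UNIV e"
    by (rule DERIV_continuous_on[of UNIV h h1], simp add: h) (rule DERIV_continuous_on[of UNIV e e1], simp add: e)
  have c: "continuous_on {- A..A} h" "continuous_on {- A..A} e" "continuous_on {- A..A} h2" "continuous_on {- A..A} e2"
    using ch h(3) e(3) by (auto intro: continuous_on_subset)
  have nz: "h t = 0 \<and> h2 t = 0" if "t \<notin> {- A..A}" for t
  proof -
    have "B < \<bar>t\<bar>" using that by (auto simp: A_def)
    then show ?thesis using supp by auto
  qed
  define F where "F t = e t * h1 t - e1 t * h t" for t
  have "has_bochner_integral lborel (\<lambda>t. indicator {- A..A} t *\<^sub>R (e t * h2 t - e2 t * h t)) (F A - F (- A))"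
  proof (rule has_bochner_integral_FTC_Icc)
    show "(F has_vector_derivative e t * h2 t - e2 t * h t) (at t within {- A..A})" for t
    proof -
      have "(F has_real_derivative (e t * h2 t + e1 t * h1 t) - (e1 t * h1 t + e2 t * h t)) (at t)"
        unfolding F_def[abs_def] by (intro DERIV_diff DERIV_mult' h(1) h(2) e(1) e(2))
      also have "(e t * h2 t + e1 t * h1 t) - (e1 t * h1 t + e2 t * h t) = e t * h2 t - e2 t * h t" by simp
      finally show ?thesis
        by (rule has_vector_derivative_at_within[OF has_real_derivative_iff_has_vector_derivative[THEN iffD1]])
    qed
    show "continuous_on {- A..A} (\<lambda>t. e t * h2 t - e2 t * h t)"
      using ch h(3) e(3) by (intro continuous_intros) (auto intro: continuous_on_subset)
  qed (simp add: A_def)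
  moreover have "F A - F (- A) = 0" using supp[of A] supp[of "- A"] by (simp add: F_def A_def)
  moreover have "(\<lambda>t. indicator {- A..A} t *\<^sub>R (e t * h2 t - e2 t * h t)) = (\<lambda>t. e t * h2 t - e2 t * h t)"
  proof
    fix t show "indicator {- A..A} t *\<^sub>R (e t * h2 t - e2 t * h t) = e t * h2 t - e2 t * h t"
      using nz[of t] by (cases "t \<in> {- A..A}") auto
  qed
  ultimately have "has_bochner_integral lborel (\<lambda>t. e t * h2 t - e2 t * h t) 0" by simp
  moreover have "integrable lborel (\<lambda>t. indicator {- A..A} t *\<^sub>R (e t
      * h2 t))" "integrable lborel (\<lambda>t. indicator {- A..A} t *\<^sub>R (e2 t * h t))"
    by (intro borel_integrable_compact continuous_on_mult c compact_Icc)+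
  moreover have "(\<lambda>t. indicator {- A..A} t *\<^sub>R (e t * h2 t))
      = (\<lambda>t. e t * h2 t)" "(\<lambda>t. indicator {- A..A} t *\<^sub>R (e2 t * h t)) = (\<lambda>t. e2 t * h t)"
    using nz by (auto simp: indicator_def fun_eq_iff)
  ultimately show ?thesis by (simp add: has_bochner_integral_iff)
qed

section \<open>A compactly supported test function against Gaussians and the logarithm\<close>

context
  fixes g :: "complex \<Rightarrow> real" and B :: real
  assumes C2: "C2_fun g" and supp: "\<And>z. B < cmod z \<Longrightarrow> g z = 0"
begin

lemma laplacian_zero: "B < cmod z \<Longrightarrow> laplacian g z = 0"
  unfolding laplacian_def by (simp add: pdir_zero_outside[OF pdir_zero_outside[OF supp]])

lemma cont_g: "continuous_on UNIV g" "continuous_on UNIV (pdir 1 (pdir 1 g))" "continuous_on UNIV (pdir \<i> (pdir \<i> g))"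
  using C2 by (auto simp: C2_fun_def cont_partials_def)

lemma cont_laplacian: "continuous_on UNIV (laplacian g)"
  unfolding laplacian_def[abs_def] by (intro continuous_intros cont_g)

text \<open>Integration by parts on every coordinate line moves the Laplacian to the Gaussian. The
  case s = 0 is included: it says that the Laplacian of the test function has integral 0.\<close>

lemma gauss_laplacian:
  "(\<integral>z. exp (- s * (cmod (z - y))\<^sup>2) * laplacian g z \<partial>lborel)
   = (\<integral>z. (4 * s\<^sup>2 * (cmod (z - y))\<^sup>2 - 4 * s) * exp (- s * (cmod (z - y))\<^sup>2) * g z \<partial>lborel)"
proof -
  define E where "E z = exp (- s * (cmod (z - y))\<^sup>2)" for z
  define E1 where "E1 z = (4 * s\<^sup>2 * (Re z - Re y)\<^sup>2 - 2 * s) * E z" for z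
  define E2 where "E2 z = (4 * s\<^sup>2 * (Im z - Im y)\<^sup>2 - 2 * s) * E z" for z
  have cE: "continuous_on UNIV E" unfolding E_def[abs_def] by (intro continuous_intros)
  have cE1: "continuous_on UNIV E1" unfolding E1_def[abs_def] by (intro continuous_intros cE)
  have cE2: "continuous_on UNIV E2" unfolding E2_def[abs_def] by (intro continuous_intros cE)
  have cp: "cont_partials g" "cont_partials (pdir 1 g)" "cont_partials (pdir \<i> g)"
    using C2 by (auto simp: C2_fun_def)
  have z: "B < cmod z \<Longrightarrow> pdir v g z = 0" "B < cmod z \<Longrightarrow> pdir v (pdir v g) z = 0" for v z
    by (auto intro!: pdir_zero_outside supp)
  have big: "B < \<bar>t\<bar> \<Longrightarrow> B < cmod (Complex t b)" "B < \<bar>t\<bar> \<Longrightarrow> B < cmod (Complex b t)" for t b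
    using abs_Re_le_cmod[of "Complex t b"] abs_Im_le_cmod[of "Complex b t"] by auto
  have lineR: "(\<integral>a. E (Complex a b) * pdir 1 (pdir 1 g) (Complex a b) \<partial>lborel)
      = (\<integral>a. E1 (Complex a b) * g (Complex a b) \<partial>lborel)" for b
  proof (rule parts_line)
    obtain w where eq: "\<And>t. Complex t b = w + of_real t * 1"
      by (rule that[of "Complex 0 b"]) (simp add: complex_eq_iff)
    show "((\<lambda>t. g (Complex t b)) has_real_derivative pdir 1 g (Complex t b)) (at t)" for t
      unfolding eq by (rule cont_partials_derivative) (use cp in auto)
    show "((\<lambda>t. pdir 1 g (Complex t b)) has_real_derivative pdir 1 (pdir 1 g) (Complex t b)) (at t)" for t
      unfolding eq by (rule cont_partials_derivative) (use cp in auto)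
    show "continuous_on UNIV (\<lambda>t. pdir 1 (pdir 1 g) (Complex t b))"
      unfolding eq by (intro continuous_on_compose2[OF cont_g(2)] continuous_intros) auto
    show "((\<lambda>t. E (Complex t b)) has_real_derivative (- 2 * s * (t - Re y)) * E (Complex t b)) (at t)" for t
      unfolding E_def cmod_power2 by (auto intro!: derivative_eq_intros)
    then show "((\<lambda>t. (- 2 * s * (t - Re y)) * E (Complex t b)) has_real_derivative E1 (Complex t b)) (at t)" for t
      unfolding E1_def by (auto intro!: derivative_eq_intros simp: power2_eq_square algebra_simps)
    show "continuous_on UNIV (\<lambda>t. E1 (Complex t b))"
      unfolding eq by (intro continuous_on_compose2[OF cE1] continuous_intros) auto
    show "g (Complex t b) = 0 \<and> pdir 1 g (Complex t b) = 0 \<and> pdir 1 (pdir 1 g) (Complex t b) = 0" if "B < \<bar>t\<bar>" for t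
      using big[OF that] supp z by auto
  qed
  have lineI: "(\<integral>a. E (Complex b a) * pdir \<i> (pdir \<i> g) (Complex b a) \<partial>lborel)
      = (\<integral>a. E2 (Complex b a) * g (Complex b a) \<partial>lborel)" for b
  proof (rule parts_line)
    obtain w where eq: "\<And>t. Complex b t = w + of_real t * \<i>"
      by (rule that[of "Complex b 0"]) (simp add: complex_eq_iff)
    show "((\<lambda>t. g (Complex b t)) has_real_derivative pdir \<i> g (Complex b t)) (at t)" for t
      unfolding eq by (rule cont_partials_derivative) (use cp in auto)
    show "((\<lambda>t. pdir \<i> g (Complex b t)) has_real_derivative pdir \<i> (pdir \<i> g) (Complex b t)) (at t)" for t
      unfolding eq by (rule cont_partials_derivative) (use cp in auto)
    show "continuous_on UNIV (\<lambda>t. pdir \<i> (pdir \<i> g) (Complex b t))"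
      unfolding eq by (intro continuous_on_compose2[OF cont_g(3)] continuous_intros) auto
    show "((\<lambda>t. E (Complex b t)) has_real_derivative (- 2 * s * (t - Im y)) * E (Complex b t)) (at t)" for t
      unfolding E_def cmod_power2 by (auto intro!: derivative_eq_intros)
    then show "((\<lambda>t. (- 2 * s * (t - Im y)) * E (Complex b t)) has_real_derivative E2 (Complex b t)) (at t)" for t
      unfolding E2_def by (auto intro!: derivative_eq_intros simp: power2_eq_square algebra_simps)
    show "continuous_on UNIV (\<lambda>t. E2 (Complex b t))"
      unfolding eq by (intro continuous_on_compose2[OF cE2] continuous_intros) auto
    show "g (Complex b t) = 0 \<and> pdir \<i> g (Complex b t) = 0 \<and> pdir \<i> (pdir \<i> g) (Complex b t) = 0" if "B < \<bar>t\<bar>" for t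
      using big[OF that] supp z by auto
  qed
  have int: "integrable lborel (\<lambda>z. E z * pdir 1 (pdir 1 g) z)" "integrable lborel (\<lambda>z. E z * pdir \<i> (pdir \<i> g) z)"
    "integrable lborel (\<lambda>z. E1 z * g z)" "integrable lborel (\<lambda>z. E2 z * g z)"
    by (rule integrable_compact_support[where B = B]; auto intro!: continuous_intros cE cE1 cE2 cont_g simp: z supp)+
  have pt: "E1 z * g z + E2 z * g z = (4 * s\<^sup>2 * (cmod (z - y))\<^sup>2 - 4 * s) * E z * g z" for z
    unfolding E1_def E2_def cmod_power2 by (simp add: algebra_simps)
  have "(\<integral>z. E z * laplacian g z \<partial>lborel)
      = (\<integral>z. E z * pdir 1 (pdir 1 g) z \<partial>lborel) + (\<integral>z. E z * pdir \<i> (pdir \<i> g) z \<partial>lborel)"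
    unfolding laplacian_def distrib_left using int by simp
  also have "(\<integral>z. E z * pdir 1 (pdir 1 g) z \<partial>lborel) = (\<integral>z. E1 z * g z \<partial>lborel)"
    using int lineR by (simp add: integral_complex(2))
  also have "(\<integral>z. E z * pdir \<i> (pdir \<i> g) z \<partial>lborel) = (\<integral>z. E2 z * g z \<partial>lborel)"
    using int lineI by (simp add: integral_complex(1))
  also have "(\<integral>z. E1 z * g z \<partial>lborel) + (\<integral>z. E2 z * g z \<partial>lborel) = (\<integral>z. E1 z * g z + E2 z * g z \<partial>lborel)"
    using int by simp
  finally show ?thesis unfolding pt E_def .
qed

lemma integral_laplacian: "(\<integral>z. laplacian g z \<partial>lborel) = 0"
  using gauss_laplacian[of 0] by simp

lemma laplacian_bound: "\<exists>M. \<forall>z. \<bar>laplacian g z\<bar> \<le> M"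
proof -
  have "compact (laplacian g ` cball 0 B)"
    by (intro compact_continuous_image continuous_on_subset[OF cont_laplacian]) auto
  then obtain M where M: "\<And>z. z \<in> cball 0 B \<Longrightarrow> norm (laplacian g z) \<le> M"
    by (metis bounded_iff compact_imp_bounded imageI)
  have "\<bar>laplacian g z\<bar> \<le> max M 0" for z
    using M[of z] laplacian_zero[of z] by (cases "cmod z \<le> B") auto
  then show ?thesis by blast
qed

lemma g_bound: "\<exists>M. \<forall>z. \<bar>g z\<bar> \<le> M"
proof -
  have "compact (g ` cball 0 B)"
    by (intro compact_continuous_image continuous_on_subset[OF cont_g(1)]) auto
  then obtain M where M: "\<And>z. z \<in> cball 0 B \<Longrightarrow> norm (g z) \<le> M"
    by (metis bounded_iff compact_imp_bounded imageI)
  have "\<bar>g z\<bar> \<le> max M 0" for z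
    using M[of z] supp[of z] by (cases "cmod z \<le> B") auto
  then show ?thesis by blast
qed

text \<open>The factor (1 - s r^2) exp(-s r^2), with r the distance to y, is the s-derivative of s
  exp(-s r^2), and the quotient by s is the one that Frullani's formula produces. The integral over
  s therefore telescopes.\<close>

lemma gauss_laplacian_scaled:
  assumes "s > 0"
  shows "(\<integral>z. exp (- s * (cmod (z - y))\<^sup>2) * laplacian g z \<partial>lborel) / s
   = - 4 * (\<integral>z. (1 - s * (cmod (z - y))\<^sup>2) * exp (- s * (cmod (z - y))\<^sup>2) * g z \<partial>lborel)"
proof -
  have "(4 * s\<^sup>2 * r - 4 * s) * E * G = (- 4 * s) * ((1 - s * r) * E * G)" for r E G :: real
    by (simp add: power2_eq_square algebra_simps)
  then show ?thesis
    unfolding gauss_laplacian using assms by simp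
qed

lemma gauss_flow_integral:
  "(\<integral>s. (\<integral>z. (1 - s * (cmod (z - y))\<^sup>2) * exp (- s * (cmod (z - y))\<^sup>2) * g z \<partial>lborel) * indicator {0..real n} s \<partial>lborel)
   = (\<integral>z. real n * exp (- real n * (cmod (z - y))\<^sup>2) * g z \<partial>lborel)"
proof -
  have [measurable]: "g \<in> borel_measurable borel" by (rule borel_measurable_continuous_onI[OF cont_g(1)])
  define f where "f s z = (1 - s * (cmod (z - y))\<^sup>2) * exp (- s * (cmod (z - y))\<^sup>2) * g z * indicator {0..real n} s" for s z
  obtain M where M: "\<And>z. \<bar>g z\<bar> \<le> M" using g_bound by blast
  have gi: "integrable lborel g" by (rule integrable_compact_support[OF cont_g(1) supp])
  have le1: "\<bar>(1 - u) * exp (- u)\<bar> \<le> 1" if "u \<ge> 0" for u :: real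
  proof -
    have "\<bar>1 - u\<bar> \<le> 1 + u" using that by simp
    also have "\<dots> \<le> exp u" by simp
    finally show ?thesis by (simp add: abs_mult exp_minus field_simps)
  qed
  have bound: "\<bar>f s z\<bar> \<le> \<bar>g z\<bar> * indicator {0..real n} s" for s z
  proof (cases "s \<in> {0..real n}")
    case True
    then have "\<bar>(1 - s * (cmod (z - y))\<^sup>2) * exp (- (s * (cmod (z - y))\<^sup>2))\<bar> \<le> 1" by (intro le1) auto
    then have "\<bar>(1 - s * (cmod (z - y))\<^sup>2) * exp (- (s * (cmod (z - y))\<^sup>2))\<bar> * \<bar>g z\<bar> \<le> 1 * \<bar>g z\<bar>"
      by (intro mult_right_mono) auto
    then show ?thesis using True by (simp add: f_def abs_mult)
  qed (simp add: f_def)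
  have int: "integrable (lborel \<Otimes>\<^sub>M lborel) (\<lambda>(z, s). f s z)"
  proof (rule Bochner_Integration.integrable_bound)
    show "integrable (lborel \<Otimes>\<^sub>M lborel) (\<lambda>p. \<bar>g (fst p)\<bar> * indicator {0..real n} (snd p) :: real)"
    proof (rule integrableI_nonneg)
      have "(\<integral>\<^sup>+p. ennreal (\<bar>g (fst p)\<bar> * indicator {0..real n} (snd p)) \<partial>(lborel \<Otimes>\<^sub>M lborel))
          = (\<integral>\<^sup>+z. \<integral>\<^sup>+s. ennreal \<bar>g z\<bar> * indicator {0..real n} s \<partial>lborel \<partial>lborel)"
        by (subst lborel.nn_integral_fst[symmetric]) (auto simp: ennreal_mult' ennreal_indicator)
      also have "\<dots> = (\<integral>\<^sup>+z. ennreal \<bar>g z\<bar> \<partial>lborel) * ennreal (real n)"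
        by (simp add: nn_integral_cmult_indicator nn_integral_multc)
      also have "\<dots> < \<infinity>"
        using gi by (simp add: ennreal_mult_less_top integrable_iff_bounded)
      finally show "(\<integral>\<^sup>+p. ennreal (\<bar>g (fst p)\<bar> * indicator {0..real n} (snd p)) \<partial>(lborel \<Otimes>\<^sub>M lborel)) < \<infinity>" .
    qed auto
    show "(\<lambda>(z, s). f s z) \<in> borel_measurable (lborel \<Otimes>\<^sub>M lborel)" unfolding f_def by measurable
  qed (use bound in \<open>auto simp: abs_mult\<close>)
  have "(\<integral>s. \<integral>z. f s z \<partial>lborel \<partial>lborel) = (\<integral>z. \<integral>s. f s z \<partial>lborel \<partial>lborel)"
    by (rule lborel_pair.Fubini_integral[OF int])
  also have "\<dots> = (\<integral>z. real n * exp (- real n * (cmod (z - y))\<^sup>2) * g z \<partial>lborel)"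
  proof (intro Bochner_Integration.integral_cong refl)
    fix z
    define r where "r = (cmod (z - y))\<^sup>2"
    have "has_bochner_integral lborel (\<lambda>s. indicator {0..real n} s *\<^sub>R ((1 - s * r) * exp (- s * r) * g z))
        (real n * exp (- real n * r) * g z - 0 * exp (- 0 * r) * g z)"
    proof (rule has_bochner_integral_FTC_Icc)
      show "((\<lambda>s. s * exp (- s * r) * g z) has_vector_derivative (1 - s * r) * exp (- s * r)
          * g z) (at s within {0..real n})" for s
      proof (rule has_vector_derivative_at_within)
        have "((\<lambda>s. s * exp (- s * r) * g z) has_real_derivative (1 - s * r) * exp (- s * r) * g z) (at s)"
          by (auto intro!: derivative_eq_intros simp: algebra_simps)
        then show "((\<lambda>s. s * exp (- s * r) * g z) has_vector_derivative (1 - s * r) * exp (- s * r) * g z) (at s)"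
          by (simp only: has_real_derivative_iff_has_vector_derivative)
      qed
    qed (auto intro!: continuous_intros)
    then show "(\<integral>s. f s z \<partial>lborel) = real n * exp (- real n * (cmod (z - y))\<^sup>2) * g z"
      by (simp add: has_bochner_integral_iff f_def r_def mult.commute)
  qed
  finally show ?thesis by (simp add: f_def)
qed

text \<open>Rescaling by 1 / sqrt n turns the integral into an average of g near y against a fixed
  Gaussian of mass pi.\<close>

lemma gauss_concentrates:
  "(\<lambda>n. \<integral>z. real n * exp (- real n * (cmod (z - y))\<^sup>2) * g z \<partial>lborel) \<longlonglongrightarrow> pi * g y"
proof -
  have [measurable]: "g \<in> borel_measurable borel" by (rule borel_measurable_continuous_onI[OF cont_g(1)])
  obtain M where M: "\<And>z. \<bar>g z\<bar> \<le> M" using g_bound by blast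
  have gauss: "has_bochner_integral lborel (\<lambda>w::complex. exp (- (cmod w)\<^sup>2)) pi"
    using nn_integral_gauss_complex[of 1 0] by (intro has_bochner_integral_nn_integral) auto
  have eq: "(\<integral>z. real n * exp (- real n * (cmod (z - y))\<^sup>2) * g z \<partial>lborel)
      = (\<integral>w. exp (- (cmod w)\<^sup>2) * g (y + (1 / sqrt (real n)) *\<^sub>R w) \<partial>lborel)"
    if "n > 0" for n
  proof -
    define c where "c = 1 / sqrt (real n)"
    have c: "c > 0" "real n * c\<^sup>2 = 1" using that by (auto simp: c_def power_divide)
    have "(\<integral>z. real n * exp (- real n * (cmod (z - y))\<^sup>2) * g z \<partial>lborel)
        = c\<^sup>2 * (\<integral>w. real n * exp (- real n * (cmod ((y + c *\<^sub>R w) - y))\<^sup>2) * g (y + c *\<^sub>R w) \<partial>lborel)"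
      by (rule integral_affine_complex) (use c in auto)
    also have "\<dots> = (\<integral>w. exp (- (real n * c\<^sup>2) * (cmod w)\<^sup>2) * ((real n * c\<^sup>2) * g (y + c *\<^sub>R w)) \<partial>lborel)"
      by (subst integral_mult_right_zero[symmetric])
         (auto intro!: Bochner_Integration.integral_cong simp: power_mult_distrib ac_simps)
    finally show ?thesis unfolding c by (simp add: c_def)
  qed
  have "(\<lambda>n. \<integral>w. exp (- (cmod w)\<^sup>2) * g (y + (1 / sqrt (real n)) *\<^sub>R w) \<partial>lborel) \<longlonglongrightarrow> (\<integral>w. exp (- (cmod w)\<^sup>2) * g y \<partial>lborel)"
  proof (rule integral_dominated_convergence[where w = "\<lambda>w. exp (- (cmod w)\<^sup>2) * M"])
    show "AE w in lborel. (\<lambda>n. exp (- (cmod w)\<^sup>2) * g (y + (1 / sqrt (real n)) *\<^sub>R w)) \<longlonglongrightarrow> exp (- (cmod w)\<^sup>2) * g y"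
    proof (intro AE_I2 tendsto_mult tendsto_const)
      fix w
      have "(\<lambda>n. 1 / sqrt (real n)) \<longlonglongrightarrow> 0" by real_asymp
      then have "(\<lambda>n. y + (1 / sqrt (real n)) *\<^sub>R w) \<longlonglongrightarrow> y + 0 *\<^sub>R w" by (intro tendsto_intros)
      then show "(\<lambda>n. g (y + (1 / sqrt (real n)) *\<^sub>R w)) \<longlonglongrightarrow> g y"
        using continuous_on_tendsto_compose[OF cont_g(1), of "\<lambda>n. y + (1 / sqrt (real n)) *\<^sub>R w" y] by simp
    qed
    show "integrable lborel (\<lambda>w::complex. exp (- (cmod w)\<^sup>2) * M)"
      using gauss by (simp add: has_bochner_integral_iff)
    show "AE w in lborel. norm (exp (- (cmod w)\<^sup>2) * g (y + (1 / sqrt (real n)) *\<^sub>R w)) \<le> exp (- (cmod w)\<^sup>2) * M" for n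
      using M by (intro AE_I2) (auto simp: abs_mult)
  qed auto
  also have "(\<integral>w. exp (- (cmod w)\<^sup>2) * g y \<partial>lborel) = pi * g y"
    using gauss by (simp add: has_bochner_integral_iff)
  finally show ?thesis
    by (rule Lim_transform_eventually) (use eq in \<open>auto intro!: eventually_sequentiallyI[of 1]\<close>)
qed

text \<open>The growth in y is kept to 1 + \<open>Lg y\<close> so that Fubini applies against any
  density with a logarithmic moment. Away from y the bounded support of the Laplacian suffices, and
  \<open>htail 1\<close> carries the singularity.\<close>

lemma abs_ln_laplacian_bound:
  "\<exists>C. \<forall>y. (\<integral>\<^sup>+z. ennreal (\<bar>ln (cmod (z - y))\<bar> * \<bar>laplacian g z\<bar>) \<partial>lborel) \<le> ennreal (C * (1 + Lg y))"
proof -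
  obtain M where M: "\<And>z. \<bar>laplacian g z\<bar> \<le> M" using laplacian_bound by blast
  then have M0: "M \<ge> 0" using order_trans[OF abs_ge_zero] by blast
  define A0 where "A0 = 4 + ln (1 + B\<^sup>2) / 2"
  define C where "C = M * A0 * (pi * B\<^sup>2) + M * (pi / 2)"
  show ?thesis
  proof (rule exI[of _ C], rule allI)
    fix y
    define A where "A = 2 + ln (1 + B\<^sup>2) / 2 + 2 * Lg y"
    have A0: "A \<ge> 0" using Lg_nonneg[of y] by (simp add: A_def)
    have "ennreal (\<bar>ln (cmod (z - y))\<bar> * \<bar>laplacian g z\<bar>)
       \<le> ennreal (M * A) * indicator (cball 0 \<bar>B\<bar>) z + ennreal M * htail 1 (cmod (y - z))" if "z \<noteq> y" for z
    proof (cases "B < cmod z")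
      case True
      then show ?thesis by (simp add: laplacian_zero)
    next
      case False
      then have zB: "z \<in> cball 0 \<bar>B\<bar>" by simp
      have Lz: "Lg z \<le> ln (1 + B\<^sup>2) / 2"
      proof -
        have "(cmod z)\<^sup>2 \<le> B\<^sup>2" using False by (intro power_mono) auto
        then show ?thesis unfolding Lg_def by (intro divide_right_mono ln_mono) (auto intro: one_plus_sq_pos)
      qed
      have "ennreal \<bar>ln (cmod (z - y))\<bar> \<le> ennreal A + htail 1 (cmod (y - z))"
      proof (cases "ln (cmod (z - y)) \<ge> 0")
        case True
        then have "\<bar>ln (cmod (z - y))\<bar> \<le> A" using ln_dist_le[of z y] Lz Lg_nonneg[of y] by (simp add: A_def)
        from ennreal_leI[OF this] show ?thesis by (intro add_increasing2) auto
      next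
        case False
        then have "\<bar>ln (cmod (z - y))\<bar> \<le> Lg y - ln (cmod (y - z))" using Lg_nonneg[of y] by (simp add: norm_minus_commute)
        then have "ennreal \<bar>ln (cmod (z - y))\<bar> \<le> ennreal (Lg y - ln (cmod (y - z)))" by (rule ennreal_leI)
        also have "\<dots> \<le> ennreal (2 + Lg z) + htail 1 (cmod (y - z))" using that by (intro Lg_minus_ln_dist_le) auto
        also have "\<dots> \<le> ennreal A + htail 1 (cmod (y - z))"
          using Lz Lg_nonneg[of y] by (intro add_right_mono ennreal_leI) (simp add: A_def)
        finally show ?thesis .
      qed
      then have "ennreal \<bar>ln (cmod (z - y))\<bar> * ennreal \<bar>laplacian g z\<bar> \<le> (ennreal A + htail 1 (cmod (y - z))) * ennreal M"
        using M by (intro mult_mono ennreal_leI) auto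
      then show ?thesis
        using zB A0 M0 by (simp add: ennreal_mult distrib_left mult.commute)
    qed
    then have "(\<integral>\<^sup>+z. ennreal (\<bar>ln (cmod (z - y))\<bar> * \<bar>laplacian g z\<bar>) \<partial>lborel)
        \<le> (\<integral>\<^sup>+z. ennreal (M * A) * indicator (cball 0 \<bar>B\<bar>) z + ennreal M * htail 1 (cmod (y - z)) \<partial>lborel)"
      by (intro nn_integral_mono_AE, use AE_lborel_singleton[of y] in eventually_elim) auto
    also have "\<dots> = ennreal (M * A) * emeasure lborel (cball (0::complex) \<bar>B\<bar>) + ennreal M * ennreal (pi / 2)"
    proof (subst nn_integral_add)
      have "(\<integral>\<^sup>+z. ennreal (M * A) * indicator (cball (0::complex) \<bar>B\<bar>) z \<partial>lborel)
          = ennreal (M * A) * emeasure lborel (cball (0::complex) \<bar>B\<bar>)"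
        by (rule nn_integral_cmult_indicator) simp
      moreover have "(\<integral>\<^sup>+z. ennreal M * htail 1 (cmod (y - z)) \<partial>lborel) = ennreal M * ennreal (pi / 2)"
        using nn_integral_htail[of 1 y] by (subst nn_integral_cmult) auto
      ultimately show "(\<integral>\<^sup>+z. ennreal (M * A) * indicator (cball (0::complex) \<bar>B\<bar>) z \<partial>lborel) + (\<integral>\<^sup>+z. ennreal M
          * htail 1 (cmod (y - z)) \<partial>lborel)
        = ennreal (M * A) * emeasure lborel (cball (0::complex) \<bar>B\<bar>) + ennreal M * ennreal (pi / 2)" by simp
    qed (auto intro!: borel_measurable_times_ennreal borel_measurable_indicator)
    also have "\<dots> = ennreal (M * A * (pi * B\<^sup>2) + M * (pi / 2))"
      using M0 A0 by (simp only: emeasure_cball_complex abs_ge_zero power2_abs ennreal_mult ennreal_plus mult_nonneg_nonneg pi_ge_zero zero_le_power2 pi_half_ge_zero)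
    also have "\<dots> \<le> ennreal (C * (1 + Lg y))"
    proof (rule ennreal_leI)
      have "2 + t + 2 * l \<le> (4 + t) * (1 + l)" if "0 \<le> t" "0 \<le> l" for t l :: real
      proof -
        have "(4 + t) * (1 + l) = 4 + t + 4 * l + t * l" by (simp add: algebra_simps)
        moreover have "0 \<le> t * l" using that by simp
        ultimately show ?thesis using that by linarith
      qed
      then have "A \<le> A0 * (1 + Lg y)" unfolding A_def A0_def by (simp add: Lg_nonneg)
      then have "M * A * (pi * B\<^sup>2) \<le> M * (A0 * (1 + Lg y)) * (pi * B\<^sup>2)"
        using M0 by (intro mult_right_mono mult_left_mono) auto
      moreover have "M * (pi / 2) \<le> M * (pi / 2) * (1 + Lg y)"
        using mult_left_mono[of 1 "1 + Lg y" "M * (pi / 2)"] M0 Lg_nonneg[of y] by simp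
      ultimately show "M * A * (pi * B\<^sup>2) + M * (pi / 2) \<le> C * (1 + Lg y)"
        unfolding C_def distrib_right[of "M * A0 * (pi * B\<^sup>2)"] by (simp add: ac_simps)
    qed
    finally show "(\<integral>\<^sup>+z. ennreal (\<bar>ln (cmod (z - y))\<bar> * \<bar>laplacian g z\<bar>) \<partial>lborel) \<le> ennreal (C * (1 + Lg y))" .
  qed
qed

lemma abs_ln_laplacian_integrable:
  "(\<integral>\<^sup>+z. ennreal (\<bar>ln (cmod (z - y))\<bar> * \<bar>laplacian g z\<bar>) \<partial>lborel) < \<infinity>"
proof -
  obtain C where C: "\<And>y. (\<integral>\<^sup>+z. ennreal (\<bar>ln (cmod (z - y))\<bar> * \<bar>laplacian g z\<bar>) \<partial>lborel) \<le> ennreal (C * (1 + Lg y))"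
    using abs_ln_laplacian_bound by blast
  show ?thesis by (rule le_less_trans[OF C]) simp
qed

text \<open>Frullani's formula represents the logarithm as a superposition of Gaussians, and the Laplacian
  of a Gaussian is, up to a factor, a derivative in the width parameter.\<close>
theorem log_laplacian:
  "integrable lborel (\<lambda>z. ln (cmod (z - y)) * laplacian g z)"
  "(\<integral>z. ln (cmod (z - y)) * laplacian g z \<partial>lborel) = 2 * pi * g y"
proof -
  have [measurable]: "g \<in> borel_measurable borel" by (rule borel_measurable_continuous_onI[OF cont_g(1)])
  have [measurable]: "laplacian g \<in> borel_measurable borel" by (rule borel_measurable_continuous_onI[OF cont_laplacian])
  show "integrable lborel (\<lambda>z. ln (cmod (z - y)) * laplacian g z)"
    using abs_ln_laplacian_integrable[of y] by (intro integrableI_bounded) (auto simp: abs_mult)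
  define F where "F r s = (exp (- s * r\<^sup>2) - exp (- s)) / s * indicator {0<..} s" for r s :: real
  have [measurable]: "(\<lambda>p. F (f p) (h p)) \<in> borel_measurable M" if "f \<in> borel_measurable M" "h
      \<in> borel_measurable M" for f h and M :: "'z measure"
    unfolding F_def using that by measurable
  have Fint: "has_bochner_integral lborel (F r) (- 2 * ln r)" if "r > 0" for r
    unfolding F_def[abs_def] by (rule frullani_integral[OF that])
  have Fabs: "(\<integral>\<^sup>+s. ennreal \<bar>F r s\<bar> \<partial>lborel) = ennreal (2 * \<bar>ln r\<bar>)" if "r > 0" for r
  proof (cases "r \<le> 1")
    case True
    then have "r\<^sup>2 \<le> 1" using that by (simp add: power_le_one)
    then have "F r s \<ge> 0" for s by (auto simp: F_def indicator_def mult_left_le)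
    moreover have "ln r \<le> 0" using True that by simp
    ultimately show ?thesis using nn_integral_eq_integral[of lborel "F r"] Fint[OF that]
      by (simp add: has_bochner_integral_iff)
  next
    case False
    then have "r\<^sup>2 \<ge> 1" by (simp add: one_le_power)
    then have *: "F r s \<le> 0" for s by (auto simp: F_def indicator_def divide_le_0_iff)
    moreover have "ln r \<ge> 0" using False by simp
    ultimately show ?thesis using nn_integral_eq_integral[of lborel "\<lambda>s. - F r s"] Fint[OF that]
      by (simp add: has_bochner_integral_iff abs_of_nonpos)
  qed
  have int: "integrable (lborel \<Otimes>\<^sub>M lborel) (\<lambda>(z, s). F (cmod (z - y)) s * laplacian g z)"
  proof (rule integrableI_bounded)
    have "(\<integral>\<^sup>+p. ennreal (norm (case p of (z, s) \<Rightarrow> F (cmod (z - y)) s * laplacian g z)) \<partial>(lborel \<Otimes>\<^sub>M lborel))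
        = (\<integral>\<^sup>+z. \<integral>\<^sup>+s. ennreal \<bar>F (cmod (z - y)) s\<bar> * ennreal \<bar>laplacian g z\<bar> \<partial>lborel \<partial>lborel)"
      by (subst lborel.nn_integral_fst[symmetric]) (auto simp: abs_mult ennreal_mult)
    also have "\<dots> = (\<integral>\<^sup>+z. 2 * ennreal (\<bar>ln (cmod (z - y))\<bar> * \<bar>laplacian g z\<bar>) \<partial>lborel)"
      by (intro nn_integral_cong_AE, use AE_lborel_singleton[of y] in eventually_elim)
         (simp add: nn_integral_multc Fabs ennreal_mult mult.assoc)
    also have "\<dots> < \<infinity>"
      using abs_ln_laplacian_integrable[of y] by (simp add: nn_integral_cmult ennreal_mult_less_top)
    finally show "(\<integral>\<^sup>+p. ennreal (norm (case p of (z, s) \<Rightarrow> F (cmod (z - y)) s * laplacian g z)) \<partial>(lborel \<Otimes>\<^sub>M lborel)) < \<infinity>" .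
  qed (simp add: case_prod_unfold)
  define \<psi> where "\<psi> s = (\<integral>z. (1 - s * (cmod (z - y))\<^sup>2) * exp (- s * (cmod (z - y))\<^sup>2) * g z \<partial>lborel)" for s
  have li: "integrable lborel (laplacian g)"
    by (rule integrable_compact_support[OF cont_laplacian laplacian_zero])
  \<comment> \<open>The counterterm exp(-s)/s drops out because the Laplacian of g has integral
    0.\<close>
  have inner: "(\<integral>z. F (cmod (z - y)) s * laplacian g z \<partial>lborel) = - 4 * (\<psi> s * indicator {0<..} s)" for s
  proof (cases "s > 0")
    case True
    have ei: "integrable lborel (\<lambda>z. exp (- s * (cmod (z - y))\<^sup>2) * laplacian g z)"
      using True by (intro Bochner_Integration.integrable_bound[OF li]) (auto simp: abs_mult intro!: mult_left_le_one_le)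
    have "(\<integral>z. F (cmod (z - y)) s * laplacian g z \<partial>lborel)
        = (\<integral>z. (exp (- s * (cmod (z - y))\<^sup>2) * laplacian g z) / s - exp (- s) / s * laplacian g z \<partial>lborel)"
      using True by (intro Bochner_Integration.integral_cong) (auto simp: F_def diff_divide_distrib left_diff_distrib)
    also have "\<dots> = (\<integral>z. exp (- s * (cmod (z - y))\<^sup>2) * laplacian g z \<partial>lborel) / s - exp (- s) / s
        * (\<integral>z. laplacian g z \<partial>lborel)"
      using ei li by (subst Bochner_Integration.integral_diff) auto
    also have "\<dots> = - 4 * \<psi> s"
      using gauss_laplacian_scaled[OF True] by (simp add: integral_laplacian \<psi>_def)
    finally show ?thesis using True by simp
  qed (simp add: F_def)
  have "(\<integral>z. ln (cmod (z - y)) * laplacian g z \<partial>lborel)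
      = (\<integral>z. (- 1 / 2) * (\<integral>s. F (cmod (z - y)) s * laplacian g z \<partial>lborel) \<partial>lborel)"
  proof (intro integral_cong_AE, measurable, use AE_lborel_singleton[of y] in eventually_elim)
    fix z assume "z \<noteq> y"
    then show "ln (cmod (z - y)) * laplacian g z = (- 1 / 2) * (\<integral>s. F (cmod (z - y)) s * laplacian g z \<partial>lborel)"
      using Fint[of "cmod (z - y)"] by (simp add: has_bochner_integral_iff)
  qed
  also have "\<dots> = (- 1 / 2) * (\<integral>z. \<integral>s. F (cmod (z - y)) s * laplacian g z \<partial>lborel \<partial>lborel)" by simp
  also have "(\<integral>z. \<integral>s. F (cmod (z - y)) s * laplacian g z \<partial>lborel \<partial>lborel)
      = (\<integral>s. \<integral>z. F (cmod (z - y)) s * laplacian g z \<partial>lborel \<partial>lborel)"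
    by (rule lborel_pair.Fubini_integral[OF int, symmetric])
  also have "\<dots> = - 4 * (\<integral>s. \<psi> s * indicator {0<..} s \<partial>lborel)" by (simp add: inner)
  finally have eq: "(\<integral>z. ln (cmod (z - y)) * laplacian g z \<partial>lborel) = 2 * (\<integral>s. \<psi> s * indicator {0<..} s \<partial>lborel)" by simp
  have \<psi>i: "integrable lborel (\<lambda>s. \<psi> s * indicator {0<..} s)"
    using lborel_pair.integrable_snd[OF int] by (simp add: inner)
  \<comment> \<open>The integral over all s > 0 is the limit of the integrals over [0, n], which the
    derivative structure evaluates in closed form.\<close>
  have "(\<lambda>n. \<integral>s. \<psi> s * indicator {0..real n} s \<partial>lborel) \<longlonglongrightarrow> (\<integral>s. \<psi> s * indicator {0<..} s \<partial>lborel)"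
  proof (rule integral_dominated_convergence[where w = "\<lambda>s. \<bar>\<psi> s * indicator {0<..} s\<bar>"])
    show "AE s in lborel. (\<lambda>n. \<psi> s * indicator {0..real n} s) \<longlonglongrightarrow> \<psi> s * indicator {0<..} s"
      using AE_lborel_singleton[of 0]
    proof eventually_elim
      fix s :: real assume "s \<noteq> 0"
      have "\<forall>\<^sub>F n in sequentially. s \<le> real n"
        using real_arch_simple[of s] eventually_sequentially by (metis of_nat_mono order_trans)
      then have "\<forall>\<^sub>F n in sequentially. \<psi> s * indicator {0..real n} s = \<psi> s * indicator {0<..} s"
        by eventually_elim (use \<open>s \<noteq> 0\<close> in \<open>auto simp: indicator_def\<close>)
      then show "(\<lambda>n. \<psi> s * indicator {0..real n} s) \<longlonglongrightarrow> \<psi> s * indicator {0<..} s"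
        by (rule tendsto_eventually)
    qed
    show "AE s in lborel. norm (\<psi> s * indicator {0..real n} s) \<le> \<bar>\<psi> s * indicator {0<..} s\<bar>" for n
      using AE_lborel_singleton[of 0] by eventually_elim (auto simp: indicator_def)
    show "(\<lambda>s. \<psi> s * indicator {0..real n} s) \<in> borel_measurable lborel" for n
      unfolding \<psi>_def by measurable
  qed (use \<psi>i in auto)
  moreover have "(\<lambda>n. \<integral>s. \<psi> s * indicator {0..real n} s \<partial>lborel) \<longlonglongrightarrow> pi * g y"
    unfolding \<psi>_def gauss_flow_integral by (rule gauss_concentrates)
  ultimately have "(\<integral>s. \<psi> s * indicator {0<..} s \<partial>lborel) = pi * g y" by (rule LIMSEQ_unique)
  with eq show "(\<integral>z. ln (cmod (z - y)) * laplacian g z \<partial>lborel) = 2 * pi * g y" by simp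
qed

text \<open>Fubini reduces to point sources: in the weak sense, the Laplacian of the logarithmic
  potential of m is 2 pi m.\<close>

lemma potential_laplacian:
  fixes m :: "complex \<Rightarrow> real"
  assumes [measurable]: "m \<in> borel_measurable borel" and m: "\<And>x. 0 \<le> m x"
    and int: "(\<integral>\<^sup>+x. ennreal (m x) \<partial>lborel) < \<infinity>"
    and L: "(\<integral>\<^sup>+x. ennreal (Lg x * m x) \<partial>lborel) < \<infinity>"
  shows "has_bochner_integral lborel (\<lambda>x. (\<integral>y. ln (cmod (x - y)) * m y \<partial>lborel) * laplacian g x) (2 * pi * (\<integral>y. m y
      * g y \<partial>lborel))"
proof -
  have [measurable]: "laplacian g \<in> borel_measurable borel" by (rule borel_measurable_continuous_onI[OF cont_laplacian])
  obtain C where C: "\<And>y. (\<integral>\<^sup>+z. ennreal (\<bar>ln (cmod (z - y))\<bar> * \<bar>laplacian g z\<bar>) \<partial>lborel) \<le> ennreal (C * (1 + Lg y))"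
    using abs_ln_laplacian_bound by blast
  have i: "integrable (lborel \<Otimes>\<^sub>M lborel) (\<lambda>(y, x). ln (cmod (x - y)) * m y * laplacian g x)"
  proof (rule integrableI_bounded)
    have "(\<integral>\<^sup>+p. ennreal (norm (case p of (y, x) \<Rightarrow> ln (cmod (x - y)) * m y * laplacian g x)) \<partial>(lborel \<Otimes>\<^sub>M lborel))
        = (\<integral>\<^sup>+y. \<integral>\<^sup>+x. ennreal (m y) * ennreal (\<bar>ln (cmod (x - y))\<bar> * \<bar>laplacian g x\<bar>) \<partial>lborel \<partial>lborel)"
      by (subst lborel.nn_integral_fst[symmetric]) (auto simp: abs_mult m ennreal_mult'[symmetric] ac_simps)
    also have "\<dots> \<le> (\<integral>\<^sup>+y. ennreal \<bar>C\<bar> * (ennreal (m y) + ennreal (Lg y * m y)) \<partial>lborel)"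
    proof (intro nn_integral_mono)
      fix y
      have "(\<integral>\<^sup>+x. ennreal (m y) * ennreal (\<bar>ln (cmod (x - y))\<bar> * \<bar>laplacian g x\<bar>) \<partial>lborel)
          \<le> ennreal (m y) * ennreal (C * (1 + Lg y))"
        by (subst nn_integral_cmult) (auto intro!: mult_left_mono C)
      also have "\<dots> \<le> ennreal (m y) * ennreal (\<bar>C\<bar> * (1 + Lg y))"
        using Lg_nonneg[of y] by (intro mult_left_mono ennreal_leI mult_right_mono) auto
      also have "\<dots> = ennreal (\<bar>C\<bar> * (m y + Lg y * m y))"
        using m[of y] by (simp add: ennreal_mult'[symmetric] algebra_simps)
      also have "\<dots> = ennreal \<bar>C\<bar> * (ennreal (m y) + ennreal (Lg y * m y))"
        using m[of y] Lg_nonneg[of y] by (simp add: ennreal_mult')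
      finally show "(\<integral>\<^sup>+x. ennreal (m y) * ennreal (\<bar>ln (cmod (x - y))\<bar> * \<bar>laplacian g x\<bar>) \<partial>lborel)
          \<le> ennreal \<bar>C\<bar> * (ennreal (m y) + ennreal (Lg y * m y))" .
    qed
    also have "\<dots> < \<infinity>" using int L by (simp add: nn_integral_cmult nn_integral_add ennreal_mult_less_top)
    finally show "(\<integral>\<^sup>+p. ennreal (norm (case p of (y, x) \<Rightarrow> ln (cmod (x - y)) * m y
        * laplacian g x)) \<partial>(lborel \<Otimes>\<^sub>M lborel)) < \<infinity>" .
  qed (simp add: case_prod_unfold)
  have "(\<integral>x. \<integral>y. ln (cmod (x - y)) * m y * laplacian g x \<partial>lborel \<partial>lborel)
      = (\<integral>y. \<integral>x. ln (cmod (x - y)) * m y * laplacian g x \<partial>lborel \<partial>lborel)"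
    by (rule lborel_pair.Fubini_integral[OF i])
  also have "\<dots> = (\<integral>y. m y * (\<integral>x. ln (cmod (x - y)) * laplacian g x \<partial>lborel) \<partial>lborel)"
  proof (intro Bochner_Integration.integral_cong refl)
    fix y
    have "(\<integral>x. ln (cmod (x - y)) * m y * laplacian g x \<partial>lborel) = (\<integral>x. m y * (ln (cmod (x - y)) * laplacian g x) \<partial>lborel)"
      by (intro Bochner_Integration.integral_cong refl) (simp add: ac_simps)
    then show "(\<integral>x. ln (cmod (x - y)) * m y * laplacian g x \<partial>lborel)
        = m y * (\<integral>x. ln (cmod (x - y)) * laplacian g x \<partial>lborel)" by simp
  qed
  also have "\<dots> = (\<integral>y. 2 * pi * (m y * g y) \<partial>lborel)"
    unfolding log_laplacian(2) by (intro Bochner_Integration.integral_cong refl) simp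
  also have "\<dots> = 2 * pi * (\<integral>y. m y * g y \<partial>lborel)" by simp
  finally show ?thesis
    using lborel_pair.integrable_snd[OF i] by (simp add: has_bochner_integral_iff)
qed

end

section \<open>The logarithmic kernel and the reference measure\<close>

text \<open>The summand 1 gives the margin \<open>log_kern x y \<ge> 1\<close>. On the diagonal
  \<open>ln 0 = 0\<close> makes the value finite, so this kernel does not see atoms; positivity and
  the comparison with the true energy are stated for absolutely continuous measures.\<close>

definition log_kern :: "complex \<Rightarrow> complex \<Rightarrow> real" where
  "log_kern x y = 1 + Lg x + Lg y - ln (cmod (x - y))"

lemma log_kern_ge: "log_kern x y \<ge> 1"
  using ln_dist_le[of x y] by (simp add: log_kern_def)

lemma log_kern_sym: "log_kern x y = log_kern y x"
  by (simp add: log_kern_def norm_minus_commute)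

lemma measurable_log_kern [measurable]:
  assumes [measurable]: "f \<in> borel_measurable M" "g \<in> borel_measurable M"
  shows "(\<lambda>x. log_kern (f x) (g x)) \<in> borel_measurable M"
  unfolding log_kern_def by measurable

lemma log_kern_le:
  assumes "x \<noteq> y"
  shows "ennreal (log_kern x y) \<le> ennreal (3 + 2 * Lg y) + htail 1 (cmod (x - y))"
proof (cases "Lg x - ln (cmod (x - y)) \<ge> 0")
  case True
  have "ennreal (log_kern x y) = ennreal (1 + Lg y) + ennreal (Lg x - ln (cmod (x - y)))"
    using True Lg_nonneg[of y] by (simp add: log_kern_def ennreal_plus[symmetric] del: ennreal_plus)
  also have "\<dots> \<le> ennreal (1 + Lg y) + (ennreal (2 + Lg y) + htail 1 (cmod (x - y)))"
    by (intro add_left_mono Lg_minus_ln_dist_le assms)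
  also have "\<dots> = ennreal ((1 + Lg y) + (2 + Lg y)) + htail 1 (cmod (x - y))"
    using Lg_nonneg[of y] by (subst ennreal_plus[of "1 + Lg y"]) (auto simp: add.assoc)
  finally show ?thesis by (simp add: algebra_simps)
next
  case False
  then have "log_kern x y \<le> 3 + 2 * Lg y" using Lg_nonneg[of y] by (simp add: log_kern_def)
  from ennreal_leI[OF this] show ?thesis by (intro add_increasing2) auto
qed

text \<open>The bound is uniform in x although the kernel is unbounded: the logarithm cancels the
  growth of \<open>Lg x\<close>, and the singularity is integrable against a bounded
  density.\<close>

lemma log_kern_potential_bound:
  fixes m :: "complex \<Rightarrow> real"
  assumes [measurable]: "m \<in> borel_measurable borel" and m: "\<And>x. 0 \<le> m x" "AE x in lborel. m x \<le> B"
    and int: "(\<integral>\<^sup>+x. ennreal (m x) \<partial>lborel) = 1"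
    and L: "(\<integral>\<^sup>+x. ennreal (Lg x * m x) \<partial>lborel) = ennreal c" and c: "c \<ge> 0" and B: "B \<ge> 0"
  shows "(\<integral>\<^sup>+y. ennreal (log_kern x y) * ennreal (m y) \<partial>lborel) \<le> ennreal (3 + 2 * c + B * (pi / 2))"
proof -
  have "(\<integral>\<^sup>+y. ennreal (log_kern x y) * ennreal (m y) \<partial>lborel)
      \<le> (\<integral>\<^sup>+y. 3 * ennreal (m y) + 2 * ennreal (Lg y * m y) + ennreal B * htail 1 (cmod (x - y)) \<partial>lborel)"
  proof (intro nn_integral_mono_AE, use AE_lborel_singleton[of x] m(2) in eventually_elim)
    fix y assume y: "y \<noteq> x" "m y \<le> B"
    have "ennreal (log_kern x y) * ennreal (m y) \<le> (ennreal (3 + 2 * Lg y) + htail 1 (cmod (x - y))) * ennreal (m y)"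
      using y by (intro mult_right_mono log_kern_le) auto
    also have "\<dots> = 3 * ennreal (m y) + 2 * ennreal (Lg y * m y) + ennreal (m y) * htail 1 (cmod (x - y))"
      using m(1)[of y] Lg_nonneg[of y] by (simp add: distrib_right ennreal_mult mult.assoc) (simp add: mult.commute)
    also have "\<dots> \<le> 3 * ennreal (m y) + 2 * ennreal (Lg y * m y) + ennreal B * htail 1 (cmod (x - y))"
      using y by (intro add_left_mono mult_right_mono ennreal_leI) auto
    finally show "ennreal (log_kern x y) * ennreal (m y)
        \<le> 3 * ennreal (m y) + 2 * ennreal (Lg y * m y) + ennreal B * htail 1 (cmod (x - y))" .
  qed
  also have "\<dots> = 3 + 2 * ennreal c + ennreal B * ennreal (pi / 2)"
    using nn_integral_htail[of 1 x] by (simp add: nn_integral_add nn_integral_cmult int L)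
  also have "\<dots> = ennreal (3 + 2 * c + B * (pi / 2))"
    using c B by (simp only: ennreal_plus ennreal_mult add_nonneg_nonneg mult_nonneg_nonneg zero_le_numeral ennreal_numeral pi_half_ge_zero)
  finally show ?thesis .
qed

lemma has_bochner_integral_marginals:
  fixes f g :: "_ \<Rightarrow> real"
  assumes \<mu>: "prob_space \<mu>" and \<nu>: "prob_space \<nu>"
  shows "integrable \<mu> f \<Longrightarrow> has_bochner_integral (\<mu> \<Otimes>\<^sub>M \<nu>) (\<lambda>p. f (fst p)) (\<integral>x. f x \<partial>\<mu>)"
    and "integrable \<nu> g \<Longrightarrow> has_bochner_integral (\<mu> \<Otimes>\<^sub>M \<nu>) (\<lambda>p. g (snd p)) (\<integral>x. g x \<partial>\<nu>)"
proof -
  interpret \<mu>: prob_space \<mu> by fact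
  interpret \<nu>: prob_space \<nu> by fact
  have d: "distr (\<mu> \<Otimes>\<^sub>M \<nu>) \<mu> fst = \<mu>" by (rule \<nu>.distr_pair_fst)
  have d2: "distr (\<mu> \<Otimes>\<^sub>M \<nu>) \<nu> snd = \<nu>"
  proof (rule measure_eqI)
    fix A assume "A \<in> sets (distr (\<mu> \<Otimes>\<^sub>M \<nu>) \<nu> snd)"
    then have A: "A \<in> sets \<nu>" by simp
    then have "emeasure (distr (\<mu> \<Otimes>\<^sub>M \<nu>) \<nu> snd) A = emeasure (\<mu> \<Otimes>\<^sub>M \<nu>) (space \<mu> \<times> A)"
      by (subst emeasure_distr) (auto simp: space_pair_measure dest: sets.sets_into_space intro!: arg_cong2[where f
          = emeasure])
    also have "\<dots> = emeasure \<nu> A" using A by (simp add: \<nu>.emeasure_pair_measure_Times \<mu>.emeasure_space_1)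
    finally show "emeasure (distr (\<mu> \<Otimes>\<^sub>M \<nu>) \<nu> snd) A = emeasure \<nu> A" .
  qed simp
  show "integrable \<mu> f \<Longrightarrow> has_bochner_integral (\<mu> \<Otimes>\<^sub>M \<nu>) (\<lambda>p. f (fst p)) (\<integral>x. f x \<partial>\<mu>)"
    using integrable_distr_eq[of fst "\<mu> \<Otimes>\<^sub>M \<nu>" \<mu> f] integral_distr[of fst "\<mu> \<Otimes>\<^sub>M \<nu>" \<mu> f]
        by (simp add: d has_bochner_integral_iff)
  show "integrable \<nu> g \<Longrightarrow> has_bochner_integral (\<mu> \<Otimes>\<^sub>M \<nu>) (\<lambda>p. g (snd p)) (\<integral>x. g x \<partial>\<nu>)"
    using integrable_distr_eq[of snd "\<mu> \<Otimes>\<^sub>M \<nu>" \<nu> g] integral_distr[of snd "\<mu> \<Otimes>\<^sub>M \<nu>" \<nu> g]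
        by (simp add: d2 has_bochner_integral_iff)
qed

text \<open>Positivity of the cutoff kernels \<open>Kn\<close> passes to the limit by one-sided
  bounds: the self-terms use that \<open>reg\<close> is below -ln, the cross term uses Fatou. The
  one-body weights agree on both sides, and absolute continuity makes the diagonal
  negligible.\<close>

lemma log_kern_positive:
  assumes \<mu>: "logmom \<mu>" "absolutely_continuous lborel \<mu>" and \<nu>: "logmom \<nu>" "absolutely_continuous lborel \<nu>"
  shows "2 * (\<integral>\<^sup>+x. \<integral>\<^sup>+y. ennreal (log_kern x y) \<partial>\<nu> \<partial>\<mu>)
     \<le> (\<integral>\<^sup>+x. \<integral>\<^sup>+y. ennreal (log_kern x y) \<partial>\<mu> \<partial>\<mu>) + (\<integral>\<^sup>+x. \<integral>\<^sup>+y. ennreal (log_kern x y) \<partial>\<nu> \<partial>\<nu>)"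
proof -
  define Kn where "Kn n x y = 1 + Lg x + Lg y + reg (real (Suc n)) (cmod (x - y))" for n x y
  have Kn0: "Kn n x y \<ge> 0" for n x y
    using one_plus_reg_ge[of "real (Suc n)" x y] by (simp add: Kn_def)
  have AEn: "AE y in \<nu>. y \<noteq> x" if "logmom \<nu>" "absolutely_continuous lborel \<nu>" for x and \<nu> :: "complex measure"
    using that by (intro absolutely_continuous_AE[OF _ _ AE_lborel_singleton[of x]]) (auto simp: logmom_def)
  have iter: "(\<integral>\<^sup>+x. \<integral>\<^sup>+y. f x y \<partial>\<nu> \<partial>\<mu>) = (\<integral>\<^sup>+p. f (fst p) (snd p) \<partial>(\<mu> \<Otimes>\<^sub>M \<nu>))"
    if "logmom \<mu>" "logmom \<nu>" "(\<lambda>p. f (fst p) (snd p))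
        \<in> borel_measurable (\<mu> \<Otimes>\<^sub>M \<nu>)" for \<mu> \<nu> :: "complex measure" and f :: "complex \<Rightarrow> complex \<Rightarrow> ennreal"
  proof -
    interpret \<nu>: prob_space \<nu> using that by (simp add: logmom_def)
    show ?thesis using \<nu>.nn_integral_fst[OF that(3)] by simp
  qed
  have val: "(\<integral>\<^sup>+x. \<integral>\<^sup>+y. ennreal (Kn n x y) \<partial>\<nu> \<partial>\<mu>)
      = ennreal (1 + (\<integral>x. Lg x \<partial>\<mu>) + (\<integral>x. Lg x \<partial>\<nu>) + reg_energy (real (Suc n)) \<mu> \<nu>)"
    and val0: "0 \<le> 1 + (\<integral>x. Lg x \<partial>\<mu>) + (\<integral>x. Lg x \<partial>\<nu>) + reg_energy (real (Suc n)) \<mu> \<nu>"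
    if \<mu>: "logmom \<mu>" and \<nu>: "logmom \<nu>" for \<mu> \<nu> :: "complex measure" and n
  proof -
    interpret \<mu>: prob_space \<mu> using \<mu> by (simp add: logmom_def)
    interpret \<nu>: prob_space \<nu> using \<nu> by (simp add: logmom_def)
    interpret pair_prob_space \<mu> \<nu> ..
    have [measurable_cong]: "sets \<mu> = sets borel" "sets \<nu> = sets borel" using \<mu> \<nu> by (auto simp: logmom_def)
    have L: "integrable \<mu> Lg" "integrable \<nu> Lg" using \<mu> \<nu> by (auto simp: logmom_def)
    have Lp: "has_bochner_integral (\<mu> \<Otimes>\<^sub>M \<nu>) (\<lambda>p. Lg (fst p)) (\<integral>x. Lg x \<partial>\<mu>)" "has_bochner_integral (\<mu> \<Otimes>\<^sub>M \<nu>)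
        (\<lambda>p. Lg (snd p)) (\<integral>x. Lg x \<partial>\<nu>)"
      using L by (auto intro!: has_bochner_integral_marginals \<mu>.prob_space_axioms \<nu>.prob_space_axioms)
    have one: "has_bochner_integral (\<mu> \<Otimes>\<^sub>M \<nu>) (\<lambda>p. 1 :: real) 1"
      by (simp add: has_bochner_integral_iff P.prob_space)
    have h: "has_bochner_integral (\<mu> \<Otimes>\<^sub>M \<nu>) (\<lambda>p. Kn n (fst p) (snd p)) (1 + (\<integral>x. Lg x \<partial>\<mu>) + (\<integral>x. Lg x \<partial>\<nu>)
        + reg_energy (real (Suc n)) \<mu> \<nu>)"
      unfolding Kn_def using reg_energy_fubini(1)[OF \<mu> \<nu>, of "real (Suc n)"]
      by (intro has_bochner_integral_add one Lp) (auto simp: has_bochner_integral_iff reg_energy_def)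
    show "0 \<le> 1 + (\<integral>x. Lg x \<partial>\<mu>) + (\<integral>x. Lg x \<partial>\<nu>) + reg_energy (real (Suc n)) \<mu> \<nu>"
      unfolding has_bochner_integral_integral_eq[OF h, symmetric] by (rule Bochner_Integration.integral_nonneg) (rule Kn0)
    have "(\<integral>\<^sup>+x. \<integral>\<^sup>+y. ennreal (Kn n x y) \<partial>\<nu> \<partial>\<mu>) = (\<integral>\<^sup>+p. ennreal (Kn n (fst p) (snd p)) \<partial>(\<mu> \<Otimes>\<^sub>M \<nu>))"
      using h by (intro iter \<mu> \<nu>) (auto simp: has_bochner_integral_iff)
    also have "\<dots> = ennreal (1 + (\<integral>x. Lg x \<partial>\<mu>) + (\<integral>x. Lg x \<partial>\<nu>) + reg_energy (real (Suc n)) \<mu> \<nu>)"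
      using h Kn0 by (subst nn_integral_eq_integral) (auto simp: has_bochner_integral_iff)
    finally show "(\<integral>\<^sup>+x. \<integral>\<^sup>+y. ennreal (Kn n x y) \<partial>\<nu> \<partial>\<mu>)
        = ennreal (1 + (\<integral>x. Lg x \<partial>\<mu>) + (\<integral>x. Lg x \<partial>\<nu>) + reg_energy (real (Suc n)) \<mu> \<nu>)" .
  qed
  have le: "(\<integral>\<^sup>+x. \<integral>\<^sup>+y. ennreal (Kn n x y) \<partial>\<mu> \<partial>\<mu>) \<le> (\<integral>\<^sup>+x. \<integral>\<^sup>+y. ennreal (log_kern x y) \<partial>\<mu> \<partial>\<mu>)"
    if "logmom \<mu>" "absolutely_continuous lborel \<mu>" for \<mu> :: "complex measure" and n
  proof (rule nn_integral_mono, rule nn_integral_mono_AE)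
    fix x show "AE y in \<mu>. ennreal (Kn n x y) \<le> ennreal (log_kern x y)"
      using AEn[OF that, of x]
    proof eventually_elim
      fix y assume "y \<noteq> x"
      then show "ennreal (Kn n x y) \<le> ennreal (log_kern x y)"
        using reg_le[of "real (Suc n)" "cmod (x - y)"] by (intro ennreal_leI) (simp add: Kn_def log_kern_def)
    qed
  qed
  define Bd where "Bd = (\<integral>\<^sup>+x. \<integral>\<^sup>+y. ennreal (log_kern x y) \<partial>\<mu> \<partial>\<mu>) + (\<integral>\<^sup>+x. \<integral>\<^sup>+y. ennreal (log_kern x y) \<partial>\<nu> \<partial>\<nu>)"
  have n_le: "2 * (\<integral>\<^sup>+x. \<integral>\<^sup>+y. ennreal (Kn n x y) \<partial>\<nu> \<partial>\<mu>) \<le> Bd" for n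
  proof -
    have "2 * (1 + (\<integral>x. Lg x \<partial>\<mu>) + (\<integral>x. Lg x \<partial>\<nu>) + reg_energy (real (Suc n)) \<mu> \<nu>)
       \<le> (1 + (\<integral>x. Lg x \<partial>\<mu>) + (\<integral>x. Lg x \<partial>\<mu>) + reg_energy (real (Suc n)) \<mu> \<mu>) + (1 + (\<integral>x. Lg x \<partial>\<nu>) + (\<integral>x. Lg x \<partial>\<nu>)
           + reg_energy (real (Suc n)) \<nu> \<nu>)"
      using reg_energy_positive[OF \<mu>(1) \<nu>(1), of "real (Suc n)"] by simp
    from ennreal_leI[OF this]
    have "2 * (\<integral>\<^sup>+x. \<integral>\<^sup>+y. ennreal (Kn n x y) \<partial>\<nu> \<partial>\<mu>)
        \<le> (\<integral>\<^sup>+x. \<integral>\<^sup>+y. ennreal (Kn n x y) \<partial>\<mu> \<partial>\<mu>) + (\<integral>\<^sup>+x. \<integral>\<^sup>+y. ennreal (Kn n x y) \<partial>\<nu> \<partial>\<nu>)"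
      using val0[OF \<mu>(1) \<nu>(1), of n] val0[OF \<mu>(1) \<mu>(1), of n] val0[OF \<nu>(1) \<nu>(1), of n]
      by (simp only: val[OF \<mu>(1) \<nu>(1)] val[OF \<mu>(1) \<mu>(1)] val[OF \<nu>(1) \<nu>(1)] ennreal_plus ennreal_mult zero_le_numeral ennreal_numeral)
    also have "\<dots> \<le> Bd" unfolding Bd_def by (intro add_mono le \<mu> \<nu>)
    finally show ?thesis .
  qed
  have [measurable_cong]: "sets \<mu> = sets borel" "sets \<nu> = sets borel" using \<mu> \<nu> by (auto simp: logmom_def)
  interpret \<nu>: prob_space \<nu> using \<nu> by (simp add: logmom_def)
  have [measurable]: "(\<lambda>p. Kn n (fst p) (snd p)) \<in> borel_measurable (\<mu> \<Otimes>\<^sub>M \<nu>)" "(\<lambda>y. Kn n x y)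
      \<in> borel_measurable borel" for n x
    unfolding Kn_def by measurable
  have "(\<integral>\<^sup>+x. \<integral>\<^sup>+y. ennreal (log_kern x y) \<partial>\<nu> \<partial>\<mu>) = (\<integral>\<^sup>+x. \<integral>\<^sup>+y. liminf (\<lambda>n. ennreal (Kn n x y)) \<partial>\<nu> \<partial>\<mu>)"
  proof (rule nn_integral_cong, rule nn_integral_cong_AE)
    fix x show "AE y in \<nu>. ennreal (log_kern x y) = liminf (\<lambda>n. ennreal (Kn n x y))"
      using AEn[OF \<nu>, of x]
    proof eventually_elim
      fix y assume "y \<noteq> x"
      then have "(\<lambda>n. Kn n x y) \<longlonglongrightarrow> 1 + Lg x + Lg y + - ln (cmod (x - y))"
        unfolding Kn_def by (intro tendsto_add tendsto_const reg_tendsto) auto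
      then have "(\<lambda>n. ennreal (Kn n x y)) \<longlonglongrightarrow> ennreal (log_kern x y)" by (intro tendsto_ennrealI) (simp add: log_kern_def)
      then show "ennreal (log_kern x y) = liminf (\<lambda>n. ennreal (Kn n x y))" by (intro lim_imp_Liminf[symmetric]) auto
    qed
  qed
  also have "\<dots> \<le> (\<integral>\<^sup>+x. liminf (\<lambda>n. \<integral>\<^sup>+y. ennreal (Kn n x y) \<partial>\<nu>) \<partial>\<mu>)"
    by (intro nn_integral_mono nn_integral_liminf) measurable
  also have "\<dots> \<le> liminf (\<lambda>n. \<integral>\<^sup>+x. \<integral>\<^sup>+y. ennreal (Kn n x y) \<partial>\<nu> \<partial>\<mu>)"
    by (intro nn_integral_liminf) measurable
  also have "\<dots> \<le> liminf (\<lambda>n::nat. Bd / 2)"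
  proof (intro Liminf_mono always_eventually allI)
    fix n
    have "(\<integral>\<^sup>+x. \<integral>\<^sup>+y. ennreal (Kn n x y) \<partial>\<nu> \<partial>\<mu>) = (\<integral>\<^sup>+x. \<integral>\<^sup>+y. ennreal (Kn n x y) \<partial>\<nu> \<partial>\<mu>) * 2 / 2"
      by (rule mult_divide_eq_ennreal[symmetric]) simp_all
    also have "\<dots> \<le> Bd / 2" using n_le[of n] by (intro divide_right_mono_ennreal) (simp only: mult.commute)
    finally show "(\<integral>\<^sup>+x. \<integral>\<^sup>+y. ennreal (Kn n x y) \<partial>\<nu> \<partial>\<mu>) \<le> Bd / 2" .
  qed
  also have "\<dots> = Bd / 2" by (simp add: Liminf_const)
  finally have "2 * (\<integral>\<^sup>+x. \<integral>\<^sup>+y. ennreal (log_kern x y) \<partial>\<nu> \<partial>\<mu>) \<le> 2 * (Bd / 2)" by (intro mult_left_mono) auto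
  also have "2 * (Bd / 2) = Bd" by (simp add: ennreal_times_divide mult.commute mult_divide_eq_ennreal)
  finally show ?thesis unfolding Bd_def .
qed

section \<open>The potential of the disc and the Gibbs reference measure\<close>

locale log_gas =
  fixes R \<kappa> lam :: real
  assumes R_pos: "R > 0" and \<kappa>_pos: "\<kappa> > 0" and cond: "\<kappa> * (lam - 1) > 2"
begin

definition disc :: "complex \<Rightarrow> real" where
  "disc z = indicator (cball 0 R) z / (pi * R\<^sup>2)"

lemma lam_gt: "lam > 1"
proof (rule ccontr)
  assume "\<not> 1 < lam"
  then have "\<kappa> * (lam - 1) \<le> 0" using \<kappa>_pos by (intro mult_nonneg_nonpos) auto
  then show False using cond by simp
qed

lemma measurable_disc [measurable]: "disc \<in> borel_measurable borel"
  unfolding disc_def[abs_def] by (intro borel_measurable_divide borel_measurable_indicator borel_measurable_const) simp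

lemma disc_nonneg: "0 \<le> disc z" and disc_le: "disc z \<le> 1 / (pi * R\<^sup>2)"
  using R_pos by (auto simp: disc_def indicator_def)

lemma rho_eq: "rho R = density lborel (\<lambda>z. ennreal (disc z))"
proof -
  have "emeasure lborel (cball (0::complex) R) = ennreal (pi * R\<^sup>2)"
    using R_pos by (intro emeasure_cball_complex) simp
  then show ?thesis
    unfolding rho_def uniform_measure_def using R_pos
    by (intro density_cong) (auto simp: disc_def indicator_def divide_ennreal_def inverse_ennreal inverse_eq_divide)
qed

lemma disc_integral: "(\<integral>\<^sup>+z. ennreal (disc z) \<partial>lborel) = 1"
proof -
  have "(\<integral>\<^sup>+z. ennreal (disc z) \<partial>lborel) = (\<integral>\<^sup>+z. ennreal (1 / (pi * R\<^sup>2)) * indicator (cball (0::complex) R) z \<partial>lborel)"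
    by (intro nn_integral_cong) (auto simp: disc_def indicator_def)
  also have "\<dots> = ennreal (1 / (pi * R\<^sup>2)) * emeasure lborel (cball (0::complex) R)"
    by (rule nn_integral_cmult_indicator) simp
  also have "\<dots> = ennreal (1 / (pi * R\<^sup>2)) * ennreal (pi * R\<^sup>2)"
    using R_pos by (subst emeasure_cball_complex) auto
  also have "\<dots> = 1" using R_pos by (subst ennreal_mult'[symmetric]) auto
  finally show ?thesis .
qed

lemma U_rho_eq: "U_rho R x = - (\<integral>y. ln (cmod (x - y)) * disc y \<partial>lborel)"
  unfolding U_rho_def rho_eq
  by (subst integral_density) (auto simp: disc_nonneg mult.commute)

lemma measurable_U_rho [measurable]: "U_rho R \<in> borel_measurable borel"
  unfolding U_rho_eq[abs_def] by measurable

lemma disc_moment: "(\<integral>\<^sup>+x. ennreal (Lg x * disc x) \<partial>lborel) < \<infinity>"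
proof -
  have "Lg x * disc x \<le> ln (1 + R\<^sup>2) / 2 * disc x" for x
  proof (cases "x \<in> cball 0 R")
    case True
    then have "(cmod x)\<^sup>2 \<le> R\<^sup>2" by (intro power_mono) auto
    then have "Lg x \<le> ln (1 + R\<^sup>2) / 2"
      unfolding Lg_def by (intro divide_right_mono ln_mono) (auto intro: one_plus_sq_pos)
    then show ?thesis by (intro mult_right_mono disc_nonneg)
  qed (simp add: disc_def)
  then have "(\<integral>\<^sup>+x. ennreal (Lg x * disc x) \<partial>lborel) \<le> (\<integral>\<^sup>+x. ennreal (ln (1 + R\<^sup>2) / 2) * ennreal (disc x) \<partial>lborel)"
    by (intro nn_integral_mono) (simp add: ennreal_mult'[symmetric] ennreal_leI)
  also have "\<dots> < \<infinity>" by (simp add: nn_integral_cmult disc_integral)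
  finally show ?thesis .
qed

lemma disc_potential: "\<exists>C. \<forall>x. integrable lborel (\<lambda>y. ln (cmod (x - y)) * disc y) \<and> \<bar>U_rho R x + Lg x\<bar> \<le> C"
proof -
  have "\<exists>C. \<forall>x. integrable lborel (\<lambda>y. ln (cmod (x - y)) * disc y) \<and> \<bar>(\<integral>y. ln (cmod (x - y)) * disc y \<partial>lborel) - Lg x\<bar> \<le> C"
    by (rule log_potential_bound[OF measurable_disc disc_nonneg disc_le disc_integral disc_moment])
  moreover have "\<bar>U_rho R x + Lg x\<bar> = \<bar>(\<integral>y. ln (cmod (x - y)) * disc y \<partial>lborel) - Lg x\<bar>" for x
    unfolding U_rho_eq by linarith
  ultimately show ?thesis by simp
qed

definition CU :: real where "CU = (SOME C. \<forall>x. \<bar>U_rho R x + Lg x\<bar> \<le> C)"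

lemma CU: "\<bar>U_rho R x + Lg x\<bar> \<le> CU"
proof -
  have "\<forall>x. \<bar>U_rho R x + Lg x\<bar> \<le> CU"
    unfolding CU_def by (rule someI_ex) (use disc_potential in blast)
  then show ?thesis by blast
qed

lemma CU_nonneg: "CU \<ge> 0" using CU[of 0] by linarith

text \<open>Replacing \<open>- ln (cmod (x - y))\<close> by the non-negative \<open>log_kern x y\<close> costs the one-body terms
  \<open>Lg x + Lg y\<close>, which are absorbed into the reference density. Since \<open>U_rho R\<close> is \<open>- Lg\<close> up
  to a bounded term, that density is integrable exactly when \<open>\<kappa> * (lam - 1) > 2\<close>.\<close>
definition G0 :: "complex \<Rightarrow> real" where "G0 x = exp (\<kappa> * (Lg x + lam * U_rho R x))"

text \<open>The decay exponent: \<open>G0\<close> is comparable to (1 + |x|^2)^(-pexp/2), and the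
  threshold 2 is the dimension of the plane.\<close>

definition pexp :: real where "pexp = \<kappa> * (lam - 1)"

lemma pexp: "pexp > 2" using cond by (simp add: pexp_def)

lemma G0_bounds:
  "G0 x \<le> exp (\<kappa> * lam * CU) * exp (- pexp * Lg x)"
  "exp (- \<kappa> * lam * CU) * exp (- pexp * Lg x) \<le> G0 x"
proof -
  have e: "\<kappa> * (Lg x + lam * U_rho R x) = \<kappa> * lam * (U_rho R x + Lg x) - pexp * Lg x"
    by (simp add: pexp_def algebra_simps)
  have k: "\<kappa> * lam > 0" using \<kappa>_pos lam_gt by simp
  have "\<kappa> * lam * (U_rho R x + Lg x) \<le> \<kappa> * lam * CU" "\<kappa> * lam * (- CU) \<le> \<kappa> * lam * (U_rho R x + Lg x)"
    using k CU[of x] by (intro mult_left_mono; simp add: abs_le_iff)+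
  then show "G0 x \<le> exp (\<kappa> * lam * CU) * exp (- pexp * Lg x)" "exp (- \<kappa> * lam * CU) * exp (- pexp * Lg x) \<le> G0 x"
    unfolding G0_def e exp_add[symmetric] by simp_all
qed

lemma measurable_G0 [measurable]: "G0 \<in> borel_measurable borel"
  unfolding G0_def[abs_def] by measurable

lemma G0_pos: "G0 x > 0" by (simp add: G0_def)

text \<open>The margin \<open>pexp - 2\<close> is what is available for exponential moments of
  \<open>Lg\<close>.\<close>

lemma G0_finite: "(\<integral>\<^sup>+x. ennreal (G0 x * exp (e * Lg x)) \<partial>lborel) < \<infinity>" if "e < pexp - 2"
proof -
  have "(\<integral>\<^sup>+x. ennreal (G0 x * exp (e * Lg x)) \<partial>lborel)
      \<le> (\<integral>\<^sup>+x. ennreal (exp (\<kappa> * lam * CU)) * ennreal (exp (- (pexp - e) * Lg x)) \<partial>lborel)"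
  proof (intro nn_integral_mono)
    fix x
    have "G0 x * exp (e * Lg x) \<le> exp (\<kappa> * lam * CU) * exp (- pexp * Lg x) * exp (e * Lg x)"
      by (intro mult_right_mono G0_bounds) auto
    also have "\<dots> = exp (\<kappa> * lam * CU) * exp (- (pexp - e) * Lg x)"
      by (simp add: mult.assoc exp_add[symmetric] algebra_simps)
    finally show "ennreal (G0 x * exp (e * Lg x)) \<le> ennreal (exp (\<kappa> * lam * CU)) * ennreal (exp (- (pexp - e) * Lg x))"
      by (simp add: ennreal_mult'[symmetric] ennreal_leI)
  qed
  also have "\<dots> < \<infinity>"
    using nn_integral_exp_Lg[of "pexp - e"] that by (simp add: nn_integral_cmult ennreal_mult_less_top)
  finally show ?thesis .
qed

definition Z0 :: real where "Z0 = (\<integral>x. G0 x \<partial>lborel)"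

lemma G0_integrable: "integrable lborel G0"
  using G0_finite[of 0] pexp by (intro integrableI_nonneg) (auto simp: G0_def)

lemma Z0_pos: "Z0 > 0"
proof -
  have "Z0 \<ge> 0" unfolding Z0_def by (simp add: G0_def)
  moreover have "Z0 \<noteq> 0"
  proof
    assume "Z0 = 0"
    then have "AE x in lborel. G0 x = 0"
      using integral_nonneg_eq_0_iff_AE[OF G0_integrable] less_imp_le[OF G0_pos] by (simp add: Z0_def)
    then have "AE x in (lborel :: complex measure). False" by (rule eventually_mono) (metis G0_pos less_irrefl)
    then show False by (simp add: eventually_False ae_filter_eq_bot_iff)
  qed
  ultimately show ?thesis by simp
qed

definition \<Gamma> :: "complex \<Rightarrow> real" where "\<Gamma> x = G0 x / Z0"

definition \<gamma> :: "complex measure" where "\<gamma> = density lborel (\<lambda>x. ennreal (\<Gamma> x))"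

lemma measurable_\<Gamma> [measurable]: "\<Gamma> \<in> borel_measurable borel"
  unfolding \<Gamma>_def[abs_def] by measurable

lemma \<Gamma>_pos: "\<Gamma> x > 0" using Z0_pos by (simp add: \<Gamma>_def G0_def)

lemma ln_\<Gamma>: "ln (\<Gamma> x) = \<kappa> * (Lg x + lam * U_rho R x) - ln Z0"
  using Z0_pos by (simp add: \<Gamma>_def G0_def ln_div)

definition C\<Gamma> :: real where "C\<Gamma> = exp (\<kappa> * lam * CU) / Z0"

lemma \<Gamma>_le: "\<Gamma> x \<le> C\<Gamma> * exp (- pexp * Lg x)"
  using divide_right_mono[OF G0_bounds(1)[of x], of Z0] Z0_pos by (simp add: \<Gamma>_def C\<Gamma>_def)

lemma C\<Gamma>_pos: "C\<Gamma> > 0" using Z0_pos by (simp add: C\<Gamma>_def)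

lemma \<Gamma>_le': "\<Gamma> x \<le> C\<Gamma>"
proof -
  have "exp (- pexp * Lg x) \<le> 1" using pexp Lg_nonneg[of x] by simp
  then have "C\<Gamma> * exp (- pexp * Lg x) \<le> C\<Gamma> * 1" using C\<Gamma>_pos by (intro mult_left_mono) auto
  then show ?thesis using \<Gamma>_le[of x] by simp
qed

lemma \<Gamma>_integral: "(\<integral>\<^sup>+x. ennreal (\<Gamma> x) \<partial>lborel) = 1"
proof -
  have "has_bochner_integral lborel \<Gamma> 1"
    using G0_integrable Z0_pos unfolding \<Gamma>_def[abs_def] by (auto simp: has_bochner_integral_iff Z0_def)
  then show ?thesis using \<Gamma>_pos by (subst nn_integral_eq_integral) (auto simp: has_bochner_integral_iff less_imp_le)
qed

lemma prob_\<gamma>: "prob_space \<gamma>"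
  by standard (simp add: \<gamma>_def emeasure_density \<Gamma>_integral)

lemma sets_\<gamma> [measurable_cong]: "sets \<gamma> = sets borel" by (simp add: \<gamma>_def)

lemma space_\<gamma> [simp]: "space \<gamma> = UNIV" by (simp add: \<gamma>_def)

lemma \<gamma>_integral: "f \<in> borel_measurable borel \<Longrightarrow> (\<integral>\<^sup>+x. f x \<partial>\<gamma>) = (\<integral>\<^sup>+x. ennreal (\<Gamma> x) * f x \<partial>lborel)"
  unfolding \<gamma>_def by (subst nn_integral_density) auto

text \<open>The reference density is positive everywhere, so both measures have the same null
  sets.\<close>

lemma AE_\<gamma>: "(AE x in \<gamma>. P x) \<longleftrightarrow> (AE x in lborel. P x)"
  unfolding \<gamma>_def by (subst AE_density) (auto simp: \<Gamma>_pos)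

lemma \<gamma>_exp_moment: "e < pexp - 2 \<Longrightarrow> (\<integral>\<^sup>+x. ennreal (exp (e * Lg x)) \<partial>\<gamma>) < \<infinity>"
proof -
  assume e: "e < pexp - 2"
  have "(\<integral>\<^sup>+x. ennreal (exp (e * Lg x)) \<partial>\<gamma>) = (\<integral>\<^sup>+x. ennreal (1 / Z0) * ennreal (G0 x * exp (e * Lg x)) \<partial>lborel)"
    using Z0_pos by (subst \<gamma>_integral) (auto intro!: nn_integral_cong simp: \<Gamma>_def ennreal_mult'[symmetric] G0_def)
  also have "\<dots> < \<infinity>" using G0_finite[OF e] by (simp add: nn_integral_cmult ennreal_mult_less_top)
  finally show ?thesis .
qed

sublocale gibbs_variational \<gamma> log_kern \<kappa>
proof (intro gibbs_variational.intro gibbs_variational_axioms.intro prob_\<gamma> \<kappa>_pos)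
  show "(\<lambda>(x, y). log_kern x y) \<in> borel_measurable (\<gamma> \<Otimes>\<^sub>M \<gamma>)" by measurable
  show "0 \<le> log_kern x y" for x y using log_kern_ge[of x y] by simp
  show "log_kern x y = log_kern y x" for x y by (rule log_kern_sym)
qed

lemma emeasure_\<gamma>_UNIV [simp]: "emeasure \<gamma> UNIV = 1"
  using emeasure_space_1 by simp

definition dmeas :: "(complex \<Rightarrow> real) \<Rightarrow> complex measure" where
  "dmeas f = density \<gamma> (\<lambda>x. ennreal (f x))"

lemma dmeas_lborel: "f \<in> borel_measurable borel \<Longrightarrow> dmeas f = density lborel (\<lambda>x. ennreal (\<Gamma> x * f x))"
  unfolding dmeas_def \<gamma>_def using \<Gamma>_pos by (subst density_density_eq) (auto simp: ennreal_mult'[symmetric] less_imp_le)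

lemma dens_measurable: "dens f \<Longrightarrow> f \<in> borel_measurable borel"
  by (simp add: dens_def measurable_cong_sets[OF sets_\<gamma> refl])

text \<open>Legendre duality between entropy and the exponential function.\<close>

lemma ent_young:
  assumes "a \<ge> 0"
  shows "a * b \<le> ent a + exp b - 1"
proof (cases "a = 0")
  case False
  have "1 + (b - ln a) \<le> exp (b - ln a)" by (rule exp_ge_add_one_self)
  then have "a * (1 + (b - ln a)) \<le> a * exp (b - ln a)" using assms by (intro mult_left_mono) auto
  also have "a * exp (b - ln a) = exp b" using False assms by (simp add: exp_diff)
  finally show ?thesis by (simp add: ent_def algebra_simps)
qed (simp add: ent_def)

text \<open>Entropy duality is applied with b = e Lg x. Taking e as half of the margin
  \<open>pexp - 2\<close> keeps exp(e Lg) integrable under \<gamma>, so finite relative entropy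
  forces a finite logarithmic moment.\<close>

lemma dens_logmom:
  assumes f: "dens f" "EE f < \<infinity>"
  shows "(\<integral>\<^sup>+x. ennreal (Lg x * f x) \<partial>\<gamma>) < \<infinity>" and "logmom (dmeas f)"
proof -
  have [measurable]: "f \<in> borel_measurable borel" by (rule dens_measurable[OF f(1)])
  have nn: "f x \<ge> 0" for x using f(1) by (simp add: dens_def)
  define e where "e = (pexp - 2) / 2"
  have e: "e > 0" "e < pexp - 2" using pexp by (auto simp: e_def)
  have "ennreal (Lg x * f x) \<le> ennreal (\<kappa> / e) * ennreal (ent (f x) / \<kappa>) + ennreal (1 / e) * ennreal (exp (e * Lg x))" for x
  proof -
    have "f x * (e * Lg x) \<le> ent (f x) + exp (e * Lg x)" using ent_young[OF nn[of x], of "e * Lg x"] by simp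
    then have "Lg x * f x \<le> (ent (f x) + exp (e * Lg x)) / e" using e by (simp add: field_simps)
    also have "\<dots> = \<kappa> / e * (ent (f x) / \<kappa>) + 1 / e * exp (e * Lg x)" using \<kappa>_pos by (simp add: add_divide_distrib)
    finally show ?thesis
      using e \<kappa>_pos ent_nonneg[OF nn[of x]]
          by (simp add: ennreal_mult'[symmetric] ennreal_plus[symmetric] ennreal_leI del: ennreal_plus)
  qed
  then have "(\<integral>\<^sup>+x. ennreal (Lg x * f x) \<partial>\<gamma>)
      \<le> (\<integral>\<^sup>+x. ennreal (\<kappa> / e) * ennreal (ent (f x) / \<kappa>) + ennreal (1 / e) * ennreal (exp (e * Lg x)) \<partial>\<gamma>)"
    by (intro nn_integral_mono)
  also have "\<dots> = ennreal (\<kappa> / e) * EE f + ennreal (1 / e) * (\<integral>\<^sup>+x. ennreal (exp (e * Lg x)) \<partial>\<gamma>)"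
    unfolding EE_def by (simp add: nn_integral_add nn_integral_cmult)
  also have "\<dots> < \<infinity>" using f(2) \<gamma>_exp_moment[OF e(2)] by (simp add: ennreal_mult_less_top)
  finally show L: "(\<integral>\<^sup>+x. ennreal (Lg x * f x) \<partial>\<gamma>) < \<infinity>" .
  have "integrable (dmeas f) Lg"
  proof (rule integrableI_nonneg)
    have "(\<integral>\<^sup>+x. ennreal (Lg x) \<partial>dmeas f) = (\<integral>\<^sup>+x. ennreal (Lg x * f x) \<partial>\<gamma>)"
      unfolding dmeas_def using nn Lg_nonneg
          by (subst nn_integral_density) (auto intro!: nn_integral_cong simp: ennreal_mult mult.commute)
    with L show "(\<integral>\<^sup>+x. ennreal (Lg x) \<partial>dmeas f) < \<infinity>" by simp
  qed (auto simp: dmeas_def Lg_nonneg)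
  moreover have "prob_space (dmeas f)"
    by standard (use f(1) in \<open>simp add: dmeas_def emeasure_density dens_def\<close>)
  ultimately show "logmom (dmeas f)" by (simp add: logmom_def dmeas_def sets_\<gamma>)
qed

lemma dmeas_ac: "f \<in> borel_measurable borel \<Longrightarrow> absolutely_continuous lborel (dmeas f)"
  by (simp add: dmeas_lborel absolutely_continuousI_density)

lemma KK_dmeas:
  assumes "f \<in> borel_measurable borel" "g \<in> borel_measurable borel"
  shows "KK f g = (\<integral>\<^sup>+x. \<integral>\<^sup>+y. ennreal (log_kern x y) \<partial>dmeas g \<partial>dmeas f)"
proof -
  have [measurable]: "f \<in> borel_measurable \<gamma>" "g
      \<in> borel_measurable \<gamma>" using assms by (simp_all add: measurable_cong_sets[OF sets_\<gamma> refl])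
  have "(\<integral>\<^sup>+y. ennreal (log_kern x y) \<partial>dmeas g) = pot g x" for x
    unfolding dmeas_def pot_def by (subst nn_integral_density) (auto intro!: nn_integral_cong simp: mult.commute)
  then have "(\<integral>\<^sup>+x. \<integral>\<^sup>+y. ennreal (log_kern x y) \<partial>dmeas g \<partial>dmeas f) = (\<integral>\<^sup>+x. pot g x \<partial>dmeas f)" by simp
  also have "\<dots> = (\<integral>\<^sup>+x. ennreal (f x) * pot g x \<partial>\<gamma>)"
    unfolding dmeas_def by (subst nn_integral_density) auto
  finally show ?thesis by (simp add: KK_pot mult.commute)
qed

lemma J_finite: "J f < \<infinity> \<longleftrightarrow> KK f f < \<infinity> \<and> EE f < \<infinity>"
  using ennreal_less_top[of "1/2"] by (auto simp: J_def ennreal_half ennreal_mult_less_top)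

lemma \<Gamma>_Lg: "\<exists>c\<ge>0. (\<integral>\<^sup>+x. ennreal (Lg x * \<Gamma> x) \<partial>lborel) = ennreal c"
proof -
  have "dens (\<lambda>_. 1)" by (simp add: dens_def emeasure_space_1)
  moreover have "EE (\<lambda>_. 1) < \<infinity>" by (simp add: EE_def ent_def)
  ultimately have "(\<integral>\<^sup>+x. ennreal (Lg x * 1) \<partial>\<gamma>) < \<infinity>" by (rule dens_logmom)
  also have "(\<integral>\<^sup>+x. ennreal (Lg x * 1) \<partial>\<gamma>) = (\<integral>\<^sup>+x. ennreal (Lg x * \<Gamma> x) \<partial>lborel)"
    using \<Gamma>_pos by (subst \<gamma>_integral) (auto intro!: nn_integral_cong simp: ennreal_mult'' less_imp_le mult.commute)
  finally show ?thesis by (metis ennreal_cases infinity_ennreal_def less_irrefl)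
qed

lemma pot_1_le: "\<exists>C. \<forall>x. pot (\<lambda>_. 1) x \<le> ennreal C"
proof -
  obtain c where c: "c \<ge> 0" "(\<integral>\<^sup>+x. ennreal (Lg x * \<Gamma> x) \<partial>lborel) = ennreal c" using \<Gamma>_Lg by blast
  have "pot (\<lambda>_. 1) x \<le> ennreal (3 + 2 * c + C\<Gamma> * (pi / 2))" for x
  proof -
    have "pot (\<lambda>_. 1) x = (\<integral>\<^sup>+y. ennreal (log_kern x y) * ennreal (\<Gamma> y) \<partial>lborel)"
      unfolding pot_def by (subst \<gamma>_integral) (auto intro!: nn_integral_cong simp: mult.commute)
    also have "\<dots> \<le> ennreal (3 + 2 * c + C\<Gamma> * (pi / 2))"
      using \<Gamma>_pos \<Gamma>_le' C\<Gamma>_pos c by (intro log_kern_potential_bound \<Gamma>_integral) (auto simp: less_imp_le)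
    finally show ?thesis .
  qed
  then show ?thesis by blast
qed

sublocale gibbs_variational_pos \<gamma> log_kern \<kappa>
proof (unfold_locales)
  fix f g assume f: "dens f" "J f < \<infinity>" and g: "dens g" "J g < \<infinity>"
  have [measurable]: "f \<in> borel_measurable borel" "g \<in> borel_measurable borel" using f g by (auto intro: dens_measurable)
  show "2 * KK f g \<le> KK f f + KK g g"
    using f g unfolding J_finite
    by (simp only: KK_dmeas[OF \<open>f \<in> borel_measurable borel\<close> \<open>g \<in> borel_measurable borel\<close>]
        KK_dmeas[OF \<open>f \<in> borel_measurable borel\<close> \<open>f \<in> borel_measurable borel\<close>]
        KK_dmeas[OF \<open>g \<in> borel_measurable borel\<close> \<open>g \<in> borel_measurable borel\<close>])
       (intro log_kern_positive dens_logmom dmeas_ac; simp)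
next
  obtain C where C: "\<And>x. pot (\<lambda>_. 1) x \<le> ennreal C" using pot_1_le by blast
  have "KK (\<lambda>_. 1) (\<lambda>_. 1) = (\<integral>\<^sup>+x. pot (\<lambda>_. 1) x \<partial>\<gamma>)" by (simp add: KK_pot)
  also have "\<dots> \<le> (\<integral>\<^sup>+x. ennreal C \<partial>\<gamma>)" by (intro nn_integral_mono C)
  also have "\<dots> < \<infinity>" by (simp add: emeasure_space_1)
  finally show "KK (\<lambda>_. 1) (\<lambda>_. 1) < \<infinity>" .
qed

end

section \<open>The free energy functional\<close>

lemma ennreal_max_0: "ennreal (max 0 x) = ennreal x"
  by (cases "0 \<le> x") (auto simp: max_def ennreal_neg)

lemma ereal_int_integrable:
  assumes "integrable M f"
  shows "ereal_int M (\<lambda>x. ereal (f x)) = ereal (\<integral>x. f x \<partial>M)"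
proof -
  obtain a where a: "(\<integral>\<^sup>+x. ennreal (f x) \<partial>M) = ennreal a" "a \<ge> 0"
    using assms by (cases "\<integral>\<^sup>+x. ennreal (f x) \<partial>M") (auto simp: real_integrable_def)
  obtain b where b: "(\<integral>\<^sup>+x. ennreal (- f x) \<partial>M) = ennreal b" "b \<ge> 0"
    using assms by (cases "\<integral>\<^sup>+x. ennreal (- f x) \<partial>M") (auto simp: real_integrable_def)
  show ?thesis
    unfolding ereal_int_def using a b by (simp add: real_lebesgue_integral_def[OF assms])
qed

lemma ereal_int_cong_AE:
  assumes "AE x in M. f x = g x"
  shows "ereal_int M f = ereal_int M g"
proof -
  have "(\<integral>\<^sup>+x. e2ennreal (f x) \<partial>M) = (\<integral>\<^sup>+x. e2ennreal (g x) \<partial>M)"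
    by (rule nn_integral_cong_AE) (use assms in eventually_elim, simp)
  moreover have "(\<integral>\<^sup>+x. e2ennreal (- f x) \<partial>M) = (\<integral>\<^sup>+x. e2ennreal (- g x) \<partial>M)"
    by (rule nn_integral_cong_AE) (use assms in eventually_elim, simp)
  ultimately show ?thesis by (simp add: ereal_int_def)
qed

text \<open>An infinite positive part decides the value, because infinity minus infinity is infinity
  in \<open>ereal\<close>.\<close>

lemma ereal_int_PInf: "(\<integral>\<^sup>+x. e2ennreal (f x) \<partial>M) = \<infinity> \<Longrightarrow> ereal_int M f = \<infinity>"
  by (simp add: ereal_int_def)

lemma ereal_int_MInf:
  "(\<integral>\<^sup>+x. e2ennreal (f x) \<partial>M) < \<infinity> \<Longrightarrow> (\<integral>\<^sup>+x. e2ennreal (- f x) \<partial>M) = \<infinity> \<Longrightarrow> ereal_int M f = - \<infinity>"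
  by (cases "\<integral>\<^sup>+x. e2ennreal (f x) \<partial>M") (auto simp: ereal_int_def)

context log_gas
begin

lemma ln_\<Gamma>_abs: "\<exists>c1\<ge>0. \<exists>c2\<ge>0. \<forall>x. \<bar>ln (\<Gamma> x)\<bar> \<le> c1 + c2 * Lg x"
proof (intro exI conjI allI)
  fix x
  have "ln (\<Gamma> x) = \<kappa> * lam * (U_rho R x + Lg x) - pexp * Lg x - ln Z0"
    unfolding ln_\<Gamma> by (simp add: pexp_def algebra_simps)
  moreover have "\<bar>\<kappa> * lam * (U_rho R x + Lg x)\<bar> \<le> \<kappa> * lam * CU"
    using \<kappa>_pos lam_gt CU[of x] by (simp add: abs_mult)
  moreover have "\<bar>pexp * Lg x\<bar> = pexp * Lg x" using pexp Lg_nonneg[of x] by simp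
  ultimately show "\<bar>ln (\<Gamma> x)\<bar> \<le> (\<kappa> * lam * CU + \<bar>ln Z0\<bar>) + pexp * Lg x" by linarith
qed (use \<kappa>_pos lam_gt CU_nonneg pexp in auto)

lemma U_integrable:
  assumes "logmom \<nu>" shows "integrable \<nu> (U_rho R)"
proof -
  interpret \<nu>: prob_space \<nu> using assms by (simp add: logmom_def)
  have [measurable_cong]: "sets \<nu> = sets borel" and L: "integrable \<nu> Lg" using assms by (auto simp: logmom_def)
  show ?thesis
  proof (rule Bochner_Integration.integrable_bound[of _ "\<lambda>x. CU + Lg x"])
    show "integrable \<nu> (\<lambda>x. CU + Lg x)" using L by simp
    show "AE x in \<nu>. norm (U_rho R x) \<le> norm (CU + Lg x)"
    proof (rule AE_I2)
      fix x show "norm (U_rho R x) \<le> norm (CU + Lg x)" using CU[of x] Lg_nonneg[of x] by simp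
    qed
  qed measurable
qed

text \<open>The first term is half of the constant 1 in \<open>log_kern\<close>, the second comes
  from normalizing the reference density.\<close>

definition c0 :: real where "c0 = - 1 / 2 - ln Z0 / \<kappa>"

text \<open>For the density \<Gamma> f the entropy produces the integral of ln \<Gamma> = \<kappa>
  (Lg + lam U) - ln Z0. After division by \<kappa>, its \<open>Lg\<close> part cancels the weights
  inside \<open>log_kern\<close> and its U part cancels the external field, so that J and a constant
  remain.\<close>

lemma I_functional_dmeas:
  assumes f: "dens f" "J f < \<infinity>"
  shows "I_functional \<kappa> lam R (dmeas f) = ereal (enn2real (J f) + c0)"
proof -
  have fin: "KK f f < \<infinity>" "EE f < \<infinity>" using f(2) unfolding J_finite by auto
  have [measurable]: "f \<in> borel_measurable borel" by (rule dens_measurable[OF f(1)])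
  have nn: "f x \<ge> 0" for x using f(1) by (simp add: dens_def)
  define \<nu> where "\<nu> = dmeas f"
  define \<phi> where "\<phi> x = \<Gamma> x * f x" for x
  have [measurable]: "\<phi> \<in> borel_measurable borel" unfolding \<phi>_def[abs_def] by measurable
  have \<phi>0: "\<phi> x \<ge> 0" for x using nn[of x] \<Gamma>_pos[of x] by (simp add: \<phi>_def)
  have \<nu>_eq: "\<nu> = density lborel (\<lambda>x. ennreal (\<phi> x))" unfolding \<nu>_def \<phi>_def by (simp add: dmeas_lborel)
  have lm: "logmom \<nu>" unfolding \<nu>_def by (rule dens_logmom[OF f(1) fin(2)])
  then have p: "prob_space \<nu>" "sets \<nu> = sets borel" and L: "integrable \<nu> Lg" by (auto simp: logmom_def)
  interpret \<nu>: prob_space \<nu> by fact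
  interpret \<nu>\<nu>: pair_prob_space \<nu> \<nu> ..
  note [measurable_cong] = p(2)
  define l where "l = (\<integral>x. Lg x \<partial>\<nu>)"
  define u where "u = (\<integral>x. U_rho R x \<partial>\<nu>)"
  define k where "k = (\<integral>p. log_kern (fst p) (snd p) \<partial>(\<nu> \<Otimes>\<^sub>M \<nu>))"
  have kk: "KK f f = (\<integral>\<^sup>+p. ennreal (log_kern (fst p) (snd p)) \<partial>(\<nu> \<Otimes>\<^sub>M \<nu>))"
    unfolding KK_dmeas[OF \<open>f \<in> borel_measurable borel\<close> \<open>f \<in> borel_measurable borel\<close>] \<nu>_def[symmetric]
    by (subst \<nu>.nn_integral_fst[symmetric]) auto
  have ki: "integrable (\<nu> \<Otimes>\<^sub>M \<nu>) (\<lambda>p. log_kern (fst p) (snd p))"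
  proof (rule integrableI_nonneg)
    show "AE p in \<nu> \<Otimes>\<^sub>M \<nu>. 0 \<le> log_kern (fst p) (snd p)"
    proof (rule AE_I2)
      fix p show "0 \<le> log_kern (fst p) (snd p)" using log_kern_ge[of "fst p" "snd p"] by simp
    qed
  qed (use kk fin in auto)
  have k_eq: "KK f f = ennreal k" unfolding kk k_def
  proof (rule nn_integral_eq_integral[OF ki], rule AE_I2)
    fix p show "0 \<le> log_kern (fst p) (snd p)" using log_kern_ge[of "fst p" "snd p"] by simp
  qed
  have k0: "k \<ge> 0" unfolding k_def
  proof (rule Bochner_Integration.integral_nonneg)
    fix p show "0 \<le> log_kern (fst p) (snd p)" using log_kern_ge[of "fst p" "snd p"] by simp
  qed
  have Lp: "has_bochner_integral (\<nu> \<Otimes>\<^sub>M \<nu>) (\<lambda>p. Lg (fst p)) l" "has_bochner_integral (\<nu> \<Otimes>\<^sub>M \<nu>) (\<lambda>p. Lg (snd p)) l"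
    unfolding l_def using L by (auto intro!: has_bochner_integral_marginals p)
  have one: "has_bochner_integral (\<nu> \<Otimes>\<^sub>M \<nu>) (\<lambda>p. 1::real) 1" by (simp add: has_bochner_integral_iff \<nu>\<nu>.P.prob_space)
  have "has_bochner_integral (\<nu> \<Otimes>\<^sub>M \<nu>) (\<lambda>p. log_kern (fst p) (snd p) - 1 - Lg (fst p) - Lg (snd p)) (k - 1 - l - l)"
    using ki by (intro has_bochner_integral_diff one Lp) (simp add: has_bochner_integral_iff k_def)
  then have ln_int: "has_bochner_integral (\<nu> \<Otimes>\<^sub>M \<nu>) (\<lambda>p. - ln (cmod (fst p - snd p))) (k - 1 - 2 * l)"
    by (simp add: log_kern_def)
  have LE: "log_energy \<nu> = ereal (k - 1 - 2 * l)"
  proof -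
    have "log_energy \<nu> = ereal_int (\<nu> \<Otimes>\<^sub>M \<nu>) (\<lambda>p. ereal (- ln (cmod (fst p - snd p))))"
      unfolding log_energy_def
    proof (rule ereal_int_cong_AE)
      \<comment> \<open>The diagonal is a null set, so the value infinity of
        \<open>log_kernel\<close> there and the value \<open>ln 0 = 0\<close> on the right agree for
        the integral.\<close>
      have "AE p in \<nu> \<Otimes>\<^sub>M \<nu>. fst p \<noteq> snd p"
      proof (rule \<nu>\<nu>.AE_pair_measure)
        show "{p \<in> space (\<nu> \<Otimes>\<^sub>M \<nu>). fst p \<noteq> snd p} \<in> sets (\<nu> \<Otimes>\<^sub>M \<nu>)" by measurable
        show "AE x in \<nu>. AE y in \<nu>. fst (x, y) \<noteq> snd (x, y)"
        proof (rule AE_I2)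
          fix x
          have "AE y in \<nu>. y \<noteq> x"
            unfolding \<nu>_eq by (subst AE_density) (use AE_lborel_singleton[of x] in \<open>auto elim: eventually_mono\<close>)
          then show "AE y in \<nu>. fst (x, y) \<noteq> snd (x, y)" by eventually_elim auto
        qed
      qed
      then show "AE p in \<nu> \<Otimes>\<^sub>M \<nu>. (case p of (x, y) \<Rightarrow> log_kernel x y) = ereal (- ln (cmod (fst p - snd p)))"
        by eventually_elim (auto simp: log_kernel_def)
    qed
    also have "\<dots> = ereal (k - 1 - 2 * l)"
      using ln_int by (subst ereal_int_integrable) (auto simp: has_bochner_integral_iff)
    finally show ?thesis .
  qed
  have dint: "has_bochner_integral lborel (\<lambda>x. \<phi> x * g x) (\<integral>x. g x \<partial>\<nu>)" if "integrable \<nu> g" "g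
      \<in> borel_measurable borel" for g
    using that \<phi>0 unfolding \<nu>_eq by (simp add: has_bochner_integral_iff integrable_density integral_density)
  have \<phi>i: "has_bochner_integral lborel \<phi> 1" using dint[of "\<lambda>_. 1"] by (simp add: \<nu>.prob_space)
  have \<Gamma>i: "has_bochner_integral lborel \<Gamma> 1"
    using \<Gamma>_integral \<Gamma>_pos by (intro has_bochner_integral_nn_integral) (auto simp: less_imp_le)
  define e where "e = (\<integral>x. \<Gamma> x * ent (f x) \<partial>lborel)"
  have EEl: "EE f = (\<integral>\<^sup>+x. ennreal (\<Gamma> x * ent (f x) / \<kappa>) \<partial>lborel)"
    unfolding EE_def using \<Gamma>_pos nn \<kappa>_pos
    by (subst \<gamma>_integral) (auto intro!: nn_integral_cong simp: ennreal_mult'[symmetric] less_imp_le)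
  have gnn: "0 \<le> \<Gamma> x * ent (f x)" for x using \<Gamma>_pos[of x] ent_nonneg[OF nn[of x]] by simp
  have ei: "integrable lborel (\<lambda>x. \<Gamma> x * ent (f x))"
  proof -
    have "integrable lborel (\<lambda>x. \<Gamma> x * ent (f x) / \<kappa>)"
      using fin(2) gnn \<kappa>_pos unfolding EEl by (intro integrableI_nonneg) auto
    then have "integrable lborel (\<lambda>x. \<kappa> * (\<Gamma> x * ent (f x) / \<kappa>))" by (rule integrable_mult_right)
    then show ?thesis using \<kappa>_pos by simp
  qed
  have e0: "e \<ge> 0" unfolding e_def using gnn by simp
  have EE_eq: "EE f = ennreal (e / \<kappa>)"
    unfolding EEl e_def using ei gnn \<kappa>_pos by (subst nn_integral_eq_integral) auto
  have Ui: "integrable \<nu> (U_rho R)" by (rule U_integrable[OF lm])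
  have ln\<Gamma>_int: "has_bochner_integral lborel (\<lambda>x. \<phi> x * ln (\<Gamma> x)) (\<kappa> * (l + lam * u) - ln Z0)"
  proof -
    have "has_bochner_integral lborel (\<lambda>x. \<phi> x * ln (\<Gamma> x)) (\<integral>x. ln (\<Gamma> x) \<partial>\<nu>)"
      using L Ui unfolding ln_\<Gamma> by (intro dint) auto
    also have "(\<integral>x. ln (\<Gamma> x) \<partial>\<nu>) = \<kappa> * (l + lam * u) - ln Z0"
      unfolding ln_\<Gamma> l_def u_def using L Ui by (simp add: \<nu>.prob_space)
    finally show ?thesis .
  qed
  have pw: "\<phi> x * ln (\<phi> x) = \<Gamma> x * ent (f x) + \<phi> x * ln (\<Gamma> x) + \<phi> x - \<Gamma> x" for x
    using ent_scale[OF \<Gamma>_pos[of x] \<phi>0[of x]] \<Gamma>_pos[of x] by (simp add: \<phi>_def)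
  have s_int: "has_bochner_integral lborel (\<lambda>x. \<phi> x * ln (\<phi> x)) (e + (\<kappa> * (l + lam * u) - ln Z0) + 1 - 1)"
    unfolding pw using ei by (intro has_bochner_integral_add has_bochner_integral_diff ln\<Gamma>_int \<phi>i \<Gamma>i)
        (simp add: has_bochner_integral_iff e_def)
  have Ent: "entropy_C \<nu> = ereal (e + (\<kappa> * (l + lam * u) - ln Z0))"
  proof -
    have ac: "absolutely_continuous lborel \<nu>" unfolding \<nu>_def by (rule dmeas_ac) measurable
    \<comment> \<open>\<open>entropy_C\<close> is written with the Radon--Nikodym derivative, which
      is known to agree with \<phi> almost everywhere.\<close>
    have "AE x in lborel. ennreal (\<phi> x) = RN_deriv lborel \<nu> x"
      by (rule sigma_finite_measure.RN_deriv_unique[OF sigma_finite_lborel]) (auto simp: \<nu>_eq)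
    then have "entropy_C \<nu> = ereal_int lborel (\<lambda>x. ereal (\<phi> x * ln (\<phi> x)))"
      unfolding entropy_C_def if_P[OF ac]
    proof (intro ereal_int_cong_AE, eventually_elim)
      fix x assume "ennreal (\<phi> x) = RN_deriv lborel \<nu> x"
      then have "enn2real (RN_deriv lborel \<nu> x) = \<phi> x" using \<phi>0[of x] by (metis enn2real_ennreal)
      then show "(let \<phi> = enn2real (RN_deriv lborel \<nu> x) in ereal (\<phi> * ln \<phi>)) = ereal (\<phi> x * ln (\<phi> x))"
        by (simp add: Let_def)
    qed
    then show ?thesis using s_int by (simp add: ereal_int_integrable has_bochner_integral_iff)
  qed
  have UI: "ereal_int \<nu> (\<lambda>x. ereal (U_rho R x)) = ereal u"
    unfolding u_def by (rule ereal_int_integrable[OF Ui])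
  have "J f = ennreal (k / 2 + e / \<kappa>)"
    using k0 e0 \<kappa>_pos divide_ennreal[of k 2] by (simp add: J_def k_eq EE_eq)
  then have Jr: "enn2real (J f) = k / 2 + e / \<kappa>" using k0 e0 \<kappa>_pos by (simp del: ennreal_plus)
  have "I_functional \<kappa> lam R \<nu> = ereal (1 / 2 * (k - 1 - 2 * l) - lam * u + 1 / \<kappa> * (e + (\<kappa> * (l + lam * u) - ln Z0)))"
    unfolding I_functional_def LE UI Ent by simp
  also have "1 / 2 * (k - 1 - 2 * l) - lam * u + 1 / \<kappa> * (e + (\<kappa> * (l + lam * u) - ln Z0)) = enn2real (J f) + c0"
    unfolding Jr c0_def using \<kappa>_pos by (simp add: field_simps)
  finally show ?thesis unfolding \<nu>_def .
qed

text \<open>In \<open>ereal\<close> addition infinity wins over -infinity, so each degenerate case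
  yields the value infinity: no logarithmic moment (the field integral is -infinity and enters with
  a minus sign), no density, or an infinite positive part of entropy or energy. Once these are
  excluded, the change to the weighted kernel and the reference density costs only integrable
  terms.\<close>

lemma I_functional_infinite:
  assumes \<nu>: "\<nu> \<in> prob_measures_C" and fin: "I_functional \<kappa> lam R \<nu> \<noteq> \<infinity>"
  shows "\<exists>f. dens f \<and> J f < \<infinity> \<and> \<nu> = dmeas f"
proof -
  have p: "prob_space \<nu>" "sets \<nu> = sets borel" using \<nu> by (auto simp: prob_measures_C_def)
  interpret \<nu>: prob_space \<nu> by fact
  note [measurable_cong] = p(2)
  have L_fin: "(\<integral>\<^sup>+x. ennreal (Lg x) \<partial>\<nu>) < \<infinity>"
  proof (rule ccontr)
    assume "\<not> (\<integral>\<^sup>+x. ennreal (Lg x) \<partial>\<nu>) < \<infinity>"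
    then have inf: "(\<integral>\<^sup>+x. ennreal (Lg x) \<partial>\<nu>) = \<infinity>" by (simp add: not_less top_unique)
    have "(\<integral>\<^sup>+x. ennreal (U_rho R x) \<partial>\<nu>) \<le> (\<integral>\<^sup>+x. ennreal CU \<partial>\<nu>)"
    proof (intro nn_integral_mono ennreal_leI)
      fix x show "U_rho R x \<le> CU" using CU[of x] Lg_nonneg[of x] by linarith
    qed
    then have a: "(\<integral>\<^sup>+x. e2ennreal (ereal (U_rho R x)) \<partial>\<nu>) < \<infinity>"
      by (simp add: \<nu>.emeasure_space_1 le_less_trans)
    have "(\<integral>\<^sup>+x. ennreal (Lg x) \<partial>\<nu>) \<le> (\<integral>\<^sup>+x. ennreal (- U_rho R x) + ennreal CU \<partial>\<nu>)"
    proof (intro nn_integral_mono)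
      fix x
      have "Lg x \<le> max 0 (- U_rho R x) + CU" using CU[of x] by linarith
      from ennreal_leI[OF this] have "ennreal (Lg x) \<le> ennreal (max 0 (- U_rho R x)) + ennreal CU"
        using CU_nonneg by (simp only: ennreal_plus max.cobounded1)
      then show "ennreal (Lg x) \<le> ennreal (- U_rho R x) + ennreal CU" by (simp only: ennreal_max_0)
    qed
    also have "\<dots> = (\<integral>\<^sup>+x. ennreal (- U_rho R x) \<partial>\<nu>) + ennreal CU"
      by (simp add: nn_integral_add \<nu>.emeasure_space_1)
    finally have "(\<integral>\<^sup>+x. e2ennreal (- ereal (U_rho R x)) \<partial>\<nu>) = \<infinity>" using inf by (simp add: top_unique)
    with a have "ereal_int \<nu> (\<lambda>x. ereal (U_rho R x)) = - \<infinity>" by (rule ereal_int_MInf)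
    then have "I_functional \<kappa> lam R \<nu> = \<infinity>" using lam_gt by (simp add: I_functional_def)
    with fin show False by simp
  qed
  then have lm: "logmom \<nu>" using p by (auto simp: logmom_def Lg_nonneg intro!: integrableI_nonneg)
  have ac: "absolutely_continuous lborel \<nu>"
  proof (rule ccontr)
    assume "\<not> absolutely_continuous lborel \<nu>"
    then have "I_functional \<kappa> lam R \<nu> = \<infinity>" using \<kappa>_pos by (simp add: I_functional_def entropy_C_def)
    with fin show False by simp
  qed
  define \<phi> where "\<phi> x = enn2real (RN_deriv lborel \<nu> x)" for x
  have [measurable]: "\<phi> \<in> borel_measurable borel" unfolding \<phi>_def[abs_def] by measurable
  have \<phi>0: "\<phi> x \<ge> 0" for x by (simp add: \<phi>_def)
  have "\<nu> = density lborel (RN_deriv lborel \<nu>)"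
    by (rule sigma_finite_measure.density_RN_deriv[OF sigma_finite_lborel, symmetric]) (use ac p in auto)
  also have "\<dots> = density lborel (\<lambda>x. ennreal (\<phi> x))"
  proof (rule density_cong)
    have fm: "finite_measure \<nu>" by (rule \<nu>.finite_measure_axioms)
    obtain D where "AE x in lborel. RN_deriv lborel \<nu> x = ennreal (D x)"
      by (rule sigma_finite_measure.real_RN_deriv[OF sigma_finite_lborel fm ac]) (use p in auto)
    then show "AE x in lborel. RN_deriv lborel \<nu> x = ennreal (\<phi> x)"
      by eventually_elim (simp add: \<phi>_def)
  qed auto
  finally have \<nu>_eq: "\<nu> = density lborel (\<lambda>x. ennreal (\<phi> x))" .
  define f where "f x = \<phi> x / \<Gamma> x" for x
  have [measurable]: "f \<in> borel_measurable borel" unfolding f_def[abs_def] by measurable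
  have f0: "f x \<ge> 0" for x using \<phi>0[of x] \<Gamma>_pos[of x] by (simp add: f_def)
  have \<Gamma>f: "\<Gamma> x * f x = \<phi> x" for x using \<Gamma>_pos[of x] by (simp add: f_def)
  have \<nu>f: "\<nu> = dmeas f" by (simp add: dmeas_lborel \<Gamma>f \<nu>_eq)
  have "dens f"
  proof -
    have "(\<integral>\<^sup>+x. ennreal (f x) \<partial>\<gamma>) = (\<integral>\<^sup>+x. ennreal (\<phi> x) \<partial>lborel)"
      using \<Gamma>_pos by (subst \<gamma>_integral) (auto simp: ennreal_mult'[symmetric] less_imp_le \<Gamma>f)
    also have "\<dots> = emeasure \<nu> (space \<nu>)" unfolding \<nu>_eq by (simp add: emeasure_density)
    finally show ?thesis using f0 by (simp add: dens_def \<nu>.emeasure_space_1 measurable_cong_sets[OF sets_\<gamma> refl])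
  qed
  have Ent_fin: "(\<integral>\<^sup>+x. ennreal (\<phi> x * ln (\<phi> x)) \<partial>lborel) < \<infinity>"
  proof (rule ccontr)
    assume "\<not> ?thesis"
    then have "(\<integral>\<^sup>+x. e2ennreal (let \<phi> = enn2real (RN_deriv lborel \<nu> x) in ereal (\<phi> * ln \<phi>)) \<partial>lborel) = \<infinity>"
      by (simp add: not_less top_unique \<phi>_def Let_def)
    then have "entropy_C \<nu> = \<infinity>" unfolding entropy_C_def if_P[OF ac] by (rule ereal_int_PInf)
    then have "I_functional \<kappa> lam R \<nu> = \<infinity>" using \<kappa>_pos by (simp add: I_functional_def)
    with fin show False by simp
  qed
  have LE_fin: "(\<integral>\<^sup>+p. e2ennreal (case p of (x, y) \<Rightarrow> log_kernel x y) \<partial>(\<nu> \<Otimes>\<^sub>M \<nu>)) < \<infinity>"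
  proof (rule ccontr)
    assume "\<not> ?thesis"
    then have "log_energy \<nu> = \<infinity>" unfolding log_energy_def by (intro ereal_int_PInf) (simp add: not_less top_unique)
    then have "I_functional \<kappa> lam R \<nu> = \<infinity>" by (simp add: I_functional_def)
    with fin show False by simp
  qed
  have "EE f < \<infinity>"
  proof -
    \<comment> \<open>ln \<Gamma> grows at most linearly in \<open>Lg\<close>, so the logarithmic
      moment pays for the change of reference in the entropy.\<close>
    obtain c1 c2 where c: "c1 \<ge> 0" "c2 \<ge> 0" "\<And>x. \<bar>ln (\<Gamma> x)\<bar> \<le> c1 + c2 * Lg x" using ln_\<Gamma>_abs by blast
    have "ennreal (\<Gamma> x) * ennreal (ent (f x) / \<kappa>)
        \<le> ennreal (1 / \<kappa>) * (ennreal (\<phi> x * ln (\<phi> x)) + ennreal (\<phi> x) * (ennreal c1 + ennreal c2 * ennreal (Lg x))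
        + ennreal (\<Gamma> x))" for x
    proof -
      have "\<Gamma> x * ent (f x) = \<phi> x * ln (\<phi> x) - \<phi> x * ln (\<Gamma> x) - \<phi> x + \<Gamma> x"
        using ent_scale[OF \<Gamma>_pos[of x] \<phi>0[of x]] by (simp add: f_def)
      also have "\<dots> \<le> max 0 (\<phi> x * ln (\<phi> x)) + \<phi> x * (c1 + c2 * Lg x) + \<Gamma> x"
      proof -
        have "\<phi> x * (- ln (\<Gamma> x)) \<le> \<phi> x * (c1 + c2 * Lg x)" using c(3)[of x] \<phi>0[of x] by (intro mult_left_mono) auto
        then show ?thesis using \<phi>0[of x] by simp
      qed
      finally have "\<Gamma> x * (ent (f x) / \<kappa>) \<le> 1 / \<kappa> * (max 0 (\<phi> x * ln (\<phi> x)) + \<phi> x * (c1 + c2 * Lg x) + \<Gamma> x)"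
        using \<kappa>_pos by (simp add: divide_right_mono)
      from ennreal_leI[OF this] have "ennreal (\<Gamma> x) * ennreal (ent (f x) / \<kappa>)
          \<le> ennreal (1 / \<kappa>) * (ennreal (max 0 (\<phi> x * ln (\<phi> x))) + ennreal (\<phi> x) * (ennreal c1 + ennreal c2
          * ennreal (Lg x)) + ennreal (\<Gamma> x))"
        using \<kappa>_pos \<phi>0[of x] c Lg_nonneg[of x] \<Gamma>_pos[of x] less_imp_le[OF \<Gamma>_pos[of x]]
        by (simp only: ennreal_mult' ennreal_mult'' ennreal_plus add_nonneg_nonneg mult_nonneg_nonneg max.cobounded1 divide_nonneg_pos zero_le_one)
      also have "ennreal (max 0 (\<phi> x * ln (\<phi> x))) = ennreal (\<phi> x * ln (\<phi> x))"
        by (rule ennreal_max_0)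
      finally show ?thesis .
    qed
    then have "EE f \<le> (\<integral>\<^sup>+x. ennreal (1 / \<kappa>) * (ennreal (\<phi> x * ln (\<phi> x)) + ennreal (\<phi> x) * (ennreal c1 + ennreal c2
        * ennreal (Lg x)) + ennreal (\<Gamma> x)) \<partial>lborel)"
      unfolding EE_def by (subst \<gamma>_integral) (auto intro!: nn_integral_mono)
    also have "\<dots> = ennreal (1 / \<kappa>) * ((\<integral>\<^sup>+x. ennreal (\<phi> x * ln (\<phi> x)) \<partial>lborel) + (\<integral>\<^sup>+x. ennreal (\<phi> x) * (ennreal c1
        + ennreal c2 * ennreal (Lg x)) \<partial>lborel) + 1)"
      by (simp add: nn_integral_cmult nn_integral_add \<Gamma>_integral)
    also have "(\<integral>\<^sup>+x. ennreal (\<phi> x) * (ennreal c1 + ennreal c2 * ennreal (Lg x)) \<partial>lborel)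
        = (\<integral>\<^sup>+x. ennreal c1 + ennreal c2 * ennreal (Lg x) \<partial>\<nu>)"
      unfolding \<nu>_eq by (subst nn_integral_density) auto
    also have "\<dots> = ennreal c1 + ennreal c2 * (\<integral>\<^sup>+x. ennreal (Lg x) \<partial>\<nu>)"
      by (simp add: nn_integral_add nn_integral_cmult \<nu>.emeasure_space_1)
    finally show ?thesis
      using Ent_fin L_fin by (simp add: le_less_trans ennreal_mult_less_top)
  qed
  moreover have "KK f f < \<infinity>"
  proof -
    have "KK f f = (\<integral>\<^sup>+p. ennreal (log_kern (fst p) (snd p)) \<partial>(\<nu> \<Otimes>\<^sub>M \<nu>))"
      unfolding KK_dmeas[OF \<open>f \<in> borel_measurable borel\<close> \<open>f \<in> borel_measurable borel\<close>] \<nu>f[symmetric]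
      by (subst \<nu>.nn_integral_fst[symmetric]) auto
    also have "\<dots> \<le> (\<integral>\<^sup>+p. 1 + ennreal (Lg (fst p)) + ennreal (Lg (snd p))
        + e2ennreal (case p of (x, y) \<Rightarrow> log_kernel x y) \<partial>(\<nu> \<Otimes>\<^sub>M \<nu>))"
    proof (intro nn_integral_mono)
      fix p :: "complex \<times> complex"
      obtain x y where p: "p = (x, y)" by (cases p)
      show "ennreal (log_kern (fst p) (snd p))
          \<le> 1 + ennreal (Lg (fst p)) + ennreal (Lg (snd p)) + e2ennreal (case p of (x, y) \<Rightarrow> log_kernel x y)"
      proof (cases "x = y")
        case False
        have "log_kern x y \<le> (1 + Lg x + Lg y) + max 0 (- ln (cmod (x - y)))" by (simp add: log_kern_def)
        from ennreal_leI[OF this] have "ennreal (log_kern x y)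
            \<le> 1 + ennreal (Lg x) + ennreal (Lg y) + ennreal (max 0 (- ln (cmod (x - y))))"
          using Lg_nonneg[of x] Lg_nonneg[of y]
              by (simp only: ennreal_plus add_nonneg_nonneg zero_le_one max.cobounded1 ennreal_1)
        also have "ennreal (max 0 (- ln (cmod (x - y)))) = ennreal (- ln (cmod (x - y)))" by (rule ennreal_max_0)
        finally show ?thesis using False by (simp add: p log_kernel_def)
      qed (simp add: p log_kernel_def)
    qed
    also have "\<dots> = 1 + (\<integral>\<^sup>+p. ennreal (Lg (fst p)) \<partial>(\<nu> \<Otimes>\<^sub>M \<nu>)) + (\<integral>\<^sup>+p. ennreal (Lg (snd p)) \<partial>(\<nu> \<Otimes>\<^sub>M \<nu>))
        + (\<integral>\<^sup>+p. e2ennreal (case p of (x, y) \<Rightarrow> log_kernel x y) \<partial>(\<nu> \<Otimes>\<^sub>M \<nu>))"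
    proof -
      interpret \<nu>\<nu>: pair_prob_space \<nu> \<nu> ..
      have [measurable]: "(\<lambda>p. e2ennreal (case p of (x, y) \<Rightarrow> log_kernel x y)) \<in> borel_measurable (\<nu> \<Otimes>\<^sub>M \<nu>)"
        unfolding log_kernel_def by measurable
      show ?thesis by (simp add: nn_integral_add \<nu>\<nu>.P.emeasure_space_1)
    qed
    also have "\<dots> < \<infinity>"
    proof -
      have L: "integrable \<nu> Lg" using lm by (simp add: logmom_def)
      have "integrable (\<nu> \<Otimes>\<^sub>M \<nu>) (\<lambda>p. Lg (fst p))" "integrable (\<nu> \<Otimes>\<^sub>M \<nu>) (\<lambda>p. Lg (snd p))"
        using has_bochner_integral_marginals[OF p(1) p(1)] L by (auto simp: has_bochner_integral_iff)
      then show ?thesis using LE_fin by (simp add: nn_integral_eq_integral Lg_nonneg)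
    qed
    finally show ?thesis .
  qed
  ultimately have "J f < \<infinity>" unfolding J_finite by simp
  with \<open>dens f\<close> \<nu>f show ?thesis by blast
qed

section \<open>The equilibrium measure\<close>

text \<open>The sign is that of ln, opposite to the potential U: \<open>U_rho R\<close> is
  \<open>- wpot disc\<close>.\<close>

definition wpot :: "(complex \<Rightarrow> real) \<Rightarrow> complex \<Rightarrow> real" where
  "wpot m x = (\<integral>y. ln (cmod (x - y)) * m y \<partial>lborel)"

lemma measurable_wpot [measurable]:
  assumes [measurable]: "m \<in> borel_measurable borel"
  shows "wpot m \<in> borel_measurable borel"
  unfolding wpot_def[abs_def] by measurable

text \<open>The Gibbs formula for the minimizer f is known almost everywhere. Its right-hand side,
  read at every point, defines a version \<phi> of the Lebesgue density that is positive everywhere,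
  inherits the decay of \<Gamma> and satisfies the Euler--Lagrange equation without exceptional
  set.\<close>

theorem equilibrium_exists:
  "\<exists>\<phi> c C f. \<phi> \<in> borel_measurable borel \<and> (\<forall>x. \<phi> x > 0) \<and> (\<forall>x. \<phi> x \<le> C * exp (- pexp * Lg x))
     \<and> (\<integral>\<^sup>+x. ennreal (\<phi> x) \<partial>lborel) = 1 \<and> (\<integral>\<^sup>+x. ennreal (Lg x * \<phi> x) \<partial>lborel) < \<infinity>
     \<and> (\<forall>x. ln (\<phi> x) = \<kappa> * wpot \<phi> x + \<kappa> * lam * U_rho R x + c)
     \<and> dens f \<and> J f < \<infinity> \<and> (\<forall>g. dens g \<longrightarrow> J f \<le> J g) \<and> dmeas f = density lborel (\<lambda>x. ennreal (\<phi> x))"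
proof -
  obtain f where f: "dens f" "J f < \<infinity>" "\<And>g. dens g \<Longrightarrow> J f \<le> J g" using minimizer_exists by blast
  have EEf: "EE f < \<infinity>" using f(2) unfolding J_finite by auto
  have [measurable]: "f \<in> borel_measurable borel" by (rule dens_measurable[OF f(1)])
  have nn: "f x \<ge> 0" for x using f(1) by (simp add: dens_def)
  obtain Z where Z: "Z > 0" "AE x in \<gamma>. f x = (if pot f x = \<infinity> then 0 else exp (- \<kappa> * enn2real (pot f x)) / Z)"
    using minimizer_gibbs[OF f] by blast
  define m where "m x = \<Gamma> x * f x" for x
  have [measurable]: "m \<in> borel_measurable borel" unfolding m_def[abs_def] by measurable
  have m0: "m x \<ge> 0" for x using nn[of x] \<Gamma>_pos[of x] by (simp add: m_def)
  \<comment> \<open>The potential is non-negative, so f \<le> 1/Z and the minimizer is bounded; in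
    turn its potential is finite at every point.\<close>
  define B where "B = C\<Gamma> / Z"
  have B: "B > 0" using C\<Gamma>_pos Z by (simp add: B_def)
  have mB: "AE x in lborel. m x \<le> B"
    using Z(2) unfolding AE_\<gamma>
  proof eventually_elim
    fix x assume fx: "f x = (if pot f x = \<infinity> then 0 else exp (- \<kappa> * enn2real (pot f x)) / Z)"
    have "exp (- \<kappa> * enn2real (pot f x)) \<le> 1" using \<kappa>_pos by simp
    then have "f x \<le> 1 / Z" using fx Z(1) by (auto simp: divide_right_mono)
    then have "m x \<le> C\<Gamma> * (1 / Z)" unfolding m_def using \<Gamma>_le'[of x] \<Gamma>_pos[of x] nn[of x] C\<Gamma>_pos by (intro mult_mono) auto
    then show "m x \<le> B" by (simp add: B_def)
  qed
  have nn_m: "(\<integral>\<^sup>+x. h x * ennreal (f x) \<partial>\<gamma>) = (\<integral>\<^sup>+x. h x * ennreal (m x) \<partial>lborel)" if "h \<in> borel_measurable borel" for h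
    using that \<Gamma>_pos nn by (subst \<gamma>_integral) (auto intro!: nn_integral_cong simp: m_def ennreal_mult less_imp_le ac_simps)
  have m_int: "(\<integral>\<^sup>+x. ennreal (m x) \<partial>lborel) = 1" using nn_m[of "\<lambda>_. 1"] f(1) by (simp add: dens_def)
  have "(\<integral>\<^sup>+x. ennreal (Lg x * m x) \<partial>lborel) = (\<integral>\<^sup>+x. ennreal (Lg x * f x) \<partial>\<gamma>)"
    using nn_m[of "\<lambda>x. ennreal (Lg x)"] m0 nn Lg_nonneg by (simp add: ennreal_mult)
  with dens_logmom(1)[OF f(1) EEf] have "(\<integral>\<^sup>+x. ennreal (Lg x * m x) \<partial>lborel) < \<infinity>" by simp
  then obtain l where l: "l \<ge> 0" "(\<integral>\<^sup>+x. ennreal (Lg x * m x) \<partial>lborel) = ennreal l"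
    by (metis ennreal_cases infinity_ennreal_def less_irrefl)
  have pot_m: "pot f x = (\<integral>\<^sup>+y. ennreal (log_kern x y) * ennreal (m y) \<partial>lborel)" for x
    unfolding pot_def by (rule nn_m) measurable
  have pot_le: "pot f x \<le> ennreal (3 + 2 * l + B * (pi / 2))" for x
    unfolding pot_m using B by (intro log_kern_potential_bound m0 mB m_int l) auto
  define P where "P x = enn2real (pot f x)" for x
  have pot_P: "pot f x = ennreal (P x)" for x
    using le_less_trans[OF pot_le[of x] ennreal_less_top] by (simp add: P_def less_top)
  have P0: "P x \<ge> 0" for x by (simp add: P_def)
  have [measurable]: "P \<in> borel_measurable borel"
    unfolding P_def[abs_def] using measurable_pot[of f] f(1)
    by (simp add: dens_def measurable_cong_sets[OF sets_\<gamma> refl])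
  define \<phi> where "\<phi> x = \<Gamma> x * exp (- \<kappa> * P x) / Z" for x
  have [measurable]: "\<phi> \<in> borel_measurable borel" unfolding \<phi>_def[abs_def] by measurable
  have \<phi>_pos: "\<phi> x > 0" for x using \<Gamma>_pos[of x] Z by (simp add: \<phi>_def)
  have \<phi>m: "AE x in lborel. \<phi> x = m x"
    using Z(2) unfolding AE_\<gamma>
  proof eventually_elim
    fix x assume fx: "f x = (if pot f x = \<infinity> then 0 else exp (- \<kappa> * enn2real (pot f x)) / Z)"
    have "pot f x \<noteq> \<infinity>" unfolding pot_P by simp
    then show "\<phi> x = m x" using fx by (simp add: \<phi>_def m_def P_def)
  qed
  have \<phi>_le: "\<phi> x \<le> B * exp (- pexp * Lg x)" for x
  proof -
    have "exp (- \<kappa> * P x) \<le> 1" using \<kappa>_pos P0[of x] by simp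
    then have "\<Gamma> x * exp (- \<kappa> * P x) \<le> (C\<Gamma> * exp (- pexp * Lg x)) * 1"
      using \<Gamma>_le[of x] \<Gamma>_pos[of x] C\<Gamma>_pos by (intro mult_mono) auto
    from divide_right_mono[OF this, of Z] show ?thesis using Z by (simp add: \<phi>_def B_def)
  qed
  have \<phi>_leB: "\<phi> x \<le> B" for x
  proof -
    have "exp (- pexp * Lg x) \<le> 1" using pexp Lg_nonneg[of x] by simp
    then have "B * exp (- pexp * Lg x) \<le> B * 1" using B by (intro mult_left_mono) auto
    then show ?thesis using \<phi>_le[of x] by simp
  qed
  have \<phi>_int: "(\<integral>\<^sup>+x. ennreal (\<phi> x) \<partial>lborel) = 1"
    unfolding m_int[symmetric] by (rule nn_integral_cong_AE) (use \<phi>m in eventually_elim, simp)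
  have \<phi>_L: "(\<integral>\<^sup>+x. ennreal (Lg x * \<phi> x) \<partial>lborel) = ennreal l"
    unfolding l(2)[symmetric] by (rule nn_integral_cong_AE) (use \<phi>m in eventually_elim, simp)
  have "dmeas f = density lborel (\<lambda>x. ennreal (m x))" unfolding m_def by (rule dmeas_lborel) measurable
  also have "\<dots> = density lborel (\<lambda>x. ennreal (\<phi> x))"
    by (rule density_cong) (use \<phi>m in \<open>auto elim: eventually_mono\<close>)
  finally have dm: "dmeas f = density lborel (\<lambda>x. ennreal (\<phi> x))" .
  have i1: "has_bochner_integral lborel \<phi> 1"
    using \<phi>_int \<phi>_pos by (intro has_bochner_integral_nn_integral) (auto simp: less_imp_le)
  have i2: "has_bochner_integral lborel (\<lambda>x. Lg x * \<phi> x) l"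
    using \<phi>_L \<phi>_pos l(1) by (intro has_bochner_integral_nn_integral) (auto simp: less_imp_le Lg_nonneg)
  have ln_i: "integrable lborel (\<lambda>y. ln (cmod (x - y)) * \<phi> y)" for x
    using log_potential_bound[of \<phi> B] \<phi>_pos \<phi>_leB \<phi>_int \<phi>_L by (auto simp: less_imp_le)
  \<comment> \<open>Expands \<open>log_kern\<close> under the integral; l is the logarithmic moment
    of \<phi>.\<close>
  have PW: "P x = 1 + Lg x + l - wpot \<phi> x" for x
  proof -
    have h: "has_bochner_integral lborel (\<lambda>y. (1 + Lg x) * \<phi> y + Lg y * \<phi> y - ln (cmod (x - y)) * \<phi> y) ((1 + Lg x)
        * 1 + l - wpot \<phi> x)"
      by (intro has_bochner_integral_add has_bochner_integral_diff has_bochner_integral_mult_right i1 i2)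
         (simp add: has_bochner_integral_iff ln_i wpot_def)
    have eq: "(1 + Lg x) * \<phi> y + Lg y * \<phi> y - ln (cmod (x - y)) * \<phi> y = log_kern x y * \<phi> y" for y
      by (simp add: log_kern_def algebra_simps)
    have k0: "0 \<le> log_kern x y" for y using log_kern_ge[of x y] by simp
    have "pot f x = (\<integral>\<^sup>+y. ennreal (log_kern x y * \<phi> y) \<partial>lborel)"
      unfolding pot_m by (rule nn_integral_cong_AE) (use \<phi>m in \<open>eventually_elim, simp add: ennreal_mult' k0\<close>)
    also have "\<dots> = ennreal ((1 + Lg x) * 1 + l - wpot \<phi> x)"
      using h k0 \<phi>_pos unfolding eq by (subst nn_integral_eq_integral) (auto simp: has_bochner_integral_iff less_imp_le)
    finally have "ennreal (P x) = ennreal ((1 + Lg x) * 1 + l - wpot \<phi> x)" by (simp add: pot_P)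
    moreover have "0 \<le> (1 + Lg x) * 1 + l - wpot \<phi> x"
    proof -
      have "0 \<le> (\<integral>y. log_kern x y * \<phi> y \<partial>lborel)"
        using k0 \<phi>_pos by (intro Bochner_Integration.integral_nonneg) (auto simp: less_imp_le)
      then show ?thesis using h unfolding eq by (simp add: has_bochner_integral_iff)
    qed
    ultimately show ?thesis using P0[of x] by simp
  qed
  define c where "c = - ln Z0 - \<kappa> * (1 + l) - ln Z"
  have EL: "ln (\<phi> x) = \<kappa> * wpot \<phi> x + \<kappa> * lam * U_rho R x + c" for x
  proof -
    have "ln (\<phi> x) = ln (\<Gamma> x) - \<kappa> * P x - ln Z" using \<Gamma>_pos[of x] Z by (simp add: \<phi>_def ln_mult ln_div)
    then show ?thesis unfolding ln_\<Gamma> PW c_def by (simp add: algebra_simps)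
  qed
  show ?thesis
    using \<phi>_pos \<phi>_le \<phi>_int \<phi>_L EL f dm by (intro exI[of _ \<phi>] exI[of _ c] exI[of _ B] exI[of _ f]) auto
qed

text \<open>Collects the regularity, the decay and the Euler--Lagrange equation on which the
  differential equation and the particle estimates rest.\<close>

definition is_equilibrium :: "(complex \<Rightarrow> real) \<Rightarrow> real \<Rightarrow> bool" where
  "is_equilibrium \<phi> c \<longleftrightarrow> \<phi> \<in> borel_measurable borel \<and> (\<forall>x. \<phi> x > 0) \<and> (\<exists>C. \<forall>x. \<phi> x \<le> C * exp (- pexp * Lg x))
     \<and> (\<integral>\<^sup>+x. ennreal (\<phi> x) \<partial>lborel) = 1 \<and> (\<integral>\<^sup>+x. ennreal (Lg x * \<phi> x) \<partial>lborel) < \<infinity>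
     \<and> (\<forall>x. ln (\<phi> x) = \<kappa> * wpot \<phi> x + \<kappa> * lam * U_rho R x + c)"

text \<open>Every measure with a value other than infinity comes from a density relative to
  \<gamma>, where the functional is J plus a constant; minimality and uniqueness are transferred
  from J.\<close>

theorem equilibrium_minimizer:
  "\<exists>\<phi> c. is_equilibrium \<phi> c \<and> is_minimizer \<kappa> lam R (density lborel (\<lambda>x. ennreal (\<phi> x)))
     \<and> (\<forall>\<nu>. is_minimizer \<kappa> lam R \<nu> \<longrightarrow> \<nu> = density lborel (\<lambda>x. ennreal (\<phi> x)))"
proof -
  obtain \<phi> c C f where \<phi>: "\<phi> \<in> borel_measurable borel" "\<And>x. \<phi> x > 0" "\<And>x. \<phi> x \<le> C * exp (- pexp * Lg x)"
     "(\<integral>\<^sup>+x. ennreal (\<phi> x) \<partial>lborel) = 1" "(\<integral>\<^sup>+x. ennreal (Lg x * \<phi> x) \<partial>lborel) < \<infinity>"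
     "\<And>x. ln (\<phi> x) = \<kappa> * wpot \<phi> x + \<kappa> * lam * U_rho R x + c"
     and f: "dens f" "J f < \<infinity>" "\<And>g. dens g \<Longrightarrow> J f \<le> J g" "dmeas f = density lborel (\<lambda>x. ennreal (\<phi> x))"
    by (insert equilibrium_exists, elim exE conjE, rule that) auto
  have EEf: "EE f < \<infinity>" using f(2) unfolding J_finite by auto
  have mem: "dmeas f \<in> prob_measures_C"
    using dens_logmom(2)[OF f(1) EEf] by (simp add: prob_measures_C_def logmom_def)
  have If: "I_functional \<kappa> lam R (dmeas f) = ereal (enn2real (J f) + c0)" by (rule I_functional_dmeas[OF f(1,2)])
  have min: "is_minimizer \<kappa> lam R (dmeas f)"
    unfolding is_minimizer_def
  proof (intro conjI ballI mem)
    fix \<nu> assume \<nu>: "\<nu> \<in> prob_measures_C"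
    show "I_functional \<kappa> lam R (dmeas f) \<le> I_functional \<kappa> lam R \<nu>"
    proof (cases "I_functional \<kappa> lam R \<nu> = \<infinity>")
      case False
      obtain h where h: "dens h" "J h < \<infinity>" "\<nu> = dmeas h" using I_functional_infinite[OF \<nu> False] by blast
      have "enn2real (J f) \<le> enn2real (J h)" using f(3)[OF h(1)] h(2) by (intro enn2real_mono) auto
      then show ?thesis unfolding h(3) If I_functional_dmeas[OF h(1,2)] by simp
    qed simp
  qed
  have uniq: "\<nu> = dmeas f" if "is_minimizer \<kappa> lam R \<nu>" for \<nu>
  proof -
    have \<nu>: "\<nu> \<in> prob_measures_C" and le: "I_functional \<kappa> lam R \<nu> \<le> I_functional \<kappa> lam R (dmeas f)"
      using that mem by (auto simp: is_minimizer_def)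
    then have "I_functional \<kappa> lam R \<nu> \<noteq> \<infinity>" unfolding If by auto
    then obtain h where h: "dens h" "J h < \<infinity>" "\<nu> = dmeas h" using I_functional_infinite[OF \<nu>] by blast
    have "enn2real (J h) \<le> enn2real (J f)" using le unfolding h(3) If I_functional_dmeas[OF h(1,2)] by simp
    from ennreal_leI[OF this] have "J h \<le> J f"
      unfolding ennreal_enn2real[OF h(2)[unfolded infinity_ennreal_def]] ennreal_enn2real[OF f(2)[unfolded infinity_ennreal_def]] .
    from minimizer_unique[OF f(1,2) f(3) h(1) this] have "AE x in \<gamma>. h x = f x" .
    then show ?thesis
      unfolding h(3) dmeas_def using h(1) f(1) by (intro density_cong) (auto simp: dens_def elim: eventually_mono)
  qed
  show ?thesis
    using \<phi> min uniq unfolding f(4) is_equilibrium_def by blast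
qed

text \<open>The Euler--Lagrange equation expresses ln \<phi> by the potentials of \<phi> and of the
  disc plus a constant. Testing with a Laplacian turns each potential into 2 pi times its density
  and removes the constant.\<close>

theorem equilibrium_pde:
  assumes eq: "is_equilibrium \<phi> c" and g: "test_fun S g"
  shows "integrable lborel (\<lambda>z. ln (\<phi> z) * laplacian g z)"
    and "(\<integral>z. ln (\<phi> z) * laplacian g z \<partial>lborel)
       = 2 * pi * \<kappa> * (\<integral>z. (\<phi> z - lam * indicator (cball 0 R) z / (pi * R\<^sup>2)) * g z \<partial>lborel)"
proof -
  have [measurable]: "\<phi> \<in> borel_measurable borel" and \<phi>: "\<And>x. \<phi> x > 0" "(\<integral>\<^sup>+x. ennreal (\<phi> x) \<partial>lborel)
      = 1" "(\<integral>\<^sup>+x. ennreal (Lg x * \<phi> x) \<partial>lborel) < \<infinity>"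
     and EL: "\<And>x. ln (\<phi> x) = \<kappa> * wpot \<phi> x + \<kappa> * lam * U_rho R x + c" using eq by (auto simp: is_equilibrium_def)
  have C2: "C2_fun g" using g by (simp add: test_fun_def)
  have "bounded (closure {z. g z \<noteq> 0})" using g by (auto simp: test_fun_def intro: compact_imp_bounded)
  then obtain B where B: "\<And>z. z \<in> closure {z. g z \<noteq> 0} \<Longrightarrow> norm z \<le> B" by (auto simp: bounded_iff)
  have supp: "g z = 0" if "B < cmod z" for z
    using B[of z] that closure_subset[of "{z. g z \<noteq> 0}"] by fastforce
  have i1: "has_bochner_integral lborel (\<lambda>x. wpot \<phi> x * laplacian g x) (2 * pi * (\<integral>y. \<phi> y * g y \<partial>lborel))"
    unfolding wpot_def using \<phi> by (intro potential_laplacian[OF C2 supp]) (auto simp: less_imp_le)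
  have i2: "has_bochner_integral lborel (\<lambda>x. wpot disc x * laplacian g x) (2 * pi * (\<integral>y. disc y * g y \<partial>lborel))"
    unfolding wpot_def using disc_moment by (intro potential_laplacian[OF C2 supp]) (auto simp: disc_nonneg disc_integral)
  have i3: "has_bochner_integral lborel (laplacian g) 0"
    using integrable_compact_support[OF cont_laplacian[OF C2 supp] laplacian_zero[OF C2 supp]] integral_laplacian[OF C2 supp]
    by (simp add: has_bochner_integral_iff)
  have "has_bochner_integral lborel (\<lambda>x. \<kappa> * (wpot \<phi> x * laplacian g x) - \<kappa> * lam * (wpot disc x * laplacian g x)
      + c * laplacian g x)
     (\<kappa> * (2 * pi * (\<integral>y. \<phi> y * g y \<partial>lborel)) - \<kappa> * lam * (2 * pi * (\<integral>y. disc y * g y \<partial>lborel)) + c * 0)"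
    by (intro has_bochner_integral_add has_bochner_integral_diff has_bochner_integral_mult_right i1 i2 i3)
  moreover have "\<kappa> * (wpot \<phi> x * laplacian g x) - \<kappa> * lam * (wpot disc x * laplacian g x) + c * laplacian g x
      = ln (\<phi> x) * laplacian g x" for x
    unfolding EL U_rho_eq wpot_def by (simp add: algebra_simps)
  ultimately have h: "has_bochner_integral lborel (\<lambda>x. ln (\<phi> x) * laplacian g x)
     (\<kappa> * (2 * pi * (\<integral>y. \<phi> y * g y \<partial>lborel)) - \<kappa> * lam * (2 * pi * (\<integral>y. disc y * g y \<partial>lborel)))" by simp
  then show "integrable lborel (\<lambda>z. ln (\<phi> z) * laplacian g z)" by (simp add: has_bochner_integral_iff)
  have cg: "continuous_on UNIV g" by (rule cont_g(1)[OF C2 supp])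
  have [measurable]: "g \<in> borel_measurable borel" by (rule borel_measurable_continuous_onI[OF cg])
  obtain M where M: "\<And>z. \<bar>g z\<bar> \<le> M" using g_bound[OF C2 supp] by blast
  have mg: "integrable lborel (\<lambda>z. m z * g z)" if [measurable]: "m \<in> borel_measurable borel" and m: "\<And>x. 0
      \<le> m x" "(\<integral>\<^sup>+x. ennreal (m x) \<partial>lborel) = 1" for m
  proof (rule Bochner_Integration.integrable_bound[of _ "\<lambda>z. m z * M"])
    have "integrable lborel m" using m by (intro integrableI_nonneg) auto
    then show "integrable lborel (\<lambda>z. m z * M)" by simp
    show "AE z in lborel. norm (m z * g z) \<le> norm (m z * M)"
    proof (rule AE_I2)
      fix z show "norm (m z * g z) \<le> norm (m z * M)"
        using M[of z] m(1)[of z] by (simp add: abs_mult mult_left_mono)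
    qed
  qed measurable
  have "(\<integral>z. (\<phi> z - lam * indicator (cball 0 R) z / (pi * R\<^sup>2)) * g z \<partial>lborel)
      = (\<integral>z. \<phi> z * g z - lam * (disc z * g z) \<partial>lborel)"
    by (intro Bochner_Integration.integral_cong refl) (simp add: disc_def algebra_simps)
  also have "\<dots> = (\<integral>y. \<phi> y * g y \<partial>lborel) - lam * (\<integral>y. disc y * g y \<partial>lborel)"
    using mg[of \<phi>] mg[of disc] \<phi> disc_nonneg disc_integral by (simp add: less_imp_le)
  finally have rhs: "(\<integral>z. (\<phi> z - lam * indicator (cball 0 R) z / (pi * R\<^sup>2)) * g z \<partial>lborel)
     = (\<integral>y. \<phi> y * g y \<partial>lborel) - lam * (\<integral>y. disc y * g y \<partial>lborel)" .
  show "(\<integral>z. ln (\<phi> z) * laplacian g z \<partial>lborel)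
       = 2 * pi * \<kappa> * (\<integral>z. (\<phi> z - lam * indicator (cball 0 R) z / (pi * R\<^sup>2)) * g z \<partial>lborel)"
    unfolding rhs has_bochner_integral_integral_eq[OF h] by (simp add: algebra_simps)
qed

end

section \<open>Modulated energy of empirical measures\<close>

lemma PiM_density:
  fixes f :: "'a \<Rightarrow> ennreal"
  assumes M: "sigma_finite_measure M" and [measurable]: "f
      \<in> borel_measurable M" and d: "prob_space (density M f)" and I: "finite I"
  shows "PiM I (\<lambda>_. density M f) = density (PiM I (\<lambda>_. M)) (\<lambda>x. \<Prod>i\<in>I. f (x i))"
proof -
  interpret M: sigma_finite_measure M by fact
  interpret P: product_sigma_finite "\<lambda>_. M" by standard
  interpret d: prob_space "density M f" by fact
  interpret D: product_sigma_finite "\<lambda>_. density M f" by standard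
  show ?thesis
  proof (rule D.PiM_eqI[symmetric, OF I])
    show "sets (density (PiM I (\<lambda>_. M)) (\<lambda>x. \<Prod>i\<in>I. f (x i))) = sets (PiM I (\<lambda>_. density M f))"
      by (simp cong: sets_PiM_cong)
    fix A assume A: "\<And>i. i \<in> I \<Longrightarrow> A i \<in> sets (density M f)"
    have [measurable]: "(\<lambda>x. \<Prod>i\<in>I. f (x i)) \<in> borel_measurable (PiM I (\<lambda>_. M))"
      by (intro borel_measurable_prod_ennreal measurable_compose[OF measurable_component_singleton]) auto
    have "Pi\<^sub>E I A \<in> sets (PiM I (\<lambda>_. M))" using A I by (intro sets_PiM_I_finite) auto
    then have "emeasure (density (PiM I (\<lambda>_. M)) (\<lambda>x. \<Prod>i\<in>I. f (x i))) (Pi\<^sub>E I A)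
        = (\<integral>\<^sup>+x. (\<Prod>i\<in>I. f (x i)) * indicator (Pi\<^sub>E I A) x \<partial>PiM I (\<lambda>_. M))"
      by (simp add: emeasure_density)
    also have "\<dots> = (\<integral>\<^sup>+x. (\<Prod>i\<in>I. f (x i) * indicator (A i) (x i)) \<partial>PiM I (\<lambda>_. M))"
    proof (intro nn_integral_cong)
      fix x assume "x \<in> space (PiM I (\<lambda>_. M))"
      then have "indicator (Pi\<^sub>E I A) x = (\<Prod>i\<in>I. indicator (A i) (x i) :: ennreal)"
        using I by (auto simp: indicator_def space_PiM PiE_iff prod_zero_iff)
      then show "(\<Prod>i\<in>I. f (x i)) * indicator (Pi\<^sub>E I A) x = (\<Prod>i\<in>I. f (x i) * indicator (A i) (x i))"
        by (simp add: prod.distrib)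
    qed
    also have "\<dots> = (\<Prod>i\<in>I. \<integral>\<^sup>+x. f x * indicator (A i) x \<partial>M)"
      using A by (intro P.product_nn_integral_prod[OF I]) auto
    also have "\<dots> = (\<Prod>i\<in>I. emeasure (density M f) (A i))"
      using A by (intro prod.cong) (auto simp: emeasure_density)
    finally show "emeasure (density (PiM I (\<lambda>_. M)) (\<lambda>x. \<Prod>i\<in>I. f (x i))) (Pi\<^sub>E I A) = (\<Prod>i\<in>I. emeasure (density M f) (A i))" .
  qed
qed

text \<open>Two distinct coordinates are independent with law M; this evaluates the pair interaction
  under a product measure.\<close>

lemma distr_PiM_pair:
  assumes M: "prob_space M" and ij: "i \<in> I" "j \<in> I" "i \<noteq> j"
  shows "distr (PiM I (\<lambda>_. M)) (M \<Otimes>\<^sub>M M) (\<lambda>x. (x i, x j)) = M \<Otimes>\<^sub>M M"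
proof -
  interpret M: prob_space M by fact
  interpret P: product_prob_space "\<lambda>_. M" I by standard
  have [measurable]: "(\<lambda>x. (x i, x j)) \<in> measurable (PiM I (\<lambda>_. M)) (M \<Otimes>\<^sub>M M)"
    using ij by (intro measurable_Pair measurable_component_singleton)
  show ?thesis
  proof (rule pair_measure_eqI[symmetric])
    fix A B assume AB: "A \<in> sets M" "B \<in> sets M"
    have "(\<lambda>x. (x i, x j)) -` (A \<times> B) \<inter> space (PiM I (\<lambda>_. M)) = {x \<in> space (PiM I (\<lambda>_. M)). \<forall>k\<in>{i, j}. x k \<in> (if k
        = i then A else B)}"
      using ij by auto
    then have "emeasure (distr (PiM I (\<lambda>_. M)) (M \<Otimes>\<^sub>M M) (\<lambda>x. (x i, x j))) (A \<times> B)
        = emeasure (PiM I (\<lambda>_. M)) {x \<in> space (PiM I (\<lambda>_. M)). \<forall>k\<in>{i, j}. x k \<in> (if k = i then A else B)}"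
      using AB by (subst emeasure_distr) auto
    also have "\<dots> = (\<Prod>k\<in>{i, j}. emeasure M (if k = i then A else B))"
      using ij AB by (intro P.emeasure_PiM_Collect) auto
    also have "\<dots> = emeasure M A * emeasure M B" using ij by auto
    finally show "emeasure M A * emeasure M B = emeasure (distr (PiM I (\<lambda>_. M)) (M \<Otimes>\<^sub>M M) (\<lambda>x. (x i, x j))) (A \<times> B)" ..
  qed (auto simp: M.sigma_finite_measure_axioms)
qed

text \<open>The tangent line of exp at the mean of H lies below exp. The extended integral on the
  right admits the value infinity.\<close>

lemma jensen_exp:
  assumes "prob_space M" and H: "integrable M H"
  shows "ennreal (exp (\<integral>x. H x \<partial>M)) \<le> (\<integral>\<^sup>+x. ennreal (exp (H x)) \<partial>M)"
proof -
  interpret prob_space M by fact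
  define m where "m = (\<integral>x. H x \<partial>M)"
  define g where "g x = exp m * (1 + (H x - m))" for x
  have g: "integrable M g" "(\<integral>x. g x \<partial>M) = exp m"
    unfolding g_def using H by (simp_all add: m_def prob_space)
  have le: "g x \<le> exp (H x)" for x
  proof -
    have "exp m * (1 + (H x - m)) \<le> exp m * exp (H x - m)" by (intro mult_left_mono exp_ge_add_one_self) auto
    then show ?thesis by (simp add: g_def exp_add[symmetric])
  qed
  \<comment> \<open>The tangent may be negative, so its positive part is carried over to the
    extended integral.\<close>
  have "exp m \<le> (\<integral>x. max 0 (g x) \<partial>M)"
    unfolding g(2)[symmetric] using g(1) by (intro integral_mono) auto
  then have "ennreal (exp m) \<le> ennreal (\<integral>x. max 0 (g x) \<partial>M)" by (rule ennreal_leI)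
  also have "\<dots> = (\<integral>\<^sup>+x. ennreal (max 0 (g x)) \<partial>M)"
    using g(1) by (intro nn_integral_eq_integral[symmetric]) auto
  also have "\<dots> \<le> (\<integral>\<^sup>+x. ennreal (exp (H x)) \<partial>M)"
    using le by (intro nn_integral_mono ennreal_leI) (simp add: max_def)
  finally show ?thesis by (simp add: m_def)
qed

lemma reg_energy_iterated:
  assumes "logmom \<mu>" "logmom \<nu>" "S \<ge> 1"
  shows "reg_energy S \<mu> \<nu> = (\<integral>x. \<integral>y. reg S (cmod (x - y)) \<partial>\<nu> \<partial>\<mu>)"
proof -
  interpret \<mu>: prob_space \<mu> using assms by (simp add: logmom_def)
  interpret \<nu>: prob_space \<nu> using assms by (simp add: logmom_def)
  interpret pair_prob_space \<mu> \<nu> ..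
  have "integrable (\<mu> \<Otimes>\<^sub>M \<nu>) (\<lambda>(x, y). reg S (cmod (x - y)))"
    using reg_energy_fubini(1)[OF assms] by (simp add: case_prod_unfold)
  from integral_fst[OF this] show ?thesis by (simp add: reg_energy_def case_prod_unfold)
qed

text \<open>\<open>empirical\<close> lives on the sigma-algebra of all subsets; this copy on the
  Borel sets satisfies \<open>logmom\<close> and can be paired with the equilibrium measure.\<close>

definition emp :: "nat \<Rightarrow> (nat \<Rightarrow> complex) \<Rightarrow> complex measure" where
  "emp n x = distr (measure_pmf (pmf_of_set {..<n})) borel x"

lemma emp_integral:
  fixes f :: "complex \<Rightarrow> real"
  assumes "n > 0" "f \<in> borel_measurable borel"
  shows "(\<integral>z. f z \<partial>emp n x) = (\<Sum>i<n. f (x i)) / real n"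
  unfolding emp_def using assms integral_pmf_of_set[of "{..<n}"] by (subst integral_distr) (auto simp: lessThan_empty_iff)

lemma empirical_integral:
  fixes f :: "complex \<Rightarrow> real"
  assumes "n > 0"
  shows "(\<integral>z. f z \<partial>empirical n x) = (\<Sum>i<n. f (x i)) / real n"
  unfolding empirical_def using assms integral_pmf_of_set[of "{..<n}"] by (simp add: lessThan_empty_iff)

lemma emp_logmom:
  assumes "n > 0"
  shows "logmom (emp n x)"
proof -
  have "prob_space (emp n x)" unfolding emp_def by (rule measure_pmf.prob_space_distr) simp
  moreover have "integrable (emp n x) Lg"
    unfolding emp_def using assms by (subst integrable_distr_eq)
        (auto intro!: integrable_measure_pmf_finite simp: set_pmf_of_set lessThan_empty_iff)
  ultimately show ?thesis by (simp add: logmom_def emp_def)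
qed

lemma sum_offdiag_sym:
  fixes h :: "nat \<Rightarrow> nat \<Rightarrow> real"
  assumes "\<And>i j. h i j = h j i"
  shows "(\<Sum>i<n. \<Sum>j<n. h i j) = 2 * (\<Sum>j<n. \<Sum>i<j. h i j) + (\<Sum>i<n. h i i)"
proof (induction n)
  case (Suc n)
  have "(\<Sum>i<n. h i n) = (\<Sum>i<n. h n i)" using assms by (intro sum.cong) auto
  then show ?case using Suc by (simp add: sum.distrib algebra_simps)
qed simp

section \<open>The modulated energy and its coercivity\<close>

locale log_gas_equilibrium = log_gas +
  fixes \<phi> :: "complex \<Rightarrow> real" and c :: real
  assumes equilibrium: "is_equilibrium \<phi> c"
begin

lemma measurable_\<phi> [measurable]: "\<phi> \<in> borel_measurable borel"
  and \<phi>_pos: "\<phi> x > 0"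
  and \<phi>_int: "(\<integral>\<^sup>+x. ennreal (\<phi> x) \<partial>lborel) = 1"
  and \<phi>_Lg: "(\<integral>\<^sup>+x. ennreal (Lg x * \<phi> x) \<partial>lborel) < \<infinity>"
  and ln_\<phi>: "ln (\<phi> x) = \<kappa> * wpot \<phi> x + \<kappa> * lam * U_rho R x + c"
  and \<phi>_decay: "\<exists>C\<ge>0. \<forall>x. \<phi> x \<le> C * exp (- pexp * Lg x)"
proof -
  obtain C where C: "\<And>x. \<phi> x \<le> C * exp (- pexp * Lg x)" using equilibrium by (auto simp: is_equilibrium_def)
  have "\<phi> x \<le> \<bar>C\<bar> * exp (- pexp * Lg x)" for x
    by (rule order_trans[OF C]) (intro mult_right_mono, auto)
  then show "\<exists>C\<ge>0. \<forall>x. \<phi> x \<le> C * exp (- pexp * Lg x)" by (intro exI[of _ "\<bar>C\<bar>"]) auto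
qed (use equilibrium in \<open>auto simp: is_equilibrium_def\<close>)

lemma \<phi>_bounded: "\<exists>B\<ge>0. \<forall>x. \<phi> x \<le> B"
proof -
  obtain C where C: "C \<ge> 0" "\<And>x. \<phi> x \<le> C * exp (- pexp * Lg x)" using \<phi>_decay by blast
  have "\<phi> x \<le> C" for x
  proof -
    have "exp (- pexp * Lg x) \<le> 1" using pexp Lg_nonneg[of x] by simp
    then have "C * exp (- pexp * Lg x) \<le> C * 1" using C by (intro mult_left_mono) auto
    then show ?thesis using C(2)[of x] by simp
  qed
  then show ?thesis using C(1) by blast
qed

definition \<mu> :: "complex measure" where "\<mu> = density lborel (\<lambda>x. ennreal (\<phi> x))"

abbreviation W :: "complex \<Rightarrow> real" where "W \<equiv> wpot \<phi>"

lemma prob_\<mu>: "prob_space \<mu>" by standard (simp add: \<mu>_def emeasure_density \<phi>_int)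

lemma sets_\<mu> [measurable_cong]: "sets \<mu> = sets borel" by (simp add: \<mu>_def)

lemma \<mu>_integral: "f \<in> borel_measurable borel \<Longrightarrow> (\<integral>x. f x \<partial>\<mu>) = (\<integral>x. f x * \<phi> x \<partial>lborel)" for f :: "complex \<Rightarrow> real"
  unfolding \<mu>_def using \<phi>_pos by (subst integral_density) (auto simp: less_imp_le mult.commute)

lemma \<mu>_integrable: "f \<in> borel_measurable borel
    \<Longrightarrow> integrable \<mu> f \<longleftrightarrow> integrable lborel (\<lambda>x. f x * \<phi> x)" for f :: "complex \<Rightarrow> real"
  unfolding \<mu>_def using \<phi>_pos by (subst integrable_density) (auto simp: less_imp_le mult.commute)

lemma \<mu>_logmom: "logmom \<mu>"
proof -
  have "integrable lborel (\<lambda>x. Lg x * \<phi> x)"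
    using \<phi>_Lg \<phi>_pos by (intro integrableI_nonneg) (auto simp: Lg_nonneg less_imp_le)
  then show ?thesis by (simp add: logmom_def prob_\<mu> sets_\<mu> \<mu>_integrable)
qed

lemma W_bound: "\<exists>C\<ge>0. \<forall>x. integrable lborel (\<lambda>y. ln (cmod (x - y)) * \<phi> y) \<and> \<bar>W x - Lg x\<bar> \<le> C"
proof -
  obtain B where B: "\<And>x. \<phi> x \<le> B" using \<phi>_bounded by blast
  have "\<exists>C. \<forall>x. integrable lborel (\<lambda>y. ln (cmod (x - y)) * \<phi> y) \<and> \<bar>(\<integral>y. ln (cmod (x - y)) * \<phi> y \<partial>lborel) - Lg x\<bar> \<le> C"
    by (rule log_potential_bound[OF measurable_\<phi> _ B \<phi>_int \<phi>_Lg]) (simp add: less_imp_le \<phi>_pos)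
  then obtain C where C: "\<And>x. integrable lborel (\<lambda>y. ln (cmod (x - y)) * \<phi> y)" "\<And>x. \<bar>W x - Lg x\<bar> \<le> C"
    unfolding wpot_def by blast
  moreover have "C \<ge> 0" using C(2)[of 0] by linarith
  ultimately show ?thesis by blast
qed

lemma W_integrable: "integrable \<mu> W"
proof -
  interpret prob: prob_space \<mu> by (rule prob_\<mu>)
  obtain C where C: "C \<ge> 0" "\<And>x. \<bar>W x - Lg x\<bar> \<le> C" using W_bound by blast
  show ?thesis
  proof (rule Bochner_Integration.integrable_bound[of _ "\<lambda>x. C + Lg x"])
    show "integrable \<mu> (\<lambda>x. C + Lg x)" using \<mu>_logmom by (simp add: logmom_def)
    show "AE x in \<mu>. norm (W x) \<le> norm (C + Lg x)"
    proof (rule AE_I2)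
      fix x show "norm (W x) \<le> norm (C + Lg x)" using C(2)[of x] Lg_nonneg[of x] by simp
    qed
  qed measurable
qed

definition estar :: real where "estar = (\<integral>x. W x \<partial>\<mu>)"

text \<open>The double integral of -ln|x - y| against empirical minus equilibrium measure in both
  variables, without the diagonal: the cross terms give \<open>W\<close>, the self-energy of \<mu>
  gives \<open>- estar\<close>. At coincident points \<open>ln 0 = 0\<close> replaces an infinite
  repulsion, which is why the lower estimates ask for \<open>distinct_pts\<close>.\<close>

definition Fn :: "nat \<Rightarrow> (nat \<Rightarrow> complex) \<Rightarrow> real" where
  "Fn n x = 2 / (real n)\<^sup>2 * (\<Sum>j<n. \<Sum>i<j. - ln (cmod (x i - x j))) + 2 / real n * (\<Sum>i<n. W (x i)) - estar"

text \<open>The two kernels differ by \<open>htail S\<close>, whose integral against a density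
  bounded by B lies between 0 and B pi/(2S).\<close>

lemma reg_potential_bounds:
  assumes S: "S \<ge> 1" and B: "\<And>x. \<phi> x \<le> B" "B \<ge> 0"
  shows "(\<integral>y. reg S (cmod (x - y)) \<partial>\<mu>) \<le> - W x" "- W x \<le> (\<integral>y. reg S (cmod (x - y)) \<partial>\<mu>) + B * (pi / (2 * S))"
proof -
  obtain C where ln_i: "\<And>x. integrable lborel (\<lambda>y. ln (cmod (x - y)) * \<phi> y)" using W_bound by blast
  define d where "d y = (- ln (cmod (x - y)) - reg S (cmod (x - y))) * \<phi> y" for y
  have [measurable]: "d \<in> borel_measurable borel" unfolding d_def[abs_def] by measurable
  have d0: "AE y in lborel. 0 \<le> d y"
    using AE_lborel_singleton[of x]
  proof eventually_elim
    fix y assume "y \<noteq> x"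
    then have "reg S (cmod (x - y)) \<le> - ln (cmod (x - y))" by (intro reg_le S) auto
    then show "0 \<le> d y" using \<phi>_pos[of y] by (simp add: d_def less_imp_le)
  qed
  have "(\<integral>\<^sup>+y. ennreal (d y) \<partial>lborel) \<le> (\<integral>\<^sup>+y. ennreal B * htail S (cmod (x - y)) \<partial>lborel)"
  proof (intro nn_integral_mono_AE, use AE_lborel_singleton[of x] in eventually_elim)
    fix y assume "y \<noteq> x"
    then have r: "cmod (x - y) > 0" by simp
    have "ennreal (d y) = htail S (cmod (x - y)) * ennreal (\<phi> y)"
      using reg_le[OF S r] \<phi>_pos[of y] by (simp add: d_def htail_eq[OF S r] ennreal_mult less_imp_le)
    also have "\<dots> \<le> htail S (cmod (x - y)) * ennreal B" using B(1)[of y] by (intro mult_left_mono ennreal_leI) auto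
    finally show "ennreal (d y) \<le> ennreal B * htail S (cmod (x - y))" by (simp add: mult.commute)
  qed
  also have "\<dots> = ennreal B * ennreal (pi / (2 * S))"
    using nn_integral_htail[OF S, of x] by (simp add: nn_integral_cmult)
  also have "\<dots> = ennreal (B * (pi / (2 * S)))" using B by (intro ennreal_mult'[symmetric])
  finally have db: "(\<integral>\<^sup>+y. ennreal (d y) \<partial>lborel) \<le> ennreal (B * (pi / (2 * S)))" .
  have di: "integrable lborel d"
    using db d0 by (intro integrableI_nonneg) (auto intro: le_less_trans)
  have d1: "0 \<le> (\<integral>y. d y \<partial>lborel)" using d0 by (rule integral_nonneg_AE)
  have d2: "(\<integral>y. d y \<partial>lborel) \<le> B * (pi / (2 * S))"
    using db B S nn_integral_eq_integral[OF di d0] by simp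
  have "(\<integral>y. reg S (cmod (x - y)) \<partial>\<mu>) = (\<integral>y. reg S (cmod (x - y)) * \<phi> y \<partial>lborel)"
    by (rule \<mu>_integral) measurable
  also have "\<dots> = (\<integral>y. - (ln (cmod (x - y)) * \<phi> y) - d y \<partial>lborel)"
    by (intro Bochner_Integration.integral_cong) (auto simp: d_def algebra_simps)
  also have "\<dots> = - W x - (\<integral>y. d y \<partial>lborel)"
    using ln_i[of x] di by (simp add: wpot_def)
  finally have eq: "(\<integral>y. reg S (cmod (x - y)) \<partial>\<mu>) = - W x - (\<integral>y. d y \<partial>lborel)" .
  show "(\<integral>y. reg S (cmod (x - y)) \<partial>\<mu>) \<le> - W x" "- W x \<le> (\<integral>y. reg S (cmod (x - y)) \<partial>\<mu>) + B * (pi / (2 * S))"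
    using eq d1 d2 by auto
qed

definition distinct_pts :: "nat \<Rightarrow> (nat \<Rightarrow> complex) \<Rightarrow> bool" where
  "distinct_pts n x \<longleftrightarrow> \<not> (\<exists>i<n. \<exists>j<n. i \<noteq> j \<and> x i = x j)"

text \<open>The cutoff kernel is smaller off the diagonal and finite on it. Completing the pair sum
  to a full square costs \<open>reg S 0 / real n\<close>; the cross term, which enters with the
  opposite sign, costs twice B pi/(2S); the self-energy of \<mu> changes in the favourable
  direction.\<close>

lemma Fn_lower:
  assumes n: "n > 0" and x: "distinct_pts n x" and S: "S \<ge> 1" and B: "\<And>x. \<phi> x \<le> B" "B \<ge> 0"
  shows "Fn n x \<ge> (reg_energy S (emp n x) (emp n x) - 2 * reg_energy S (emp n x) \<mu> + reg_energy S \<mu> \<mu>) - reg S 0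
      / real n - B * pi / S"
proof -
  have lm: "logmom (emp n x)" by (rule emp_logmom[OF n])
  have ri: "(\<lambda>x. \<integral>y. reg S (cmod (x - y)) \<partial>\<nu>) \<in> borel_measurable borel" if "logmom \<nu>" for \<nu>
  proof -
    interpret p: prob_space \<nu> using that by (simp add: logmom_def)
    have [measurable_cong]: "sets \<nu> = sets borel" using that by (simp add: logmom_def)
    show ?thesis by measurable
  qed
  have "reg_energy S (emp n x) (emp n x) = (\<Sum>i<n. \<integral>y. reg S (cmod (x i - y)) \<partial>emp n x) / real n"
    unfolding reg_energy_iterated[OF lm lm S] by (rule emp_integral[OF n ri[OF lm]])
  also have "\<dots> = (\<Sum>i<n. \<Sum>j<n. reg S (cmod (x i - x j))) / (real n)\<^sup>2"
    by (simp add: emp_integral[OF n] sum_divide_distrib power2_eq_square)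
  also have "(\<Sum>i<n. \<Sum>j<n. reg S (cmod (x i - x j)))
      = 2 * (\<Sum>j<n. \<Sum>i<j. reg S (cmod (x i - x j))) + (\<Sum>i<n. reg S (cmod (x i - x i)))"
    by (rule sum_offdiag_sym) (simp add: norm_minus_commute)
  also have "(\<Sum>i<n. reg S (cmod (x i - x i))) = real n * reg S 0" by simp
  finally have e1: "reg_energy S (emp n x) (emp n x)
      = 2 / (real n)\<^sup>2 * (\<Sum>j<n. \<Sum>i<j. reg S (cmod (x i - x j))) + reg S 0 / real n"
    using n by (simp add: add_divide_distrib power2_eq_square)
  have "(\<Sum>j<n. \<Sum>i<j. reg S (cmod (x i - x j))) \<le> (\<Sum>j<n. \<Sum>i<j. - ln (cmod (x i - x j)))"
  proof (intro sum_mono reg_le S)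
    fix i j assume "j \<in> {..<n}" "i \<in> {..<j}"
    then have "i < n" "j < n" "i \<noteq> j" by auto
    then have "x i \<noteq> x j" using x unfolding distinct_pts_def by blast
    then show "0 < cmod (x i - x j)" by simp
  qed
  then have 1: "2 / (real n)\<^sup>2 * (\<Sum>j<n. \<Sum>i<j. reg S (cmod (x i - x j)))
      \<le> 2 / (real n)\<^sup>2 * (\<Sum>j<n. \<Sum>i<j. - ln (cmod (x i - x j)))"
    by (intro mult_left_mono) auto
  have e2: "reg_energy S (emp n x) \<mu> = (\<Sum>i<n. \<integral>y. reg S (cmod (x i - y)) \<partial>\<mu>) / real n"
    unfolding reg_energy_iterated[OF lm \<mu>_logmom S] by (rule emp_integral[OF n ri[OF \<mu>_logmom]])
  have "- (\<Sum>i<n. W (x i)) \<le> (\<Sum>i<n. (\<integral>y. reg S (cmod (x i - y)) \<partial>\<mu>) + B * (pi / (2 * S)))"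
    unfolding sum_negf[symmetric] by (intro sum_mono reg_potential_bounds S B)
  also have "\<dots> = real n * (reg_energy S (emp n x) \<mu> + B * (pi / (2 * S)))"
    using n by (simp add: e2 sum.distrib distrib_left)
  finally have "- (\<Sum>i<n. W (x i)) \<le> real n * (reg_energy S (emp n x) \<mu> + B * (pi / (2 * S)))" .
  then have "2 / real n * - (\<Sum>i<n. W (x i)) \<le> 2 / real n * (real n * (reg_energy S (emp n x) \<mu> + B * (pi / (2 * S))))"
    by (intro mult_left_mono) auto
  also have "\<dots> = 2 * reg_energy S (emp n x) \<mu> + B * pi / S" using n S by (simp add: field_simps)
  finally have 2: "- (2 / real n * (\<Sum>i<n. W (x i))) \<le> 2 * reg_energy S (emp n x) \<mu> + B * pi / S" by simp
  have 3: "reg_energy S \<mu> \<mu> \<le> - estar"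
  proof -
    interpret p: prob_space \<mu> by (rule prob_\<mu>)
    interpret pp: pair_prob_space \<mu> \<mu> ..
    have "integrable (\<mu> \<Otimes>\<^sub>M \<mu>) (\<lambda>(x, y). reg S (cmod (x - y)))"
      using reg_energy_fubini(1)[OF \<mu>_logmom \<mu>_logmom S] by (simp add: case_prod_unfold)
    then have "integrable \<mu> (\<lambda>x. \<integral>y. reg S (cmod (x - y)) \<partial>\<mu>)" by (rule pp.integrable_fst)
    then have "reg_energy S \<mu> \<mu> \<le> (\<integral>x. - W x \<partial>\<mu>)"
      unfolding reg_energy_iterated[OF \<mu>_logmom \<mu>_logmom S] using W_integrable
      by (intro integral_mono reg_potential_bounds(1)[OF S B]) auto
    then show ?thesis by (simp add: estar_def)
  qed
  show ?thesis unfolding Fn_def using e1 1 2 3 by linarith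
qed

text \<open>Cutoff S = 1, with the non-negative Gaussian part discarded.\<close>

lemma Fn_bounded_below: "\<exists>C. \<forall>n>0. \<forall>x. distinct_pts n x \<longrightarrow> Fn n x \<ge> - C"
proof -
  obtain B where B: "B \<ge> 0" "\<And>x. \<phi> x \<le> B" using \<phi>_bounded by blast
  have "Fn n x \<ge> - (\<bar>reg 1 0\<bar> + B * pi)" if "n > 0" "distinct_pts n x" for n x
  proof -
    have "reg_energy 1 (emp n x) (emp n x) - 2 * reg_energy 1 (emp n x) \<mu> + reg_energy 1 \<mu> \<mu> \<ge> 0"
      using reg_energy_positive[OF emp_logmom[OF that(1), of x] \<mu>_logmom, of 1] by simp
    moreover have "reg 1 0 / real n \<le> \<bar>reg 1 0\<bar>"
    proof -
      have "reg 1 0 / real n \<le> \<bar>reg 1 0\<bar> / real n" by (intro divide_right_mono) auto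
      also have "\<dots> \<le> \<bar>reg 1 0\<bar> / 1" using that by (intro divide_left_mono) auto
      finally show ?thesis by simp
    qed
    ultimately show ?thesis using Fn_lower[OF that, of 1 B] B by simp
  qed
  then show ?thesis by blast
qed

text \<open>\<open>Sup\<close> on the reals carries information for non-empty bounded sets: the zero
  function is admissible and all values are at most 2. The second claim extracts a separating test
  function.\<close>

lemma d_BL_set_bdd:
  assumes "n > 0"
  shows "0 \<le> d_BL (empirical n x) \<mu>"
    and "d_BL (empirical n x) \<mu> > e \<Longrightarrow> \<exists>f. (\<forall>z. \<bar>f z\<bar> \<le> 1) \<and> (\<forall>z w. \<bar>f z - f w\<bar> \<le> dist z w)
           \<and> (\<integral>z. f z \<partial>empirical n x) - (\<integral>z. f z \<partial>\<mu>) > e"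
proof -
  interpret p: prob_space \<mu> by (rule prob_\<mu>)
  let ?S = "{(\<integral>z. f z \<partial>empirical n x) - (\<integral>z. f z \<partial>\<mu>) | f :: complex \<Rightarrow> real. (\<forall>z. \<bar>f z\<bar> \<le> 1) \<and> (\<forall>z w. \<bar>f z - f w\<bar>
      \<le> dist z w)}"
  have zero: "0 \<in> ?S" by (rule CollectI, rule exI[of _ "\<lambda>_. 0"]) simp
  have bdd: "bdd_above ?S"
  proof (rule bdd_aboveI[of _ 2])
    fix t assume "t \<in> ?S"
    then obtain f :: "complex \<Rightarrow> real" where f: "\<And>z. \<bar>f z\<bar> \<le> 1" "\<And>z w. \<bar>f z - f w\<bar> \<le> dist z w"
      and t: "t = (\<integral>z. f z \<partial>empirical n x) - (\<integral>z. f z \<partial>\<mu>)" by blast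
    have [measurable]: "f \<in> borel_measurable borel" using f(2) by (rule lipschitz_borel_measurable)
    have "(\<Sum>i<n. f (x i)) \<le> (\<Sum>i<n. 1)" using f(1) by (intro sum_mono) (simp add: abs_le_iff)
    then have "(\<Sum>i<n. f (x i)) / real n \<le> real n / real n" by (intro divide_right_mono) auto
    then have "(\<integral>z. f z \<partial>empirical n x) \<le> 1" using assms by (simp add: empirical_integral)
    moreover have "(\<integral>z. - 1 \<partial>\<mu>) \<le> (\<integral>z. f z \<partial>\<mu>)"
    proof (rule integral_mono)
      show "integrable \<mu> f" using f(1) by (intro p.integrable_const_bound[of _ 1]) auto
      show "- 1 \<le> f z" for z using f(1)[of z] by (simp add: abs_le_iff)
    qed simp
    ultimately show "t \<le> 2" unfolding t by (simp add: p.prob_space)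
  qed
  show "0 \<le> d_BL (empirical n x) \<mu>" unfolding d_BL_def by (rule cSup_upper[OF zero bdd])
  show "\<exists>f. (\<forall>z. \<bar>f z\<bar> \<le> 1) \<and> (\<forall>z w. \<bar>f z - f w\<bar> \<le> dist z w) \<and> (\<integral>z. f z \<partial>empirical n x) - (\<integral>z. f z \<partial>\<mu>) > e"
    if "d_BL (empirical n x) \<mu> > e"
    using that unfolding d_BL_def by (subst (asm) less_cSup_iff[OF _ bdd]) (use zero in blast)+
qed

theorem Fn_coercive:
  assumes e: "e > 0"
  shows "\<exists>c1>0. \<exists>N>0. \<forall>n\<ge>N. \<forall>x. distinct_pts n x \<longrightarrow> d_BL (empirical n x) \<mu> > e \<longrightarrow> Fn n x \<ge> c1"
proof -
  obtain a c where ac: "a > 0" "c > 0" and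
    co: "\<And>\<nu> f s. prob_space \<nu> \<Longrightarrow> sets \<nu> = sets borel \<Longrightarrow> (\<forall>z. \<bar>f z\<bar> \<le> 1) \<Longrightarrow> (\<forall>z w. \<bar>f z - f w\<bar> \<le> dist z w) \<Longrightarrow>
     \<bar>(\<integral>z. f z \<partial>\<nu>) - (\<integral>z. f z \<partial>\<mu>)\<bar> \<ge> e \<Longrightarrow> a \<le> s \<Longrightarrow> s \<le> 2 * a \<Longrightarrow> gdist s \<nu> \<mu> \<ge> c"
    using gdist_coercive[OF prob_\<mu> sets_\<mu> e] by metis
  obtain B where B: "B \<ge> 0" "\<And>x. \<phi> x \<le> B" using \<phi>_bounded by blast
  \<comment> \<open>S has to include the scales [a, 2a] on which \<open>gdist\<close> is at least c,
    and to make the error B pi/S at most c/16. It does not depend on n, so the diagonal error falls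
    below c/16 for large n, and c/4 - c/16 - c/16 = c/8 is left.\<close>
  define S where "S = max 1 (max (2 * a) (16 * B * pi / c))"
  have S: "S \<ge> 1" "2 * a \<le> S" "16 * B * pi / c \<le> S" by (auto simp: S_def)
  have BS: "B * pi / S \<le> c / 16" using S ac by (simp add: field_simps)
  obtain N0 :: nat where N0: "16 * \<bar>reg S 0\<bar> / c < real N0" using reals_Archimedean2 by blast
  show ?thesis
  proof (rule exI[of _ "c / 8"], intro conjI exI[of _ "Suc N0"] allI impI)
    fix n x assume n: "Suc N0 \<le> n" and x: "distinct_pts n x" and d: "d_BL (empirical n x) \<mu> > e"
    then have n0: "n > 0" by simp
    obtain f where f: "\<forall>z. \<bar>f z\<bar> \<le> 1" "\<forall>z w. \<bar>f z - f w\<bar> \<le> dist z w" "(\<integral>z. f z \<partial>empirical n x) - (\<integral>z. f z \<partial>\<mu>) > e"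
      using d_BL_set_bdd(2)[OF n0 d] by blast
    have [measurable]: "f \<in> borel_measurable borel" using f(2) by (intro lipschitz_borel_measurable) auto
    have ge: "\<bar>(\<integral>z. f z \<partial>emp n x) - (\<integral>z. f z \<partial>\<mu>)\<bar> \<ge> e"
      using f(3) n0 by (simp add: emp_integral empirical_integral)
    have lm: "logmom (emp n x)" by (rule emp_logmom[OF n0])
    have "reg_energy S (emp n x) (emp n x) - 2 * reg_energy S (emp n x) \<mu> + reg_energy S \<mu> \<mu> \<ge> c / 4"
    proof (rule reg_energy_lower[OF lm \<mu>_logmom S(1) ac(1) S(2)])
      show "c \<le> gdist s (emp n x) \<mu>" if "a \<le> s" "s \<le> 2 * a" for s
        using lm f ge that by (intro co[of _ f]) (auto simp: logmom_def)
    qed (use ac in simp)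
    moreover have "reg S 0 / real n \<le> c / 16"
    proof -
      have "16 * \<bar>reg S 0\<bar> / c \<le> real n" using N0 n by linarith
      then have "\<bar>reg S 0\<bar> \<le> c / 16 * real n" using ac by (simp add: field_simps)
      then have "\<bar>reg S 0\<bar> / real n \<le> c / 16" using n0 by (simp add: field_simps)
      moreover have "reg S 0 / real n \<le> \<bar>reg S 0\<bar> / real n" by (intro divide_right_mono) auto
      ultimately show ?thesis by linarith
    qed
    ultimately show "c / 8 \<le> Fn n x" using Fn_lower[OF n0 x S(1) B(2,1)] BS by linarith
  qed (use ac in auto)
qed

section \<open>Partition functions\<close>

text \<open>The one-body mismatch when k = n \<beta>_n and l = \<beta>_n \<alpha>_n differ from
  their limits \<kappa> and \<kappa> lam.\<close>

definition tilt :: "real \<Rightarrow> real \<Rightarrow> complex \<Rightarrow> real" where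
  "tilt k l x = (k - \<kappa>) * W x + (l - \<kappa> * lam) * U_rho R x"

lemma measurable_tilt [measurable]: "tilt k l \<in> borel_measurable borel"
  unfolding tilt_def[abs_def] by measurable

definition logw :: "nat \<Rightarrow> real \<Rightarrow> real \<Rightarrow> (nat \<Rightarrow> complex) \<Rightarrow> real" where
  "logw n k l x = - (k * real n / 2) * Fn n x + (\<Sum>i<n. tilt k l (x i))"

text \<open>The factor independent of the configuration; it occurs in the upper and in the lower
  bound and cancels in their quotient.\<close>

definition Cn :: "nat \<Rightarrow> real \<Rightarrow> real" where
  "Cn n k = exp (- real n * c - k * real n * estar / 2)"

lemma Cn_pos: "Cn n k > 0" by (simp add: Cn_def)

text \<open>The Gibbs weight relative to the product of equilibrium densities: by the Euler--Lagrange
  equation the one-body terms combine with the pair interaction to the modulated energy \<open>Fn\<close>.\<close>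
lemma gibbs_weight_eq:
  assumes n: "n > 0" and x: "distinct_pts n x"
  shows "gibbs_weight n a b R x = Cn n (real n * b) * (\<Prod>i<n. \<phi> (x i)) * exp (logw n (real n * b) (b * a) x)"
proof -
  define T where "T = (\<Sum>j<n. \<Sum>i<j. - ln (cmod (x i - x j)))"
  define SU where "SU = (\<Sum>i<n. U_rho R (x i))"
  define SW where "SW = (\<Sum>i<n. W (x i))"
  have prod: "(\<Prod>i<n. \<phi> (x i)) = exp (\<Sum>i<n. ln (\<phi> (x i)))"
    using \<phi>_pos by (subst exp_sum) auto
  have sl: "(\<Sum>i<n. ln (\<phi> (x i))) = \<kappa> * SW + \<kappa> * lam * SU + real n * c"
    unfolding ln_\<phi> SU_def SW_def by (simp add: sum.distrib sum_distrib_left)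
  have st: "(\<Sum>i<n. tilt (real n * b) (b * a) (x i)) = (real n * b - \<kappa>) * SW + (b * a - \<kappa> * lam) * SU"
    unfolding tilt_def SU_def SW_def by (simp add: sum.distrib sum_distrib_left)
  have E: "E_n n a R x = T - a * SU"
  proof -
    have "real n * (\<Sum>i<n. V_pot n a R (x i)) = - a * SU"
      unfolding V_pot_def SU_def sum_distrib_left[symmetric] using n by simp
    then show ?thesis by (simp add: E_n_def T_def)
  qed
  have F: "real n * b * real n / 2 * Fn n x = b * T + real n * b * SW - real n * b * real n / 2 * estar"
    unfolding Fn_def T_def[symmetric] SW_def[symmetric] using n by (simp add: field_simps power2_eq_square)
  have "gibbs_weight n a b R x = exp (- b * E_n n a R x)"
    using x by (simp add: gibbs_weight_def distinct_pts_def)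
  \<comment> \<open>The terms in \<open>W\<close> cancel: -k from the modulated energy, \<kappa>
    from the equilibrium densities and k - \<kappa> from the tilt. The terms in \<open>U_rho\<close>
    add up to \<open>b * a\<close>.\<close>
  also have "- b * E_n n a R x = (- real n * c - (real n * b) * real n * estar / 2) + (\<Sum>i<n. ln (\<phi> (x i)))
      + logw n (real n * b) (b * a) x"
    unfolding logw_def st sl E minus_mult_left[symmetric] F by (simp add: algebra_simps)
  finally show ?thesis unfolding prod Cn_def by (simp add: exp_add)
qed

lemma gibbs_weight_0: "\<not> distinct_pts n x \<Longrightarrow> gibbs_weight n a b R x = 0"
  by (auto simp: gibbs_weight_def distinct_pts_def)

lemma measurable_coord:
  "i < n \<Longrightarrow> (\<lambda>x. x i) \<in> borel_measurable (leb_n n)"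
  using measurable_component_singleton[of i "{..<n}" "\<lambda>_. lborel :: complex measure"] by (simp add: leb_n_def)

lemma prod_\<phi>_measurable: "(\<lambda>x. \<Prod>i<n. ennreal (\<phi> (x i))) \<in> borel_measurable (leb_n n)"
proof (rule borel_measurable_prod_ennreal)
  fix i assume "i \<in> {..<n}"
  then have [measurable]: "(\<lambda>x. x i) \<in> borel_measurable (leb_n n)" by (intro measurable_coord) simp
  show "(\<lambda>x. ennreal (\<phi> (x i))) \<in> borel_measurable (leb_n n)" by measurable
qed

lemma measurable_Fn [measurable]: "Fn n \<in> borel_measurable (leb_n n)"
proof -
  have m: "(\<lambda>x. ln (cmod (x i - x j))) \<in> borel_measurable (leb_n n)" if "i < j" "j < n" for i j
  proof -
    have [measurable]: "(\<lambda>x. x i) \<in> borel_measurable (leb_n n)" "(\<lambda>x. x j) \<in> borel_measurable (leb_n n)"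
      using that by (auto intro: measurable_coord)
    show ?thesis by measurable
  qed
  have w: "(\<lambda>x. W (x i)) \<in> borel_measurable (leb_n n)" if "i < n" for i
    using measurable_compose[OF measurable_coord[OF that] measurable_wpot[OF measurable_\<phi>]] .
  show ?thesis
    unfolding Fn_def[abs_def]
    by (intro borel_measurable_diff borel_measurable_add borel_measurable_times borel_measurable_const
        borel_measurable_sum borel_measurable_uminus m w) auto
qed

lemma measurable_logw [measurable]: "logw n k l \<in> borel_measurable (leb_n n)"
proof -
  have w: "(\<lambda>x. tilt k l (x i)) \<in> borel_measurable (leb_n n)" if "i < n" for i
    using measurable_compose[OF measurable_coord[OF that] measurable_tilt] .
  show ?thesis
    unfolding logw_def[abs_def]
    by (intro borel_measurable_add borel_measurable_times borel_measurable_const measurable_Fn borel_measurable_sum w) auto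
qed

lemma distinct_pts_sets [measurable]: "{x \<in> space (leb_n n). distinct_pts n x} \<in> sets (leb_n n)"
proof -
  have "{x \<in> space (leb_n n). distinct_pts n x} = space (leb_n n) \<inter> (\<Inter>i\<in>{..<n}. \<Inter>j\<in>{..<n} - {i}. {x
      \<in> space (leb_n n). x i \<noteq> x j})"
    by (auto simp: distinct_pts_def)
  moreover have "{x \<in> space (leb_n n). x i \<noteq> x j} \<in> sets (leb_n n)" if "i < n" "j < n" for i j
  proof -
    have [measurable]: "(\<lambda>x. x i) \<in> borel_measurable (leb_n n)" "(\<lambda>x. x j) \<in> borel_measurable (leb_n n)"
      using that by (auto intro: measurable_coord)
    have "{x \<in> space (leb_n n). cmod (x i - x j) \<noteq> 0} \<in> sets (leb_n n)" by measurable
    then show ?thesis by simp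
  qed
  ultimately show ?thesis
    by (cases "n = 0") (auto intro!: sets.Int sets.finite_INT sets.countable_INT'' simp: distinct_pts_def)
qed

lemma gibbs_weight_measurable [measurable]: "(\<lambda>x. ennreal (gibbs_weight n a b R x)) \<in> borel_measurable (leb_n n)"
proof (cases "n = 0")
  case True
  then show ?thesis by (simp add: gibbs_weight_def E_n_def)
next
  case False
  then have n: "n > 0" by simp
  have [measurable]: "(\<lambda>x. \<Prod>i<n. \<phi> (x i)) \<in> borel_measurable (leb_n n)"
    using measurable_compose[OF measurable_coord measurable_\<phi>] by (intro borel_measurable_prod) auto
  have "gibbs_weight n a b R x = (if distinct_pts n x then Cn n (real n * b) * (\<Prod>i<n. \<phi> (x i))
      * exp (logw n (real n * b) (b * a) x) else 0)" for x
    using gibbs_weight_eq[OF n] gibbs_weight_0 by simp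
  then show ?thesis by (simp cong: measurable_cong)
qed

text \<open>The one-particle integral; it equals 1 at k = \<kappa>, l = \<kappa> lam, where the tilt
  vanishes.\<close>

definition \<Phi> :: "real \<Rightarrow> real \<Rightarrow> ennreal" where
  "\<Phi> k l = (\<integral>\<^sup>+x. ennreal (\<phi> x * exp (tilt k l x)) \<partial>lborel)"

text \<open>A lower bound for the modulated energy on A replaces the interaction by a constant, and
  the remaining one-body factors integrate independently. With A the whole space this gives
  finiteness of the partition function, with A = \<open>bad n t\<close> exponential
  smallness.\<close>

lemma gibbs_upper:
  assumes n: "n > 0" and b: "b \<ge> 0" and A: "\<And>x. x \<in> A \<Longrightarrow> distinct_pts n x \<Longrightarrow> Fn n x \<ge> t"
  shows "(\<integral>\<^sup>+x. ennreal (gibbs_weight n a b R x) * indicator A x \<partial>leb_n n)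
    \<le> ennreal (Cn n (real n * b) * exp (- (real n * b * real n / 2) * t)) * \<Phi> (real n * b) (b * a) ^ n"
proof -
  define k l where "k = real n * b" and "l = b * a"
  have k: "k \<ge> 0" using b by (simp add: k_def)
  interpret P: product_sigma_finite "\<lambda>_::nat. lborel :: complex measure" by standard
  have "(\<integral>\<^sup>+x. ennreal (gibbs_weight n a b R x) * indicator A x \<partial>leb_n n)
     \<le> (\<integral>\<^sup>+x. ennreal (Cn n k * exp (- (k * real n / 2) * t)) * (\<Prod>i<n. ennreal (\<phi> (x i) * exp (tilt k l (x i)))) \<partial>leb_n n)"
  proof (rule nn_integral_mono)
    fix x
    show "ennreal (gibbs_weight n a b R x) * indicator A x
        \<le> ennreal (Cn n k * exp (- (k * real n / 2) * t)) * (\<Prod>i<n. ennreal (\<phi> (x i) * exp (tilt k l (x i))))"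
    proof (cases "distinct_pts n x \<and> x \<in> A")
      case True
      have "k * real n / 2 * t \<le> k * real n / 2 * Fn n x" using True A[of x] k by (intro mult_left_mono) auto
      then have "exp (logw n k l x) \<le> exp (- (k * real n / 2) * t + (\<Sum>i<n. tilt k l (x i)))" by (simp add: logw_def)
      also have "\<dots> = exp (- (k * real n / 2) * t) * (\<Prod>i<n. exp (tilt k l (x i)))"
          by (simp only: exp_add exp_sum finite_lessThan)
      finally have "Cn n k * (\<Prod>i<n. \<phi> (x i)) * exp (logw n k l x)
          \<le> Cn n k * (\<Prod>i<n. \<phi> (x i)) * (exp (- (k * real n / 2) * t) * (\<Prod>i<n. exp (tilt k l (x i))))"
        using Cn_pos[of n k] \<phi>_pos by (intro mult_left_mono mult_nonneg_nonneg prod_nonneg) (auto simp: less_imp_le)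
      also have "\<dots> = (Cn n k * exp (- (k * real n / 2) * t)) * (\<Prod>i<n. \<phi> (x i) * exp (tilt k l (x i)))"
        by (simp add: prod.distrib)
      finally have "ennreal (gibbs_weight n a b R x)
          \<le> ennreal ((Cn n k * exp (- (k * real n / 2) * t)) * (\<Prod>i<n. \<phi> (x i) * exp (tilt k l (x i))))"
        using gibbs_weight_eq[OF n, of x a b] True by (intro ennreal_leI) (simp add: k_def l_def)
      also have "\<dots> = ennreal (Cn n k * exp (- (k * real n / 2) * t)) * (\<Prod>i<n. ennreal (\<phi> (x i) * exp (tilt k l (x i))))"
        using Cn_pos[of n k] \<phi>_pos by (subst ennreal_mult') (auto simp: prod_ennreal less_imp_le)
      finally show ?thesis using True by simp
    qed (auto simp: gibbs_weight_0)
  qed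
  also have "\<dots> = ennreal (Cn n k * exp (- (k * real n / 2) * t)) * (\<integral>\<^sup>+x. (\<Prod>i<n. ennreal (\<phi> (x i)
      * exp (tilt k l (x i)))) \<partial>leb_n n)"
  proof (rule nn_integral_cmult)
    have "(\<lambda>x. ennreal (\<phi> (x i) * exp (tilt k l (x i)))) \<in> borel_measurable (leb_n n)" if "i < n" for i
      by (rule measurable_compose[OF measurable_coord[OF that], of "\<lambda>z. ennreal (\<phi> z * exp (tilt k l z))"]) measurable
    then show "(\<lambda>x. \<Prod>i<n. ennreal (\<phi> (x i) * exp (tilt k l (x i)))) \<in> borel_measurable (leb_n n)"
      by (intro borel_measurable_prod_ennreal) auto
  qed
  also have "(\<integral>\<^sup>+x. (\<Prod>i<n. ennreal (\<phi> (x i) * exp (tilt k l (x i)))) \<partial>leb_n n) = \<Phi> k l ^ n"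
    unfolding leb_n_def \<Phi>_def by (subst P.product_nn_integral_prod) auto
  finally show ?thesis by (simp add: k_def l_def)
qed

lemma ln_pair_integral: "has_bochner_integral (\<mu> \<Otimes>\<^sub>M \<mu>) (\<lambda>p. ln (cmod (fst p - snd p))) estar"
proof -
  interpret p: prob_space \<mu> by (rule prob_\<mu>)
  interpret pp: pair_prob_space \<mu> \<mu> ..
  obtain B where B: "B \<ge> 0" "\<And>x. \<phi> x \<le> B" using \<phi>_bounded by blast
  obtain l where l: "l \<ge> 0" "(\<integral>\<^sup>+x. ennreal (Lg x * \<phi> x) \<partial>lborel) = ennreal l"
    using \<phi>_Lg by (metis ennreal_cases infinity_ennreal_def less_irrefl)
  have k0: "0 \<le> log_kern x y" for x y using log_kern_ge[of x y] by simp
  have ki: "integrable (\<mu> \<Otimes>\<^sub>M \<mu>) (\<lambda>p. log_kern (fst p) (snd p))"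
  proof (rule integrableI_nonneg)
    have "(\<integral>\<^sup>+p. ennreal (log_kern (fst p) (snd p)) \<partial>(\<mu> \<Otimes>\<^sub>M \<mu>)) = (\<integral>\<^sup>+x. \<integral>\<^sup>+y. ennreal (log_kern x y) \<partial>\<mu> \<partial>\<mu>)"
      by (subst p.nn_integral_fst[symmetric]) auto
    also have "\<dots> \<le> (\<integral>\<^sup>+x. ennreal (3 + 2 * l + B * (pi / 2)) \<partial>\<mu>)"
    proof (intro nn_integral_mono)
      fix x
      have "(\<integral>\<^sup>+y. ennreal (log_kern x y) \<partial>\<mu>) = (\<integral>\<^sup>+y. ennreal (log_kern x y) * ennreal (\<phi> y) \<partial>lborel)"
        unfolding \<mu>_def by (subst nn_integral_density) (auto simp: mult.commute)
      also have "\<dots> \<le> ennreal (3 + 2 * l + B * (pi / 2))"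
        using \<phi>_pos B by (intro log_kern_potential_bound \<phi>_int l) (auto simp: less_imp_le)
      finally show "(\<integral>\<^sup>+y. ennreal (log_kern x y) \<partial>\<mu>) \<le> ennreal (3 + 2 * l + B * (pi / 2))" .
    qed
    also have "\<dots> < \<infinity>" by (simp add: p.emeasure_space_1)
    finally show "(\<integral>\<^sup>+p. ennreal (log_kern (fst p) (snd p)) \<partial>(\<mu> \<Otimes>\<^sub>M \<mu>)) < \<infinity>" .
  qed (use k0 in auto)
  have L: "integrable \<mu> Lg" using \<mu>_logmom by (simp add: logmom_def)
  have Lp: "integrable (\<mu> \<Otimes>\<^sub>M \<mu>) (\<lambda>p. Lg (fst p))" "integrable (\<mu> \<Otimes>\<^sub>M \<mu>) (\<lambda>p. Lg (snd p))"
    using has_bochner_integral_marginals[OF prob_\<mu> prob_\<mu>] L by (auto simp: has_bochner_integral_iff)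
  have "integrable (\<mu> \<Otimes>\<^sub>M \<mu>) (\<lambda>p. 1 + Lg (fst p) + Lg (snd p) - log_kern (fst p) (snd p))"
    using ki Lp by simp
  then have i: "integrable (\<mu> \<Otimes>\<^sub>M \<mu>) (\<lambda>p. ln (cmod (fst p - snd p)))" by (simp add: log_kern_def)
  then have i': "integrable (\<mu> \<Otimes>\<^sub>M \<mu>) (\<lambda>(x, y). ln (cmod (x - y)))" by (simp add: case_prod_unfold)
  have "(\<integral>p. ln (cmod (fst p - snd p)) \<partial>(\<mu> \<Otimes>\<^sub>M \<mu>)) = (\<integral>x. \<integral>y. ln (cmod (x - y)) \<partial>\<mu> \<partial>\<mu>)"
    using pp.integral_fst[OF i'] by (simp add: case_prod_unfold)
  also have "\<dots> = estar" unfolding estar_def wpot_def by (simp add: \<mu>_integral)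
  finally show ?thesis using i by (simp add: has_bochner_integral_iff)
qed

lemma tilt_integrable: "integrable \<mu> (tilt k l)"
  unfolding tilt_def[abs_def] using W_integrable U_integrable[OF \<mu>_logmom] by simp

text \<open>Jensen's inequality relative to the n-fold product of \<mu>. There \<open>Fn\<close> has
  mean estar/n: the pairs contribute -estar (n - 1)/n against 2 estar - estar from the other terms.
  Multiplied by k n/2 this costs only k estar/2, apart from the tilt.\<close>

lemma Z_lower:
  assumes n: "n > 0"
  shows "Z_n n a b R \<ge> ennreal (Cn n (real n * b) * exp (- (real n * b) * estar / 2 + real n * (\<integral>x. tilt (real n
      * b) (b * a) x \<partial>\<mu>)))"
proof -
  define k l where "k = real n * b" and "l = b * a"
  define \<mu>n where "\<mu>n = PiM {..<n} (\<lambda>_. \<mu>)"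
  interpret p: prob_space \<mu> by (rule prob_\<mu>)
  interpret pp: pair_prob_space \<mu> \<mu> ..
  interpret Pn: product_prob_space "\<lambda>_::nat. \<mu>" "{..<n}" by standard
  have prob: "prob_space \<mu>n" unfolding \<mu>n_def by (rule Pn.prob_space_axioms)
  have dens: "\<mu>n = density (leb_n n) (\<lambda>x. \<Prod>i<n. ennreal (\<phi> (x i)))"
    unfolding \<mu>n_def \<mu>_def leb_n_def
    by (rule PiM_density) (auto simp: sigma_finite_lborel prob_\<mu>[unfolded \<mu>_def])
  have sets_\<mu>n [measurable_cong]: "sets \<mu>n = sets (leb_n n)" by (simp add: dens)
  have comp: "has_bochner_integral \<mu>n (\<lambda>x. f (x i)) (\<integral>z. f z \<partial>\<mu>)" if "i < n" "integrable \<mu> f" for f :: "complex \<Rightarrow> real" and i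
  proof -
    have d: "distr \<mu>n \<mu> (\<lambda>x. x i) = \<mu>" unfolding \<mu>n_def using that by (intro Pn.PiM_component) auto
    have m: "(\<lambda>x. x i) \<in> measurable \<mu>n \<mu>" unfolding \<mu>n_def using that by (intro measurable_component_singleton) auto
    show ?thesis
      using that(2) integrable_distr_eq[OF m, of f] integral_distr[OF m, of f] by (simp add: d has_bochner_integral_iff)
  qed
  have pair: "distr \<mu>n (\<mu> \<Otimes>\<^sub>M \<mu>) (\<lambda>x. (x i, x j)) = \<mu> \<Otimes>\<^sub>M \<mu>" "(\<lambda>x. (x i, x j)) \<in> measurable \<mu>n (\<mu> \<Otimes>\<^sub>M \<mu>)" if "i
      < n" "j < n" "i \<noteq> j" for i j
    unfolding \<mu>n_def using that by (auto intro!: distr_PiM_pair prob_\<mu> measurable_Pair measurable_component_singleton)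
  have ln_pair: "has_bochner_integral \<mu>n (\<lambda>x. ln (cmod (x i - x j))) estar" if "i < n" "j < n" "i \<noteq> j" for i j
    using ln_pair_integral integrable_distr_eq[OF pair(2)[OF that], of "\<lambda>p. ln (cmod (fst p - snd p))"]
      integral_distr[OF pair(2)[OF that], of "\<lambda>p. ln (cmod (fst p - snd p))"]
    by (simp add: pair(1)[OF that] has_bochner_integral_iff)
  have AE_ne: "AE x in \<mu>n. x i \<noteq> x j" if "i < n" "j < n" "i \<noteq> j" for i j
  proof -
    have "AE p in \<mu> \<Otimes>\<^sub>M \<mu>. fst p \<noteq> snd p"
    proof (rule pp.AE_pair_measure)
      show "{p \<in> space (\<mu> \<Otimes>\<^sub>M \<mu>). fst p \<noteq> snd p} \<in> sets (\<mu> \<Otimes>\<^sub>M \<mu>)" by measurable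
      show "AE x in \<mu>. AE y in \<mu>. fst (x, y) \<noteq> snd (x, y)"
      proof (rule AE_I2)
        fix x
        have "AE y in \<mu>. y \<noteq> x"
          unfolding \<mu>_def by (subst AE_density) (use AE_lborel_singleton[of x] in \<open>auto elim: eventually_mono\<close>)
        then show "AE y in \<mu>. fst (x, y) \<noteq> snd (x, y)" by eventually_elim auto
      qed
    qed
    then have "AE p in distr \<mu>n (\<mu> \<Otimes>\<^sub>M \<mu>) (\<lambda>x. (x i, x j)). fst p \<noteq> snd p" by (subst pair(1)[OF that])
    then show ?thesis by (subst (asm) AE_distr_iff[OF pair(2)[OF that]]) auto
  qed
  have "AE x in \<mu>n. \<forall>i\<in>{..<n}. \<forall>j\<in>{..<n} - {i}. x i \<noteq> x j"
    by (intro AE_finite_allI AE_ne) auto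
  then have distinct_AE: "AE x in \<mu>n. distinct_pts n x"
    by eventually_elim (auto simp: distinct_pts_def)
  have H: "has_bochner_integral \<mu>n (logw n k l) (- k * estar / 2 + real n * (\<integral>x. tilt k l x \<partial>\<mu>))"
  proof -
    interpret \<mu>n: prob_space \<mu>n by (rule prob)
    have one: "has_bochner_integral \<mu>n (\<lambda>_. estar) estar" by (simp add: has_bochner_integral_iff \<mu>n.prob_space)
    have F: "has_bochner_integral \<mu>n (Fn n) (2 / (real n)\<^sup>2 * (\<Sum>j<n. \<Sum>i<j. - estar) + 2 / real n * (\<Sum>i<n. estar) - estar)"
      unfolding Fn_def[abs_def]
    proof (intro has_bochner_integral_add has_bochner_integral_diff has_bochner_integral_mult_right has_bochner_integral_sum has_bochner_integral_minus one)
      fix j i assume "j \<in> {..<n}" "i \<in> {..<j}"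
      then show "has_bochner_integral \<mu>n (\<lambda>x. ln (cmod (x i - x j))) estar" by (intro ln_pair) auto
    next
      fix i assume "i \<in> {..<n}"
      then show "has_bochner_integral \<mu>n (\<lambda>x. W (x i)) estar" unfolding estar_def by (intro comp W_integrable) auto
    qed
    have "(\<Sum>j<n. \<Sum>i<j. - estar) = - estar * (\<Sum>j<n. real j)" by (simp add: sum_distrib_left mult.commute)
    also have "(\<Sum>j<n. real j) = real n * (real n - 1) / 2" by (induction n) (auto simp: field_simps)
    finally have v: "2 / (real n)\<^sup>2 * (\<Sum>j<n. \<Sum>i<j. - estar) + 2 / real n * (\<Sum>i<n. estar) - estar = estar / real n"
      using n by (simp add: field_simps power2_eq_square)
    have "has_bochner_integral \<mu>n (logw n k l) (- (k * real n / 2) * (estar / real n) + (\<Sum>i<n. \<integral>x. tilt k l x \<partial>\<mu>))"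
      unfolding logw_def[abs_def] using F[unfolded v]
      by (intro has_bochner_integral_add has_bochner_integral_mult_right has_bochner_integral_sum comp tilt_integrable) auto
    then show ?thesis using n by simp
  qed
  define m where "m = - k * estar / 2 + real n * (\<integral>x. tilt k l x \<partial>\<mu>)"
  have "ennreal (exp m) \<le> (\<integral>\<^sup>+x. ennreal (exp (logw n k l x)) \<partial>\<mu>n)"
    using jensen_exp[OF prob, of "logw n k l"] H by (simp add: has_bochner_integral_iff m_def)
  also have "\<dots> = (\<integral>\<^sup>+x. ennreal (exp (logw n k l x)) * indicator {x. distinct_pts n x} x \<partial>\<mu>n)"
    by (rule nn_integral_cong_AE) (use distinct_AE in \<open>eventually_elim, simp\<close>)
  also have "\<dots> = (\<integral>\<^sup>+x. ennreal (exp (logw n k l x)) * indicator {x \<in> space (leb_n n). distinct_pts n x} x \<partial>\<mu>n)"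
    by (rule nn_integral_cong) (auto simp: indicator_def dens)
  also have "\<dots> = (\<integral>\<^sup>+x. (\<Prod>i<n. ennreal (\<phi> (x i))) * (ennreal (exp (logw n k l x)) * indicator {x
      \<in> space (leb_n n). distinct_pts n x} x) \<partial>leb_n n)"
  proof (subst dens, rule nn_integral_density)
    show "(\<lambda>x. \<Prod>i<n. ennreal (\<phi> (x i))) \<in> borel_measurable (leb_n n)"
      by (rule prod_\<phi>_measurable)
  qed measurable
  finally have "ennreal (Cn n k) * ennreal (exp m)
      \<le> ennreal (Cn n k) * (\<integral>\<^sup>+x. (\<Prod>i<n. ennreal (\<phi> (x i))) * (ennreal (exp (logw n k l x)) * indicator {x
      \<in> space (leb_n n). distinct_pts n x} x) \<partial>leb_n n)"
    by (intro mult_left_mono) auto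
  also have "\<dots> = (\<integral>\<^sup>+x. ennreal (Cn n k) * ((\<Prod>i<n. ennreal (\<phi> (x i))) * (ennreal (exp (logw n k l x))
      * indicator {x \<in> space (leb_n n). distinct_pts n x} x)) \<partial>leb_n n)"
  proof (rule nn_integral_cmult[symmetric])
    have [measurable]: "(\<lambda>x. \<Prod>i<n. ennreal (\<phi> (x i))) \<in> borel_measurable (leb_n n)"
      by (rule prod_\<phi>_measurable)
    show "(\<lambda>x. (\<Prod>i<n. ennreal (\<phi> (x i))) * (ennreal (exp (logw n k l x)) * indicator {x
        \<in> space (leb_n n). distinct_pts n x} x)) \<in> borel_measurable (leb_n n)"
      by measurable
  qed
  also have "\<dots> \<le> Z_n n a b R"
    unfolding Z_n_def
  proof (rule nn_integral_mono)
    fix x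
    show "ennreal (Cn n k) * ((\<Prod>i<n. ennreal (\<phi> (x i))) * (ennreal (exp (logw n k l x)) * indicator {x
        \<in> space (leb_n n). distinct_pts n x} x)) \<le> ennreal (gibbs_weight n a b R x)"
    proof (cases "distinct_pts n x")
      case True
      have "ennreal (Cn n k) * ((\<Prod>i<n. ennreal (\<phi> (x i))) * ennreal (exp (logw n k l x))) = ennreal (gibbs_weight n a b R x)"
        unfolding gibbs_weight_eq[OF n True] using Cn_pos[of n k] \<phi>_pos
        by (simp add: k_def l_def prod_ennreal less_imp_le ennreal_mult prod_nonneg mult.assoc)
      then show ?thesis by (simp add: indicator_def)
    qed (simp add: gibbs_weight_0)
  qed
  finally show ?thesis
    using Cn_pos[of n k] by (simp add: ennreal_mult'[symmetric] less_imp_le m_def k_def l_def)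
qed

text \<open>Both potentials are \<open>Lg\<close> up to sign and a bounded term, so the tilt grows
  at most linearly in \<open>Lg\<close>, with the mismatch as coefficient.\<close>

lemma tilt_bound: "\<exists>C\<ge>0. \<forall>k l x. \<bar>tilt k l x\<bar> \<le> (\<bar>k - \<kappa>\<bar> + \<bar>l - \<kappa> * lam\<bar>) * (C + Lg x)"
proof -
  obtain C where C: "C \<ge> 0" "\<And>x. \<bar>W x - Lg x\<bar> \<le> C" using W_bound by blast
  have "\<bar>tilt k l x\<bar> \<le> (\<bar>k - \<kappa>\<bar> + \<bar>l - \<kappa> * lam\<bar>) * (max C CU + Lg x)" for k l x
  proof -
    have w: "\<bar>W x\<bar> \<le> max C CU + Lg x" using C(2)[of x] Lg_nonneg[of x] by linarith
    have u: "\<bar>U_rho R x\<bar> \<le> max C CU + Lg x" using CU[of x] Lg_nonneg[of x] by linarith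
    have "\<bar>tilt k l x\<bar> \<le> \<bar>k - \<kappa>\<bar> * \<bar>W x\<bar> + \<bar>l - \<kappa> * lam\<bar> * \<bar>U_rho R x\<bar>"
      unfolding tilt_def abs_mult[symmetric] by (rule abs_triangle_ineq)
    also have "\<dots> \<le> \<bar>k - \<kappa>\<bar> * (max C CU + Lg x) + \<bar>l - \<kappa> * lam\<bar> * (max C CU + Lg x)"
      by (intro add_mono mult_left_mono w u) auto
    finally show ?thesis by (simp add: distrib_right)
  qed
  then show ?thesis using C(1) by (intro exI[of _ "max C CU"]) auto
qed

text \<open>The coefficient of \<open>Lg\<close> in the tilt tends to 0, so eventually it consumes
  at most half of the margin \<open>pexp - 2\<close> in the decay of \<phi>, and dominated
  convergence applies.\<close>

lemma tilt_limits:
  fixes k l :: "nat \<Rightarrow> real"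
  assumes k: "k \<longlonglongrightarrow> \<kappa>" and l: "l \<longlonglongrightarrow> \<kappa> * lam"
  shows "(\<lambda>n. \<integral>x. tilt (k n) (l n) x \<partial>\<mu>) \<longlonglongrightarrow> 0"
    and "\<exists>u. u \<longlonglongrightarrow> 1 \<and> (\<forall>\<^sub>F n in sequentially. \<Phi> (k n) (l n) = ennreal (u n))"
proof -
  interpret p: prob_space \<mu> by (rule prob_\<mu>)
  obtain C where C: "C \<ge> 0" "\<And>k l x. \<bar>tilt k l x\<bar> \<le> (\<bar>k - \<kappa>\<bar> + \<bar>l - \<kappa> * lam\<bar>) * (C + Lg x)" using tilt_bound by blast
  define \<eta> where "\<eta> n = \<bar>k n - \<kappa>\<bar> + \<bar>l n - \<kappa> * lam\<bar>" for n
  have "\<eta> \<longlonglongrightarrow> \<bar>\<kappa> - \<kappa>\<bar> + \<bar>\<kappa> * lam - \<kappa> * lam\<bar>" unfolding \<eta>_def by (intro tendsto_intros k l)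
  then have \<eta>: "\<eta> \<longlonglongrightarrow> 0" by simp
  have \<eta>0: "\<eta> n \<ge> 0" for n by (simp add: \<eta>_def)
  have L: "integrable \<mu> Lg" using \<mu>_logmom by (simp add: logmom_def)
  have tb: "\<bar>tilt (k n) (l n) x\<bar> \<le> \<eta> n * (C + Lg x)" for n x using C(2)[of "k n" "l n" x] by (simp add: \<eta>_def)
  have "\<bar>\<integral>x. tilt (k n) (l n) x \<partial>\<mu>\<bar> \<le> \<eta> n * (\<integral>x. C + Lg x \<partial>\<mu>)" for n
  proof -
    have "\<bar>\<integral>x. tilt (k n) (l n) x \<partial>\<mu>\<bar> \<le> (\<integral>x. \<bar>tilt (k n) (l n) x\<bar> \<partial>\<mu>)" by (rule integral_abs_bound)
    also have "\<dots> \<le> (\<integral>x. \<eta> n * (C + Lg x) \<partial>\<mu>)"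
      using L tilt_integrable tb by (intro integral_mono) auto
    finally show ?thesis by simp
  qed
  moreover have "(\<lambda>n. \<eta> n * (\<integral>x. C + Lg x \<partial>\<mu>)) \<longlonglongrightarrow> 0 * (\<integral>x. C + Lg x \<partial>\<mu>)" by (intro tendsto_intros \<eta>)
  ultimately show "(\<lambda>n. \<integral>x. tilt (k n) (l n) x \<partial>\<mu>) \<longlonglongrightarrow> 0"
    using Lim_null_comparison[of "\<lambda>n. \<integral>x. tilt (k n) (l n) x \<partial>\<mu>" "\<lambda>n. \<eta> n * (\<integral>x. C + Lg x \<partial>\<mu>)" sequentially] by simp
  define e where "e = (pexp - 2) / 2"
  have e: "e > 0" "pexp - e > 2" using pexp by (simp_all add: e_def field_simps)
  obtain D where D: "D \<ge> 0" "\<And>x. \<phi> x \<le> D * exp (- pexp * Lg x)" using \<phi>_decay by blast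
  \<comment> \<open>Replaced by \<phi> itself while \<eta> n exceeds e, so that the single majorant
    w serves all n.\<close>
  define g where "g n x = (if \<eta> n \<le> e then \<phi> x * exp (tilt (k n) (l n) x) else \<phi> x)" for n x
  define w where "w x = D * exp (e * C) * exp (- (pexp - e) * Lg x)" for x
  have [measurable]: "g n \<in> borel_measurable borel" for n unfolding g_def[abs_def] by measurable
  have [measurable]: "w \<in> borel_measurable borel" unfolding w_def[abs_def] by measurable
  have "(\<integral>\<^sup>+x. ennreal (w x) \<partial>lborel) = ennreal (D * exp (e * C)) * (\<integral>\<^sup>+x. ennreal (exp (- (pexp - e) * Lg x)) \<partial>lborel)"
    unfolding w_def using D by (subst nn_integral_cmult[symmetric]) (auto simp: ennreal_mult'[symmetric])
  also have "\<dots> < \<infinity>" using nn_integral_exp_Lg[OF e(2)] by (simp add: ennreal_mult_less_top)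
  finally have wi: "integrable lborel w" using D by (intro integrableI_nonneg) (auto simp: w_def)
  have gw: "\<bar>g n x\<bar> \<le> w x" for n x
  proof -
    have "g n x \<le> \<phi> x * exp (e * (C + Lg x))"
    proof (cases "\<eta> n \<le> e")
      case True
      have "tilt (k n) (l n) x \<le> \<eta> n * (C + Lg x)" using tb[of n x] by linarith
      also have "\<dots> \<le> e * (C + Lg x)" using True C Lg_nonneg[of x] by (intro mult_right_mono) auto
      finally show ?thesis using True \<phi>_pos[of x] by (simp add: g_def)
    next
      case False
      have "1 \<le> exp (e * (C + Lg x))" using e C Lg_nonneg[of x] by simp
      then have "\<phi> x * 1 \<le> \<phi> x * exp (e * (C + Lg x))" using \<phi>_pos[of x] by (intro mult_left_mono) auto
      then show ?thesis using False by (simp add: g_def)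
    qed
    also have "\<dots> \<le> (D * exp (- pexp * Lg x)) * exp (e * (C + Lg x))" using D(2)[of x] by (intro mult_right_mono) auto
    also have "\<dots> = w x" by (simp add: w_def mult.assoc exp_add[symmetric] algebra_simps)
    finally show ?thesis using \<phi>_pos[of x] by (simp add: g_def)
  qed
  have g0: "g n x \<ge> 0" for n x using \<phi>_pos[of x] by (simp add: g_def)
  have gi: "integrable lborel (g n)" for n
  proof (rule Bochner_Integration.integrable_bound[OF wi])
    show "AE x in lborel. norm (g n x) \<le> norm (w x)"
    proof (rule AE_I2)
      fix x show "norm (g n x) \<le> norm (w x)" using gw[of n x] by simp
    qed
  qed measurable
  have "(\<lambda>n. \<integral>x. g n x \<partial>lborel) \<longlonglongrightarrow> (\<integral>x. \<phi> x \<partial>lborel)"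
  proof (rule integral_dominated_convergence[OF _ _ wi])
    show "AE x in lborel. (\<lambda>n. g n x) \<longlonglongrightarrow> \<phi> x"
    proof (rule AE_I2)
      fix x
      have "(\<lambda>n. \<eta> n * (C + Lg x)) \<longlonglongrightarrow> 0 * (C + Lg x)" by (intro tendsto_intros \<eta>)
      then have "(\<lambda>n. tilt (k n) (l n) x) \<longlonglongrightarrow> 0"
        using tb Lim_null_comparison[of "\<lambda>n. tilt (k n) (l n) x" "\<lambda>n. \<eta> n * (C + Lg x)" sequentially] by simp
      then have "(\<lambda>n. \<phi> x * exp (tilt (k n) (l n) x)) \<longlonglongrightarrow> \<phi> x * exp 0" by (intro tendsto_intros)
      moreover have "\<forall>\<^sub>F n in sequentially. \<phi> x * exp (tilt (k n) (l n) x) = g n x"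
        using order_tendstoD(2)[OF \<eta> e(1)] by eventually_elim (simp add: g_def)
      ultimately show "(\<lambda>n. g n x) \<longlonglongrightarrow> \<phi> x" using Lim_transform_eventually by fastforce
    qed
    show "AE x in lborel. norm (g n x) \<le> w x" for n using gw by simp
  qed auto
  moreover have "(\<integral>x. \<phi> x \<partial>lborel) = 1"
    using \<mu>_integral[of "\<lambda>_. 1"] by (simp add: p.prob_space)
  moreover have "\<forall>\<^sub>F n in sequentially. \<Phi> (k n) (l n) = ennreal (\<integral>x. g n x \<partial>lborel)"
    using order_tendstoD(2)[OF \<eta> e(1)]
  proof eventually_elim
    fix n assume "\<eta> n < e"
    then have "\<Phi> (k n) (l n) = (\<integral>\<^sup>+x. ennreal (g n x) \<partial>lborel)" by (simp add: \<Phi>_def g_def)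
    also have "\<dots> = ennreal (\<integral>x. g n x \<partial>lborel)" using gi g0 by (intro nn_integral_eq_integral) auto
    finally show "\<Phi> (k n) (l n) = ennreal (\<integral>x. g n x \<partial>lborel)" .
  qed
  ultimately show "\<exists>u. u \<longlonglongrightarrow> 1 \<and> (\<forall>\<^sub>F n in sequentially. \<Phi> (k n) (l n) = ennreal (u n))"
    by (intro exI[of _ "\<lambda>n. \<integral>x. g n x \<partial>lborel"]) auto
qed

section \<open>Exponential decay and almost sure convergence\<close>

lemma product_limit:
  assumes b: "(\<lambda>n. real n * \<beta> n) \<longlonglongrightarrow> \<kappa>" and a: "(\<lambda>n. \<alpha> n / real n) \<longlonglongrightarrow> lam"
  shows "(\<lambda>n. \<beta> n * \<alpha> n) \<longlonglongrightarrow> \<kappa> * lam"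
proof (rule Lim_transform_eventually[OF tendsto_mult[OF b a]])
  show "\<forall>\<^sub>F n in sequentially. real n * \<beta> n * (\<alpha> n / real n) = \<beta> n * \<alpha> n"
    using eventually_gt_at_top[of 0] by eventually_elim simp
qed

text \<open>\<open>gibbs_upper\<close> on the whole space, with the global lower bound of the
  modulated energy; n must be large enough for the tilted one-particle integral to be
  finite.\<close>

lemma Z_finite:
  assumes b: "(\<lambda>n. real n * \<beta> n) \<longlonglongrightarrow> \<kappa>" and a: "(\<lambda>n. \<alpha> n / real n) \<longlonglongrightarrow> lam" and pos: "\<And>n. \<beta> n > 0"
  shows "\<forall>\<^sub>F n in sequentially. Z_n n (\<alpha> n) (\<beta> n) R < \<infinity>"
proof -
  obtain u where u: "\<forall>\<^sub>F n in sequentially. \<Phi> (real n * \<beta> n) (\<beta> n * \<alpha> n) = ennreal (u n)"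
    using tilt_limits(2)[OF b product_limit[OF b a]] by blast
  obtain C where C: "\<And>n x. n > 0 \<Longrightarrow> distinct_pts n x \<Longrightarrow> Fn n x \<ge> - C" using Fn_bounded_below by blast
  show ?thesis
    using u eventually_gt_at_top[of 0]
  proof eventually_elim
    fix n :: nat assume un: "\<Phi> (real n * \<beta> n) (\<beta> n * \<alpha> n) = ennreal (u n)" and n: "0 < n"
    have "Z_n n (\<alpha> n) (\<beta> n) R = (\<integral>\<^sup>+x. ennreal (gibbs_weight n (\<alpha> n) (\<beta> n) R x) * indicator UNIV x \<partial>leb_n n)"
      by (simp add: Z_n_def)
    also have "\<dots> \<le> ennreal (Cn n (real n * \<beta> n) * exp (- (real n * \<beta> n * real n / 2) * (- C))) * ennreal (u n) ^ n"
      unfolding un[symmetric] by (intro gibbs_upper[OF n less_imp_le[OF pos]] C n)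
    also have "\<dots> < \<infinity>" by (simp add: ennreal_mult_less_top power_less_top_ennreal)
    finally show "Z_n n (\<alpha> n) (\<beta> n) R < \<infinity>" .
  qed
qed

text \<open>Coincident configurations are included because the coercivity of \<open>Fn\<close> says
  nothing about them; their Gibbs weight is 0, so they add no probability.\<close>

definition bad :: "nat \<Rightarrow> real \<Rightarrow> (nat \<Rightarrow> complex) set" where
  "bad n t = {x \<in> space (leb_n n). \<not> distinct_pts n x \<or> t \<le> Fn n x}"

lemma bad_sets [measurable]: "bad n t \<in> sets (leb_n n)"
proof -
  have "bad n t = (space (leb_n n) - {x \<in> space (leb_n n). distinct_pts n x}) \<union> {x \<in> space (leb_n n). t \<le> Fn n x}"
    by (auto simp: bad_def)
  moreover have "{x \<in> space (leb_n n). t \<le> Fn n x} \<in> sets (leb_n n)" by measurable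
  ultimately show ?thesis by (auto intro!: sets.Un sets.Diff)
qed

lemma exponential_decay:
  assumes b: "(\<lambda>n. real n * \<beta> n) \<longlonglongrightarrow> \<kappa>" and a: "(\<lambda>n. \<alpha> n / real n) \<longlonglongrightarrow> lam" and pos: "\<And>n. \<beta> n > 0" and t: "t > 0"
  shows "\<forall>\<^sub>F n in sequentially. emeasure (P_n n (\<alpha> n) (\<beta> n) R) (bad n t) \<le> ennreal (exp (- \<kappa> * t / 4) ^ n)"
proof -
  define k l where "k n = real n * \<beta> n" and "l n = \<beta> n * \<alpha> n" for n
  have kl: "k \<longlonglongrightarrow> \<kappa>" "l \<longlonglongrightarrow> \<kappa> * lam" using b product_limit[OF b a] by (simp_all add: k_def[abs_def] l_def[abs_def])
  define d where "d n = (\<integral>x. tilt (k n) (l n) x \<partial>\<mu>)" for n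
  have d: "d \<longlonglongrightarrow> 0" unfolding d_def by (rule tilt_limits(1)[OF kl])
  obtain u where u: "u \<longlonglongrightarrow> 1" "\<forall>\<^sub>F n in sequentially. \<Phi> (k n) (l n) = ennreal (u n)"
    using tilt_limits(2)[OF kl] by blast
  \<comment> \<open>The exponent per particle in the quotient of the upper bound by the lower bound.
    Its limit is -\<kappa> t/2, and the claim keeps half of it.\<close>
  define s where "s n = - k n * t / 2 + ln (u n) - d n + k n * estar / 2 * (1 / real n)" for n
  have "(\<lambda>n. 1 / real n) \<longlonglongrightarrow> 0" by real_asymp
  then have "s \<longlonglongrightarrow> - \<kappa> * t / 2 + ln 1 - 0 + \<kappa> * estar / 2 * 0"
    unfolding s_def by (intro tendsto_intros kl u d) auto
  then have "\<forall>\<^sub>F n in sequentially. s n < - \<kappa> * t / 4"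
    using \<kappa>_pos t by (intro order_tendstoD) auto
  moreover have "\<forall>\<^sub>F n in sequentially. u n > 0" using order_tendstoD(1)[OF u(1), of 0] by simp
  ultimately show ?thesis
    using u(2) Z_finite[OF b a pos] eventually_gt_at_top[of 0]
  proof eventually_elim
    fix n :: nat
    assume sn: "s n < - \<kappa> * t / 4" and un: "0 < u n" and \<Phi>n: "\<Phi> (k n) (l n) = ennreal (u n)"
      and Zf: "Z_n n (\<alpha> n) (\<beta> n) R < \<infinity>" and n: "0 < n"
    define X where "X = (\<integral>\<^sup>+x. ennreal (gibbs_weight n (\<alpha> n) (\<beta> n) R x) * indicator (bad n t) x \<partial>leb_n n)"
    define zl where "zl = Cn n (k n) * exp (- k n * estar / 2 + real n * d n)"
    define aa where "aa = Cn n (k n) * exp (- (k n * real n / 2) * t) * u n ^ n"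
    have zl: "zl > 0" by (simp add: zl_def Cn_pos)
    have aa: "aa \<ge> 0" using un by (simp add: aa_def Cn_pos less_imp_le)
    have "X \<le> ennreal (Cn n (k n) * exp (- (k n * real n / 2) * t)) * ennreal (u n) ^ n"
      unfolding X_def k_def \<Phi>n[unfolded k_def l_def, symmetric]
      by (rule gibbs_upper[OF n less_imp_le[OF pos]]) (auto simp: bad_def)
    also have "\<dots> = ennreal aa"
      using un Cn_pos[of n "k n"] by (simp add: aa_def ennreal_power ennreal_mult'[symmetric] less_imp_le)
    finally have X: "X \<le> ennreal aa" .
    have Zl: "Z_n n (\<alpha> n) (\<beta> n) R \<ge> ennreal zl"
      using Z_lower[OF n, of "\<beta> n" "\<alpha> n"] by (simp add: zl_def k_def l_def d_def)
    obtain z where z: "Z_n n (\<alpha> n) (\<beta> n) R = ennreal z" "z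
        \<ge> 0" using Zf by (metis ennreal_cases infinity_ennreal_def less_irrefl)
    have zz: "zl \<le> z" using Zl z by simp
    have "emeasure (P_n n (\<alpha> n) (\<beta> n) R) (bad n t)
        = (\<integral>\<^sup>+x. ennreal (gibbs_weight n (\<alpha> n) (\<beta> n) R x) / Z_n n (\<alpha> n) (\<beta> n) R * indicator (bad n t) x \<partial>leb_n n)"
      unfolding P_n_def by (rule emeasure_density) measurable
    also have "\<dots> = (\<integral>\<^sup>+x. ennreal (gibbs_weight n (\<alpha> n) (\<beta> n) R x) * indicator (bad n t) x / Z_n n (\<alpha> n) (\<beta> n) R \<partial>leb_n n)"
      by (intro nn_integral_cong) (simp add: divide_ennreal_def ac_simps)
    also have "\<dots> = X / Z_n n (\<alpha> n) (\<beta> n) R"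
      unfolding X_def by (rule nn_integral_divide) measurable
    also have "\<dots> \<le> ennreal aa / ennreal z" unfolding z by (rule divide_right_mono_ennreal[OF X])
    also have "\<dots> = ennreal (aa / z)" using aa zl zz by (intro divide_ennreal) auto
    also have "\<dots> \<le> ennreal (aa / zl)" using aa zl zz by (intro ennreal_leI divide_left_mono) auto
    also have "aa / zl = exp (real n * s n)"
    proof -
      have "u n ^ n = exp (real n * ln (u n))" using un by (simp add: exp_of_nat_mult)
      then have "aa = Cn n (k n) * exp (- (k n * real n / 2) * t + real n * ln (u n))"
        unfolding aa_def exp_add by (simp only: mult.assoc)
      then have "aa / zl = exp (- (k n * real n / 2) * t + real n * ln (u n) - (- k n * estar / 2 + real n * d n))"
        unfolding zl_def exp_diff[of "- (k n * real n / 2) * t + real n * ln (u n)"] using Cn_pos[of n "k n"] by simp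
      also have "- (k n * real n / 2) * t + real n * ln (u n) - (- k n * estar / 2 + real n * d n) = real n * s n"
        using n by (simp add: s_def field_simps)
      finally show ?thesis .
    qed
    also have "ennreal (exp (real n * s n)) \<le> ennreal (exp (real n * (- \<kappa> * t / 4)))"
    proof -
      have "real n * s n \<le> real n * (- \<kappa> * t / 4)" using sn by (intro mult_left_mono) auto
      then show ?thesis by (intro ennreal_leI) (simp only: exp_le_cancel_iff)
    qed
    also have "exp (real n * (- \<kappa> * t / 4)) = exp (- \<kappa> * t / 4) ^ n" by (rule exp_of_nat_mult)
    finally show "emeasure (P_n n (\<alpha> n) (\<beta> n) R) (bad n t) \<le> ennreal (exp (- \<kappa> * t / 4) ^ n)" .
  qed
qed

text \<open>The first Borel--Cantelli lemma uses only the law of each \<open>X n\<close>, so every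
  joint realization is covered. Thresholds 1/(m + 1) reduce the limit to countably many almost sure
  events.\<close>

theorem empirical_convergence:
  assumes b: "(\<lambda>n. real n * \<beta> n) \<longlonglongrightarrow> \<kappa>" and a: "(\<lambda>n. \<alpha> n / real n) \<longlonglongrightarrow> lam" and pos: "\<And>n. \<beta> n > 0"
    and M: "prob_space M"
    and X: "\<And>n. n \<ge> N \<Longrightarrow> X n \<in> measurable M (leb_n n)" "\<And>n. n \<ge> N \<Longrightarrow> distr M (leb_n n) (X n) = P_n n (\<alpha> n) (\<beta> n) R"
  shows "AE \<omega> in M. (\<lambda>n. d_BL (empirical n (X n \<omega>)) \<mu>) \<longlonglongrightarrow> 0"
proof -
  interpret M: prob_space M by fact
  have step: "AE \<omega> in M. \<forall>\<^sub>F n in sequentially. d_BL (empirical n (X n \<omega>)) \<mu> \<le> e" if e: "e > 0" for e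
  proof -
    obtain t N1 where t: "t > 0" and N1: "\<And>n x. n \<ge> N1 \<Longrightarrow> distinct_pts n x \<Longrightarrow> d_BL (empirical n x) \<mu> > e \<Longrightarrow> Fn n x \<ge> t"
      using Fn_coercive[OF e] by metis
    define q where "q = exp (- \<kappa> * t / 4)"
    have q: "0 \<le> q" "q < 1" using \<kappa>_pos t by (auto simp: q_def)
    obtain N2 where N2: "\<And>n. n \<ge> N2 \<Longrightarrow> emeasure (P_n n (\<alpha> n) (\<beta> n) R) (bad n t) \<le> ennreal (q ^ n)"
      using exponential_decay[OF b a pos t] unfolding q_def eventually_sequentially by blast
    define B where "B n = (if n \<ge> max N N2 then X n -` bad n t \<inter> space M else {})" for n
    have B_sets: "B n \<in> sets M" for n
      unfolding B_def using X(1)[of n] bad_sets[of n t] by (auto intro: measurable_sets)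
    have B_le: "measure M (B n) \<le> q ^ n" for n
    proof (cases "n \<ge> max N N2")
      case True
      have "emeasure M (B n) = emeasure (distr M (leb_n n) (X n)) (bad n t)"
        using True X(1)[of n] bad_sets[of n t] by (simp add: B_def emeasure_distr)
      also have "\<dots> \<le> ennreal (q ^ n)" using True X(2)[of n] N2[of n] by simp
      finally show ?thesis using q by (simp add: M.emeasure_eq_measure)
    next
      case False
      then have "B n = {}" by (auto simp: B_def)
      then show ?thesis using q by simp
    qed
    have "AE \<omega> in M. \<forall>\<^sub>F n in sequentially. \<omega> \<in> space M - B n"
    proof (rule borel_cantelli_AE1[OF B_sets])
      show "emeasure M (B n) < \<infinity>" for n by (simp add: M.emeasure_eq_measure)
      show "summable (\<lambda>n. measure M (B n))"
        by (rule summable_comparison_test'[OF summable_geometric[of q], of 0]) (use q B_le in auto)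
    qed
    then show ?thesis
    proof eventually_elim
      fix \<omega> assume "\<forall>\<^sub>F n in sequentially. \<omega> \<in> space M - B n"
      then show "\<forall>\<^sub>F n in sequentially. d_BL (empirical n (X n \<omega>)) \<mu> \<le> e"
        using eventually_ge_at_top[of "max (max N N2) N1"]
      proof eventually_elim
        fix n assume \<omega>: "\<omega> \<in> space M - B n" and n: "max (max N N2) N1 \<le> n"
        then have "X n \<omega> \<notin> bad n t" by (auto simp: B_def)
        moreover have "X n \<omega> \<in> space (leb_n n)" using \<omega> n X(1)[of n] by (auto dest: measurable_space)
        ultimately have "distinct_pts n (X n \<omega>)" "\<not> t \<le> Fn n (X n \<omega>)" by (auto simp: bad_def)
        then show "d_BL (empirical n (X n \<omega>)) \<mu> \<le> e" using N1[of n "X n \<omega>"] n by (meson max.boundedE not_le)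
      qed
    qed
  qed
  have "AE \<omega> in M. \<forall>m::nat. \<forall>\<^sub>F n in sequentially. d_BL (empirical n (X n \<omega>)) \<mu> \<le> 1 / real (Suc m)"
    by (subst AE_all_countable) (intro allI step, simp)
  then show ?thesis
  proof eventually_elim
    fix \<omega> assume \<omega>: "\<forall>m::nat. \<forall>\<^sub>F n in sequentially. d_BL (empirical n (X n \<omega>)) \<mu> \<le> 1 / real (Suc m)"
    show "(\<lambda>n. d_BL (empirical n (X n \<omega>)) \<mu>) \<longlonglongrightarrow> 0"
    proof (rule tendstoI)
      fix e :: real assume "e > 0"
      then obtain m where m: "1 / real (Suc m) < e" using nat_approx_posE by blast
      show "\<forall>\<^sub>F n in sequentially. dist (d_BL (empirical n (X n \<omega>)) \<mu>) 0 < e"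
        using \<omega>[rule_format, of m] eventually_gt_at_top[of 0]
      proof eventually_elim
        fix n :: nat assume le: "d_BL (empirical n (X n \<omega>)) \<mu> \<le> 1 / real (Suc m)" and n: "0 < n"
        have "0 \<le> d_BL (empirical n (X n \<omega>)) \<mu>" by (rule d_BL_set_bdd(1)[OF n])
        then show "dist (d_BL (empirical n (X n \<omega>)) \<mu>) 0 < e" using le m by (simp add: dist_real_def)
      qed
    qed
  qed
qed

end

theorem theorem1p3:
  fixes R \<kappa> lam :: real and \<alpha> \<beta> :: "nat \<Rightarrow> real"
  assumes R_pos: "R > 0"
    and alpha_pos: "\<forall>n. \<alpha> n > 0" and beta_pos: "\<forall>n. \<beta> n > 0"
    and kappa_pos: "\<kappa> > 0"
    and lim_beta: "(\<lambda>n. real n * \<beta> n) \<longlonglongrightarrow> \<kappa>"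
    and lim_alpha: "(\<lambda>n. \<alpha> n / real n) \<longlonglongrightarrow> lam"
    and cond: "\<kappa> * (lam - 1) > 2"
  shows "(\<exists>N. \<forall>n\<ge>N. Z_n n (\<alpha> n) (\<beta> n) R < \<infinity>) \<and>
    (\<exists>\<mu>s :: complex measure. \<exists>\<phi> :: complex \<Rightarrow> real.
       is_minimizer \<kappa> lam R \<mu>s \<and>
       (\<forall>\<nu>. is_minimizer \<kappa> lam R \<nu> \<longrightarrow> \<nu> = \<mu>s) \<and>
       \<phi> \<in> borel_measurable lborel \<and> (\<forall>z. \<phi> z \<ge> 0) \<and>
       \<mu>s = density lborel (\<lambda>z. ennreal (\<phi> z)) \<and>
       (\<forall>g. test_fun (interior (measure_support \<mu>s)) g \<longrightarrow>
          integrable lborel (\<lambda>z. ln (\<phi> z) * laplacian g z) \<and>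
          (\<integral>z. ln (\<phi> z) * laplacian g z \<partial>lborel) =
            2 * pi * \<kappa> * (\<integral>z. (\<phi> z - lam * indicator (cball 0 R) z / (pi * R\<^sup>2)) * g z \<partial>lborel)) \<and>
       (\<forall>(M :: 'a measure) (X :: nat \<Rightarrow> 'a \<Rightarrow> (nat \<Rightarrow> complex)) N.
          prob_space M \<longrightarrow>
          (\<forall>n\<ge>N. X n \<in> measurable M (leb_n n) \<and>
                  distr M (leb_n n) (X n) = P_n n (\<alpha> n) (\<beta> n) R) \<longrightarrow>
          (AE \<omega> in M. (\<lambda>n. d_BL (empirical n (X n \<omega>)) \<mu>s) \<longlonglongrightarrow> 0)))"
proof -
  interpret log_gas R \<kappa> lam by standard (fact R_pos kappa_pos cond)+
  obtain \<phi> c where eq: "is_equilibrium \<phi> c"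
    and min: "is_minimizer \<kappa> lam R (density lborel (\<lambda>x. ennreal (\<phi> x)))"
    and uniq: "\<And>\<nu>. is_minimizer \<kappa> lam R \<nu> \<Longrightarrow> \<nu> = density lborel (\<lambda>x. ennreal (\<phi> x))"
    using equilibrium_minimizer by blast
  interpret log_gas_equilibrium R \<kappa> lam \<phi> c by standard (rule eq)
  have bp: "\<And>n. \<beta> n > 0" using beta_pos by blast
  have fin: "\<exists>N. \<forall>n\<ge>N. Z_n n (\<alpha> n) (\<beta> n) R < \<infinity>"
    using Z_finite[OF lim_beta lim_alpha bp] by (simp add: eventually_sequentially)
  have conv: "AE \<omega> in M. (\<lambda>n. d_BL (empirical n (X n \<omega>)) \<mu>) \<longlonglongrightarrow> 0"
    if "prob_space M" "\<forall>n\<ge>N. X n \<in> measurable M (leb_n n) \<and> distr M (leb_n n) (X n) = P_n n (\<alpha> n) (\<beta> n) R"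
    for M :: "'a measure" and X :: "nat \<Rightarrow> 'a \<Rightarrow> (nat \<Rightarrow> complex)" and N
    using that by (intro empirical_convergence[OF lim_beta lim_alpha bp, of M N X]) auto
  show ?thesis
  proof (intro conjI fin exI[of _ \<mu>] exI[of _ \<phi>] allI impI)
    show "is_minimizer \<kappa> lam R \<mu>" using min by (simp add: \<mu>_def)
    show "\<nu> = \<mu>" if "is_minimizer \<kappa> lam R \<nu>" for \<nu> using uniq[OF that] by (simp add: \<mu>_def)
    show "\<phi> \<in> borel_measurable lborel" by simp
    show "0 \<le> \<phi> z" for z using \<phi>_pos[of z] by simp
    show "\<mu> = density lborel (\<lambda>z. ennreal (\<phi> z))" by (rule \<mu>_def)
  qed (use conv equilibrium_pde[OF eq] in blast)+
qed

end
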